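(* Let $m\in C^\infty(\mathbb{T}^d;\mathbb{R})$, $\kappa>0$, $\lambda(k)=(\kappa^2+4\pi^2|k|^2)^{1/2}$, let $W$ be Gaussian white noise on $\mathbb{T}^d$, and let $u=\mathrm{Op}(q_m)W$ with $q_m(x,k)=\lambda(k)^{-m(x)}$ be the variable-order Matérn field with order function $m$. Put $U:=\{x\in\mathbb{T}^d: m(x)>d/2\}$, $H(x):=m(x)-\tfrac d2$, and, for non-empty open $V\subseteq U$, $\gamma_V:=\inf_VH$. (i) (Upper bound.) $u$ has a modification whose restriction to $U$ is continuous and which, for every non-empty open $V$ with $\overline V\subset U$, lies in $C^{\gamma_V^-}_{loc}(V)$ almost surely. (ii) (Sharpness.) For every non-empty open $V\subseteq U$ and every $\gamma>\gamma_V$, almost surely $u|_V\notin C^{\gamma^-}_{loc}(V)$. (iii) (Below threshold.) If $V\subseteq\mathbb{T}^d$ is non-empty and open with $\sup_Vm<d/2$, then almost surely $u|_V\notin L^2(V)$. Consequently, for every $x_0\in U$, $$\sup\bigl\{\gamma>0:\ u\in C^{\gamma^-}_{loc}(V)\text{ a.s. for some neighbourhood }V\ni x_0\bigr\}=H(x_0),$$ so the sample-path exponent of $u$ at $x_0$ is $H(x_0)$.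
   Context: $\mathbb{T}^d=\mathbb{R}^d/\mathbb{Z}^d$ has total mass $1$; $\hat f(k)=\int_{\mathbb{T}^d}f(x)e^{-2\pi ik\cdot x}dx$; $\mathcal{S}(\mathbb{T}^d)=C^\infty(\mathbb{T}^d)$. A real generalized random field (GeRF) $Z$ is a continuous linear map $\mathcal{S}(\mathbb{T}^d)\to L^2(\Omega,\mathcal{A},\mathbb{P})$ taking real test functions to real random variables, written $\varphi\mapsto\langle Z,\varphi\rangle$; all GeRFs have mean zero; $Z$ is Gaussian if every $\langle Z,\varphi\rangle$ is Gaussian. By Minlos' theorem such a field is regarded as a random element of $\mathcal{S}'(\mathbb{T}^d)$, and membership of $u|_V$ in a function space means that the distribution $u|_V$ is given by a function in that space. White noise $W$ is the real GeRF with $\mathrm{Cov}(\langle W,\varphi\rangle,\langle W,\phi\rangle)=\int_{\mathbb{T}^d}\varphi\bar\phi\,dx$. For $p:\mathbb{T}^d\times\mathbb{Z}^d\to\mathbb{C}$, $\mathrm{Op}(p)f(x)=\sum_{k\in\mathbb{Z}^d}p(x,k)\hat f(k)e^{2\pi ik\cdot x}$. The field $u=\mathrm{Op}(q_m)W$ is defined by $\langle u,\varphi\rangle:=\langle W,\mathrm{Op}(q_m)^*\varphi\rangle$, where $\mathrm{Op}(q_m)^*$ is the $L^2$-adjoint, which maps $\mathcal{S}(\mathbb{T}^d)$ into itself. For $n\in\mathbb{N}_0$, $\gamma\in[0,1]$ and $\mathcal{O}$ open, $C^{n,\gamma}_{loc}(\mathcal{O})$ is the space of functions $f$ on $\mathcal{O}$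 for which $\partial^\alpha f$ exists for all $|\alpha|\le n$ and such that for every compact $K\subset\mathcal{O}$ there is $C_K>0$ with $|\partial^\alpha f(x)-\partial^\alpha f(y)|\le C_K\|x-y\|^\gamma$ for all $x,y\in K$, $|\alpha|=n$ (read in local isometric charts). For $\gamma\ge0$ real, $C^{\gamma^-}_{loc}(\mathcal{O})=\bigcap_{n'+\gamma'<\gamma}C^{n',\gamma'}_{loc}(\mathcal{O})$ over $n'\in\mathbb{N}_0$, $\gamma'\in[0,1]$. *)

theory Defs
  imports "HOL-Probability.Probability"
begin

section \<open>The torus\<close>

text \<open>
  The torus of dimension \<open>d = CARD('d)\<close> is handled through its universal cover: functions on it
  are \<open>\<int>\<^sup>d\<close>-periodic functions on \<open>real^'d\<close>, and its open subsets are the \<open>\<int>\<^sup>d\<close>-invariant open subsets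
  of \<open>real^'d\<close>. Passing to the preimage commutes with closures, suprema and infima, and the
  covering map is a local isometry, so its local inverses are the isometric charts.
\<close>

definition lattice_vec :: "int^'d \<Rightarrow> real^'d" where
  "lattice_vec k = (\<chi> i. real_of_int (k $ i))"

definition torus_open :: "(real^'d) set \<Rightarrow> bool" where
  "torus_open V \<longleftrightarrow> open V \<and> (\<forall>x k. x \<in> V \<longrightarrow> x + lattice_vec k \<in> V)"

definition periodic_on :: "(real^'d) set \<Rightarrow> (real^'d \<Rightarrow> 'b) \<Rightarrow> bool" where
  "periodic_on V f \<longleftrightarrow> (\<forall>x\<in>V. \<forall>k. f (x + lattice_vec k) = f x)"

definition torus_cell :: "(real^'d) set" where
  "torus_cell = cbox 0 1"

definition torus_integral :: "(real^'d \<Rightarrow> complex) \<Rightarrow> complex" where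
  "torus_integral f = (LINT x:torus_cell|lborel. f x)"

definition torus_inner :: "(real^'d \<Rightarrow> complex) \<Rightarrow> (real^'d \<Rightarrow> complex) \<Rightarrow> complex" where
  "torus_inner f g = torus_integral (\<lambda>x. f x * cnj (g x))"

definition fourier_mode :: "int^'d \<Rightarrow> real^'d \<Rightarrow> complex" where
  "fourier_mode k x = cis (2 * pi * (lattice_vec k \<bullet> x))"

definition fourier_coeff :: "(real^'d \<Rightarrow> complex) \<Rightarrow> int^'d \<Rightarrow> complex" where
  "fourier_coeff f k = torus_integral (\<lambda>x. f x * cis (- 2 * pi * (lattice_vec k \<bullet> x)))"


section \<open>Partial derivatives and function spaces\<close>

definition pderiv_at :: "'d \<Rightarrow> (real^'d \<Rightarrow> 'b::real_normed_vector) \<Rightarrow> real^'d \<Rightarrow> 'b" where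
  "pderiv_at i f x = vector_derivative (\<lambda>t. f (x + t *\<^sub>R axis i 1)) (at 0)"

text \<open>
  A derivative \<open>\<partial>\<^sup>\<alpha>\<close> is given by the list \<open>\<alpha>\<close> of its directions, so that \<open>\<bar>\<alpha>\<bar>\<close> is the length
  of the list; all orders of differentiation are considered.
\<close>

primrec pderivs :: "'d list \<Rightarrow> (real^'d \<Rightarrow> 'b::real_normed_vector) \<Rightarrow> real^'d \<Rightarrow> 'b" where
  "pderivs [] f = f"
| "pderivs (i # \<alpha>) f = pderiv_at i (pderivs \<alpha> f)"

definition has_pderivs_on :: "nat \<Rightarrow> (real^'d) set \<Rightarrow> (real^'d \<Rightarrow> 'b::real_normed_vector) \<Rightarrow> bool" where
  "has_pderivs_on n V f \<longleftrightarrow>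
     (\<forall>\<alpha> i. length \<alpha> < n \<longrightarrow>
        (\<forall>x\<in>V. (\<lambda>t. pderivs \<alpha> f (x + t *\<^sub>R axis i 1)) differentiable (at 0)))"

definition torus_smooth :: "(real^'d \<Rightarrow> 'b::real_normed_vector) \<Rightarrow> bool" where
  "torus_smooth f \<longleftrightarrow> periodic_on UNIV f \<and> (\<forall>n. has_pderivs_on n UNIV f) \<and>
     (\<forall>\<alpha>. continuous_on UNIV (pderivs \<alpha> f))"

definition test_functions :: "(real^'d \<Rightarrow> complex) set" where
  "test_functions = {\<phi>. torus_smooth \<phi>}"

definition holder_loc :: "nat \<Rightarrow> real \<Rightarrow> (real^'d) set \<Rightarrow> (real^'d \<Rightarrow> complex) set" where
  "holder_loc n \<gamma> V = {f. periodic_on V f \<and> has_pderivs_on n V f \<and>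
     (\<forall>K. compact K \<and> K \<subseteq> V \<longrightarrow>
        (\<exists>C>0. \<forall>\<alpha> x y. length \<alpha> = n \<and> x \<in> K \<and> y \<in> K \<longrightarrow>
           norm (pderivs \<alpha> f x - pderivs \<alpha> f y) \<le> C * norm (x - y) powr \<gamma>))}"

definition holder_loc_minus :: "real \<Rightarrow> (real^'d) set \<Rightarrow> (real^'d \<Rightarrow> complex) set" where
  "holder_loc_minus \<gamma> V = {f. periodic_on V f \<and>
     (\<forall>n' \<gamma>'. 0 \<le> \<gamma>' \<and> \<gamma>' \<le> 1 \<and> real n' + \<gamma>' < \<gamma> \<longrightarrow> f \<in> holder_loc n' \<gamma>' V)}"

definition torus_L2 :: "(real^'d) set \<Rightarrow> (real^'d \<Rightarrow> complex) set" where
  "torus_L2 V = {f. periodic_on V f \<and> set_borel_measurable lborel V f \<and>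
     set_integrable lborel (V \<inter> torus_cell) (\<lambda>x. (norm (f x))\<^sup>2)}"


section \<open>Distributions\<close>

text \<open>
  Basic neighbourhoods for the Frechet topology of \<open>test_functions\<close>, which is generated by the
  seminorms \<open>\<phi> \<mapsto> sup \<bar>\<partial>\<^sup>\<alpha>\<phi>\<bar>\<close>.
\<close>

definition test_nbhd :: "(real^'d \<Rightarrow> complex) \<Rightarrow> nat \<Rightarrow> real \<Rightarrow> (real^'d \<Rightarrow> complex) set" where
  "test_nbhd \<phi> N \<delta> = {\<psi>\<in>test_functions.
     \<forall>\<alpha>. length \<alpha> \<le> N \<longrightarrow> (\<forall>x. norm (pderivs \<alpha> (\<lambda>y. \<psi> y - \<phi> y) x) < \<delta>)}"

definition torus_distributions :: "((real^'d \<Rightarrow> complex) \<Rightarrow> complex) set" where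
  "torus_distributions = {T.
     (\<forall>\<phi>\<in>test_functions. \<forall>\<psi>\<in>test_functions. \<forall>a b.
        T (\<lambda>x. a * \<phi> x + b * \<psi> x) = a * T \<phi> + b * T \<psi>) \<and>
     (\<forall>\<phi>\<in>test_functions. \<forall>\<epsilon>>0. \<exists>N. \<exists>\<delta>>0. \<forall>\<psi>\<in>test_nbhd \<phi> N \<delta>. norm (T \<psi> - T \<phi>) < \<epsilon>)}"

definition represents_on ::
    "(real^'d) set \<Rightarrow> (real^'d \<Rightarrow> complex) \<Rightarrow> ((real^'d \<Rightarrow> complex) \<Rightarrow> complex) \<Rightarrow> bool" where
  "represents_on V f T \<longleftrightarrow> periodic_on V f \<and>
     (\<forall>K. compact K \<and> K \<subseteq> V \<longrightarrow> set_integrable lborel K f) \<and>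
     (\<forall>\<phi>\<in>test_functions. closure {x. \<phi> x \<noteq> 0} \<subseteq> V \<longrightarrow> T \<phi> = torus_integral (\<lambda>x. f x * \<phi> x))"

definition restriction_in ::
    "((real^'d \<Rightarrow> complex) \<Rightarrow> complex) \<Rightarrow> (real^'d) set \<Rightarrow> (real^'d \<Rightarrow> complex) set \<Rightarrow> bool" where
  "restriction_in T V F \<longleftrightarrow> (\<exists>f\<in>F. represents_on V f T)"


section \<open>Generalized random fields\<close>

text \<open>
  The values of a field are representatives of elements of \<open>L\<^sup>2\<close>, so linearity and
  reality are required almost surely, separately for each choice of test functions.
\<close>

definition real_GeRF :: "'w measure \<Rightarrow> ((real^'d \<Rightarrow> complex) \<Rightarrow> 'w \<Rightarrow> complex) \<Rightarrow> bool" where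
  "real_GeRF M Z \<longleftrightarrow>
     (\<forall>\<phi>\<in>test_functions. Z \<phi> \<in> borel_measurable M \<and> integrable M (\<lambda>\<omega>. (norm (Z \<phi> \<omega>))\<^sup>2)) \<and>
     (\<forall>\<phi>\<in>test_functions. \<forall>\<psi>\<in>test_functions. \<forall>a b.
        AE \<omega> in M. Z (\<lambda>x. a * \<phi> x + b * \<psi> x) \<omega> = a * Z \<phi> \<omega> + b * Z \<psi> \<omega>) \<and>
     (\<forall>\<phi>\<in>test_functions. \<forall>\<epsilon>>0. \<exists>N. \<exists>\<delta>>0. \<forall>\<psi>\<in>test_nbhd \<phi> N \<delta>.
        (LINT \<omega>|M. (norm (Z \<psi> \<omega> - Z \<phi> \<omega>))\<^sup>2) < \<epsilon>) \<and>
     (\<forall>\<phi>\<in>test_functions. (\<forall>x. \<phi> x \<in> \<real>) \<longrightarrow> (AE \<omega> in M. Z \<phi> \<omega> \<in> \<real>))"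

definition centered_GeRF :: "'w measure \<Rightarrow> ((real^'d \<Rightarrow> complex) \<Rightarrow> 'w \<Rightarrow> complex) \<Rightarrow> bool" where
  "centered_GeRF M Z \<longleftrightarrow> (\<forall>\<phi>\<in>test_functions. (LINT \<omega>|M. Z \<phi> \<omega>) = 0)"

text \<open>Constants count as (degenerate) Gaussian variables.\<close>

definition gaussian_rv :: "'w measure \<Rightarrow> ('w \<Rightarrow> real) \<Rightarrow> bool" where
  "gaussian_rv M X \<longleftrightarrow> X \<in> borel_measurable M \<and>
     ((\<exists>\<mu>. AE \<omega> in M. X \<omega> = \<mu>) \<or>
      (\<exists>\<mu> \<sigma>. \<sigma> > 0 \<and> distributed M lborel X (normal_density \<mu> \<sigma>)))"

text \<open>A complex variable is Gaussian if its real and imaginary part are jointly Gaussian.\<close>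

definition gaussian_GeRF :: "'w measure \<Rightarrow> ((real^'d \<Rightarrow> complex) \<Rightarrow> 'w \<Rightarrow> complex) \<Rightarrow> bool" where
  "gaussian_GeRF M Z \<longleftrightarrow>
     (\<forall>\<phi>\<in>test_functions. \<forall>a b. gaussian_rv M (\<lambda>\<omega>. a * Re (Z \<phi> \<omega>) + b * Im (Z \<phi> \<omega>)))"

definition gaussian_white_noise :: "'w measure \<Rightarrow> ((real^'d \<Rightarrow> complex) \<Rightarrow> 'w \<Rightarrow> complex) \<Rightarrow> bool" where
  "gaussian_white_noise M W \<longleftrightarrow> real_GeRF M W \<and> centered_GeRF M W \<and> gaussian_GeRF M W \<and>
     (\<forall>\<phi>\<in>test_functions. \<forall>\<psi>\<in>test_functions.
        (LINT \<omega>|M. W \<phi> \<omega> * cnj (W \<psi> \<omega>)) = torus_inner \<phi> \<psi>)"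

text \<open>
  A modification of a field as a random element of the space of distributions: a measurable
  family of distributions that agrees almost surely with the field on each test function.
\<close>

definition distributional_modification ::
    "'w measure \<Rightarrow> ((real^'d \<Rightarrow> complex) \<Rightarrow> 'w \<Rightarrow> complex) \<Rightarrow>
     ('w \<Rightarrow> (real^'d \<Rightarrow> complex) \<Rightarrow> complex) \<Rightarrow> bool" where
  "distributional_modification M Z T \<longleftrightarrow>
     (\<forall>\<omega>\<in>space M. T \<omega> \<in> torus_distributions) \<and>
     (\<forall>\<phi>\<in>test_functions. (\<lambda>\<omega>. T \<omega> \<phi>) \<in> borel_measurable M \<and> (AE \<omega> in M. T \<omega> \<phi> = Z \<phi> \<omega>))"


section \<open>Pseudo-differential operators and the Matern field\<close>

definition torus_Op ::
    "(real^'d \<Rightarrow> int^'d \<Rightarrow> complex) \<Rightarrow> (real^'d \<Rightarrow> complex) \<Rightarrow> real^'d \<Rightarrow> complex" where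
  "torus_Op p f x = (\<Sum>\<^sub>\<infinity>k. p x k * fourier_coeff f k * fourier_mode k x)"

text \<open>
  The adjoint as an operator on test functions; the value is unique because continuous periodic
  functions are determined by their inner products with test functions.
\<close>

definition L2_adjoint ::
    "((real^'d \<Rightarrow> complex) \<Rightarrow> real^'d \<Rightarrow> complex) \<Rightarrow> (real^'d \<Rightarrow> complex) \<Rightarrow> real^'d \<Rightarrow> complex" where
  "L2_adjoint A \<phi> = (THE \<psi>. \<psi> \<in> test_functions \<and>
     (\<forall>f\<in>test_functions. torus_inner (A f) \<phi> = torus_inner f \<psi>))"

definition matern_lambda :: "real \<Rightarrow> int^'d \<Rightarrow> real" where
  "matern_lambda \<kappa> k = sqrt (\<kappa>\<^sup>2 + 4 * pi\<^sup>2 * (norm (lattice_vec k))\<^sup>2)"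

definition matern_symbol :: "real \<Rightarrow> (real^'d \<Rightarrow> real) \<Rightarrow> real^'d \<Rightarrow> int^'d \<Rightarrow> complex" where
  "matern_symbol \<kappa> m x k = complex_of_real (matern_lambda \<kappa> k powr (- m x))"

definition matern_field ::
    "real \<Rightarrow> (real^'d \<Rightarrow> real) \<Rightarrow> ((real^'d \<Rightarrow> complex) \<Rightarrow> 'w \<Rightarrow> complex) \<Rightarrow>
     (real^'d \<Rightarrow> complex) \<Rightarrow> 'w \<Rightarrow> complex" where
  "matern_field \<kappa> m W \<phi> = W (L2_adjoint (torus_Op (matern_symbol \<kappa> m)) \<phi>)"

end

theory Submission
  imports Defs
begin

text \<open>
  Expanding the noise as \<open>\<Sum>\<^sub>k \<xi>\<^sub>k e\<^sub>k\<close>, the field is the series of the dyadic blocks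
  \<open>B\<^sub>j(x) = \<Sum> q\<^sub>m(x, k) \<xi>\<^sub>k e\<^sub>k(x)\<close> over \<open>\<bar>k\<bar> \<approx> 2 ^ j\<close>. At the point \<open>x\<close> the block has standard deviation
  of order \<open>2 ^ (- j H(x))\<close>, and a moment and union bound shows that almost surely
  \<open>\<bar>\<partial>\<^sup>\<alpha> B\<^sub>j(x)\<bar> \<le> C 2 ^ (j (\<bar>\<alpha>\<bar> - H(x) + \<epsilon>))\<close> for all \<open>x\<close> and \<open>j\<close>. Summation over \<open>j\<close> gives the continuous
  modification on \<open>U\<close> and its Hoelder regularity, and pairing with test functions, whose
  coefficients decay rapidly, gives the distribution on the whole torus.

  For the converse let \<open>\<eta>\<close> be a bump function near \<open>a\<close>. If the field is given near \<open>a\<close> by a function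
  \<open>f\<close> of class \<open>C\<^sup>\<sigma>\<close> (or \<open>L\<^sup>2\<close>, with \<open>\<sigma> = 0\<close>), then the squares of the Fourier coefficients of \<open>f \<eta>\<close> over
  a block of \<open>N\<^sup>d\<close> frequencies of size \<open>\<approx> N\<close> sum up to at most \<open>C N ^ (- 2 \<sigma>)\<close>, by finite differences
  and Bessel's inequality. These coefficients are jointly Gaussian with variances at least
  \<open>c N ^ (- 2 m\<^sub>1)\<close>, where \<open>m \<le> m\<^sub>1\<close> on the support of \<open>\<eta>\<close>. A sum of squares of jointly Gaussian variables
  is small only with small probability when its mean is large, no matter how they are correlated,
  as the Laplace transform shows. So almost surely no such \<open>f\<close> exists if \<open>\<sigma> > m\<^sub>1 - d / 2\<close>.
\<close>

section \<open>Calculus of partial derivatives\<close>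

text \<open>Two obstacles shape the development. The noise is linear only up to null sets that
  depend on the test functions, while regularity quantifies over uncountably many points, test
  functions and representing functions. Every almost sure statement is therefore reduced to
  countably many values of the noise: for the upper bound through a pathwise series in the variables
  \<open>xi k\<close>, for sharpness because a representing function \<open>f\<close> enters only
  through the Fourier coefficients of \<open>f \<eta>\<close>, which are values of the distribution
  at countably many test functions. The other obstacle is the variable order. Estimates are kept
  pointwise in x: a derivative of the symbol is compared with the symbol at the same x, and
  differentiating the exponent m(x) costs only logarithms of the frequency. On the grids of the
  union bound H changes by O(1 / j), so 2 ^ (j H) changes by a bounded factor. In the converse only
  a small neighbourhood of one point a matters, and replacing m by a constant m1 slightly above m(a)
  is paid for by a strict inequality. The cutoff correlates the coefficients, so no argument with
  independent blocks is available.\<close>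

definition has_pderiv :: "'d \<Rightarrow> (real^'d \<Rightarrow> 'b::real_normed_vector) \<Rightarrow> 'b \<Rightarrow> real^'d \<Rightarrow> bool" where
  "has_pderiv i f D x \<longleftrightarrow> ((\<lambda>t. f (x + t *\<^sub>R axis i 1)) has_vector_derivative D) (at 0)"

lemma has_pderiv_pderiv_at: "has_pderiv i f D x \<Longrightarrow> pderiv_at i f x = D"
  unfolding has_pderiv_def pderiv_at_def by (rule vector_derivative_at)

lemma differentiable_imp_has_pderiv:
  "(\<lambda>t. f (x + t *\<^sub>R axis i 1)) differentiable (at 0) \<Longrightarrow> has_pderiv i f (pderiv_at i f x) x"
  unfolding has_pderiv_def pderiv_at_def by (simp add: vector_derivative_works[symmetric])

lemma has_pderiv_imp_differentiable:
  "has_pderiv i f D x \<Longrightarrow> (\<lambda>t. f (x + t *\<^sub>R axis i 1)) differentiable (at 0)"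
  unfolding has_pderiv_def by (rule differentiableI_vector)

text \<open>Moving the base point along the line turns the derivative at 0 into the derivative at
  \<open>t\<close>. One-variable theorems can then be applied along a whole segment in direction
  \<open>i\<close>.\<close>

lemma has_pderiv_line:
  assumes "has_pderiv i f D (x + t *\<^sub>R axis i 1)"
  shows "((\<lambda>s. f (x + s *\<^sub>R axis i 1)) has_vector_derivative D) (at t)"
proof -
  have "((\<lambda>s. f ((x + t *\<^sub>R axis i 1) + s *\<^sub>R axis i 1)) has_vector_derivative D) (at (t - t))"
    using assms by (simp add: has_pderiv_def)
  then have "((\<lambda>s. f ((x + t *\<^sub>R axis i 1) + s *\<^sub>R axis i 1)) \<circ> (\<lambda>s. s - t) has_vector_derivative 1 *\<^sub>R D) (at t)"
    by (intro vector_diff_chain_at) (auto intro!: derivative_eq_intros)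
  then show ?thesis
    by (simp add: o_def algebra_simps)
qed

lemma has_pderiv_const [intro]: "has_pderiv i (\<lambda>_. c) 0 x"
  by (simp add: has_pderiv_def)

lemma has_pderiv_add: "has_pderiv i f D x \<Longrightarrow> has_pderiv i g E x \<Longrightarrow> has_pderiv i (\<lambda>x. f x + g x) (D + E) x"
  unfolding has_pderiv_def by (rule has_vector_derivative_add)

lemma has_pderiv_mult:
  fixes f g :: "real^'d \<Rightarrow> 'b::real_normed_algebra"
  shows "has_pderiv i f D x \<Longrightarrow> has_pderiv i g E x \<Longrightarrow> has_pderiv i (\<lambda>x. f x * g x) (D * g x + f x * E) x"
  unfolding has_pderiv_def using has_vector_derivative_mult[of "\<lambda>t. f (x + t *\<^sub>R axis i 1)" D 0 UNIV "\<lambda>t. g (x + t *\<^sub>R axis i 1)" E]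
  by (simp add: add.commute)

lemma has_pderiv_linear: "bounded_linear L \<Longrightarrow> has_pderiv i f D x \<Longrightarrow> has_pderiv i (\<lambda>x. L (f x)) (L D) x"
  unfolding has_pderiv_def by (rule bounded_linear.has_vector_derivative)

lemma has_pderiv_inner: "has_pderiv i (\<lambda>x. c \<bullet> x) (c $ i) x"
  unfolding has_pderiv_def
  by (auto intro!: derivative_eq_intros simp: inner_add_right has_vector_derivative_def inner_axis)

lemma has_pderiv_chain:
  fixes f :: "real^'d \<Rightarrow> 'b::real_normed_field"
  assumes "has_pderiv i f D x" "(h has_field_derivative E) (at (f x))"
  shows "has_pderiv i (\<lambda>x. h (f x)) (D * E) x"
  using field_vector_diff_chain_at[of "\<lambda>t. f (x + t *\<^sub>R axis i 1)" D 0 h E] assms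
  by (simp add: has_pderiv_def o_def)

lemma has_pderiv_cong_open:
  assumes "has_pderiv i f D x" "open S" "x \<in> S" "\<And>y. y \<in> S \<Longrightarrow> g y = f y"
  shows "has_pderiv i g D x"
proof -
  let ?l = "\<lambda>t. x + t *\<^sub>R axis i (1::real)"
  have "open (?l -` S)"
    by (intro open_vimage assms continuous_intros)
  then show ?thesis
    using assms unfolding has_pderiv_def
    by (elim has_vector_derivative_transform_within_open[where S = "?l -` S"]) auto
qed

text \<open>Holds also where no derivative exists: the two functions have the same derivatives in
  the relational sense of \<open>has_pderiv\<close>, so the choice behind \<open>pderiv_at\<close>
  returns the same value for both.\<close>

lemma pderiv_at_cong_open:
  assumes "open S" "x \<in> S" "\<And>y. y \<in> S \<Longrightarrow> g y = f y"
  shows "pderiv_at i g x = pderiv_at i f x"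
proof -
  have "has_pderiv i g D x \<longleftrightarrow> has_pderiv i f D x" for D
    using has_pderiv_cong_open[of i f D x S g] has_pderiv_cong_open[of i g D x S f] assms by auto
  then show ?thesis
    by (simp add: pderiv_at_def vector_derivative_def has_pderiv_def)
qed

text \<open>The recursion exposes the outermost derivative. The inductions for products and
  exponentials need the innermost one, which acts on the given function itself.\<close>

lemma pderivs_snoc: "pderivs (\<alpha> @ [i]) f = pderivs \<alpha> (pderiv_at i f)"
  by (induction \<alpha>) auto

lemma pderiv_at_periodic:
  assumes "torus_open V" "periodic_on V f"
  shows "periodic_on V (pderiv_at i f)"
  unfolding periodic_on_def
proof (intro ballI allI)
  fix x k assume "x \<in> V"
  have *: "f (y + lattice_vec k) = f y" if "y \<in> V" for y
    using assms that by (auto simp: periodic_on_def)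
  have "pderiv_at i f (x + lattice_vec k) = pderiv_at i (\<lambda>y. f (y + lattice_vec k)) x"
    by (simp add: pderiv_at_def add_ac)
  also have "\<dots> = pderiv_at i f x"
    using assms \<open>x \<in> V\<close> * by (intro pderiv_at_cong_open[of V]) (auto simp: torus_open_def)
  finally show "pderiv_at i f (x + lattice_vec k) = pderiv_at i f x" .
qed

lemma pderivs_periodic:
  "torus_open V \<Longrightarrow> periodic_on V f \<Longrightarrow> periodic_on V (pderivs \<alpha> f)"
  by (induction \<alpha>) (auto intro: pderiv_at_periodic)

lemma torus_open_UNIV [simp]: "torus_open UNIV"
  by (simp add: torus_open_def)


section \<open>Smooth functions\<close>

text \<open>Differentiability is encoded by a derivative function of one order less rather than
  through \<open>pderivs\<close>, so that closure under sums, products and exponentials is an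
  induction on the order with the function generalized.\<close>

primrec Ck :: "nat \<Rightarrow> (real^'d \<Rightarrow> 'b::real_normed_vector) \<Rightarrow> bool" where
  "Ck 0 f \<longleftrightarrow> continuous_on UNIV f"
| "Ck (Suc n) f \<longleftrightarrow> continuous_on UNIV f \<and> (\<forall>i. \<exists>f'. Ck n f' \<and> (\<forall>x. has_pderiv i f (f' x) x))"

definition smooth :: "(real^'d \<Rightarrow> 'b::real_normed_vector) \<Rightarrow> bool" where
  "smooth f \<longleftrightarrow> (\<forall>n. Ck n f)"

lemma Ck_continuous: "Ck n f \<Longrightarrow> continuous_on UNIV f"
  by (cases n) auto

lemma Ck_SucD: "Ck (Suc n) f \<Longrightarrow> \<exists>f'. Ck n f' \<and> (\<forall>x. has_pderiv i f (f' x) x)"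
  by simp

lemma Ck_Suc_imp: "Ck (Suc n) f \<Longrightarrow> Ck n f"
proof (induction n arbitrary: f)
  case (Suc n)
  have "\<exists>f'. Ck n f' \<and> (\<forall>x. has_pderiv i f (f' x) x)" for i
  proof -
    obtain f' where "Ck (Suc n) f'" "\<forall>x. has_pderiv i f (f' x) x"
      using Ck_SucD[OF Suc.prems] by blast
    then show ?thesis using Suc.IH by blast
  qed
  then show ?case unfolding Ck.simps(2) using Ck_continuous[OF Suc.prems] by blast
qed auto

lemma Ck_const: "Ck n (\<lambda>_::real^'d. c)"
proof (induction n arbitrary: c)
  case (Suc n)
  have "\<exists>f'. Ck n f' \<and> (\<forall>x. has_pderiv i (\<lambda>_::real^'d. c) (f' x) x)" for i
    by (rule exI[of _ "\<lambda>_. 0"]) (auto intro: Suc)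
  then show ?case by simp
qed auto

lemma Ck_add: "Ck n f \<Longrightarrow> Ck n g \<Longrightarrow> Ck n (\<lambda>x. f x + g x)"
proof (induction n arbitrary: f g)
  case (Suc n)
  have "\<exists>f'. Ck n f' \<and> (\<forall>x. has_pderiv i (\<lambda>x. f x + g x) (f' x) x)" for i
  proof -
    obtain f' g' where "Ck n f'" "\<forall>x. has_pderiv i f (f' x) x" "Ck n g'" "\<forall>x. has_pderiv i g (g' x) x"
      using Suc.prems by (blast dest: Ck_SucD)
    then show ?thesis
      by (intro exI[of _ "\<lambda>x. f' x + g' x"]) (auto intro: Suc has_pderiv_add)
  qed
  then show ?case using Suc.prems by (auto intro: continuous_intros)
qed (auto intro: continuous_intros)

lemma Ck_mult:
  fixes f g :: "real^'d \<Rightarrow> 'b::real_normed_algebra"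
  shows "Ck n f \<Longrightarrow> Ck n g \<Longrightarrow> Ck n (\<lambda>x. f x * g x)"
proof (induction n arbitrary: f g)
  case (Suc n)
  have "\<exists>f'. Ck n f' \<and> (\<forall>x. has_pderiv i (\<lambda>x. f x * g x) (f' x) x)" for i
  proof -
    obtain f' g' where "Ck n f'" "\<forall>x. has_pderiv i f (f' x) x" "Ck n g'" "\<forall>x. has_pderiv i g (g' x) x"
      using Suc.prems by (blast dest: Ck_SucD)
    then show ?thesis using Suc.prems
      by (intro exI[of _ "\<lambda>x. f' x * g x + f x * g' x"])
        (intro conjI allI Ck_add Suc.IH has_pderiv_mult, auto dest: Ck_Suc_imp simp del: Ck.simps(2))
  qed
  then show ?case using Suc.prems by (auto intro: continuous_intros)
qed (auto intro: continuous_intros)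

lemma Ck_linear: "bounded_linear L \<Longrightarrow> Ck n f \<Longrightarrow> Ck n (\<lambda>x. L (f x))"
proof (induction n arbitrary: f)
  case (Suc n)
  have "\<exists>f'. Ck n f' \<and> (\<forall>x. has_pderiv i (\<lambda>x. L (f x)) (f' x) x)" for i
  proof -
    obtain f' where "Ck n f'" "\<forall>x. has_pderiv i f (f' x) x"
      using Suc.prems by (blast dest: Ck_SucD)
    then show ?thesis using Suc
      by (intro exI[of _ "\<lambda>x. L (f' x)"]) (auto intro: has_pderiv_linear)
  qed
  then show ?case using Suc.prems by (auto intro: linear_continuous_on_compose bounded_linear.linear bounded_linear.continuous_on)
qed (auto intro: bounded_linear.continuous_on)

lemma Ck_inner: "Ck n (\<lambda>x. c \<bullet> x)"
proof (cases n)
  case (Suc n)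
  have "\<exists>f'. Ck n f' \<and> (\<forall>x. has_pderiv i ((\<bullet>) c) (f' x) x)" for i
    by (rule exI[of _ "\<lambda>_. c $ i"]) (auto intro: Ck_const has_pderiv_inner)
  then show ?thesis by (auto simp: Suc intro: continuous_intros)
qed (auto intro: continuous_intros)

lemma Ck_exp:
  fixes f :: "real^'d \<Rightarrow> 'b::{real_normed_field,banach}"
  shows "Ck n f \<Longrightarrow> Ck n (\<lambda>x. exp (f x))"
proof (induction n arbitrary: f)
  case (Suc n)
  have "\<exists>f'. Ck n f' \<and> (\<forall>x. has_pderiv i (\<lambda>x. exp (f x)) (f' x) x)" for i
  proof -
    obtain f' where "Ck n f'" "\<forall>x. has_pderiv i f (f' x) x"
      using Suc.prems by (blast dest: Ck_SucD)
    then show ?thesis using Suc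
      by (intro exI[of _ "\<lambda>x. f' x * exp (f x)"])
        (intro conjI allI Ck_mult Suc.IH has_pderiv_chain[where h = exp] DERIV_exp,
          auto dest: Ck_Suc_imp simp del: Ck.simps(2))
  qed
  then show ?case using Suc.prems by (auto intro: continuous_intros)
qed (auto intro: continuous_intros)

lemma smooth_continuous: "smooth f \<Longrightarrow> continuous_on S f"
  unfolding smooth_def using Ck_continuous[of 0 f] continuous_on_subset by blast

lemma smooth_has_pderiv: "smooth f \<Longrightarrow> has_pderiv i f (pderiv_at i f x) x"
  unfolding smooth_def by (metis Ck_SucD has_pderiv_pderiv_at)

lemma smooth_pderiv_at: 
  assumes "smooth f" shows "smooth (pderiv_at i f)"
  unfolding smooth_def
proof
  fix n
  have "Ck (Suc n) f" using assms by (simp only: smooth_def)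
  then obtain f' where f': "Ck n f'" "\<And>x. has_pderiv i f (f' x) x" by (blast dest: Ck_SucD)
  then have "pderiv_at i f = f'" by (auto simp: has_pderiv_pderiv_at)
  with f' show "Ck n (pderiv_at i f)" by simp
qed

lemma smooth_pderivs: "smooth f \<Longrightarrow> smooth (pderivs \<alpha> f)"
  by (induction \<alpha>) (auto intro: smooth_pderiv_at)

lemma smooth_const [intro, simp]: "smooth (\<lambda>_::real^'d. c)"
  and smooth_add: "smooth f \<Longrightarrow> smooth g \<Longrightarrow> smooth (\<lambda>x. f x + g x)"
  and smooth_linear: "bounded_linear L \<Longrightarrow> smooth f \<Longrightarrow> smooth (\<lambda>x. L (f x))"
  and smooth_inner [intro]: "smooth (\<lambda>x. b \<bullet> x)"
  by (simp_all add: smooth_def Ck_const Ck_add Ck_linear Ck_inner)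

lemma smooth_mult:
  fixes f g :: "real^'d \<Rightarrow> 'b::real_normed_algebra"
  shows "smooth f \<Longrightarrow> smooth g \<Longrightarrow> smooth (\<lambda>x. f x * g x)"
  by (simp add: smooth_def Ck_mult)

lemma smooth_exp:
  fixes f :: "real^'d \<Rightarrow> 'b::{real_normed_field,banach}"
  shows "smooth f \<Longrightarrow> smooth (\<lambda>x. exp (f x))"
  by (simp add: smooth_def Ck_exp)

lemma smooth_sum: "(\<And>k. k \<in> A \<Longrightarrow> smooth (f k)) \<Longrightarrow> smooth (\<lambda>x. \<Sum>k\<in>A. f k x)"
  by (induction A rule: infinite_finite_induct) (auto intro: smooth_add smooth_const)

lemma smooth_cmult:
  fixes f :: "real^'d \<Rightarrow> 'b::real_normed_algebra"
  shows "smooth f \<Longrightarrow> smooth (\<lambda>x. c * f x)"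
  by (rule smooth_mult[OF smooth_const])

text \<open>From left to right, the induction on the order treats all iterated derivatives of
  \<open>f\<close> at once: each is continuous and differentiable, with derivative again in the
  family. The empty list gives \<open>f\<close>.\<close>

lemma torus_smooth_iff: "torus_smooth f \<longleftrightarrow> periodic_on UNIV f \<and> smooth f"
proof (intro iffI conjI)
  assume f: "torus_smooth f"
  then show "periodic_on UNIV f" by (simp add: torus_smooth_def)
  have "Ck n (pderivs \<alpha> f)" for n \<alpha>
  proof (induction n arbitrary: \<alpha>)
    case (Suc n)
    have "has_pderiv i (pderivs \<alpha> f) (pderivs (i # \<alpha>) f x) x" for i x
      using f unfolding torus_smooth_def has_pderivs_on_def pderivs.simps
      by (intro differentiable_imp_has_pderiv) (meson UNIV_I lessI)
    moreover have "continuous_on UNIV (pderivs \<alpha> f)" using f by (simp add: torus_smooth_def)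
    ultimately show ?case unfolding Ck.simps(2) using Suc[of "_ # \<alpha>"] by blast
  qed (use f in \<open>auto simp: torus_smooth_def\<close>)
  from this[of _ "[]"] show "smooth f" by (simp add: smooth_def)
next
  assume "periodic_on UNIV f \<and> smooth f"
  then show "torus_smooth f"
    unfolding torus_smooth_def has_pderivs_on_def
    by (auto intro: smooth_continuous smooth_pderivs has_pderiv_imp_differentiable smooth_has_pderiv)
qed

lemma pderiv_at_const [simp]: "pderiv_at i (\<lambda>_. c) = (\<lambda>_. 0)"
  by (rule ext, rule has_pderiv_pderiv_at) auto

lemma pderiv_at_add: "smooth f \<Longrightarrow> smooth g \<Longrightarrow> pderiv_at i (\<lambda>x. f x + g x) = (\<lambda>x. pderiv_at i f x + pderiv_at i g x)"
  by (rule ext, rule has_pderiv_pderiv_at) (intro has_pderiv_add smooth_has_pderiv)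

lemma pderiv_at_mult:
  fixes f g :: "real^'d \<Rightarrow> 'b::real_normed_algebra"
  shows "smooth f \<Longrightarrow> smooth g \<Longrightarrow> pderiv_at i (\<lambda>x. f x * g x) = (\<lambda>x. pderiv_at i f x * g x + f x * pderiv_at i g x)"
  by (rule ext, rule has_pderiv_pderiv_at) (intro has_pderiv_mult smooth_has_pderiv)

lemma pderiv_at_exp:
  fixes f :: "real^'d \<Rightarrow> 'b::{real_normed_field,banach}"
  shows "smooth f \<Longrightarrow> pderiv_at i (\<lambda>x. exp (f x)) = (\<lambda>x. pderiv_at i f x * exp (f x))"
  by (rule ext, rule has_pderiv_pderiv_at) (intro has_pderiv_chain[where h = exp] DERIV_exp smooth_has_pderiv)

lemma pderiv_at_linear: "bounded_linear L \<Longrightarrow> smooth f \<Longrightarrow> pderiv_at i (\<lambda>x. L (f x)) = (\<lambda>x. L (pderiv_at i f x))"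
  by (rule ext, rule has_pderiv_pderiv_at) (erule has_pderiv_linear, erule smooth_has_pderiv)

lemma pderivs_add: "smooth f \<Longrightarrow> smooth g \<Longrightarrow> pderivs \<alpha> (\<lambda>x. f x + g x) = (\<lambda>x. pderivs \<alpha> f x + pderivs \<alpha> g x)"
  by (induction \<alpha>) (auto simp: pderiv_at_add smooth_pderivs)

lemma pderivs_linear: "bounded_linear L \<Longrightarrow> smooth f \<Longrightarrow> pderivs \<alpha> (\<lambda>x. L (f x)) = (\<lambda>x. L (pderivs \<alpha> f x))"
  by (induction \<alpha>) (auto simp: pderiv_at_linear smooth_pderivs)

lemma pderivs_cmult:
  fixes f :: "real^'d \<Rightarrow> 'b::real_normed_algebra"
  shows "smooth f \<Longrightarrow> pderivs \<alpha> (\<lambda>x. c * f x) = (\<lambda>x. c * pderivs \<alpha> f x)"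
  by (rule pderivs_linear[OF bounded_linear_mult_right])

lemma pderivs_zero [simp]: "pderivs \<alpha> (\<lambda>_. 0) = (\<lambda>_. 0)"
  by (induction \<alpha>) auto

lemma pderivs_sum:
  "(\<And>k. k \<in> A \<Longrightarrow> smooth (f k)) \<Longrightarrow> pderivs \<alpha> (\<lambda>x. \<Sum>k\<in>A. f k x) = (\<lambda>x. \<Sum>k\<in>A. pderivs \<alpha> (f k) x)"
  by (induction A rule: infinite_finite_induct) (auto simp: pderivs_add smooth_sum)

text \<open>A crude Leibniz rule: each differentiation at most doubles the number of products,
  whence \<open>2 ^ n\<close>. Removing the innermost derivative leaves two products to which the
  induction hypothesis applies. All bounds are at the single point \<open>x\<close>, so they may
  depend on the order at that point.\<close>

lemma pderivs_mult_bound: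
  fixes f g :: "real^'d \<Rightarrow> 'b::real_normed_algebra"
  assumes "smooth f" "smooth g" "A \<ge> 0" 
    and "\<And>\<alpha>. length \<alpha> \<le> n \<Longrightarrow> norm (pderivs \<alpha> f x) \<le> A"
    and "\<And>\<alpha>. length \<alpha> \<le> n \<Longrightarrow> norm (pderivs \<alpha> g x) \<le> B"
    and "length \<alpha> \<le> n"
  shows "norm (pderivs \<alpha> (\<lambda>x. f x * g x) x) \<le> 2 ^ n * A * B"
  using assms
proof (induction n arbitrary: f g \<alpha>)
  case 0
  then have "norm (f x * g x) \<le> A * B"
    using "0.prems"(4)[of "[]"] "0.prems"(5)[of "[]"]
    by (intro order.trans[OF norm_mult_ineq] mult_mono) auto
  then show ?case using 0 by simp
next
  case (Suc n)
  have B: "B \<ge> 0" using order.trans[OF norm_ge_zero Suc.prems(5)[of "[]"]] by simp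
  show ?case
  proof (cases "length \<alpha> \<le> n")
    case True
    then have "norm (pderivs \<alpha> (\<lambda>x. f x * g x) x) \<le> 2 ^ n * A * B"
      using Suc.prems by (intro Suc.IH) auto
    also have "\<dots> \<le> 2 ^ Suc n * A * B" using B Suc.prems(3) by (simp add: mult_right_mono)
    finally show ?thesis .
  next
    case False
    then obtain \<beta> i where \<alpha>: "\<alpha> = \<beta> @ [i]" using Suc.prems(6) by (cases \<alpha> rule: rev_cases) auto
    with Suc.prems(6) have \<beta>: "length \<beta> \<le> n" by simp
    have f': "norm (pderivs \<gamma> (pderiv_at i f) x) \<le> A" if "length \<gamma> \<le> n" for \<gamma>
      using Suc.prems(4)[of "\<gamma> @ [i]"] that by (simp add: pderivs_snoc)
    have g': "norm (pderivs \<gamma> (pderiv_at i g) x) \<le> B" if "length \<gamma> \<le> n" for \<gamma>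
      using Suc.prems(5)[of "\<gamma> @ [i]"] that by (simp add: pderivs_snoc)
    have 1: "norm (pderivs \<beta> (\<lambda>x. pderiv_at i f x * g x) x) \<le> 2 ^ n * A * B"
      using Suc.prems f' \<beta> by (intro Suc.IH) (auto intro: smooth_pderiv_at)
    have 2: "norm (pderivs \<beta> (\<lambda>x. f x * pderiv_at i g x) x) \<le> 2 ^ n * A * B"
      using Suc.prems g' \<beta> by (intro Suc.IH) (auto intro: smooth_pderiv_at)
    have "norm (pderivs \<alpha> (\<lambda>x. f x * g x) x) =
        norm (pderivs \<beta> (\<lambda>x. pderiv_at i f x * g x) x + pderivs \<beta> (\<lambda>x. f x * pderiv_at i g x) x)"
      using Suc.prems by (simp add: \<alpha> pderivs_snoc pderiv_at_mult pderivs_add smooth_mult smooth_pderiv_at)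
    also have "\<dots> \<le> 2 ^ n * A * B + 2 ^ n * A * B"
      by (intro norm_triangle_le add_mono 1 2)
    finally show ?thesis by (simp add: algebra_simps)
  qed
qed

text \<open>Derivatives of exp(f) are polynomials in the derivatives of f times exp(f), and the last
  factor survives at the same point \<open>x\<close>. Writing (exp f)' = f' exp f and applying the
  product bound multiplies the constant by \<open>2 ^ n * A\<close> at step n, which stays below
  \<open>2 ^ (n\<^sup>2) * A ^ n\<close>; \<open>A \<ge> 1\<close> covers the lists that are shorter
  than the current order.\<close>

lemma pderivs_exp_bound:
  fixes f :: "real^'d \<Rightarrow> 'b::{real_normed_field,banach}"
  assumes "smooth f" "A \<ge> 1"
    and "\<And>i \<alpha>. length \<alpha> < n \<Longrightarrow> norm (pderivs \<alpha> (pderiv_at i f) x) \<le> A"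
    and "length \<alpha> \<le> n"
  shows "norm (pderivs \<alpha> (\<lambda>x. exp (f x)) x) \<le> 2 ^ (n\<^sup>2) * A ^ n * norm (exp (f x))"
  using assms(3,4)
proof (induction n arbitrary: \<alpha>)
  case 0
  then show ?case by simp
next
  case (Suc n)
  have "(2::real) ^ (n\<^sup>2) * A ^ n \<le> 2 ^ ((Suc n)\<^sup>2) * A ^ Suc n"
    using assms(2) by (intro mult_mono power_increasing) (auto simp: power2_eq_square)
  note le = this
  show ?case
  proof (cases "length \<alpha> \<le> n")
    case True
    then have "norm (pderivs \<alpha> (\<lambda>x. exp (f x)) x) \<le> 2 ^ (n\<^sup>2) * A ^ n * norm (exp (f x))"
      using Suc.prems by (intro Suc.IH) auto
    also have "\<dots> \<le> 2 ^ ((Suc n)\<^sup>2) * A ^ Suc n * norm (exp (f x))" 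
      using le by (intro mult_right_mono) auto
    finally show ?thesis .
  next
    case False
    then obtain \<beta> i where \<alpha>: "\<alpha> = \<beta> @ [i]" using Suc.prems(2) by (cases \<alpha> rule: rev_cases) auto
    with Suc.prems have \<beta>: "length \<beta> \<le> n" by simp
    have "norm (pderivs \<beta> (\<lambda>x. pderiv_at i f x * exp (f x)) x) \<le> 2 ^ n * A * (2 ^ (n\<^sup>2) * A ^ n * norm (exp (f x)))"
      using Suc.prems assms \<beta>
      by (intro pderivs_mult_bound Suc.IH) (auto intro: smooth_pderiv_at smooth_exp)
    also have "\<dots> = 2 ^ (n + n\<^sup>2) * A ^ Suc n * norm (exp (f x))" by (simp add: power_add)
    also have "\<dots> \<le> 2 ^ ((Suc n)\<^sup>2) * A ^ Suc n * norm (exp (f x))"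
      using assms(2) by (intro mult_right_mono power_increasing) (auto simp: power2_eq_square)
    finally show ?thesis
      using assms by (simp add: \<alpha> pderivs_snoc pderiv_at_exp)
  qed
qed


section \<open>Smooth periodic bump functions\<close>

definition bump_aux :: "nat \<Rightarrow> real \<Rightarrow> real" where
  "bump_aux p t = (if t > 0 then exp (- 1 / t) / t ^ p else 0)"

text \<open>Raise y <= exp y with y = 1 / ((p + 2) t) to the power p + 2; this gives exp (- 1 / t)
  <= ((p + 2) t) ^ (p + 2), and dividing by t ^ p leaves t ^ 2. A quadratic bound is what makes the
  derivative at 0 vanish.\<close>

lemma bump_aux_bound: "\<bar>bump_aux p t\<bar> \<le> real (p + 2) ^ (p + 2) * t\<^sup>2"
proof (cases "t > 0")
  case True
  let ?n = "p + 2"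
  have "1 / (real ?n * t) \<le> exp (1 / (real ?n * t))"
    using exp_ge_add_one_self[of "1 / (real ?n * t)"] by linarith
  then have "(1 / (real ?n * t)) ^ ?n \<le> exp (1 / (real ?n * t)) ^ ?n"
    using True by (intro power_mono) auto
  also have "\<dots> = exp (1 / t)"
  proof -
    have "real ?n * (1 / (real ?n * t)) = 1 / t" using True by (simp del: of_nat_add)
    then show ?thesis by (simp only: exp_of_nat_mult[symmetric])
  qed
  finally have *: "(1 / (real ?n * t)) ^ ?n \<le> exp (1 / t)" .
  have "exp (- 1 / t) \<le> (real ?n * t) ^ ?n"
  proof -
    have X: "0 < (real ?n * t) ^ ?n" using True by simp
    have "1 / (real ?n * t) ^ ?n \<le> exp (1 / t)" using * by (simp only: power_one_over)
    then have "1 \<le> exp (1 / t) * (real ?n * t) ^ ?n" using X by (simp only: pos_divide_le_eq)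
    then have "exp (- (1 / t)) * 1 \<le> exp (- (1 / t)) * (exp (1 / t) * (real ?n * t) ^ ?n)"
      by (intro mult_left_mono) auto
    then show ?thesis by (simp add: mult.assoc[symmetric] exp_add[symmetric] del: of_nat_add)
  qed
  then have "exp (- 1 / t) / t ^ p \<le> (real ?n * t) ^ ?n / t ^ p"
    using True by (intro divide_right_mono) auto
  also have "\<dots> = real ?n ^ ?n * t\<^sup>2"
    using True by (simp only: power_mult_distrib power_add[of t]) simp
  finally show ?thesis
    using True by (simp only: bump_aux_def) simp
qed (simp add: bump_aux_def)

text \<open>The powers of t in the denominator are carried along so that the family is closed under
  differentiation up to linear combinations. Smoothness of every order then follows by induction
  with \<open>p\<close> generalized.\<close>

lemma bump_aux_deriv:
  "(bump_aux p has_field_derivative bump_aux (p + 2) t - real p * bump_aux (p + 1) t) (at t)"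
proof (cases t "0::real" rule: linorder_cases)
  case greater
  have "((\<lambda>t. exp (- 1 / t) / t ^ p) has_field_derivative bump_aux (p + 2) t - real p * bump_aux (p + 1) t) (at t)"
  proof (cases p)
    case 0
    then show ?thesis using greater
      by (auto intro!: derivative_eq_intros simp: bump_aux_def power2_eq_square)
  next
    case (Suc q)
    show ?thesis using greater
    proof -
      have "((\<lambda>t. exp (- 1 / t) / t ^ p) has_field_derivative
          (exp (- 1 / t) * (1 / t\<^sup>2) * t ^ p - exp (- 1 / t) * (real p * t ^ q)) / (t ^ p * t ^ p)) (at t)"
        using greater by (auto intro!: derivative_eq_intros simp: Suc power2_eq_square simp del: power_Suc)
      also have "(exp (- 1 / t) * (1 / t\<^sup>2) * t ^ p - exp (- 1 / t) * (real p * t ^ q)) / (t ^ p * t ^ p) =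
          bump_aux (p + 2) t - real p * bump_aux (p + 1) t"
        using greater by (simp add: bump_aux_def Suc field_simps power2_eq_square)
      finally show ?thesis .
    qed
  qed
  then show ?thesis
    by (rule has_field_derivative_transform_within_open[where S = "{0<..}"])
      (use greater in \<open>auto simp: bump_aux_def\<close>)
next
  case less
  have "((\<lambda>t. 0) has_field_derivative bump_aux (p + 2) t - real p * bump_aux (p + 1) t) (at t)"
    using less by (simp add: bump_aux_def)
  then show ?thesis
    by (rule has_field_derivative_transform_within_open[where S = "{..<0}"])
      (use less in \<open>auto simp: bump_aux_def\<close>)
next
  case equal
  let ?C = "real (p + 2) ^ (p + 2)"
  have "((\<lambda>y. bump_aux p y / y) \<longlongrightarrow> 0) (at 0)"
  proof (rule Lim_null_comparison)
    show "\<forall>\<^sub>F y in at 0. norm (bump_aux p y / y) \<le> ?C * \<bar>y\<bar>"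
    proof (intro eventually_at_filter[THEN iffD2] always_eventually allI impI)
      fix y :: real assume "y \<noteq> 0"
      then show "norm (bump_aux p y / y) \<le> ?C * \<bar>y\<bar>"
        using bump_aux_bound[of p y]
        by (simp add: field_simps power2_eq_square abs_mult[symmetric] del: of_nat_add)
    qed
    show "((\<lambda>y. ?C * \<bar>y\<bar>) \<longlongrightarrow> 0) (at 0)"
      by (auto intro!: tendsto_eq_intros)
  qed
  then show ?thesis
    by (simp add: equal has_field_derivative_iff bump_aux_def)
qed

lemma continuous_bump_aux: "continuous_on S (bump_aux p)"
  by (rule DERIV_continuous_on) (rule has_field_derivative_at_within[OF bump_aux_deriv])

lemma has_pderiv_bump_aux:
  assumes "has_pderiv i f D x"
  shows "has_pderiv i (\<lambda>x. bump_aux p (f x)) (D * (bump_aux (p + 2) (f x) + - real p * bump_aux (p + 1) (f x))) x"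
  using has_pderiv_chain[OF assms bump_aux_deriv[of p]] by simp

lemma Ck_bump_aux: "Ck n f \<Longrightarrow> Ck n (\<lambda>x. bump_aux p (f x))"
proof (induction n arbitrary: f p)
  case 0
  have "continuous_on UNIV (bump_aux p)"
    by (rule continuous_bump_aux)
  with 0 show ?case using continuous_on_compose2[of UNIV "bump_aux p" UNIV f] by simp
next
  case (Suc n)
  have "continuous_on UNIV (bump_aux p)"
    by (rule continuous_bump_aux)
  then have "continuous_on UNIV (\<lambda>x. bump_aux p (f x))" 
    using continuous_on_compose2[of UNIV "bump_aux p" UNIV f] Ck_continuous[OF Suc.prems] by simp
  moreover have "\<exists>f'. Ck n f' \<and> (\<forall>x. has_pderiv i (\<lambda>x. bump_aux p (f x)) (f' x) x)" for i
  proof -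
    obtain f' where f': "Ck n f'" "\<forall>x. has_pderiv i f (f' x) x"
      using Suc.prems by (blast dest: Ck_SucD)
    show ?thesis 
      by (rule exI[of _ "\<lambda>x. f' x * (bump_aux (p + 2) (f x) + - real p * bump_aux (p + 1) (f x))"])
        (intro conjI allI Ck_mult Ck_add Ck_const Suc.IH has_pderiv_bump_aux f'(1) f'(2)[rule_format] Ck_Suc_imp[OF Suc.prems])
  qed
  ultimately show ?case unfolding Ck.simps(2) by blast
qed

lemma lattice_vec_nth [simp]: "lattice_vec k $ i = real_of_int (k $ i)"
  by (simp add: lattice_vec_def)

lemma cos_add_int_2pi: "cos (2 * pi * (y + real_of_int k)) = cos (2 * pi * y)"
proof -
  have "cos (2 * pi * real_of_int k) = 1" "sin (2 * pi * real_of_int k) = 0"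
    by (simp_all add: cos_int_2pin sin_int_2pin)
  then show ?thesis by (simp add: distrib_left cos_add)
qed

text \<open>Composing with the periodic function \<open>\<Sum>i. 1 - cos (2 \<pi> (x\<^sub>i - a\<^sub>i))\<close> instead of the squared
  distance to \<open>a\<close> makes the bump function periodic.\<close>

lemma torus_bump:
  fixes a :: "real^'d"
  assumes r: "0 < r" "r < 1 / 2"
  obtains \<eta> :: "real^'d \<Rightarrow> real" where "torus_smooth \<eta>" "\<And>x. \<eta> x \<ge> 0" "\<eta> a > 0"
    "\<And>x. x \<in> closure {x. \<eta> x \<noteq> 0} \<Longrightarrow> \<exists>k. x + lattice_vec k \<in> cbox (a - (\<chi> i. r)) (a + (\<chi> i. r))"
proof -
  define c where "c = (\<lambda>x::real^'d. \<Sum>i\<in>UNIV. 1 - cos (2 * pi * (x $ i - a $ i)))"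
  define \<delta> where "\<delta> = 1 - cos (2 * pi * r)"
  define \<eta> where "\<eta> = (\<lambda>x. bump_aux 0 (\<delta> - c x))"
  have "cos (2 * pi * r) < cos 0"
    using r by (intro cos_monotone_0_pi) auto
  then have \<delta>: "\<delta> > 0" by (simp add: \<delta>_def)
  have smooth_c: "smooth (\<lambda>x. \<delta> - c x)"
  proof -
    \<comment> \<open>Each cosine is the real part of an exponential of an affine function, so
      smoothness follows from closure under exponentials and bounded linear maps.\<close>
    have eq: "(\<lambda>x::real^'d. \<delta> - c x) = (\<lambda>x. \<delta> + (\<Sum>i\<in>UNIV. (- 1) + Re (exp ((axis i 1 \<bullet> x + - a $ i) *\<^sub>R (2 * pi * \<i>)))))"
    proof
      fix x :: "real^'d"
      have "Re (exp ((axis i 1 \<bullet> x + - a $ i) *\<^sub>R (2 * pi * \<i>))) = cos (2 * pi * (x $ i - a $ i))" for i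
        by (simp add: inner_axis' Re_exp mult.commute)
      then show "\<delta> - c x = \<delta> + (\<Sum>i\<in>UNIV. (- 1) + Re (exp ((axis i 1 \<bullet> x + - a $ i) *\<^sub>R (2 * pi * \<i>))))"
        by (simp add: c_def sum.distrib sum_subtractf)
    qed
    show ?thesis unfolding eq
      by (intro smooth_add smooth_const smooth_sum smooth_linear[OF bounded_linear_Re] smooth_exp
          smooth_linear[OF bounded_linear_scaleR_left] smooth_inner)
  qed
  have per: "c (x + lattice_vec k) = c x" for x k
  proof -
    have "x $ i + real_of_int (k $ i) - a $ i = (x $ i - a $ i) + real_of_int (k $ i)" for i by simp
    then show ?thesis by (simp only: c_def vector_add_component lattice_vec_nth cos_add_int_2pi)
  qed
  have cont: "continuous_on UNIV c" unfolding c_def by (intro continuous_intros)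
  \<comment> \<open>All summands of \<open>c\<close> are nonnegative, so the bound holds in each
    coordinate separately. After rounding, the difference lies in [- 1 / 2, 1 / 2], and on
    [0, 1 / 2] the map y to cos (2 pi y) is decreasing, so the bound on the cosine becomes a bound
    on the distance.\<close>
  have near: "\<exists>k. x + lattice_vec k \<in> cbox (a - (\<chi> i. r)) (a + (\<chi> i. r))" if "c x \<le> \<delta>" for x
  proof -
    define k :: "int^'d" where "k = (\<chi> i. - round (x $ i - a $ i))"
    have "\<bar>x $ i - a $ i + real_of_int (k $ i)\<bar> \<le> r" for i
    proof -
      let ?y = "x $ i - a $ i" let ?z = "\<bar>?y + real_of_int (k $ i)\<bar>"
      have "1 - cos (2 * pi * ?y) \<le> c x"
        unfolding c_def by (rule member_le_sum[of i UNIV "\<lambda>i. 1 - cos (2 * pi * (x $ i - a $ i))"]) auto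
      with that have "cos (2 * pi * r) \<le> cos (2 * pi * ?y)" by (simp add: \<delta>_def)
      also have "\<dots> = cos (2 * pi * (?y + real_of_int (k $ i)))" by (rule cos_add_int_2pi[symmetric])
      also have "\<dots> = cos (2 * pi * ?z)" by (metis abs_mult abs_numeral abs_of_pos cos_abs_real pi_gt_zero)
      finally have "cos (2 * pi * r) \<le> cos (2 * pi * ?z)" .
      moreover have "?z \<le> 1 / 2" using of_int_round_abs_le[of ?y] by (simp add: k_def abs_minus_commute)
      ultimately have "2 * pi * ?z \<le> 2 * pi * r"
        using r by (subst (asm) cos_mono_le_eq) auto
      then show ?thesis by simp
    qed
    then show ?thesis
      by (intro exI[of _ k]) (auto simp: mem_box_cart abs_le_iff algebra_simps)
  qed
  show ?thesis
  proof
    show "torus_smooth \<eta>"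
      unfolding torus_smooth_iff periodic_on_def smooth_def \<eta>_def
      using smooth_c by (auto simp: per smooth_def intro: Ck_bump_aux)
    show "\<eta> x \<ge> 0" for x by (simp add: \<eta>_def bump_aux_def)
    show "\<eta> a > 0" using \<delta> by (simp add: \<eta>_def bump_aux_def c_def)
    have "closure {x. \<eta> x \<noteq> 0} \<subseteq> {x. c x \<le> \<delta>}"
      by (rule closure_minimal) (auto simp: \<eta>_def bump_aux_def intro!: closed_Collect_le cont split: if_splits)
    then show "\<exists>k. x + lattice_vec k \<in> cbox (a - (\<chi> i. r)) (a + (\<chi> i. r))" if "x \<in> closure {x. \<eta> x \<noteq> 0}" for x
      using near that by auto
  qed
qed


section \<open>Integration over the torus\<close>

text \<open>Haar measure of the torus as a probability measure on the closed cell. Opposite faces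
  are identified points that occur twice, but they form a null set.\<close>

definition torus_measure :: "(real^'d) measure" where
  "torus_measure = restrict_space lborel torus_cell"

lemma torus_cell_borel [measurable, simp]: "torus_cell \<in> sets borel"
  by (simp add: torus_cell_def)

lemma space_torus_measure [simp]: "space torus_measure = torus_cell"
  by (simp add: torus_measure_def space_restrict_space)

lemma torus_integral_eq: "torus_integral f = integral\<^sup>L torus_measure f"
  by (simp add: torus_integral_def torus_measure_def integral_restrict_space set_lebesgue_integral_def)

lemma set_integrable_torus_cell_iff:
  fixes f :: "real^'d \<Rightarrow> 'b::{banach,second_countable_topology}"
  shows "set_integrable lborel torus_cell f \<longleftrightarrow> integrable torus_measure f"
  by (simp add: torus_measure_def integrable_restrict_space set_integrable_def)

lemma measurable_torus_measure: "f \<in> borel_measurable borel \<Longrightarrow> f \<in> borel_measurable torus_measure"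
  unfolding torus_measure_def by (intro measurable_restrict_space1) simp

lemma prob_space_torus_measure: "prob_space (torus_measure :: (real^'d) measure)"
proof
  have "emeasure lborel (torus_cell :: (real^'d) set) = ennreal (\<Prod>b\<in>Basis. (1 - 0 :: real^'d) \<bullet> b)"
    unfolding torus_cell_def by (rule emeasure_lborel_cbox) (auto simp: Basis_vec_def inner_axis)
  also have "(\<Prod>b\<in>Basis. (1 - 0 :: real^'d) \<bullet> b) = 1"
    by (rule prod.neutral) (auto simp: Basis_vec_def inner_axis)
  finally show "emeasure torus_measure (space (torus_measure :: (real^'d) measure)) = 1"
    by (simp add: torus_measure_def emeasure_restrict_space space_restrict_space)
qed

interpretation torus: prob_space "torus_measure :: (real^'d) measure"
  by (rule prob_space_torus_measure)

lemma torus_integrable_bounded: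
  fixes f :: "real^'d \<Rightarrow> 'b::{banach,second_countable_topology}"
  assumes "f \<in> borel_measurable torus_measure" "\<And>x. x \<in> torus_cell \<Longrightarrow> norm (f x) \<le> B"
  shows "integrable torus_measure f"
  by (rule torus.integrable_const_bound[of _ B]) (use assms in \<open>auto intro!: AE_I2\<close>)

lemma torus_integral_bound:
  fixes f :: "real^'d \<Rightarrow> 'b::{banach,second_countable_topology}"
  assumes "f \<in> borel_measurable torus_measure" "\<And>x. x \<in> torus_cell \<Longrightarrow> norm (f x) \<le> B"
  shows "norm (integral\<^sup>L torus_measure f) \<le> B"
proof -
  have "norm (integral\<^sup>L torus_measure f) \<le> (\<integral>x. norm (f x) \<partial>torus_measure)"
    by (rule integral_norm_bound)
  also have "\<dots> \<le> (\<integral>x. B \<partial>(torus_measure :: (real^'d) measure))"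
    using assms by (intro integral_mono integrable_norm torus_integrable_bounded[of f B] torus.integrable_const) auto
  also have "\<dots> = B" by (simp add: torus.prob_space[simplified])
  finally show ?thesis .
qed

lemma continuous_torus_measurable:
  fixes f :: "real^'d \<Rightarrow> 'b::{banach,second_countable_topology}"
  shows "continuous_on UNIV f \<Longrightarrow> f \<in> borel_measurable torus_measure"
  by (intro measurable_torus_measure borel_measurable_continuous_onI)

lemma continuous_torus_integrable:
  fixes f :: "real^'d \<Rightarrow> 'b::{banach,second_countable_topology}"
  assumes "continuous_on UNIV f"
  shows "integrable torus_measure f"
proof -
  have "compact (f ` torus_cell)"
    by (intro compact_continuous_image continuous_on_subset[OF assms]) (auto simp: torus_cell_def)
  then obtain B where "\<forall>y\<in>f ` torus_cell. norm y \<le> B"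
    by (meson bounded_iff compact_imp_bounded)
  then have "\<And>x. x \<in> torus_cell \<Longrightarrow> norm (f x) \<le> B" by blast
  with assms show ?thesis by (blast intro: torus_integrable_bounded continuous_torus_measurable)
qed

text \<open>The exact fundamental domain, with one representative for every point. The closed cell
  serves compactness arguments, this one serves periodicity; they differ by a null set.\<close>

definition half_cell :: "(real^'d) set" where
  "half_cell = {x. \<forall>i. 0 \<le> x $ i \<and> x $ i < 1}"

definition floor_vec :: "real^'d \<Rightarrow> int^'d" where
  "floor_vec x = (\<chi> i. \<lfloor>x $ i\<rfloor>)"

lemma half_cell_frac: "x - lattice_vec (floor_vec x) \<in> half_cell"
  by (auto simp: half_cell_def floor_vec_def) linarith+

lemma half_cell_subset: "half_cell \<subseteq> torus_cell"
  by (auto simp: half_cell_def torus_cell_def mem_box_cart less_imp_le)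

lemma lattice_vec_uminus [simp]: "lattice_vec (- k) = - lattice_vec k"
  by (simp add: vec_eq_iff)

lemma lattice_vec_add: "lattice_vec (k + l) = lattice_vec k + lattice_vec l"
  by (simp add: vec_eq_iff)

lemma lattice_vec_0 [simp]: "lattice_vec 0 = 0"
  by (simp add: vec_eq_iff)

lemma periodic_frac: 
  assumes "periodic_on UNIV f"
  shows "f (x - lattice_vec (floor_vec x)) = f x"
proof -
  have "f (x + lattice_vec (- floor_vec x)) = f x" using assms unfolding periodic_on_def by blast
  then show ?thesis by simp
qed

lemma periodic_bounded:
  fixes f :: "real^'d \<Rightarrow> 'b::real_normed_vector"
  assumes "continuous_on UNIV f" "periodic_on UNIV f"
  obtains B where "B > 0" "\<And>x. norm (f x) \<le> B"
proof -
  have "compact (f ` torus_cell)"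
    by (intro compact_continuous_image continuous_on_subset[OF assms(1)]) (auto simp: torus_cell_def)
  then obtain B where "\<forall>y\<in>f ` torus_cell. norm y \<le> B"
    by (meson bounded_iff compact_imp_bounded)
  then have B: "\<And>x. x \<in> torus_cell \<Longrightarrow> norm (f x) \<le> B" by blast
  have "norm (f x) \<le> max B 1" for x
    using B[of "x - lattice_vec (floor_vec x)"] half_cell_subset half_cell_frac[of x] periodic_frac[OF assms(2), of x]
    by auto
  then show ?thesis by (intro that[of "max B 1"]) auto
qed

lemma AE_half_cell: "AE x in lborel. x \<in> torus_cell \<longleftrightarrow> x \<in> (half_cell :: (real^'d) set)"
proof (rule AE_I')
  show "cbox 0 1 - box 0 (1::real^'d) \<in> null_sets lborel" by (rule null_sets_cbox_Diff_box)
  show "{x \<in> space lborel. \<not> (x \<in> torus_cell \<longleftrightarrow> x \<in> (half_cell :: (real^'d) set))} \<subseteq> cbox 0 1 - box 0 1"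
    using half_cell_subset by (auto simp: torus_cell_def half_cell_def mem_box_cart less_imp_le)
qed

lemma half_cell_borel [measurable, simp]: "half_cell \<in> sets borel"
proof -
  have "half_cell = (\<Inter>i. {x::real^'d. 0 \<le> x $ i} \<inter> {x. x $ i < 1})"
    by (auto simp: half_cell_def)
  also have "\<dots> \<in> sets borel" 
    by (intro sets.finite_INT sets.Int borel_closed borel_open closed_Collect_le open_Collect_less continuous_intros) auto
  finally show ?thesis .
qed

text \<open>A periodic function is its restriction to the cell composed with the fractional part
  map, and both are measurable.\<close>

lemma periodic_measurable:
  fixes f :: "real^'d \<Rightarrow> 'b::{banach,second_countable_topology}"
  assumes "periodic_on UNIV f" "f \<in> borel_measurable torus_measure"
  shows "f \<in> borel_measurable borel"
proof -
  have 1: "(\<lambda>x. indicator torus_cell x *\<^sub>R f x) \<in> borel_measurable borel"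
  proof -
    have "torus_cell \<inter> space (lborel :: (real^'d) measure) \<in> sets lborel" by simp
    from borel_measurable_restrict_space_iff[OF this, of f] assms(2)
    have "(\<lambda>x. indicator torus_cell x *\<^sub>R f x) \<in> borel_measurable lborel" unfolding torus_measure_def by blast
    then show ?thesis by (simp only: measurable_lborel2)
  qed
  have "(\<lambda>x::real^'d. x - lattice_vec (floor_vec x)) \<in> borel_measurable borel"
  proof (rule borel_measurable_euclidean_space[THEN iffD2], rule ballI)
    fix b :: "real^'d" assume "b \<in> Basis"
    then obtain i where "b = axis i 1" by (auto simp: Basis_vec_def)
    then have eq: "(\<lambda>x. (x - lattice_vec (floor_vec x)) \<bullet> b) = (\<lambda>x. x $ i - real_of_int \<lfloor>x $ i\<rfloor>)"
      by (auto simp: inner_axis floor_vec_def)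
    have [measurable]: "(\<lambda>x::real^'d. x $ i) \<in> borel_measurable borel"
      by (intro borel_measurable_continuous_onI continuous_intros)
    show "(\<lambda>x. (x - lattice_vec (floor_vec x)) \<bullet> b) \<in> borel_measurable borel"
      unfolding eq by measurable
  qed
  from measurable_compose[OF this 1] 
  have "(\<lambda>x. indicator torus_cell (x - lattice_vec (floor_vec x)) *\<^sub>R f (x - lattice_vec (floor_vec x))) \<in> borel_measurable borel" .
  also have "(\<lambda>x. indicator torus_cell (x - lattice_vec (floor_vec x)) *\<^sub>R f (x - lattice_vec (floor_vec x))) = f"
    using half_cell_frac half_cell_subset by (auto simp: periodic_frac[OF assms(1)] fun_eq_iff indicator_def)
  finally show ?thesis .
qed

lemma lborel_translate:
  fixes f :: "'a::euclidean_space \<Rightarrow> 'b::{banach,second_countable_topology}"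
  assumes "integrable lborel f"
  shows "integrable lborel (\<lambda>x. f (x + c)) \<and> integral\<^sup>L lborel (\<lambda>x. f (x + c)) = integral\<^sup>L lborel f"
proof -
  have m: "f \<in> borel_measurable borel" using assms by auto
  have "integrable (distr lborel borel ((+) c)) f" using assms by (simp add: lborel_distr_plus)
  then have "integrable lborel (\<lambda>x. f (c + x))" by (subst (asm) integrable_distr_eq) (auto simp: m)
  moreover have "integral\<^sup>L (distr lborel borel ((+) c)) f = integral\<^sup>L lborel (\<lambda>x. f (c + x))"
    by (subst integral_distr) (auto simp: m)
  ultimately show ?thesis by (simp add: lborel_distr_plus add.commute)
qed

text \<open>Cut the half-open cell at height \<open>t\<close> in coordinate \<open>i\<close>. The
  shifted cell consists of the upper piece \<open>A\<close> and of the lower piece \<open>B\<close>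
  moved up by a unit vector, and by periodicity that move does not change \<open>f\<close>.
  Translation invariance of Lebesgue measure on the two pieces does the rest.\<close>

lemma torus_shift:
  fixes f :: "real^'d \<Rightarrow> 'b::{banach,second_countable_topology}"
  assumes per: "periodic_on UNIV f" and int: "integrable torus_measure f" and t: "0 \<le> t" "t \<le> 1"
  shows "integrable torus_measure (\<lambda>x. f (x + t *\<^sub>R axis i 1)) \<and>
    integral\<^sup>L torus_measure (\<lambda>x. f (x + t *\<^sub>R axis i 1)) = integral\<^sup>L torus_measure f"
proof -
  let ?e = "axis i (1::real)"
  have f[measurable]: "f \<in> borel_measurable borel"
    using periodic_measurable[OF per] int by auto
  have shift_meas [measurable]: "(\<lambda>x. f (x + t *\<^sub>R ?e)) \<in> borel_measurable borel" by measurable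
  have half: "integrable torus_measure g \<longleftrightarrow> integrable lborel (\<lambda>x. indicator half_cell x *\<^sub>R g x)"
    "integral\<^sup>L torus_measure g = integral\<^sup>L lborel (\<lambda>x. indicator half_cell x *\<^sub>R g x)"
    if [measurable]: "g \<in> borel_measurable borel" for g :: "real^'d \<Rightarrow> 'b"
  proof -
    have ae: "AE x in lborel. indicator torus_cell x *\<^sub>R g x = indicator half_cell x *\<^sub>R g x"
      using AE_half_cell by eventually_elim (auto simp: indicator_def)
    show "integrable torus_measure g \<longleftrightarrow> integrable lborel (\<lambda>x. indicator half_cell x *\<^sub>R g x)"
      unfolding torus_measure_def by (simp add: integrable_restrict_space, rule integrable_cong_AE[OF _ _ ae]) measurable
    show "integral\<^sup>L torus_measure g = integral\<^sup>L lborel (\<lambda>x. indicator half_cell x *\<^sub>R g x)"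
      unfolding torus_measure_def by (simp add: integral_restrict_space, rule integral_cong_AE[OF _ _ ae]) measurable
  qed
  have [measurable]: "{x::real^'d. t \<le> x $ i} \<in> sets borel" "{x::real^'d. x $ i < t} \<in> sets borel"
    by (auto intro!: borel_closed borel_open closed_Collect_le open_Collect_less continuous_intros)
  define A where "A = (half_cell \<inter> {x::real^'d. t \<le> x $ i})"
  define B where "B = (half_cell \<inter> {x::real^'d. x $ i < t})"
  have intC: "integrable lborel (\<lambda>x. indicator half_cell x *\<^sub>R f x)" using half(1)[OF f] int by simp
  have intAB: "integrable lborel (\<lambda>x. indicator A x *\<^sub>R f x)" "integrable lborel (\<lambda>x. indicator B x *\<^sub>R f x)"
    unfolding A_def B_def using set_integrable_subset[of lborel half_cell f] intC by (auto simp: set_integrable_def)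
  have AB: "indicator half_cell x *\<^sub>R f x = indicator A x *\<^sub>R f x + indicator B x *\<^sub>R f x" for x
    by (auto simp: A_def B_def indicator_def)
  have shift: "indicator half_cell x *\<^sub>R f (x + t *\<^sub>R ?e) =
      indicator A (x + t *\<^sub>R ?e) *\<^sub>R f (x + t *\<^sub>R ?e) + indicator B (x + (t - 1) *\<^sub>R ?e) *\<^sub>R f (x + (t - 1) *\<^sub>R ?e)" for x
  proof -
    have k: "lattice_vec (axis i 1) = ?e" by (simp add: vec_eq_iff axis_def)
    have "f (x + (t - 1) *\<^sub>R ?e + lattice_vec (axis i 1)) = f (x + (t - 1) *\<^sub>R ?e)"
      using per unfolding periodic_on_def by blast
    then have per': "f (x + (t - 1) *\<^sub>R ?e) = f (x + t *\<^sub>R ?e)" by (simp add: k algebra_simps)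
    have *: "(x + s *\<^sub>R ?e) $ j = (if j = i then x $ i + s else x $ j)" for s j
      by (simp add: axis_def)
    have "x \<in> half_cell \<longleftrightarrow> (x + t *\<^sub>R ?e \<in> A \<or> x + (t - 1) *\<^sub>R ?e \<in> B)"
         "\<not> (x + t *\<^sub>R ?e \<in> A \<and> x + (t - 1) *\<^sub>R ?e \<in> B)"
    proof -
      have a: "x + t *\<^sub>R ?e \<in> A \<longleftrightarrow> (\<forall>j. j \<noteq> i \<longrightarrow> 0 \<le> x $ j \<and> x $ j < 1) \<and> 0 \<le> x $ i \<and> x $ i < 1 - t"
        using t unfolding A_def half_cell_def by (auto simp only: Int_iff mem_Collect_eq *) (auto split: if_splits)
      have b: "x + (t - 1) *\<^sub>R ?e \<in> B \<longleftrightarrow> (\<forall>j. j \<noteq> i \<longrightarrow> 0 \<le> x $ j \<and> x $ j < 1) \<and> 1 - t \<le> x $ i \<and> x $ i < 1"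
        using t unfolding B_def half_cell_def by (auto simp only: Int_iff mem_Collect_eq *) (auto split: if_splits)
      have c: "x \<in> half_cell \<longleftrightarrow> (\<forall>j. j \<noteq> i \<longrightarrow> 0 \<le> x $ j \<and> x $ j < 1) \<and> 0 \<le> x $ i \<and> x $ i < 1"
        unfolding half_cell_def by auto
      show "x \<in> half_cell \<longleftrightarrow> (x + t *\<^sub>R ?e \<in> A \<or> x + (t - 1) *\<^sub>R ?e \<in> B)"
         "\<not> (x + t *\<^sub>R ?e \<in> A \<and> x + (t - 1) *\<^sub>R ?e \<in> B)"
        unfolding a b c using t by auto
    qed
    then show ?thesis unfolding per' by (auto simp: indicator_def)
  qed
  note tA = lborel_translate[OF intAB(1), of "t *\<^sub>R ?e"] and tB = lborel_translate[OF intAB(2), of "(t - 1) *\<^sub>R ?e"]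
  show ?thesis
    unfolding half[OF f] half[OF shift_meas] shift
    using tA tB intAB by (simp add: AB)
qed


section \<open>Mean value estimates and integration by parts on the torus\<close>

lemma pderiv_mvt:
  assumes "\<And>s. s \<in> closed_segment 0 t \<Longrightarrow> has_pderiv i f (D s) (x + s *\<^sub>R axis i 1)"
    and "\<And>s. s \<in> closed_segment 0 t \<Longrightarrow> norm (D s) \<le> B"
  shows "norm (f (x + t *\<^sub>R axis i 1) - f x) \<le> B * \<bar>t\<bar>"
proof -
  have "norm (f (x + t *\<^sub>R axis i 1) - f (x + 0 *\<^sub>R axis i 1)) \<le> B * norm (t - 0)"
  proof (rule differentiable_bound[OF convex_closed_segment[of 0 t], where f' = "\<lambda>s h. h *\<^sub>R D s"])
    fix s assume s: "s \<in> closed_segment 0 t"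
    have "((\<lambda>s. f (x + s *\<^sub>R axis i 1)) has_vector_derivative D s) (at s)"
      using assms(1)[OF s] by (rule has_pderiv_line)
    then show "((\<lambda>s. f (x + s *\<^sub>R axis i 1)) has_derivative (\<lambda>h. h *\<^sub>R D s)) (at s within closed_segment 0 t)"
      unfolding has_vector_derivative_def by (rule has_derivative_at_withinI)
    show "onorm (\<lambda>h. h *\<^sub>R D s) \<le> B"
      by (rule onorm_le) (use mult_left_mono[OF assms(2)[OF s] abs_ge_zero] in \<open>simp add: mult.commute\<close>)
  qed auto
  then show ?thesis by simp
qed

text \<open>The coordinates of \<open>x\<close> are exchanged for those of \<open>y\<close> one at a
  time. A box is a product, so all intermediate points \<open>z A\<close> stay inside it, and each
  exchange is a one-variable mean value estimate. Only partial derivatives are involved.\<close>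

lemma box_lipschitz:
  fixes f :: "real^'d \<Rightarrow> 'b::real_normed_vector"
  assumes der: "\<And>i x. x \<in> cbox a b \<Longrightarrow> has_pderiv i f (D i x) x"
    and bd: "\<And>i x. x \<in> cbox a b \<Longrightarrow> norm (D i x) \<le> B"
    and x: "x \<in> cbox a b" and y: "y \<in> cbox a b"
  shows "norm (f y - f x) \<le> B * (\<Sum>i\<in>UNIV. \<bar>y $ i - x $ i\<bar>)"
proof -
  define z where "z = (\<lambda>A. \<chi> i. if i \<in> A then y $ i else x $ i)"
  have z: "z A \<in> cbox a b" for A using x y by (auto simp: z_def mem_box_cart)
  have "norm (f (z A) - f x) \<le> B * (\<Sum>i\<in>A. \<bar>y $ i - x $ i\<bar>)" if "finite A" for A
    using that
  proof induction
    case empty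
    have "z {} = x" by (simp add: z_def vec_eq_iff)
    then show ?case by simp
  next
    case (insert i A)
    have eq: "z (insert i A) = z A + (y $ i - x $ i) *\<^sub>R axis i 1"
      using insert by (auto simp: z_def vec_eq_iff axis_def)
    have "norm (f (z A + (y $ i - x $ i) *\<^sub>R axis i 1) - f (z A)) \<le> B * \<bar>y $ i - x $ i\<bar>"
    proof (rule pderiv_mvt)
      fix s assume s: "s \<in> closed_segment 0 (y $ i - x $ i)"
      then obtain u where u: "0 \<le> u" "u \<le> 1" "s = u * (y $ i - x $ i)" by (auto simp: closed_segment_def)
      have "z A + (u * c) *\<^sub>R axis i 1 = (1 - u) *\<^sub>R z A + u *\<^sub>R (z A + c *\<^sub>R axis i 1)" for c
        by (simp add: scaleR_left_diff_distrib scaleR_right_distrib)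
      with u have "z A + s *\<^sub>R axis i 1 = (1 - u) *\<^sub>R z A + u *\<^sub>R z (insert i A)"
        unfolding eq by simp
      then have "z A + s *\<^sub>R axis i 1 \<in> cbox a b"
        using convex_box(1)[of a b] z u by (simp add: convex_alt)
      then show "has_pderiv i f (D i (z A + s *\<^sub>R axis i 1)) (z A + s *\<^sub>R axis i 1)"
        "norm (D i (z A + s *\<^sub>R axis i 1)) \<le> B" using der bd by auto
    qed
    then have "norm (f (z (insert i A)) - f x) \<le> B * \<bar>y $ i - x $ i\<bar> + B * (\<Sum>i\<in>A. \<bar>y $ i - x $ i\<bar>)"
      using insert.IH norm_triangle_ineq[of "f (z (insert i A)) - f (z A)" "f (z A) - f x"] by (simp add: eq)
    then show ?case using insert by (simp add: distrib_left)
  qed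
  from this[of UNIV] show ?thesis by (simp add: z_def)
qed

lemma smooth_lipschitz:
  fixes f :: "real^'d \<Rightarrow> 'b::real_normed_vector"
  assumes "smooth f" "\<And>i x. norm (pderiv_at i f x) \<le> B"
  shows "norm (f y - f x) \<le> B * (\<Sum>i\<in>UNIV. \<bar>y $ i - x $ i\<bar>)"
proof (rule box_lipschitz[where D = "\<lambda>i. pderiv_at i f"])
  show "x \<in> cbox (\<chi> i. min (x $ i) (y $ i)) (\<chi> i. max (x $ i) (y $ i))"
       "y \<in> cbox (\<chi> i. min (x $ i) (y $ i)) (\<chi> i. max (x $ i) (y $ i))"
    by (auto simp: mem_box_cart)
qed (use assms in \<open>auto intro: smooth_has_pderiv\<close>)

lemma torus_smooth_pderivs: "torus_smooth f \<Longrightarrow> torus_smooth (pderivs \<alpha> f)"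
  unfolding torus_smooth_iff using pderivs_periodic[of UNIV f \<alpha>] smooth_pderivs by auto

lemma torus_smooth_bounded:
  fixes f :: "real^'d \<Rightarrow> 'b::real_normed_vector"
  assumes "torus_smooth f" obtains B where "B > 0" "\<And>x. norm (f x) \<le> B"
  using periodic_bounded[of f] assms smooth_continuous unfolding torus_smooth_iff by blast

lemma torus_smooth_continuous: "torus_smooth f \<Longrightarrow> continuous_on S f"
  unfolding torus_smooth_iff by (auto intro: smooth_continuous)

lemma torus_smooth_integrable:
  fixes f :: "real^'d \<Rightarrow> 'b::{banach,second_countable_topology}"
  shows "torus_smooth f \<Longrightarrow> integrable torus_measure f"
  by (intro continuous_torus_integrable torus_smooth_continuous)

lemma torus_smooth_mult:
  fixes f g :: "real^'d \<Rightarrow> 'b::real_normed_algebra"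
  shows "torus_smooth f \<Longrightarrow> torus_smooth g \<Longrightarrow> torus_smooth (\<lambda>x. f x * g x)"
  unfolding torus_smooth_iff periodic_on_def by (auto intro: smooth_mult)

lemma torus_smooth_add: "torus_smooth f \<Longrightarrow> torus_smooth g \<Longrightarrow> torus_smooth (\<lambda>x. f x + g x)"
  unfolding torus_smooth_iff periodic_on_def by (auto intro: smooth_add)

lemma torus_smooth_const [intro, simp]: "torus_smooth (\<lambda>_. c)"
  unfolding torus_smooth_iff periodic_on_def by auto

lemma torus_smooth_cmult:
  fixes f :: "real^'d \<Rightarrow> 'b::real_normed_algebra"
  shows "torus_smooth f \<Longrightarrow> torus_smooth (\<lambda>x. c * f x)"
  by (intro torus_smooth_mult torus_smooth_const)

lemma torus_smooth_sum: "(\<And>k. k \<in> A \<Longrightarrow> torus_smooth (f k)) \<Longrightarrow> torus_smooth (\<lambda>x. \<Sum>k\<in>A. f k x)"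
  unfolding torus_smooth_iff periodic_on_def by (auto intro: smooth_sum)

lemma torus_smooth_linear: "bounded_linear L \<Longrightarrow> torus_smooth f \<Longrightarrow> torus_smooth (\<lambda>x. L (f x))"
  unfolding torus_smooth_iff periodic_on_def by (auto intro: smooth_linear)

lemma torus_smooth_of_real:
  fixes f :: "real^'d \<Rightarrow> real"
  shows "torus_smooth f \<Longrightarrow> torus_smooth (\<lambda>x. complex_of_real (f x))"
  by (rule torus_smooth_linear[OF bounded_linear_of_real])

lemma torus_smooth_cnj: "torus_smooth f \<Longrightarrow> torus_smooth (\<lambda>x. cnj (f x))"
  by (rule torus_smooth_linear[OF bounded_linear_cnj])

lemma difference_quotient_tendsto:
  assumes "has_pderiv i f D x"
  shows "(\<lambda>n. (f (x + inverse (real (Suc n)) *\<^sub>R axis i 1) - f x) /\<^sub>R inverse (real (Suc n))) \<longlonglongrightarrow> D"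
proof -
  have "((\<lambda>h. norm (f (x + h *\<^sub>R axis i 1) - f x - h *\<^sub>R D) / norm h) \<longlongrightarrow> 0) (at 0)"
    using assms unfolding has_pderiv_def has_vector_derivative_def has_derivative_at by simp
  moreover have "filterlim (\<lambda>n. inverse (real (Suc n))) (at 0) sequentially"
    by (intro filterlim_atI LIMSEQ_inverse_real_of_nat) auto
  ultimately have lim: "(\<lambda>n. norm (f (x + inverse (real (Suc n)) *\<^sub>R axis i 1) - f x - inverse (real (Suc n)) *\<^sub>R D) /
      norm (inverse (real (Suc n)))) \<longlonglongrightarrow> 0"
    by (rule filterlim_compose)
  have key: "norm (a - t *\<^sub>R D) / norm t = norm (a /\<^sub>R t - D)" if "t \<noteq> 0" for a and t :: real
  proof -
    have "a /\<^sub>R t - D = (a - t *\<^sub>R D) /\<^sub>R t" using that by (simp add: scaleR_diff_right)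
    then have "norm (a /\<^sub>R t - D) = \<bar>inverse t\<bar> * norm (a - t *\<^sub>R D)" by (simp only: norm_scaleR)
    then show ?thesis by (simp add: divide_inverse mult.commute)
  qed
  have "(\<lambda>n. norm ((f (x + inverse (real (Suc n)) *\<^sub>R axis i 1) - f x) /\<^sub>R inverse (real (Suc n)) - D)) \<longlonglongrightarrow> 0"
    by (rule filterlim_cong[THEN iffD1, OF refl refl _ lim]) (intro always_eventually allI key, simp)
  then show ?thesis
    by (rule Lim_null[THEN iffD2, OF tendsto_norm_zero_cancel])
qed

text \<open>By shift invariance every difference quotient has integral zero. The mean value bound
  dominates the quotients, so the limit may be taken under the integral. Applied to a product, this
  is integration by parts.\<close>

lemma torus_integral_pderiv:
  fixes f :: "real^'d \<Rightarrow> 'b::{banach,second_countable_topology}"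
  assumes "torus_smooth f"
  shows "integral\<^sup>L torus_measure (pderiv_at i f) = 0"
proof -
  have s: "smooth f" "periodic_on UNIV f" using assms by (auto simp: torus_smooth_iff)
  obtain B where B: "B > 0" "\<And>x. norm (pderiv_at i f x) \<le> B"
    using torus_smooth_bounded[OF torus_smooth_pderivs[OF assms, of "[i]"]] by auto
  define t where "t = (\<lambda>n. inverse (real (Suc n)))"
  have t: "t n > 0" "t n \<le> 1" for n by (auto simp: t_def inverse_le_1_iff)
  let ?q = "\<lambda>n x. (f (x + t n *\<^sub>R axis i 1) - f x) /\<^sub>R t n"
  have sh: "integrable torus_measure (\<lambda>x. f (x + t n *\<^sub>R axis i 1)) \<and>
      integral\<^sup>L torus_measure (\<lambda>x. f (x + t n *\<^sub>R axis i 1)) = integral\<^sup>L torus_measure f" for n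
    using t[of n] by (intro torus_shift s torus_smooth_integrable assms) auto
  have "(\<lambda>n. integral\<^sup>L torus_measure (?q n)) \<longlonglongrightarrow> integral\<^sup>L torus_measure (pderiv_at i f)"
  proof (rule integral_dominated_convergence[where w = "\<lambda>_. B"])
    show "AE x in torus_measure. (\<lambda>n. ?q n x) \<longlonglongrightarrow> pderiv_at i f x"
      unfolding t_def by (intro AE_I2 difference_quotient_tendsto smooth_has_pderiv s)
    show "AE x in torus_measure. norm (?q n x) \<le> B" for n
    proof (rule AE_I2)
      fix x
      have "norm (f (x + t n *\<^sub>R axis i 1) - f x) \<le> B * \<bar>t n\<bar>"
        by (rule pderiv_mvt[where D = "\<lambda>s. pderiv_at i f (x + s *\<^sub>R axis i 1)"]) (auto intro: smooth_has_pderiv s B)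
      then have "norm (f (x + t n *\<^sub>R axis i 1) - f x) / t n \<le> B" using t(1)[of n] by (simp add: pos_divide_le_eq)
      moreover have "norm (?q n x) = \<bar>inverse (t n)\<bar> * norm (f (x + t n *\<^sub>R axis i 1) - f x)" by (rule norm_scaleR)
      ultimately show "norm (?q n x) \<le> B" using t(1)[of n] by (simp add: divide_inverse mult.commute)
    qed
    show "pderiv_at i f \<in> borel_measurable torus_measure"
      by (intro continuous_torus_measurable smooth_continuous smooth_pderiv_at s)
    show "?q n \<in> borel_measurable torus_measure" for n
      using sh[of n] torus_smooth_integrable[OF assms] by (intro borel_measurable_scaleR borel_measurable_diff) auto
  qed (rule torus.integrable_const)
  moreover have "integral\<^sup>L torus_measure (?q n) = 0" for n
    using sh[of n] torus_smooth_integrable[OF assms] by simp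
  ultimately show ?thesis by (simp only: LIMSEQ_const_iff)
qed


section \<open>Fourier coefficients\<close>

lemma torus_smooth_fourier_mode: "torus_smooth (fourier_mode k)"
  unfolding torus_smooth_iff
proof
  have "(\<lambda>x. exp ((lattice_vec k \<bullet> x) *\<^sub>R (2 * pi * \<i>))) = fourier_mode k"
    by (auto simp: fourier_mode_def cis_conv_exp scaleR_conv_of_real algebra_simps)
  then show "smooth (fourier_mode k)"
    using smooth_exp[OF smooth_linear[OF bounded_linear_scaleR_left smooth_inner]] by metis
  have "cis (2 * pi * (lattice_vec k \<bullet> lattice_vec l)) = 1" for l
  proof -
    have "lattice_vec k \<bullet> lattice_vec l = real_of_int (\<Sum>i\<in>UNIV. k $ i * l $ i)"
      by (simp add: inner_vec_def)
    then show ?thesis by (metis cis_multiple_2pi Ints_of_int)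
  qed
  then show "periodic_on UNIV (fourier_mode k)"
    by (simp add: periodic_on_def fourier_mode_def inner_add_right distrib_left cis_mult[symmetric])
qed

lemma norm_fourier_mode [simp]: "norm (fourier_mode k x) = 1"
  by (simp add: fourier_mode_def)

lemma cnj_fourier_mode: "cnj (fourier_mode k x) = fourier_mode (- k) x"
  by (simp add: fourier_mode_def cis_cnj)

lemma fourier_mode_add: "fourier_mode (k + l) x = fourier_mode k x * fourier_mode l x"
  by (simp add: fourier_mode_def lattice_vec_add inner_add_left distrib_left cis_mult)

lemma fourier_mode_0 [simp]: "fourier_mode 0 x = 1"
  by (simp add: fourier_mode_def)

lemma pderiv_at_fourier_mode:
  "pderiv_at i (fourier_mode k) = (\<lambda>x. (2 * pi * real_of_int (k $ i) * \<i>) * fourier_mode k x)"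
proof -
  let ?L = "\<lambda>x. (lattice_vec k \<bullet> x) *\<^sub>R (2 * pi * \<i>)"
  have exp: "exp (?L x) = fourier_mode k x" for x
    by (simp add: fourier_mode_def cis_conv_exp scaleR_conv_of_real algebra_simps)
  have L: "pderiv_at i ?L = (\<lambda>x. (lattice_vec k $ i) *\<^sub>R (2 * pi * \<i>))"
    by (rule ext, rule has_pderiv_pderiv_at) (intro has_pderiv_linear[OF bounded_linear_scaleR_left] has_pderiv_inner)
  have "pderiv_at i (\<lambda>x. exp (?L x)) = (\<lambda>x. pderiv_at i ?L x * exp (?L x))"
    by (intro pderiv_at_exp smooth_linear[OF bounded_linear_scaleR_left] smooth_inner)
  then show ?thesis
    unfolding exp L by (simp add: scaleR_conv_of_real mult_ac)
qed

lemma pderivs_fourier_mode: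
  "pderivs \<alpha> (fourier_mode k) = (\<lambda>x. (\<Prod>i\<leftarrow>\<alpha>. 2 * pi * real_of_int (k $ i) * \<i>) * fourier_mode k x)"
proof (induction \<alpha>)
  case (Cons i \<alpha>)
  have "smooth (fourier_mode k)" using torus_smooth_fourier_mode by (auto simp: torus_smooth_iff)
  define P where "P = (\<Prod>i\<leftarrow>\<alpha>. 2 * pi * real_of_int (k $ i) * \<i>)"
  have "pderivs (i # \<alpha>) (fourier_mode k) = (\<lambda>x. P * pderiv_at i (fourier_mode k) x)"
    using pderivs_cmult[OF \<open>smooth (fourier_mode k)\<close>, of "[i]" P] by (simp add: Cons P_def)
  then show ?case
    by (simp add: pderiv_at_fourier_mode P_def mult_ac)
qed simp

lemma fourier_coeff_eq: "fourier_coeff f k = integral\<^sup>L torus_measure (\<lambda>x. f x * cnj (fourier_mode k x))"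
  by (simp add: fourier_coeff_def torus_integral_eq fourier_mode_def cis_cnj)

lemma fourier_coeff_pderiv:
  assumes "torus_smooth f"
  shows "fourier_coeff (pderiv_at i f) k = 2 * pi * real_of_int (k $ i) * \<i> * fourier_coeff f k"
proof -
  note e = torus_smooth_fourier_mode[of "- k"]
  have s: "smooth f" "smooth (fourier_mode (- k))" using assms e by (auto simp: torus_smooth_iff)
  have i1: "integrable torus_measure (\<lambda>x. pderiv_at i f x * fourier_mode (- k) x)"
    using torus_smooth_pderivs[OF assms, of "[i]"] by (intro torus_smooth_integrable torus_smooth_mult e) auto
  have i2: "integrable torus_measure (\<lambda>x. f x * fourier_mode (- k) x)"
    by (intro torus_smooth_integrable torus_smooth_mult assms e)
  have "0 = integral\<^sup>L torus_measure (pderiv_at i (\<lambda>x. f x * fourier_mode (- k) x))"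
    by (intro torus_integral_pderiv[symmetric] torus_smooth_mult assms e)
  also have "\<dots> = integral\<^sup>L torus_measure (\<lambda>x. pderiv_at i f x * fourier_mode (- k) x
      - (2 * pi * real_of_int (k $ i) * \<i>) * (f x * fourier_mode (- k) x))"
    by (simp add: pderiv_at_mult[OF s] pderiv_at_fourier_mode algebra_simps)
  also have "\<dots> = fourier_coeff (pderiv_at i f) k - 2 * pi * real_of_int (k $ i) * \<i> * fourier_coeff f k"
    using i1 i2 by (simp add: fourier_coeff_eq cnj_fourier_mode)
  finally show ?thesis by simp
qed

lemma fourier_coeff_pderivs:
  assumes "torus_smooth f"
  shows "fourier_coeff (pderivs (replicate n i) f) k = (2 * pi * real_of_int (k $ i) * \<i>) ^ n * fourier_coeff f k"
proof (induction n)
  case (Suc n)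
  then show ?case
    using fourier_coeff_pderiv[OF torus_smooth_pderivs[OF assms, of "replicate n i"], of i k] by simp
qed simp

text \<open>A nonconstant mode is a nonzero multiple of one of its own partial derivatives, whose
  integral vanishes.\<close>

lemma torus_integral_fourier_mode: "integral\<^sup>L torus_measure (fourier_mode k) = (if k = 0 then 1 else 0)"
proof (cases "k = 0")
  case True
  then have "fourier_mode k = (\<lambda>_. 1)" by auto
  then show ?thesis using True by (simp add: torus.prob_space[simplified])
next
  case False
  then obtain i where i: "k $ i \<noteq> 0" by (auto simp: vec_eq_iff)
  have "(2 * pi * real_of_int (k $ i) * \<i>) * integral\<^sup>L torus_measure (fourier_mode k) = 0"
    using torus_integral_pderiv[OF torus_smooth_fourier_mode[of k], of i]
    by (simp add: pderiv_at_fourier_mode)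
  then show ?thesis using False i by simp
qed

lemma fourier_mode_orthonormal:
  "integral\<^sup>L torus_measure (\<lambda>x. fourier_mode k x * cnj (fourier_mode l x)) = (if k = l then 1 else 0)"
proof -
  have "(\<lambda>x. fourier_mode k x * cnj (fourier_mode l x)) = fourier_mode (k - l)"
    using fourier_mode_add[of k "- l"] by (auto simp: cnj_fourier_mode)
  then show ?thesis by (simp add: torus_integral_fourier_mode)
qed

lemma torus_inner_fourier_sums:
  assumes "finite F"
  shows "torus_inner (\<lambda>x. \<Sum>k\<in>F. a k * fourier_mode k x) (\<lambda>x. \<Sum>k\<in>F. b k * fourier_mode k x) = (\<Sum>k\<in>F. a k * cnj (b k))"
proof -
  have int: "integrable torus_measure (\<lambda>x. a k * cnj (b l) * (fourier_mode k x * cnj (fourier_mode l x)))" for k l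
    by (intro torus_smooth_integrable torus_smooth_mult torus_smooth_const torus_smooth_cnj torus_smooth_fourier_mode)
  have "torus_inner (\<lambda>x. \<Sum>k\<in>F. a k * fourier_mode k x) (\<lambda>x. \<Sum>k\<in>F. b k * fourier_mode k x) =
      integral\<^sup>L torus_measure (\<lambda>x. \<Sum>k\<in>F. \<Sum>l\<in>F. a k * cnj (b l) * (fourier_mode k x * cnj (fourier_mode l x)))"
    unfolding torus_inner_def torus_integral_eq by (simp add: sum_product mult_ac)
  also have "\<dots> = (\<Sum>k\<in>F. \<Sum>l\<in>F. a k * cnj (b l) * (if k = l then 1 else 0))"
    using int by (simp add: fourier_mode_orthonormal)
  also have "\<dots> = (\<Sum>k\<in>F. a k * cnj (b k))"
    by (intro sum.cong refl) (simp add: if_distrib[of "(*) _"] sum.delta[OF assms] assms cong: if_cong)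
  finally show ?thesis .
qed

text \<open>Expand the square norm of \<open>h - s\<close>, where \<open>s\<close> is the partial
  Fourier sum over \<open>F\<close>: the mixed terms and the norm of \<open>s\<close> are the same
  sum. No smoothness of \<open>h\<close> enters, since it will be the product of a Hoelder or square
  integrable function with a cutoff.\<close>

lemma bessel:
  fixes h :: "real^'d \<Rightarrow> complex"
  assumes h: "h \<in> borel_measurable torus_measure" "integrable torus_measure (\<lambda>x. (norm (h x))\<^sup>2)" and F: "finite F"
  shows "(\<Sum>k\<in>F. (norm (fourier_coeff h k))\<^sup>2) \<le> (\<integral>x. (norm (h x))\<^sup>2 \<partial>torus_measure)"
proof -
  have le: "y \<le> 1 + y\<^sup>2" for y :: real
    using zero_le_power2[of "y - 1 / 2"] zero_le_power2[of y] by (simp add: power2_eq_square algebra_simps)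
  have inth: "integrable torus_measure h"
    by (rule Bochner_Integration.integrable_bound[of _ "\<lambda>x. 1 + (norm (h x))\<^sup>2"]) (use h le in \<open>auto intro!: AE_I2\<close>)
  define c where "c = fourier_coeff h"
  define s where "s = (\<lambda>x. \<Sum>k\<in>F. c k * fourier_mode k x)"
  have cc: "c k * cnj (c k) = of_real ((norm (c k))\<^sup>2)" "cnj (c k) * c k = of_real ((norm (c k))\<^sup>2)" for k
    by (simp_all only: complex_norm_square mult.commute)
  have hm: "integrable torus_measure (\<lambda>x. cnj (c k) * (h x * cnj (fourier_mode k x)))" for k
    by (intro integrable_mult_right Bochner_Integration.integrable_bound[OF inth])
      (use h continuous_torus_measurable[OF torus_smooth_continuous[OF torus_smooth_fourier_mode[of "- k"]]]
       in \<open>auto simp: norm_mult cnj_fourier_mode intro!: borel_measurable_times\<close>)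
  have hs_eq: "h x * cnj (s x) = (\<Sum>k\<in>F. cnj (c k) * (h x * cnj (fourier_mode k x)))" for x
    by (simp add: s_def sum_distrib_left mult_ac)
  have ihs: "integrable torus_measure (\<lambda>x. h x * cnj (s x))"
    unfolding hs_eq using hm by auto
  have hs: "integral\<^sup>L torus_measure (\<lambda>x. h x * cnj (s x)) = (\<Sum>k\<in>F. (norm (c k))\<^sup>2)"
    unfolding hs_eq using hm 
    by (simp add: fourier_coeff_eq[symmetric] c_def[symmetric] cc del: of_real_power)
  have ss: "integral\<^sup>L torus_measure (\<lambda>x. s x * cnj (s x)) = (\<Sum>k\<in>F. (norm (c k))\<^sup>2)"
    using torus_inner_fourier_sums[OF F, of c c] unfolding torus_inner_def torus_integral_eq s_def
    by (simp add: cc del: of_real_power)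
  have ts: "torus_smooth s" unfolding s_def by (intro torus_smooth_sum torus_smooth_cmult torus_smooth_fourier_mode)
  have iss: "integrable torus_measure (\<lambda>x. s x * cnj (s x))"
    by (intro torus_smooth_integrable torus_smooth_mult torus_smooth_cnj ts)
  have eq: "(norm (h x - s x))\<^sup>2 = (norm (h x))\<^sup>2 - 2 * Re (h x * cnj (s x)) + Re (s x * cnj (s x))" for x
    unfolding cmod_power2 by (simp add: power2_eq_square algebra_simps)
  have "0 \<le> (\<integral>x. (norm (h x - s x))\<^sup>2 \<partial>torus_measure)" by simp
  also have "\<dots> = (\<integral>x. (norm (h x))\<^sup>2 \<partial>torus_measure) - 2 * Re (integral\<^sup>L torus_measure (\<lambda>x. h x * cnj (s x)))
      + Re (integral\<^sup>L torus_measure (\<lambda>x. s x * cnj (s x)))"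
    unfolding eq using h(2) ihs iss by (simp del: complex_cnj_mult times_complex.sel)
  also have "\<dots> = (\<integral>x. (norm (h x))\<^sup>2 \<partial>torus_measure) - (\<Sum>k\<in>F. (norm (c k))\<^sup>2)"
    unfolding hs ss by simp
  finally show ?thesis by (simp add: c_def)
qed


lemma fourier_coeff_bound:
  assumes "f \<in> borel_measurable torus_measure" "\<And>x. norm (f x) \<le> A"
  shows "norm (fourier_coeff f k) \<le> A"
  unfolding fourier_coeff_eq cnj_fourier_mode
  by (rule torus_integral_bound)
    (use assms continuous_torus_measurable[OF torus_smooth_continuous[OF torus_smooth_fourier_mode[of "- k"]]]
     in \<open>auto simp: norm_mult intro!: borel_measurable_times\<close>)


section \<open>Dyadic shells of frequencies\<close>

text \<open>The sup norm instead of the Euclidean one: it is an integer attained at some coordinate,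
  and its balls are cubes whose lattice points are counted as products.\<close>

definition inorm :: "int^'d \<Rightarrow> nat" where
  "inorm k = Max (range (\<lambda>i. nat \<bar>k $ i\<bar>))"

text \<open>Plays the role of the Japanese bracket. The summand 1 keeps powers and logarithms
  harmless at k = 0.\<close>

definition jap :: "int^'d \<Rightarrow> real" where
  "jap k = 1 + real (inorm k)"

definition shell :: "nat \<Rightarrow> (int^'d) set" where
  "shell j = {k. 2 ^ j \<le> 1 + inorm k \<and> 1 + inorm k < 2 ^ (j + 1)}"

lemma inorm_ge: "\<bar>k $ i\<bar> \<le> int (inorm k)"
proof -
  have "nat \<bar>k $ i\<bar> \<le> inorm k" unfolding inorm_def by (rule Max_ge) auto
  then show ?thesis by linarith
qed

lemma inorm_attained: obtains i where "\<bar>k $ i\<bar> = int (inorm k)"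
proof -
  have "inorm k \<in> range (\<lambda>i. nat \<bar>k $ i\<bar>)" unfolding inorm_def by (rule Max_in) auto
  then show ?thesis using that by auto
qed

lemma jap_ge_1: "jap k \<ge> 1"
  by (simp add: jap_def)

lemma jap_nonneg [simp]: "0 \<le> jap k" and jap_pos [simp]: "0 < jap k"
  by (simp_all add: jap_def)

lemma shell_jap: "k \<in> shell j \<Longrightarrow> 2 ^ j \<le> jap k \<and> jap k < 2 ^ (j + 1)"
proof -
  assume "k \<in> shell j"
  then have "2 ^ j \<le> 1 + inorm k" "1 + inorm k < 2 ^ (j + 1)" by (auto simp: shell_def)
  then have "real (2 ^ j) \<le> real (1 + inorm k)" "real (1 + inorm k) < real (2 ^ (j + 1))"
    by (simp_all only: of_nat_le_iff of_nat_less_iff)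
  then show ?thesis by (simp add: jap_def)
qed

lemma ex_shell: "\<exists>j. k \<in> shell j"
proof -
  obtain n where "2 ^ n \<le> 1 + inorm k" "1 + inorm k < 2 ^ (n + 1)"
    using ex_power_ivl1[of 2 "1 + inorm k"] by auto
  then show ?thesis by (auto simp: shell_def)
qed

lemma shell_disjoint: "k \<in> shell i \<Longrightarrow> k \<in> shell j \<Longrightarrow> i = j"
proof (rule ccontr)
  assume a: "k \<in> shell i" "k \<in> shell j" "i \<noteq> j"
  have False if "k \<in> shell i" "k \<in> shell j" "i < j" for i j
  proof -
    have "(2::nat) ^ (i + 1) \<le> 2 ^ j" using that by (intro power_increasing) auto
    then show False using that unfolding shell_def by auto
  qed
  then show False using a by (meson linorder_neqE_nat)
qed

lemma card_vec_box:
  fixes A :: "'d::finite \<Rightarrow> int set"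
  assumes "\<And>i. finite (A i)"
  shows "finite {k::int^'d. \<forall>i. k $ i \<in> A i} \<and> card {k::int^'d. \<forall>i. k $ i \<in> A i} = (\<Prod>i\<in>UNIV. card (A i))"
proof -
  have bij: "bij_betw (\<lambda>f. \<chi> i. f i) (PiE UNIV A) {k::int^'d. \<forall>i. k $ i \<in> A i}"
    by (rule bij_betw_byWitness[where f' = "\<lambda>k i. k $ i"]) (auto simp: PiE_def Pi_def vec_eq_iff)
  have "finite (PiE UNIV A)" using assms by (intro finite_PiE) auto
  moreover have "card (PiE UNIV A) = (\<Prod>i\<in>UNIV. card (A i))" by (rule card_PiE) simp
  ultimately show ?thesis using bij_betw_finite[OF bij] bij_betw_same_card[OF bij] by simp
qed

text \<open>The shell lies in a cube with \<open>2 ^ (j + 2)\<close> integers per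
  coordinate.\<close>

lemma shell_finite_card: "finite (shell j :: (int^'d) set) \<and> real (card (shell j :: (int^'d) set)) \<le> 4 ^ CARD('d) * (2 ^ j) ^ CARD('d)"
proof -
  let ?A = "{- (2 ^ (j + 1)) .. 2 ^ (j + 1) - 1 :: int}"
  have sub: "shell j \<subseteq> {k::int^'d. \<forall>i. k $ i \<in> ?A}"
  proof (intro subsetI CollectI allI)
    fix k :: "int^'d" and i assume "k \<in> shell j"
    then have "int (1 + inorm k) < int (2 ^ (j + 1))" by (simp only: shell_def mem_Collect_eq of_nat_less_iff)
    then show "k $ i \<in> ?A" using inorm_ge[of k i] by auto
  qed
  have fin: "finite {k::int^'d. \<forall>i. k $ i \<in> ?A}" and card: "card {k::int^'d. \<forall>i. k $ i \<in> ?A} = card ?A ^ CARD('d)"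
    using card_vec_box[of "\<lambda>_::'d. ?A"] by auto
  have "card ?A = 2 ^ (j + 2)"
  proof -
    have "2 ^ (j + 1) - 1 + 1 - - (2 ^ (j + 1)) = (2::int) ^ (j + 2)" by simp
    then show ?thesis by (simp add: nat_mult_distrib nat_power_eq)
  qed
  moreover have "card (shell j :: (int^'d) set) \<le> card ?A ^ CARD('d)"
    using card_mono[OF fin sub] card by simp
  ultimately have "card (shell j :: (int^'d) set) \<le> (2 ^ (j + 2)) ^ CARD('d)" by simp
  then have "real (card (shell j :: (int^'d) set)) \<le> real ((2 ^ (j + 2)) ^ CARD('d))" by (simp only: of_nat_le_iff)
  also have "\<dots> = 4 ^ CARD('d) * (2 ^ j) ^ CARD('d)" by (simp add: power_mult_distrib power_add)
  finally show ?thesis using finite_subset[OF sub fin] by simp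
qed

lemma finite_shell [simp, intro]: "finite (shell j)"
  using shell_finite_card by blast

text \<open>Decay of order d + 1 beats the number of frequencies in the shell, of order
  \<open>2 ^ (j * d)\<close>, by one factor \<open>2 ^ j\<close>. This is the source of the exponent
  \<open>CARD('d) + 1\<close> in the later bounds.\<close>

lemma shell_sum_bound:
  fixes a :: "int^'d \<Rightarrow> 'b::real_normed_vector"
  assumes "\<And>k. k \<in> shell j \<Longrightarrow> norm (a k) * jap k ^ (CARD('d) + 1) \<le> C" "C \<ge> 0"
  shows "(\<Sum>k\<in>shell j. norm (a k)) \<le> 4 ^ CARD('d) * C * (1 / 2) ^ j"
proof -
  let ?d = "CARD('d)"
  have "norm (a k) \<le> C / (2 ^ j) ^ (?d + 1)" if k: "k \<in> shell j" for k
  proof -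
    have "norm (a k) * (2 ^ j) ^ (?d + 1) \<le> norm (a k) * jap k ^ (?d + 1)"
      using shell_jap[OF k] by (intro mult_left_mono power_mono) auto
    also have "\<dots> \<le> C" by (rule assms(1)[OF k])
    finally show ?thesis by (simp add: pos_le_divide_eq)
  qed
  then have "(\<Sum>k\<in>shell j. norm (a k)) \<le> real (card (shell j :: (int^'d) set)) * (C / (2 ^ j) ^ (?d + 1))"
    by (rule sum_bounded_above)
  also have "\<dots> \<le> (4 ^ ?d * (2 ^ j) ^ ?d) * (C / (2 ^ j) ^ (?d + 1))"
    using shell_finite_card assms(2) by (intro mult_right_mono) auto
  also have "\<dots> = 4 ^ ?d * C * (1 / 2) ^ j"
    by (simp add: power_one_over field_simps)
  finally show ?thesis .
qed

lemma shells_abs_summable: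
  fixes a :: "int^'d \<Rightarrow> 'b::banach"
  assumes "\<And>k. norm (a k) * jap k ^ (CARD('d) + 1) \<le> C"
  shows "(\<lambda>k. norm (a k)) summable_on UNIV"
proof (rule nonneg_bdd_above_summable_on)
  have "0 \<le> norm (a 0) * jap 0 ^ (CARD('d) + 1)"
    by (intro mult_nonneg_nonneg zero_le_power) auto
  then have C: "C \<ge> 0" using assms by (rule order.trans)
  show "bdd_above (sum (\<lambda>k. norm (a k)) ` {F. F \<subseteq> UNIV \<and> finite F})"
  proof (intro bdd_aboveI2)
    fix F :: "(int^'d) set" assume "F \<in> {F. F \<subseteq> UNIV \<and> finite F}"
    then have F: "finite F" by simp
    obtain s where s: "\<And>k::int^'d. k \<in> shell (s k)" using ex_shell by metis
    obtain J where J: "\<And>k. k \<in> F \<Longrightarrow> s k < J"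
      using F finite_nat_set_iff_bounded[of "s ` F"] by auto
    have "(\<Sum>k\<in>F. norm (a k)) \<le> (\<Sum>k\<in>(\<Union>j\<in>{..<J}. shell j). norm (a k))"
    proof (rule sum_mono2)
      show "F \<subseteq> (\<Union>j\<in>{..<J}. shell j)" using J s by blast
    qed auto
    also have "\<dots> = (\<Sum>j<J. \<Sum>k\<in>shell j. norm (a k))"
      using shell_disjoint by (intro sum.UNION_disjoint) auto
    also have "\<dots> \<le> (\<Sum>j<J. 4 ^ CARD('d) * C * (1 / 2) ^ j)"
      using assms C by (intro sum_mono shell_sum_bound) auto
    also have "\<dots> = 4 ^ CARD('d) * C * (\<Sum>j<J. (1 / 2) ^ j)"
      by (simp add: sum_distrib_left)
    also have "\<dots> \<le> 4 ^ CARD('d) * C * 2"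
    proof (intro mult_left_mono)
      show "(\<Sum>j<J. (1 / 2) ^ j) \<le> (2::real)"
        using sum_le_suminf[of "\<lambda>j. (1 / 2::real) ^ j" "{..<J}"] suminf_geometric[of "1/2::real"] by simp
    qed (use C in auto)
    finally show "(\<Sum>k\<in>F. norm (a k)) \<le> 4 ^ CARD('d) * C * 2" .
  qed
qed auto

text \<open>Links the unordered sum in \<open>torus_Op\<close> with the ordinary series over shells
  used everywhere else: the unions of the first shells eventually contain every finite set of
  frequencies.\<close>

lemma shells_sums_infsum:
  fixes a :: "int^'d \<Rightarrow> 'b::banach"
  assumes "\<And>k. norm (a k) * jap k ^ (CARD('d) + 1) \<le> C"
  shows "(\<lambda>j. \<Sum>k\<in>shell j. a k) sums (\<Sum>\<^sub>\<infinity>k. a k)"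
proof -
  have "a summable_on UNIV" by (rule abs_summable_summable[OF shells_abs_summable[of a C]]) (rule assms)
  then have "(sum a \<longlongrightarrow> (\<Sum>\<^sub>\<infinity>k. a k)) (finite_subsets_at_top UNIV)"
    by (simp add: has_sum_def[symmetric])
  moreover have "filterlim (\<lambda>J. \<Union>j\<in>{..<J}. shell j) (finite_subsets_at_top (UNIV :: (int^'d) set)) sequentially"
    unfolding filterlim_finite_subsets_at_top
  proof (intro allI impI)
    fix F :: "(int^'d) set" assume "finite F \<and> F \<subseteq> UNIV"
    then have F: "finite F" by simp
    obtain s where s: "\<And>k::int^'d. k \<in> shell (s k)" using ex_shell by metis
    obtain J where J: "\<And>k. k \<in> F \<Longrightarrow> s k < J"
      using F finite_nat_set_iff_bounded[of "s ` F"] by auto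
    have "F \<subseteq> (\<Union>j\<in>{..<n}. shell j)" if "n \<ge> J" for n
    proof
      fix k assume "k \<in> F"
      then have "s k < n" using J that by force
      then show "k \<in> (\<Union>j\<in>{..<n}. shell j)" using s by blast
    qed
    then show "\<forall>\<^sub>F n in sequentially. finite (\<Union>j\<in>{..<n}. shell j) \<and> F \<subseteq> (\<Union>j\<in>{..<n}. shell j) \<and>
        (\<Union>j\<in>{..<n}. shell j) \<subseteq> (UNIV :: (int^'d) set)"
      by (intro eventually_sequentiallyI[of J]) auto
  qed
  ultimately have "(\<lambda>J. sum a (\<Union>j\<in>{..<J}. shell j)) \<longlonglongrightarrow> (\<Sum>\<^sub>\<infinity>k. a k)"
    by (rule filterlim_compose)
  moreover have "sum a (\<Union>j\<in>{..<J}. shell j) = (\<Sum>j<J. \<Sum>k\<in>shell j. a k)" for J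
    using shell_disjoint by (intro sum.UNION_disjoint) auto
  ultimately show ?thesis by (simp add: sums_def)
qed

text \<open>Differentiate \<open>N\<close> times in a direction in which the frequency attains its
  sup norm. For nonzero \<open>k\<close> the factor 2 pi |k_i| is at least half of
  \<open>jap k\<close>, which costs \<open>2 ^ N\<close>; at k = 0 the trivial bound is
  enough.\<close>

lemma fourier_coeff_decay:
  assumes f: "torus_smooth f" and A: "\<And>\<alpha> x. length \<alpha> \<le> N \<Longrightarrow> norm (pderivs \<alpha> f x) \<le> A"
  shows "norm (fourier_coeff f k) * jap k ^ N \<le> 2 ^ N * A"
proof -
  have c: "norm (fourier_coeff (pderivs \<alpha> f) k) \<le> A" if "length \<alpha> \<le> N" for \<alpha>
    by (intro fourier_coeff_bound A that continuous_torus_measurable torus_smooth_continuous torus_smooth_pderivs f)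
  have A0: "A \<ge> 0" using order.trans[OF norm_ge_zero A[of "[]"]] by simp
  obtain i where i: "\<bar>k $ i\<bar> = int (inorm k)" using inorm_attained .
  show ?thesis
  proof (cases "inorm k = 0")
    case True
    have "norm (fourier_coeff f k) \<le> A" using c[of "[]"] by simp
    also have "A \<le> 2 ^ N * A" using A0 by (simp add: mult_le_cancel_right1)
    finally show ?thesis by (simp add: jap_def True)
  next
    case False
    have le: "jap k \<le> 2 * (2 * pi * real (inorm k))"
    proof -
      have "real (inorm k) \<ge> 1" using False by simp
      moreover have "1 * real (inorm k) \<le> 2 * pi * real (inorm k)" using pi_gt3 by (intro mult_right_mono) auto
      ultimately show ?thesis unfolding jap_def by linarith
    qed
    have "norm (2 * pi * real_of_int (k $ i) * \<i>) = 2 * pi * real (inorm k)"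
    proof -
      have "real_of_int \<bar>k $ i\<bar> = real (inorm k)" using i by simp
      then show ?thesis by (simp add: norm_mult)
    qed
    then have *: "(2 * pi * real (inorm k)) ^ N * norm (fourier_coeff f k) \<le> A"
      using c[of "replicate N i"] by (simp only: fourier_coeff_pderivs[OF f] norm_mult norm_power length_replicate order_refl)
    have "norm (fourier_coeff f k) * jap k ^ N \<le> norm (fourier_coeff f k) * (2 * (2 * pi * real (inorm k))) ^ N"
      using le jap_ge_1[of k] by (intro mult_left_mono power_mono) auto
    also have "\<dots> = 2 ^ N * ((2 * pi * real (inorm k)) ^ N * norm (fourier_coeff f k))"
      by (simp only: power_mult_distrib mult_ac)
    also have "\<dots> \<le> 2 ^ N * A"
      using * by (intro mult_left_mono) auto
    finally show ?thesis .
  qed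
qed


section \<open>Termwise differentiation\<close>

text \<open>Restriction to a short segment through \<open>x\<close> in direction \<open>i\<close>
  that stays in \<open>V\<close> reduces the claim to termwise differentiation in one variable; the
  summable bound \<open>b\<close> makes the series of derivatives converge uniformly there.\<close>

lemma has_pderiv_suminf:
  fixes q :: "nat \<Rightarrow> real^'d \<Rightarrow> 'b::banach"
  assumes V: "open V" "x \<in> V" and der: "\<And>j y. y \<in> V \<Longrightarrow> has_pderiv i (q j) (D j y) y"
    and b: "\<And>j y. y \<in> V \<Longrightarrow> norm (q j y) \<le> b j" "\<And>j y. y \<in> V \<Longrightarrow> norm (D j y) \<le> b j" "summable b"
  shows "has_pderiv i (\<lambda>y. \<Sum>j. q j y) (\<Sum>j. D j x) x"
proof -
  let ?l = "\<lambda>t. x + t *\<^sub>R axis i (1::real)"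
  have "open (?l -` V)" by (intro open_vimage V continuous_intros)
  moreover have "0 \<in> ?l -` V" using V by simp
  ultimately obtain r where r: "r > 0" "ball 0 r \<subseteq> ?l -` V" using openE by blast
  have sb: "summable (\<lambda>j. f j)" if "\<And>j. norm (f j) \<le> b j" for f :: "nat \<Rightarrow> 'b"
    by (rule summable_comparison_test'[OF b(3), of 0]) (rule that)
  have "\<exists>g. \<forall>t\<in>ball 0 r. (\<lambda>j. q j (?l t)) sums (g t) \<and>
      (g has_derivative (\<lambda>h. h *\<^sub>R (\<Sum>j. D j (?l t)))) (at t within ball 0 r)"
  proof (rule has_derivative_series[where f' = "\<lambda>j t h. h *\<^sub>R D j (?l t)" and x = 0])
    show "((\<lambda>t. q j (?l t)) has_derivative (\<lambda>h. h *\<^sub>R D j (?l t))) (at t within ball 0 r)" if "t \<in> ball 0 r" for j t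
    proof -
      have "?l t \<in> V" using r that by auto
      from has_pderiv_line[OF der[OF this]] show ?thesis
        unfolding has_vector_derivative_def by (rule has_derivative_at_withinI)
    qed
    show "(\<lambda>j. q j (?l 0)) sums (\<Sum>j. q j x)"
      using summable_sums[OF sb[of "\<lambda>j. q j x"]] V b(1) by simp
    fix e :: real assume "e > 0"
    then obtain N where N: "\<And>n. n \<ge> N \<Longrightarrow> norm (\<Sum>j. b (j + n)) < e" using suminf_exist_split[OF _ b(3)] by blast
    show "\<forall>\<^sub>F n in sequentially. \<forall>t\<in>ball 0 r. \<forall>h. norm ((\<Sum>j<n. h *\<^sub>R D j (?l t)) - h *\<^sub>R (\<Sum>j. D j (?l t))) \<le> e * norm h"
    proof (intro eventually_sequentiallyI[of N] ballI allI)
      fix n and t h :: real assume n: "n \<ge> N" and t: "t \<in> ball 0 r"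
      have l: "?l t \<in> V" using r t by auto
      have "(\<Sum>j<n. D j (?l t)) - (\<Sum>j. D j (?l t)) = - (\<Sum>j. D (j + n) (?l t))"
        using suminf_minus_initial_segment[OF sb[of "\<lambda>j. D j (?l t)"], of n] b(2) l by simp
      then have "norm ((\<Sum>j<n. D j (?l t)) - (\<Sum>j. D j (?l t))) \<le> (\<Sum>j. b (j + n))"
        using b l by (simp, intro norm_suminf_le) (auto intro: summable_ignore_initial_segment)
      also have "\<dots> \<le> e" using N[OF n] by simp
      finally have "\<bar>h\<bar> * norm ((\<Sum>j<n. D j (?l t)) - (\<Sum>j. D j (?l t))) \<le> \<bar>h\<bar> * e" by (intro mult_left_mono) auto
      moreover have "(\<Sum>j<n. h *\<^sub>R D j (?l t)) - h *\<^sub>R (\<Sum>j. D j (?l t)) = h *\<^sub>R ((\<Sum>j<n. D j (?l t)) - (\<Sum>j. D j (?l t)))"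
        by (simp add: scaleR_right_diff_distrib scaleR_sum_right)
      ultimately show "norm ((\<Sum>j<n. h *\<^sub>R D j (?l t)) - h *\<^sub>R (\<Sum>j. D j (?l t))) \<le> e * norm h"
        by (simp add: mult.commute)
    qed
  qed (use r in auto)
  then obtain g where g: "\<And>t. t \<in> ball 0 r \<Longrightarrow> (\<lambda>j. q j (?l t)) sums (g t)"
    "\<And>t. t \<in> ball 0 r \<Longrightarrow> (g has_derivative (\<lambda>h. h *\<^sub>R (\<Sum>j. D j (?l t)))) (at t within ball 0 r)" by blast
  have "(g has_vector_derivative (\<Sum>j. D j x)) (at 0)"
    using g(2)[of 0] r by (simp add: has_vector_derivative_def at_within_open[of 0 "ball 0 r"])
  then have "((\<lambda>t. \<Sum>j. q j (?l t)) has_vector_derivative (\<Sum>j. D j x)) (at 0)"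
    by (rule has_vector_derivative_transform_within_open[where S = "ball 0 r"]) (use r g(1) sums_unique in auto)
  then show ?thesis by (simp add: has_pderiv_def)
qed

text \<open>The two conclusions depend on each other: \<open>step\<close> obtains the derivative for
  a list on which the identity is already known, and the induction on the list feeds it. The bounds
  concern only the open set \<open>V\<close>; outside of it the series may diverge.\<close>

lemma pderivs_suminf:
  fixes p :: "nat \<Rightarrow> real^'d \<Rightarrow> 'b::banach"
  assumes p: "\<And>j. smooth (p j)" and V: "open V"
    and b: "\<And>\<alpha> j x. length \<alpha> \<le> n \<Longrightarrow> x \<in> V \<Longrightarrow> norm (pderivs \<alpha> (p j) x) \<le> b j" "summable b"
  shows "length \<alpha> \<le> n \<Longrightarrow> x \<in> V \<Longrightarrow> pderivs \<alpha> (\<lambda>x. \<Sum>j. p j x) x = (\<Sum>j. pderivs \<alpha> (p j) x)"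
    and "length \<alpha> < n \<Longrightarrow> x \<in> V \<Longrightarrow> has_pderiv i (pderivs \<alpha> (\<lambda>x. \<Sum>j. p j x)) (\<Sum>j. pderivs (i # \<alpha>) (p j) x) x"
proof -
  have step: "has_pderiv i (pderivs \<alpha> (\<lambda>x. \<Sum>j. p j x)) (\<Sum>j. pderivs (i # \<alpha>) (p j) x) x"
    if eq: "\<And>y. y \<in> V \<Longrightarrow> pderivs \<alpha> (\<lambda>x. \<Sum>j. p j x) y = (\<Sum>j. pderivs \<alpha> (p j) y)"
      and l: "length \<alpha> < n" and x: "x \<in> V" for \<alpha> i x
  proof (rule has_pderiv_cong_open[OF _ V x eq])
    show "has_pderiv i (\<lambda>y. \<Sum>j. pderivs \<alpha> (p j) y) (\<Sum>j. pderivs (i # \<alpha>) (p j) x) x"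
    proof (rule has_pderiv_suminf[OF V x _ _ _ b(2)])
      show "has_pderiv i (pderivs \<alpha> (p j)) (pderivs (i # \<alpha>) (p j) y) y" for j y
        using p by (auto intro: smooth_has_pderiv smooth_pderivs)
      show "norm (pderivs \<alpha> (p j) y) \<le> b j" "norm (pderivs (i # \<alpha>) (p j) y) \<le> b j" if "y \<in> V" for j y
        using b(1)[of \<alpha>, OF _ that] b(1)[of "i # \<alpha>", OF _ that] l by simp_all
    qed
  qed
  have eq: "length \<alpha> \<le> n \<Longrightarrow> x \<in> V \<Longrightarrow> pderivs \<alpha> (\<lambda>x. \<Sum>j. p j x) x = (\<Sum>j. pderivs \<alpha> (p j) x)" for \<alpha> x
  proof (induction \<alpha> arbitrary: x)
    case (Cons i \<alpha>)
    show ?case using has_pderiv_pderiv_at[OF step[of \<alpha> x i]] Cons by simp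
  qed simp
  then show "length \<alpha> \<le> n \<Longrightarrow> x \<in> V \<Longrightarrow> pderivs \<alpha> (\<lambda>x. \<Sum>j. p j x) x = (\<Sum>j. pderivs \<alpha> (p j) x)" .
  show "length \<alpha> < n \<Longrightarrow> x \<in> V \<Longrightarrow> has_pderiv i (pderivs \<alpha> (\<lambda>x. \<Sum>j. p j x)) (\<Sum>j. pderivs (i # \<alpha>) (p j) x) x"
    using eq by (intro step) auto
qed

lemma continuous_on_suminf_bounded:
  fixes q :: "nat \<Rightarrow> 'a::topological_space \<Rightarrow> 'b::banach"
  assumes "\<And>j. continuous_on V (q j)" "\<And>j x. x \<in> V \<Longrightarrow> norm (q j x) \<le> b j" "summable b"
  shows "continuous_on V (\<lambda>x. \<Sum>j. q j x)"
proof (rule uniform_limit_theorem[where F = sequentially])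
  show "uniform_limit V (\<lambda>n x. \<Sum>j<n. q j x) (\<lambda>x. \<Sum>j. q j x) sequentially"
    using assms by (intro Weierstrass_m_test) auto
  show "\<forall>\<^sub>F n in sequentially. continuous_on V (\<lambda>x. \<Sum>j<n. q j x)"
    using assms by (intro always_eventually allI continuous_on_sum) auto
qed simp

lemma torus_smooth_suminf:
  fixes p :: "nat \<Rightarrow> real^'d \<Rightarrow> 'b::banach"
  assumes p: "\<And>j. torus_smooth (p j)"
    and b: "\<And>\<alpha>. \<exists>b. summable b \<and> (\<forall>j x. norm (pderivs \<alpha> (p j) x) \<le> b j)"
  shows "torus_smooth (\<lambda>x. \<Sum>j. p j x)" 
    and "pderivs \<alpha> (\<lambda>x. \<Sum>j. p j x) x = (\<Sum>j. pderivs \<alpha> (p j) x)"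
proof -
  have sm: "\<And>j. smooth (p j)" and per: "\<And>j. periodic_on UNIV (p j)" using p by (auto simp: torus_smooth_iff)
  obtain B where B: "\<And>\<alpha>. summable (B \<alpha>)" "\<And>\<alpha> j x. norm (pderivs \<alpha> (p j) x) \<le> B \<alpha> j"
    using b by metis
  \<comment> \<open>Each list of directions has its own summable bound. There are finitely many
    lists of length at most n, so the sum of their bounds serves all of them at once.\<close>
  define b' where "b' = (\<lambda>n j. \<Sum>\<alpha>\<in>{\<alpha>. set \<alpha> \<subseteq> UNIV \<and> length \<alpha> \<le> n}. B \<alpha> j)"
  have fin: "finite {\<alpha>::'d list. set \<alpha> \<subseteq> UNIV \<and> length \<alpha> \<le> n}" for n
    by (rule finite_lists_length_le) simp
  have Bnn: "B \<alpha> j \<ge> 0" for \<alpha> j using order.trans[OF norm_ge_zero B(2)] .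
  have b': "norm (pderivs \<alpha> (p j) x) \<le> b' n j" if "length \<alpha> \<le> n" for \<alpha> n j x
  proof -
    have "B \<alpha> j \<le> b' n j"
      unfolding b'_def by (rule member_le_sum[where i = \<alpha> and f = "\<lambda>\<alpha>. B \<alpha> j"]) (use that Bnn fin in auto)
    then show ?thesis using B(2)[of \<alpha> j x] by linarith
  qed
  have sb': "summable (b' n)" for n
    unfolding b'_def using B by (intro summable_sum) auto
  show eq: "pderivs \<alpha> (\<lambda>x. \<Sum>j. p j x) x = (\<Sum>j. pderivs \<alpha> (p j) x)" for \<alpha> x
    by (rule pderivs_suminf(1)[OF sm open_UNIV b' sb' order_refl UNIV_I])
  show "torus_smooth (\<lambda>x. \<Sum>j. p j x)"
    unfolding torus_smooth_def
  proof (intro conjI allI)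
    show "periodic_on UNIV (\<lambda>x. \<Sum>j. p j x)"
      using per by (simp add: periodic_on_def)
    show "has_pderivs_on n UNIV (\<lambda>x. \<Sum>j. p j x)" for n
      unfolding has_pderivs_on_def
    proof (intro allI impI ballI)
      fix \<alpha> :: "'d list" and i :: 'd and x assume l: "length \<alpha> < n"
      show "(\<lambda>t. pderivs \<alpha> (\<lambda>x. \<Sum>j. p j x) (x + t *\<^sub>R axis i 1)) differentiable at 0"
        by (rule has_pderiv_imp_differentiable, rule pderivs_suminf(2)[OF sm open_UNIV b' sb' l]) simp_all
    qed
    show "continuous_on UNIV (pderivs \<alpha> (\<lambda>x. \<Sum>j. p j x))" for \<alpha>
    proof -
      have "continuous_on UNIV (\<lambda>x. \<Sum>j. pderivs \<alpha> (p j) x)"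
        using B sm by (intro continuous_on_suminf_bounded[where b = "B \<alpha>"] smooth_continuous smooth_pderivs) auto
      then show ?thesis by (simp add: eq[abs_def])
    qed
  qed
qed

lemma torus_integral_suminf:
  fixes f :: "nat \<Rightarrow> real^'d \<Rightarrow> 'b::{banach,second_countable_topology}"
  assumes "\<And>j. integrable torus_measure (f j)" "\<And>j x. x \<in> torus_cell \<Longrightarrow> norm (f j x) \<le> b j" "summable b"
  shows "(\<lambda>j. integral\<^sup>L torus_measure (f j)) sums integral\<^sup>L torus_measure (\<lambda>x. \<Sum>j. f j x)"
proof (rule sums_integral)
  show "AE x in torus_measure. summable (\<lambda>j. norm (f j x))"
    using assms(2,3) by (intro AE_I2 summable_comparison_test'[OF assms(3), of 0]) auto
  have "\<bar>integral\<^sup>L torus_measure (\<lambda>x. norm (f j x))\<bar> \<le> b j" for j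
    using torus_integral_bound[of "\<lambda>x. norm (f j x)" "b j"] assms(1)[of j] assms(2)[of _ j] by simp
  then show "summable (\<lambda>j. integral\<^sup>L torus_measure (\<lambda>x. norm (f j x)))"
    by (intro summable_comparison_test'[OF assms(3), of 0]) auto
qed (rule assms)


section \<open>Fourier series\<close>

text \<open>Fourier coefficient sequences of smooth functions: decay faster than every power of the
  frequency.\<close>

definition rapid :: "(int^'d \<Rightarrow> complex) \<Rightarrow> bool" where
  "rapid c \<longleftrightarrow> (\<forall>N. \<exists>C. \<forall>k. norm (c k) * jap k ^ N \<le> C)"

text \<open>Summation by shells gives a series indexed by the natural numbers with geometrically
  decaying terms when the coefficients are rapid.\<close>

definition fseries :: "(int^'d \<Rightarrow> complex) \<Rightarrow> real^'d \<Rightarrow> complex" where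
  "fseries c x = (\<Sum>j. \<Sum>k\<in>shell j. c k * fourier_mode k x)"

lemma pderivs_fourier_mode_bound: "norm (pderivs \<alpha> (fourier_mode k) x) \<le> (2 * pi * jap k) ^ length \<alpha>"
proof -
  have "norm (\<Prod>i\<leftarrow>\<alpha>. 2 * pi * real_of_int (k $ i) * \<i>) \<le> (2 * pi * jap k) ^ length \<alpha>"
  proof (induction \<alpha>)
    case (Cons i \<alpha>)
    have "\<bar>real_of_int (k $ i)\<bar> \<le> jap k"
    proof -
      have "real_of_int \<bar>k $ i\<bar> \<le> real_of_int (int (inorm k))" by (intro of_int_le_iff[THEN iffD2] inorm_ge)
      then show ?thesis by (simp add: jap_def)
    qed
    then have "norm (2 * pi * real_of_int (k $ i) * \<i>) \<le> 2 * pi * jap k" by (simp add: norm_mult)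
    then show ?case using Cons by (simp add: norm_mult del: of_int_mult) (intro mult_mono, auto)
  qed simp
  then show ?thesis by (simp add: pderivs_fourier_mode norm_mult)
qed

text \<open>Of the decay order \<open>length \<alpha> + (CARD('d) + 1)\<close>, the first part pays
  for the derivatives of the modes and the second for the summation over the shell.\<close>

lemma fseries_block_bound:
  fixes c :: "int^'d \<Rightarrow> complex"
  assumes "rapid c"
  shows "\<exists>C\<ge>0. \<forall>j x. norm (pderivs \<alpha> (\<lambda>x. \<Sum>k\<in>shell j. c k * fourier_mode k x) x) \<le> C * (1 / 2) ^ j"
proof -
  let ?N = "length \<alpha> + (CARD('d) + 1)"
  obtain C where C: "\<And>k. norm (c k) * jap k ^ ?N \<le> C" using assms[unfolded rapid_def, rule_format, of ?N] by blast
  have "0 \<le> norm (c 0) * jap 0 ^ ?N" by (intro mult_nonneg_nonneg zero_le_power) auto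
  then have C0: "C \<ge> 0" using C by (rule order.trans)
  have sm: "smooth (fourier_mode k)" for k :: "int^'d" using torus_smooth_fourier_mode by (auto simp: torus_smooth_iff)
  let ?C = "(2 * pi) ^ length \<alpha> * C"
  have b: "norm (c k * pderivs \<alpha> (fourier_mode k) x) * jap k ^ (CARD('d) + 1) \<le> ?C" for k x
  proof -
    have "norm (c k * pderivs \<alpha> (fourier_mode k) x) * jap k ^ (CARD('d) + 1) \<le>
        norm (c k) * (2 * pi * jap k) ^ length \<alpha> * jap k ^ (CARD('d) + 1)"
      unfolding norm_mult by (intro mult_right_mono mult_left_mono pderivs_fourier_mode_bound) auto
    also have "\<dots> = (2 * pi) ^ length \<alpha> * (norm (c k) * jap k ^ ?N)"
      by (simp add: power_mult_distrib power_add mult_ac)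
    also have "\<dots> \<le> ?C" using C by (intro mult_left_mono) auto
    finally show ?thesis .
  qed
  have "norm (pderivs \<alpha> (\<lambda>x. \<Sum>k\<in>shell j. c k * fourier_mode k x) x) \<le> (4 ^ CARD('d) * ?C) * (1 / 2) ^ j" for j x
  proof -
    have "pderivs \<alpha> (\<lambda>x. \<Sum>k\<in>shell j. c k * fourier_mode k x) x = (\<Sum>k\<in>shell j. c k * pderivs \<alpha> (fourier_mode k) x)"
      using sm by (subst pderivs_sum) (auto intro: smooth_cmult simp: pderivs_cmult)
    also have "norm \<dots> \<le> (\<Sum>k\<in>shell j. norm (c k * pderivs \<alpha> (fourier_mode k) x))" by (rule norm_sum)
    also have "\<dots> \<le> 4 ^ CARD('d) * ?C * (1 / 2) ^ j" using b C0 by (intro shell_sum_bound) auto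
    finally show ?thesis .
  qed
  moreover have "4 ^ CARD('d) * ?C \<ge> 0" using C0 by simp
  ultimately show ?thesis by blast
qed

lemma torus_smooth_block: "torus_smooth (\<lambda>x. \<Sum>k\<in>F. c k * fourier_mode k x)"
  by (intro torus_smooth_sum torus_smooth_cmult torus_smooth_fourier_mode)

lemma
  assumes "rapid c"
  shows torus_smooth_fseries: "torus_smooth (fseries c)"
    and pderivs_fseries: "pderivs \<alpha> (fseries c) x = (\<Sum>j. pderivs \<alpha> (\<lambda>x. \<Sum>k\<in>shell j. c k * fourier_mode k x) x)"
proof -
  have b: "\<exists>b. summable b \<and> (\<forall>j x. norm (pderivs \<alpha> (\<lambda>x. \<Sum>k\<in>shell j. c k * fourier_mode k x) x) \<le> b j)" for \<alpha>
  proof -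
    obtain C where "\<And>j x. norm (pderivs \<alpha> (\<lambda>x. \<Sum>k\<in>shell j. c k * fourier_mode k x) x) \<le> C * (1 / 2) ^ j"
      using fseries_block_bound[OF assms] by blast
    moreover have "summable (\<lambda>j. C * (1 / 2) ^ j)" by (intro summable_mult summable_geometric) simp
    ultimately show ?thesis by blast
  qed
  show "torus_smooth (fseries c)"
    using torus_smooth_suminf(1)[OF torus_smooth_block b] unfolding fseries_def[abs_def] .
  show "pderivs \<alpha> (fseries c) x = (\<Sum>j. pderivs \<alpha> (\<lambda>x. \<Sum>k\<in>shell j. c k * fourier_mode k x) x)"
    using torus_smooth_suminf(2)[OF torus_smooth_block b] unfolding fseries_def[abs_def] .
qed

text \<open>The bound holds for every derivative, so the partial sums converge in the topology of
  the test functions. It serves twice: to show that a distribution is determined by its values on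
  the modes, and to give the rate at which the noise series converges.\<close>

lemma fseries_tail_bound:
  assumes "rapid c"
  shows "\<exists>C\<ge>0. \<forall>J x. norm (pderivs \<alpha> (\<lambda>x. (\<Sum>j<J. \<Sum>k\<in>shell j. c k * fourier_mode k x) - fseries c x) x) \<le> C * (1 / 2) ^ J"
proof -
  obtain C where C: "C \<ge> 0" "\<And>j x. norm (pderivs \<alpha> (\<lambda>x. \<Sum>k\<in>shell j. c k * fourier_mode k x) x) \<le> C * (1 / 2) ^ j"
    using fseries_block_bound[OF assms] by blast
  have sC: "summable (\<lambda>j. C * (1 / 2) ^ j)" by (intro summable_mult summable_geometric) simp
  have "norm (pderivs \<alpha> (\<lambda>x. (\<Sum>j<J. \<Sum>k\<in>shell j. c k * fourier_mode k x) - fseries c x) x) \<le> (2 * C) * (1 / 2) ^ J" for J x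
  proof -
    let ?q = "\<lambda>j. pderivs \<alpha> (\<lambda>x. \<Sum>k\<in>shell j. c k * fourier_mode k x) x"
    have sm: "smooth (fseries c)" "smooth (\<lambda>x. \<Sum>k\<in>F. c k * fourier_mode k x)" for F
      using torus_smooth_fseries[OF assms] torus_smooth_block by (auto simp: torus_smooth_iff)
    have sq: "summable ?q" by (rule summable_comparison_test'[OF sC, of 0]) (rule C)
    have "pderivs \<alpha> (\<lambda>x. (\<Sum>j<J. \<Sum>k\<in>shell j. c k * fourier_mode k x) + (- 1) * fseries c x) x = (\<Sum>j<J. ?q j) + (- 1) * pderivs \<alpha> (fseries c) x"
      unfolding pderivs_add[OF smooth_sum[OF sm(2)] smooth_cmult[OF sm(1)]] pderivs_cmult[OF sm(1)] pderivs_sum[OF sm(2)] ..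
    also have "\<dots> = - (\<Sum>j. ?q (j + J))"
      using suminf_minus_initial_segment[OF sq, of J] by (simp add: pderivs_fseries[OF assms])
    finally have "norm (pderivs \<alpha> (\<lambda>x. (\<Sum>j<J. \<Sum>k\<in>shell j. c k * fourier_mode k x) - fseries c x) x) = norm (\<Sum>j. ?q (j + J))" by simp
    also have "\<dots> \<le> (\<Sum>j. C * (1 / 2) ^ (j + J))"
      using C sC by (intro norm_suminf_le) (auto intro: summable_ignore_initial_segment)
    also have "\<dots> = (\<Sum>j. (C * (1 / 2) ^ J) * (1 / 2) ^ j)" by (simp add: power_add mult_ac)
    also have "\<dots> = (C * (1 / 2) ^ J) * 2"
      by (subst suminf_mult) (auto simp: suminf_geometric summable_geometric)
    finally show ?thesis by simp
  qed
  then show ?thesis using C by (intro exI[of _ "2 * C"]) auto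
qed

lemma fseries_block_0: 
  assumes "rapid c"
  shows "\<exists>C\<ge>0. \<forall>j x. norm (\<Sum>k\<in>shell j. c k * fourier_mode k x) \<le> C * (1 / 2) ^ j"
  using fseries_block_bound[OF assms, of "[]"] by simp

text \<open>Parseval's identity with the series on one side only: the blocks are uniformly
  geometrically small and may be integrated against the bounded function \<open>f\<close> term by
  term.\<close>

lemma torus_inner_fseries:
  assumes "rapid c" "torus_smooth f"
  shows "(\<lambda>j. \<Sum>k\<in>shell j. fourier_coeff f k * cnj (c k)) sums torus_inner f (fseries c)"
proof -
  obtain C where C: "C \<ge> 0" "\<And>j x. norm (\<Sum>k\<in>shell j. c k * fourier_mode k x) \<le> C * (1 / 2) ^ j"
    using fseries_block_0[OF assms(1)] by blast
  obtain B where B: "B > 0" "\<And>x. norm (f x) \<le> B" using torus_smooth_bounded[OF assms(2)] by blast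
  let ?q = "\<lambda>j x. f x * cnj (\<Sum>k\<in>shell j. c k * fourier_mode k x)"
  have sC: "summable (\<lambda>j. C * (1 / 2) ^ j)" by (intro summable_mult summable_geometric) simp
  have "(\<lambda>j. integral\<^sup>L torus_measure (?q j)) sums integral\<^sup>L torus_measure (\<lambda>x. \<Sum>j. ?q j x)"
  proof (rule torus_integral_suminf[where b = "\<lambda>j. B * (C * (1 / 2) ^ j)"])
    show "integrable torus_measure (?q j)" for j
      by (intro torus_smooth_integrable torus_smooth_mult torus_smooth_cnj torus_smooth_block assms)
    show "norm (?q j x) \<le> B * (C * (1 / 2) ^ j)" for j x
      unfolding norm_mult complex_mod_cnj using B C by (intro mult_mono) auto
    show "summable (\<lambda>j. B * (C * (1 / 2) ^ j))" using sC by (rule summable_mult)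
  qed
  moreover have "integral\<^sup>L torus_measure (?q j) = (\<Sum>k\<in>shell j. fourier_coeff f k * cnj (c k))" for j
  proof -
    have int: "integrable torus_measure (\<lambda>x. cnj (c k) * (f x * cnj (fourier_mode k x)))" for k
      by (intro torus_smooth_integrable torus_smooth_cmult torus_smooth_mult torus_smooth_cnj torus_smooth_fourier_mode assms)
    have "?q j = (\<lambda>x. \<Sum>k\<in>shell j. cnj (c k) * (f x * cnj (fourier_mode k x)))"
      by (auto simp: sum_distrib_left mult_ac)
    then show ?thesis using int by (simp add: fourier_coeff_eq mult.commute)
  qed
  moreover have "(\<Sum>j. ?q j x) = f x * cnj (fseries c x)" for x
  proof -
    have s: "summable (\<lambda>j. \<Sum>k\<in>shell j. c k * fourier_mode k x)"
      by (rule summable_comparison_test'[OF sC, of 0]) (rule C)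
    have "(\<lambda>j. cnj (\<Sum>k\<in>shell j. c k * fourier_mode k x)) sums cnj (fseries c x)"
      unfolding fseries_def sums_cnj by (rule summable_sums[OF s])
    from sums_unique[OF sums_mult[OF this, of "f x"]] show ?thesis by simp
  qed
  ultimately show ?thesis by (simp add: torus_inner_def torus_integral_eq)
qed

lemma torus_inner_commute: "torus_inner g f = cnj (torus_inner f g)"
proof -
  have "(\<lambda>x. g x * cnj (f x)) = (\<lambda>x. cnj (f x * cnj (g x)))" by (auto simp: mult.commute)
  then show ?thesis unfolding torus_inner_def torus_integral_eq by (simp only: Bochner_Integration.integral_cnj)
qed

lemma fourier_coeff_fseries:
  fixes c :: "int^'d \<Rightarrow> complex"
  assumes "rapid c" shows "fourier_coeff (fseries c) k = c k"
proof -
  obtain i where i: "k \<in> shell i" using ex_shell by blast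
  have f: "fourier_coeff (fourier_mode k) l = (if k = l then 1 else 0)" for l
    by (simp add: fourier_coeff_eq fourier_mode_orthonormal)
  have "(\<lambda>j. \<Sum>l\<in>shell j. fourier_coeff (fourier_mode k) l * cnj (c l)) sums torus_inner (fourier_mode k) (fseries c)"
    by (intro torus_inner_fseries assms torus_smooth_fourier_mode)
  moreover have "(\<Sum>l\<in>shell j. fourier_coeff (fourier_mode k) l * cnj (c l)) = (if j = i then cnj (c k) else 0)" for j
  proof -
    have "(\<Sum>l\<in>shell j. fourier_coeff (fourier_mode k) l * cnj (c l)) = (\<Sum>l\<in>shell j. if k = l then cnj (c k) else 0)"
      by (intro sum.cong refl) (simp add: f)
    also have "\<dots> = (if k \<in> shell j then cnj (c k) else 0)" by (subst sum.delta') auto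
    also have "k \<in> shell j \<longleftrightarrow> j = i" using i shell_disjoint by blast
    finally show ?thesis by simp
  qed
  ultimately have "(\<lambda>j. if j = i then cnj (c k) else 0) sums torus_inner (fourier_mode k) (fseries c)" by simp
  then have "torus_inner (fourier_mode k) (fseries c) = cnj (c k)"
    using sums_single[of i "\<lambda>_. cnj (c k)"] sums_unique2 by blast
  then show ?thesis
    using torus_inner_commute[of "fseries c" "fourier_mode k"]
    by (simp add: fourier_coeff_eq torus_inner_def torus_integral_eq)
qed

lemma torus_smooth_pderivs_bounded:
  fixes f :: "real^'d \<Rightarrow> 'b::real_normed_vector"
  assumes "torus_smooth f"
  obtains A where "A \<ge> 0" "\<And>\<alpha> x. length \<alpha> \<le> N \<Longrightarrow> norm (pderivs \<alpha> f x) \<le> A"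
proof -
  have "\<exists>B. \<forall>x. norm (pderivs \<alpha> f x) \<le> B" for \<alpha>
    by (rule torus_smooth_bounded[OF torus_smooth_pderivs[OF assms, of \<alpha>]]) blast
  then obtain B where B: "\<And>\<alpha> x. norm (pderivs \<alpha> f x) \<le> B \<alpha>" by metis
  define A where "A = (\<Sum>\<alpha>\<in>{\<alpha>. set \<alpha> \<subseteq> UNIV \<and> length \<alpha> \<le> N}. B \<alpha>)"
  have fin: "finite {\<alpha>::'d list. set \<alpha> \<subseteq> UNIV \<and> length \<alpha> \<le> N}"
    by (rule finite_lists_length_le) simp
  have B0: "B \<alpha> \<ge> 0" for \<alpha> using order.trans[OF norm_ge_zero B] .
  have "norm (pderivs \<alpha> f x) \<le> A" if "length \<alpha> \<le> N" for \<alpha> x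
  proof -
    have "B \<alpha> \<le> A"
      unfolding A_def by (rule member_le_sum[where i = \<alpha> and f = B]) (use that B0 fin in auto)
    then show ?thesis using B[of \<alpha> x] by linarith
  qed
  then show ?thesis using that[of A] B0 by (simp add: A_def sum_nonneg)
qed

lemma rapid_fourier_coeff:
  assumes "torus_smooth f" shows "rapid (fourier_coeff f)"
  unfolding rapid_def
proof
  fix N
  obtain A where "A \<ge> 0" "\<And>\<alpha> x. length \<alpha> \<le> N \<Longrightarrow> norm (pderivs \<alpha> f x) \<le> A"
    using torus_smooth_pderivs_bounded[OF assms] by blast
  then show "\<exists>C. \<forall>k. norm (fourier_coeff f k) * jap k ^ N \<le> C"
    using fourier_coeff_decay[OF assms] by blast
qed

text \<open>A continuous nonnegative function with integral zero vanishes on the whole cell, and by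
  periodicity everywhere.\<close>

lemma torus_inner_self_eq_0:
  assumes f: "torus_smooth f" and 0: "torus_inner f f = 0"
  shows "f x = 0"
proof -
  have cont: "continuous_on S (\<lambda>x. (norm (f x))\<^sup>2)" for S
    by (intro continuous_intros torus_smooth_continuous f)
  have "torus_inner f f = of_real (integral\<^sup>L torus_measure (\<lambda>x. (norm (f x))\<^sup>2))"
  proof -
    have "(\<lambda>x. f x * cnj (f x)) = (\<lambda>x. complex_of_real ((norm (f x))\<^sup>2))" by (simp only: complex_norm_square)
    then show ?thesis unfolding torus_inner_def torus_integral_eq by (simp only: Bochner_Integration.integral_complex_of_real)
  qed
  with 0 have "integral\<^sup>L torus_measure (\<lambda>x. (norm (f x))\<^sup>2) = 0" by simp
  then have "set_lebesgue_integral lborel torus_cell (\<lambda>x. (norm (f x))\<^sup>2) = 0"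
    by (simp add: torus_measure_def integral_restrict_space set_lebesgue_integral_def)
  moreover have int: "set_integrable lborel torus_cell (\<lambda>x. (norm (f x))\<^sup>2)"
    unfolding set_integrable_torus_cell_iff by (intro continuous_torus_integrable cont)
  ultimately have "((\<lambda>x. (norm (f x))\<^sup>2) has_integral 0) torus_cell"
    using set_borel_integral_eq_integral[OF int] by (simp add: integrable_integral has_integral_iff)
  moreover have "(\<chi> i. 1 / 2) \<in> box 0 (1::real^'d)" by (simp add: mem_box_cart)
  then have "box 0 (1::real^'d) \<noteq> {}" by blast
  ultimately have "(norm (f y))\<^sup>2 = 0" if "y \<in> cbox 0 1" for y
    by (intro has_integral_0_cbox_imp_0[OF cont]) (use that in \<open>auto simp: torus_cell_def\<close>)
  then have "f (x - lattice_vec (floor_vec x)) = 0"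
    using half_cell_frac[of x] half_cell_subset by (auto simp: torus_cell_def)
  then show ?thesis using periodic_frac[of f x] f by (simp add: torus_smooth_iff)
qed

text \<open>Trigonometric polynomials, for the density argument through the Stone--Weierstrass theorem on
  the image of the torus in \<open>\<complex>\<^sup>d\<close>.\<close>

inductive trig_poly :: "(real^'d \<Rightarrow> complex) \<Rightarrow> bool" where
  mode: "trig_poly (fourier_mode k)"
| add: "trig_poly p \<Longrightarrow> trig_poly q \<Longrightarrow> trig_poly (\<lambda>x. p x + q x)"
| cmult: "trig_poly p \<Longrightarrow> trig_poly (\<lambda>x. c * p x)"

lemma trig_poly_mult: "trig_poly p \<Longrightarrow> trig_poly q \<Longrightarrow> trig_poly (\<lambda>x. p x * q x)"
proof (induction p rule: trig_poly.induct)
  case (mode k)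
  from mode show ?case
  proof (induction q rule: trig_poly.induct)
    case (mode l)
    have "(\<lambda>x. fourier_mode k x * fourier_mode l x) = fourier_mode (k + l)" by (auto simp: fourier_mode_add)
    then show ?case by (simp add: trig_poly.mode)
  next
    case (add p q)
    from trig_poly.add[OF add.IH] show ?case by (simp add: distrib_left)
  next
    case (cmult p c)
    from trig_poly.cmult[OF cmult.IH, of c] show ?case by (simp add: mult_ac)
  qed
next
  case (add p1 p2)
  from trig_poly.add[OF add.IH[OF add.prems]] show ?case by (simp add: distrib_right)
next
  case (cmult p c)
  from trig_poly.cmult[OF cmult.IH[OF cmult.prems], of c] show ?case by (simp add: mult_ac)
qed

lemma trig_poly_const: "trig_poly (\<lambda>_. c)"
  using trig_poly.cmult[OF trig_poly.mode[of 0], of c] by simp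

lemma trig_poly_sum: "(\<And>i. i \<in> A \<Longrightarrow> trig_poly (p i)) \<Longrightarrow> trig_poly (\<lambda>x. \<Sum>i\<in>A. p i x)"
  by (induction A rule: infinite_finite_induct) (auto intro: trig_poly.add trig_poly_const)

lemma trig_poly_smooth: "trig_poly p \<Longrightarrow> torus_smooth p"
  by (induction rule: trig_poly.induct) (auto intro: torus_smooth_fourier_mode torus_smooth_add torus_smooth_cmult)

lemma trig_poly_orthogonal:
  assumes "torus_smooth g" "\<And>k. fourier_coeff g k = 0" "trig_poly p"
  shows "torus_inner g p = 0"
  using assms(3)
proof (induction rule: trig_poly.induct)
  case (mode k)
  then show ?case using assms(2)[of k] by (simp add: torus_inner_def torus_integral_eq fourier_coeff_eq)
next
  case (add p q)
  have "integrable torus_measure (\<lambda>x. g x * cnj (p x))" "integrable torus_measure (\<lambda>x. g x * cnj (q x))"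
    by (intro torus_smooth_integrable torus_smooth_mult torus_smooth_cnj assms trig_poly_smooth add)+
  with add show ?case by (simp add: torus_inner_def torus_integral_eq distrib_left)
next
  case (cmult p c)
  have "integrable torus_measure (\<lambda>x. g x * cnj (p x))"
    by (intro torus_smooth_integrable torus_smooth_mult torus_smooth_cnj assms trig_poly_smooth cmult)
  have "(\<lambda>x. g x * cnj (c * p x)) = (\<lambda>x. cnj c * (g x * cnj (p x)))" by auto
  with cmult show ?case by (simp add: torus_inner_def torus_integral_eq)
qed

definition torus_embed :: "real^'d \<Rightarrow> complex^'d" where
  "torus_embed x = (\<chi> i. cis (2 * pi * x $ i))"

lemma lattice_vec_axis: "lattice_vec (axis i 1) \<bullet> x = x $ i"
proof -
  have "lattice_vec (axis i 1) = axis i 1" by (simp add: vec_eq_iff axis_def)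
  then show ?thesis by (simp add: inner_axis')
qed

text \<open>A real linear functional of the embedded point is a combination of the cosines and sines
  of its coordinates, each a combination of two modes. Products of modes are modes, so all
  polynomials pull back to trigonometric ones.\<close>

lemma trig_poly_real_polynomial:
  assumes "real_polynomial_function p"
  shows "trig_poly (\<lambda>x::real^'d. complex_of_real (p (torus_embed x)))"
  using assms
proof (induction p rule: real_polynomial_function.induct)
  case (linear f)
  have tp: "trig_poly (\<lambda>x::real^'d. complex_of_real (cos (2 * pi * x $ i)))"
    "trig_poly (\<lambda>x::real^'d. complex_of_real (sin (2 * pi * x $ i)))" for i
  proof -
    let ?e = "fourier_mode (axis i 1) :: real^'d \<Rightarrow> complex" and ?f = "fourier_mode (- axis i 1) :: real^'d \<Rightarrow> complex"
    have "(\<lambda>x::real^'d. complex_of_real (cos (2 * pi * x $ i))) = (\<lambda>x. 1 / 2 * (?e x + ?f x))"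
      "(\<lambda>x::real^'d. complex_of_real (sin (2 * pi * x $ i))) = (\<lambda>x. (- \<i> / 2) * (?e x + (- 1) * ?f x))"
      by (auto simp: fun_eq_iff fourier_mode_def lattice_vec_axis complex_eq_iff)
    then show "trig_poly (\<lambda>x::real^'d. complex_of_real (cos (2 * pi * x $ i)))"
      "trig_poly (\<lambda>x::real^'d. complex_of_real (sin (2 * pi * x $ i)))"
      by (simp_all only:) (intro trig_poly.intros)+
  qed
  interpret bounded_linear f by fact
  have eq: "complex_of_real (f (torus_embed x)) = (\<Sum>i\<in>UNIV. of_real (f (axis i 1)) * of_real (cos (2 * pi * x $ i)) +
      of_real (f (axis i \<i>)) * of_real (sin (2 * pi * x $ i)))" for x :: "real^'d"
  proof -
    have "torus_embed x = (\<Sum>i\<in>UNIV. cos (2 * pi * x $ i) *\<^sub>R axis i 1 + sin (2 * pi * x $ i) *\<^sub>R axis i \<i>)"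
      by (auto simp: vec_eq_iff torus_embed_def axis_def if_distrib complex_eq_iff sum.distrib cong: if_cong)
    then show ?thesis by (simp add: sum add scaleR mult.commute)
  qed
  show ?case unfolding eq by (intro trig_poly_sum trig_poly.add trig_poly.cmult tp)
next
  case (const c)
  show ?case by (rule trig_poly_const)
next
  case (add f g)
  then show ?case using trig_poly.add by force
next
  case (mult f g)
  then show ?case using trig_poly_mult by force
qed

text \<open>A continuous map from a compact space to a Hausdorff space is closed, hence a quotient
  map onto its image.\<close>

lemma continuous_on_factor:
  fixes E :: "'a::topological_space \<Rightarrow> 'b::t2_space" and G :: "'b \<Rightarrow> 'c::topological_space"
  assumes "compact K" "continuous_on K E" "continuous_on K (\<lambda>x. G (E x))"
  shows "continuous_on (E ` K) G"
proof -
  have cl: "closed (E ` K)" using assms by (intro compact_imp_closed compact_continuous_image)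
  show ?thesis unfolding continuous_on_closed_vimage[OF cl]
  proof (intro allI impI)
    fix B :: "'c set" assume B: "closed B"
    have "closedin (top_of_set K) (K \<inter> (\<lambda>x. G (E x)) -` B)"
      using assms(3) B by (rule continuous_closedin_preimage)
    then have "compact (K \<inter> (\<lambda>x. G (E x)) -` B)" using assms(1) closedin_compact by blast
    then have "compact (E ` (K \<inter> (\<lambda>x. G (E x)) -` B))"
      by (intro compact_continuous_image continuous_on_subset[OF assms(2)]) auto
    moreover have "E ` (K \<inter> (\<lambda>x. G (E x)) -` B) = G -` B \<inter> E ` K" by auto
    ultimately show "closed (G -` B \<inter> E ` K)" by (metis compact_imp_closed)
  qed
qed

lemma torus_embed_eq_imp:
  assumes "torus_embed x = torus_embed y"
  shows "\<exists>k. x = y + lattice_vec k"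
proof -
  have "\<exists>n::int. x $ i = y $ i + n" for i
  proof -
    have "cis (2 * pi * x $ i) = cis (2 * pi * y $ i)" using assms by (simp add: torus_embed_def vec_eq_iff)
    then have "sin (2 * pi * x $ i) = sin (2 * pi * y $ i) \<and> cos (2 * pi * x $ i) = cos (2 * pi * y $ i)"
      by (metis cis.sel)
    then obtain n :: int where "2 * pi * x $ i = 2 * pi * y $ i + 2 * pi * n"
      unfolding sin_cos_eq_iff by blast
    then have "2 * pi * x $ i = 2 * pi * (y $ i + n)" by (simp add: distrib_left)
    then show ?thesis by auto
  qed
  then obtain n :: "'a \<Rightarrow> int" where "\<And>i. x $ i = y $ i + n i" by metis
  then show ?thesis by (intro exI[of _ "\<chi> i. n i"]) (simp add: vec_eq_iff)
qed

lemma trig_poly_dense_real: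
  fixes f :: "real^'d \<Rightarrow> real"
  assumes "torus_smooth f" "e > 0"
  shows "\<exists>p. trig_poly p \<and> (\<forall>x. norm (complex_of_real (f x) - p x) < e)"
proof -
  \<comment> \<open>The function on the embedded torus whose pullback is \<open>f\<close>. The
    choice of the preimage does not matter, since two preimages differ by a lattice vector.\<close>
  define G where "G = (\<lambda>z. f (SOME x. torus_embed x = z))"
  have G: "G (torus_embed x) = f x" for x
  proof -
    have "torus_embed (SOME y. torus_embed y = torus_embed x) = torus_embed x" by (rule someI) (rule refl)
    then obtain k where "(SOME y. torus_embed y = torus_embed x) = x + lattice_vec k" using torus_embed_eq_imp by blast
    then show ?thesis using assms by (simp add: G_def torus_smooth_iff periodic_on_def)
  qed
  have K: "compact (torus_cell :: (real^'d) set)" by (simp add: torus_cell_def)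
  have E: "continuous_on torus_cell (torus_embed :: real^'d \<Rightarrow> _)"
    unfolding torus_embed_def cis_conv_exp by (intro continuous_intros)
  have "continuous_on (torus_embed ` torus_cell) G"
    by (rule continuous_on_factor[OF K E]) (simp add: G torus_smooth_continuous assms)
  then obtain p where p: "real_polynomial_function p" "\<And>z. z \<in> torus_embed ` torus_cell \<Longrightarrow> \<bar>G z - p z\<bar> < e"
    using Stone_Weierstrass_real_polynomial_function[OF compact_continuous_image[OF E K], of G e] assms(2) by blast
  have "norm (complex_of_real (f x) - complex_of_real (p (torus_embed x))) < e" for x
  proof -
    let ?y = "x - lattice_vec (floor_vec x)"
    have "torus_embed ?y = torus_embed x"
    proof -
      have "cis (2 * pi * (x $ i - of_int n)) = cis (2 * pi * x $ i)" for i and n :: int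
      proof -
        have "cis (2 * pi * of_int n) = 1" by (metis cis_multiple_2pi Ints_of_int)
        then show ?thesis by (simp add: right_diff_distrib cis_divide[symmetric])
      qed
      then show ?thesis by (simp add: torus_embed_def vec_eq_iff)
    qed
    moreover have y: "?y \<in> torus_cell" using half_cell_frac half_cell_subset by blast
    ultimately have "\<bar>G (torus_embed x) - p (torus_embed x)\<bar> < e" using p(2)[OF imageI[OF y]] by simp
    then show ?thesis by (simp add: G of_real_diff[symmetric] del: of_real_diff)
  qed
  then show ?thesis using trig_poly_real_polynomial[OF p(1)] by blast
qed

text \<open>\<open>g\<close> is orthogonal to every trigonometric polynomial r, so <g, g> = <g, g -
  r>, and r may be chosen uniformly close to \<open>g\<close>, with real and imaginary part
  approximated separately.\<close>

lemma fourier_coeff_eq_0_imp: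
  assumes g: "torus_smooth g" and 0: "\<And>k. fourier_coeff g k = 0"
  shows "g x = 0"
proof (rule torus_inner_self_eq_0[OF g])
  obtain B where B: "B > 0" "\<And>x. norm (g x) \<le> B" using torus_smooth_bounded[OF g] by blast
  have "norm (torus_inner g g) \<le> e" if "e > 0" for e
  proof -
    define e' where "e' = e / (2 * B)"
    have e': "e' > 0" using that B by (simp add: e'_def)
    obtain p where p: "trig_poly p" "\<And>x. norm (complex_of_real (Re (g x)) - p x) < e'"
      using trig_poly_dense_real[OF torus_smooth_linear[OF bounded_linear_Re g] e'] by blast
    obtain q where q: "trig_poly q" "\<And>x. norm (complex_of_real (Im (g x)) - q x) < e'"
      using trig_poly_dense_real[OF torus_smooth_linear[OF bounded_linear_Im g] e'] by blast
    define r where "r = (\<lambda>x. p x + \<i> * q x)"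
    have r: "trig_poly r" unfolding r_def by (intro trig_poly.intros p q)
    have d: "norm (g x - r x) \<le> e / B" for x
    proof -
      have "g x - r x = (of_real (Re (g x)) - p x) + \<i> * (of_real (Im (g x)) - q x)"
        unfolding r_def by (subst complex_eq[of "g x"]) (simp add: algebra_simps)
      also have "norm \<dots> \<le> e' + e'"
        using p(2)[of x] q(2)[of x] by (intro norm_triangle_le add_mono) (auto simp: norm_mult)
      also have "\<dots> = e / B" by (simp add: e'_def)
      finally show ?thesis .
    qed
    have sr: "torus_smooth r" using r by (rule trig_poly_smooth)
    have i: "integrable torus_measure (\<lambda>x. g x * cnj (g x))" "integrable torus_measure (\<lambda>x. g x * cnj (r x))"
      by (intro torus_smooth_integrable torus_smooth_mult torus_smooth_cnj g sr)+
    have "torus_inner g g = torus_inner g g - torus_inner g r" 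
      using trig_poly_orthogonal[OF g 0 r] by simp
    also have "\<dots> = integral\<^sup>L torus_measure (\<lambda>x. g x * cnj (g x - r x))"
      using i by (simp add: torus_inner_def torus_integral_eq right_diff_distrib)
    also have "norm \<dots> \<le> B * (e / B)"
    proof (rule torus_integral_bound)
      show "norm (g x * cnj (g x - r x)) \<le> B * (e / B)" for x
        unfolding norm_mult complex_mod_cnj using B d by (intro mult_mono) auto
      show "(\<lambda>x. g x * cnj (g x - r x)) \<in> borel_measurable torus_measure"
        by (intro continuous_torus_measurable continuous_intros torus_smooth_continuous g sr)
    qed
    finally show ?thesis using B by simp
  qed
  then show "torus_inner g g = 0" using field_le_epsilon[of "norm (torus_inner g g)" 0] by simp
qed

text \<open>Both sides are smooth with the same Fourier coefficients, so completeness of the modes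
  applies to their difference.\<close>

lemma fourier_inversion:
  assumes "torus_smooth f" shows "fseries (fourier_coeff f) = f"
proof
  fix x
  let ?c = "fourier_coeff f"
  have r: "rapid ?c" by (rule rapid_fourier_coeff[OF assms])
  note s = torus_smooth_fseries[OF r]
  let ?g = "\<lambda>x. fseries ?c x + (- 1) * f x"
  have "?g x = 0"
  proof (rule fourier_coeff_eq_0_imp[where g = ?g])
    show "torus_smooth ?g" by (intro torus_smooth_add torus_smooth_cmult s assms)
    fix k
    have "integrable torus_measure (\<lambda>x. fseries ?c x * cnj (fourier_mode k x))" "integrable torus_measure (\<lambda>x. f x * cnj (fourier_mode k x))"
      by (intro torus_smooth_integrable torus_smooth_mult torus_smooth_cnj torus_smooth_fourier_mode s assms)+
    then show "fourier_coeff ?g k = 0"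
      using fourier_coeff_fseries[OF r, of k] by (simp add: fourier_coeff_eq left_diff_distrib)
  qed
  then show "fseries ?c x = f x" by simp
qed


section \<open>The Matern symbol and the adjoint of its operator\<close>

locale matern =
  fixes \<kappa> :: real and m :: "real^'d \<Rightarrow> real"
  assumes m_smooth: "torus_smooth m" and kappa_pos: "\<kappa> > 0"
begin

abbreviation sym :: "int^'d \<Rightarrow> real^'d \<Rightarrow> complex" where
  "sym k x \<equiv> matern_symbol \<kappa> m x k"

text \<open>The Fourier coefficient at \<open>k\<close> of the adjoint operator applied to \<phi>.
  The symbol is taken at the same frequency \<open>k\<close> and needs no conjugation because it is
  real.\<close>

definition coef :: "(real^'d \<Rightarrow> complex) \<Rightarrow> int^'d \<Rightarrow> complex" where
  "coef \<phi> k = fourier_coeff (\<lambda>x. sym k x * \<phi> x) k"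

lemma norm_lattice_vec_ge: "real (inorm k) \<le> norm (lattice_vec (k::int^'d))"
proof -
  obtain i where i: "\<bar>k $ i\<bar> = int (inorm k)" by (rule inorm_attained)
  have "real (inorm k) = \<bar>lattice_vec k $ i\<bar>" using i by (metis lattice_vec_nth of_int_abs of_int_of_nat_eq)
  then show ?thesis using component_le_norm_cart by metis
qed

lemma norm_lattice_vec_le: "norm (lattice_vec (k::int^'d)) \<le> real CARD('d) * real (inorm k)"
proof -
  have "norm (lattice_vec k) \<le> (\<Sum>i\<in>UNIV. \<bar>lattice_vec k $ i\<bar>)" by (rule norm_le_l1_cart)
  also have "\<dots> \<le> (\<Sum>i\<in>(UNIV :: 'd set). real (inorm k))"
  proof (rule sum_mono)
    fix i
    have "real_of_int \<bar>k $ i\<bar> \<le> real_of_int (int (inorm k))" by (intro of_int_le_iff[THEN iffD2] inorm_ge)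
    then show "\<bar>lattice_vec k $ i\<bar> \<le> real (inorm k)" by simp
  qed
  finally show ?thesis by simp
qed

lemma lambda_pos: "matern_lambda \<kappa> k > 0"
  unfolding matern_lambda_def using kappa_pos by (intro real_sqrt_gt_zero add_pos_nonneg) auto

lemma lambda_bounds: "\<exists>c C. 0 < c \<and> 0 < C \<and> (\<forall>k::int^'d. c * jap k \<le> matern_lambda \<kappa> k \<and> matern_lambda \<kappa> k \<le> C * jap k)"
proof (intro exI conjI allI)
  \<comment> \<open>At k = 0 the lower bound comes from \<open>\<kappa>\<close>, elsewhere from 2 pi
    |k|, which is at least \<open>1 + inorm k\<close>.\<close>
  let ?c = "min \<kappa> 1" and ?C = "\<kappa> + 2 * pi * real CARD('d)"
  show "0 < ?c" "0 < ?C" using kappa_pos by (auto intro!: add_pos_nonneg)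
  fix k :: "int^'d"
  let ?l = "norm (lattice_vec k)"
  have k1: "\<kappa> \<le> matern_lambda \<kappa> k"
    unfolding matern_lambda_def using kappa_pos by (intro real_le_rsqrt) auto
  have k2: "2 * pi * ?l \<le> matern_lambda \<kappa> k"
    unfolding matern_lambda_def by (intro real_le_rsqrt) (auto simp: power_mult_distrib)
  show "?c * jap k \<le> matern_lambda \<kappa> k"
  proof (cases "inorm k = 0")
    case True then show ?thesis using k1 by (simp add: jap_def)
  next
    case False
    have "?c * jap k \<le> 1 * jap k" by (intro mult_right_mono) auto
    also have "\<dots> \<le> 2 * real (inorm k)" using False by (simp add: jap_def)
    also have "\<dots> \<le> 2 * pi * real (inorm k)" using pi_gt3 by (intro mult_right_mono) auto
    also have "\<dots> \<le> 2 * pi * ?l" using norm_lattice_vec_ge[of k] by (intro mult_left_mono) auto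
    finally show ?thesis using k2 by linarith
  qed
  have "matern_lambda \<kappa> k \<le> \<kappa> + 2 * pi * ?l"
    unfolding matern_lambda_def using kappa_pos
    by (intro real_le_lsqrt) (auto simp: power2_sum power_mult_distrib intro!: add_nonneg_nonneg)
  also have "\<dots> \<le> \<kappa> * jap k + 2 * pi * (real CARD('d) * jap k)"
    using kappa_pos norm_lattice_vec_le[of k] jap_ge_1[of k]
    by (intro add_mono mult_left_mono) (auto simp: jap_def algebra_simps intro: order.trans)
  finally show "matern_lambda \<kappa> k \<le> ?C * jap k" by (simp add: algebra_simps)
qed

text \<open>From ln y = 2 ln (sqrt y) <= 2 (sqrt y - 1). Half a power is what later leaves a net
  gain in each integration by parts.\<close>

lemma ln_lambda_bound: "\<exists>L\<ge>1. \<forall>k::int^'d. 1 + \<bar>ln (matern_lambda \<kappa> k)\<bar> \<le> L * sqrt (jap k)"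
proof -
  obtain c C where c: "0 < c" "0 < C" "\<And>k::int^'d. c * jap k \<le> matern_lambda \<kappa> k" "\<And>k::int^'d. matern_lambda \<kappa> k \<le> C * jap k"
    using lambda_bounds by blast
  show ?thesis
  proof (intro exI[of _ "3 + \<bar>ln c\<bar> + \<bar>ln C\<bar>"] conjI allI)
    fix k :: "int^'d"
    have s: "1 \<le> sqrt (jap k)" using jap_ge_1[of k] by simp
    have "ln (jap k) = 2 * ln (sqrt (jap k))" by (simp add: ln_sqrt)
    also have "\<dots> \<le> 2 * (sqrt (jap k) - 1)" using s by (intro mult_left_mono ln_le_minus_one) auto
    finally have lj: "ln (jap k) \<le> 2 * sqrt (jap k)" "0 \<le> ln (jap k)" using jap_ge_1[of k] by auto
    have "ln (c * jap k) \<le> ln (matern_lambda \<kappa> k)" using c lambda_pos[of k] by (subst ln_le_cancel_iff) auto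
    moreover have "ln (matern_lambda \<kappa> k) \<le> ln (C * jap k)" using c lambda_pos[of k] by (subst ln_le_cancel_iff) auto
    ultimately have "\<bar>ln (matern_lambda \<kappa> k)\<bar> \<le> \<bar>ln c\<bar> + \<bar>ln C\<bar> + 2 * sqrt (jap k)"
    proof -
      have "ln (c * jap k) = ln c + ln (jap k)" "ln (C * jap k) = ln C + ln (jap k)"
        using c(1,2) by (auto intro!: ln_mult_pos)
      moreover assume "ln (c * jap k) \<le> ln (matern_lambda \<kappa> k)" "ln (matern_lambda \<kappa> k) \<le> ln (C * jap k)"
      ultimately show ?thesis using lj by linarith
    qed
    also have "1 + \<dots> \<le> sqrt (jap k) + (\<bar>ln c\<bar> * sqrt (jap k) + \<bar>ln C\<bar> * sqrt (jap k)) + 2 * sqrt (jap k)"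
      using s mult_left_mono[OF s, of "\<bar>ln c\<bar>"] mult_left_mono[OF s, of "\<bar>ln C\<bar>"] by linarith
    finally show "1 + \<bar>ln (matern_lambda \<kappa> k)\<bar> \<le> (3 + \<bar>ln c\<bar> + \<bar>ln C\<bar>) * sqrt (jap k)" by (simp add: algebra_simps)
  qed auto
qed

lemma m_bounded: "\<exists>N::nat. \<forall>x. \<bar>m x\<bar> \<le> real N"
proof -
  obtain B where "\<And>x. norm (m x) \<le> B" using torus_smooth_bounded[OF m_smooth] by blast
  then show ?thesis using real_arch_simple[of B] by (metis order.trans real_norm_def)
qed

lemma norm_sym: "norm (sym k x) = matern_lambda \<kappa> k powr (- m x)"
  by (simp add: matern_symbol_def)

lemma sym_exp: "sym k x = exp (complex_of_real (- ln (matern_lambda \<kappa> k)) * complex_of_real (m x))"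
  using lambda_pos[of k] by (simp add: matern_symbol_def powr_def exp_of_real[symmetric] mult.commute)

text \<open>The ratio of \<open>matern_lambda \<kappa> k\<close> to \<open>jap k\<close> stays
  between two positive constants, and the exponent m(x) is bounded, so the power of the ratio is
  bounded above and below uniformly in \<open>k\<close> and \<open>x\<close>.\<close>

lemma norm_sym_bounds:
  "\<exists>C>0. \<forall>k x. norm (sym k x) \<le> C * jap k powr (- m x) \<and> jap k powr (- m x) \<le> C * norm (sym k x)"
proof -
  obtain c C where c: "0 < c" "0 < C" "\<And>k::int^'d. c * jap k \<le> matern_lambda \<kappa> k" "\<And>k::int^'d. matern_lambda \<kappa> k \<le> C * jap k"
    using lambda_bounds by blast
  obtain N :: nat where N: "\<And>x. \<bar>m x\<bar> \<le> real N" using m_bounded by blast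
  let ?K = "\<bar>ln c\<bar> + \<bar>ln C\<bar>"
  show ?thesis
  proof (intro exI[of _ "exp (N * ?K)"] conjI allI)
    fix k :: "int^'d" and x :: "real^'d"
    define r where "r = matern_lambda \<kappa> k / jap k"
    have r: "r > 0" "matern_lambda \<kappa> k = r * jap k" using lambda_pos[of k] jap_pos[of k] by (auto simp: r_def less_imp_neq[symmetric])
    have "c \<le> r" "r \<le> C" using c by (auto simp: r_def field_simps)
    then have "ln c \<le> ln r" "ln r \<le> ln C" using c r by auto
    then have "\<bar>ln r\<bar> \<le> ?K" by linarith
    then have "\<bar>m x * ln r\<bar> \<le> N * ?K" unfolding abs_mult using N by (intro mult_mono) auto
    then have e: "- m x * ln r \<le> N * ?K" "m x * ln r \<le> N * ?K" by auto
    have n: "norm (sym k x) = exp (- m x * ln r) * jap k powr (- m x)"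
      unfolding norm_sym r(2) using r(1) by (simp add: powr_mult powr_def[of r])
    show "norm (sym k x) \<le> exp (N * ?K) * jap k powr (- m x)"
      unfolding n using e by (intro mult_right_mono) auto
    have "jap k powr (- m x) = exp (m x * ln r) * norm (sym k x)"
      unfolding n by (simp add: mult.assoc[symmetric] exp_add[symmetric])
    also have "\<dots> \<le> exp (N * ?K) * norm (sym k x)" using e by (intro mult_right_mono) auto
    finally show "jap k powr (- m x) \<le> exp (N * ?K) * norm (sym k x)" .
  qed simp
qed

lemma sym_poly_bound: "\<exists>C N. C > 0 \<and> (\<forall>k x. norm (sym k x) \<le> C * jap k ^ N)"
proof -
  obtain C where C: "C > 0" "\<And>k x. norm (sym k x) \<le> C * jap k powr (- m x)" using norm_sym_bounds by blast
  obtain N :: nat where N: "\<And>x. \<bar>m x\<bar> \<le> real N" using m_bounded by blast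
  have "norm (sym k x) \<le> C * jap k ^ N" for k x
  proof -
    have "jap k powr (- m x) \<le> jap k powr N" using N[of x] jap_ge_1[of k] by (intro powr_mono) auto
    also have "\<dots> = jap k ^ N" by (simp add: powr_realpow)
    finally show ?thesis using C(2)[where k = k and x = x] C(1) by (meson mult_le_cancel_left_pos order.trans)
  qed
  with C show ?thesis by blast
qed

lemma torus_smooth_sym: "torus_smooth (sym k)"
  unfolding torus_smooth_iff
proof
  have s: "smooth (\<lambda>x. complex_of_real (m x))" using torus_smooth_of_real[OF m_smooth] by (simp add: torus_smooth_iff)
  show "smooth (sym k)" unfolding sym_exp by (intro smooth_exp smooth_cmult s)
  show "periodic_on UNIV (sym k)" using m_smooth by (simp add: periodic_on_def matern_symbol_def torus_smooth_iff)
qed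

text \<open>As a function of x the symbol is exp (- ln \<lambda>(k) m(x)), so each derivative costs
  at most a logarithm of the frequency, here absorbed by a square root. The factor
  \<open>norm (sym k x)\<close> at the same point preserves the variable order.\<close>

lemma pderivs_sym_bound:
  "\<exists>C>0. \<forall>\<alpha> k x. length \<alpha> \<le> n \<longrightarrow> norm (pderivs \<alpha> (sym k) x) \<le> C * sqrt (jap k) ^ n * norm (sym k x)"
proof -
  obtain L where L: "L \<ge> 1" "\<And>k::int^'d. 1 + \<bar>ln (matern_lambda \<kappa> k)\<bar> \<le> L * sqrt (jap k)" using ln_lambda_bound by blast
  have tm: "torus_smooth (\<lambda>x. complex_of_real (m x))" by (rule torus_smooth_of_real[OF m_smooth])
  then have s: "smooth (\<lambda>x. complex_of_real (m x))" by (simp add: torus_smooth_iff)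
  obtain A where A: "A \<ge> 0" "\<And>\<alpha> x. length \<alpha> \<le> n + 1 \<Longrightarrow> norm (pderivs \<alpha> (\<lambda>x. complex_of_real (m x)) x) \<le> A"
    using torus_smooth_pderivs_bounded[OF tm] by blast
  have "norm (pderivs \<alpha> (sym k) x) \<le> (2 ^ (n\<^sup>2) * ((1 + A) * L) ^ n) * sqrt (jap k) ^ n * norm (sym k x)"
    if l: "length \<alpha> \<le> n" for \<alpha> k x
  proof -
    let ?l = "complex_of_real (- ln (matern_lambda \<kappa> k))"
    let ?B = "(1 + A) * (L * sqrt (jap k))"
    have Ls: "1 \<le> L * sqrt (jap k)" using L(2)[of k] by linarith
    have B: "?B \<ge> 1" using A Ls mult_mono[of 1 "1 + A" 1 "L * sqrt (jap k)"] by simp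
    have "norm (pderivs \<alpha> (\<lambda>x. exp (?l * complex_of_real (m x))) x) \<le> 2 ^ (n\<^sup>2) * ?B ^ n * norm (exp (?l * complex_of_real (m x)))"
    proof (rule pderivs_exp_bound[OF _ B _ l])
      show "smooth (\<lambda>x. ?l * complex_of_real (m x))" by (intro smooth_cmult s)
      fix i :: 'd and \<beta> :: "'d list" assume "length \<beta> < n"
      then have "norm (pderivs (\<beta> @ [i]) (\<lambda>x. ?l * complex_of_real (m x)) x) \<le> \<bar>ln (matern_lambda \<kappa> k)\<bar> * A"
        unfolding pderivs_cmult[OF s] using A(2)[of "\<beta> @ [i]" x] by (simp add: norm_mult mult_left_mono)
      also have "\<dots> \<le> (L * sqrt (jap k)) * (1 + A)" using L(2)[of k] A(1) Ls by (intro mult_mono) auto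
      finally show "norm (pderivs \<beta> (pderiv_at i (\<lambda>x. ?l * complex_of_real (m x))) x) \<le> ?B"
        by (simp add: pderivs_snoc mult.commute)
    qed
    then show ?thesis unfolding sym_exp by (simp add: power_mult_distrib mult_ac)
  qed
  moreover have "2 ^ (n\<^sup>2) * ((1 + A) * L) ^ n > 0" using A L by simp
  ultimately show ?thesis by blast
qed

text \<open>Differentiating the symbol costs only powers of \<open>ln \<lambda>(k) = O(jap k ^ (1 / 2))\<close>, so that repeated
  integration by parts still gains half a power of the frequency in each step.\<close>

lemma coef_decay:
  "\<exists>N C. C \<ge> 0 \<and> (\<forall>\<phi> B k. torus_smooth \<phi> \<longrightarrow> (\<forall>\<alpha> x. length \<alpha> \<le> N \<longrightarrow> norm (pderivs \<alpha> \<phi> x) \<le> B) \<longrightarrow>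
      norm (coef \<phi> k) * jap k ^ q \<le> C * B)"
proof -
  obtain C0 M where C0: "C0 > 0" "\<And>k x. norm (sym k x) \<le> C0 * jap k ^ M" using sym_poly_bound by blast
  \<comment> \<open>Integrating by parts N times gains \<open>jap k ^ N\<close>. Derivatives of the
    symbol cost half of it, \<open>jap k ^ (q + M)\<close>, and the symbol itself
    \<open>jap k ^ M\<close>, so that exactly \<open>jap k ^ q\<close> is left.\<close>
  define N where "N = 2 * (q + M)"
  obtain C1 where C1: "C1 > 0" "\<And>\<alpha> k x. length \<alpha> \<le> N \<Longrightarrow> norm (pderivs \<alpha> (sym k) x) \<le> C1 * sqrt (jap k) ^ N * norm (sym k x)"
    using pderivs_sym_bound by blast
  have "norm (coef \<phi> k) * jap k ^ q \<le> (2 ^ N * (2 ^ N * (C1 * C0))) * B"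
    if \<phi>: "torus_smooth \<phi>" and B: "\<And>\<alpha> x. length \<alpha> \<le> N \<Longrightarrow> norm (pderivs \<alpha> \<phi> x) \<le> B" for \<phi> B k
  proof -
    have s: "smooth (sym k)" "smooth \<phi>" using \<phi> torus_smooth_sym by (auto simp: torus_smooth_iff)
    let ?A = "C1 * C0 * jap k ^ (q + 2 * M)"
    have sq: "sqrt (jap k) ^ N = jap k ^ (q + M)" by (simp only: N_def power_mult) simp
    have A: "norm (pderivs \<alpha> (sym k) x) \<le> ?A" if "length \<alpha> \<le> N" for \<alpha> x
    proof -
      have "norm (pderivs \<alpha> (sym k) x) \<le> C1 * jap k ^ (q + M) * norm (sym k x)" using C1(2)[OF that, where k = k and x = x] by (simp add: sq)
      also have "\<dots> \<le> C1 * jap k ^ (q + M) * (C0 * jap k ^ M)" using C0 C1(1) by (intro mult_left_mono) auto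
      also have "\<dots> = C1 * C0 * (jap k ^ (q + M) * jap k ^ M)" by (simp only: mult_ac)
      also have "jap k ^ (q + M) * jap k ^ M = jap k ^ (q + 2 * M)" by (simp add: power_add[symmetric] mult_2 add_ac)
      finally show ?thesis .
    qed
    have "norm (fourier_coeff (\<lambda>x. sym k x * \<phi> x) k) * jap k ^ N \<le> 2 ^ N * (2 ^ N * ?A * B)"
    proof (rule fourier_coeff_decay)
      show "torus_smooth (\<lambda>x. sym k x * \<phi> x)" by (intro torus_smooth_mult torus_smooth_sym \<phi>)
      show "norm (pderivs \<alpha> (\<lambda>x. sym k x * \<phi> x) x) \<le> 2 ^ N * ?A * B" if "length \<alpha> \<le> N" for \<alpha> x
        using C1 C0 by (intro pderivs_mult_bound s A B that) auto
    qed
    moreover have "jap k ^ N = jap k ^ q * jap k ^ (q + 2 * M)" by (simp add: N_def power_add[symmetric])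
    ultimately have "(norm (coef \<phi> k) * jap k ^ q) * jap k ^ (q + 2 * M) \<le> ((2 ^ N * (2 ^ N * (C1 * C0))) * B) * jap k ^ (q + 2 * M)"
      by (simp add: coef_def mult_ac)
    then show ?thesis by (simp add: mult_le_cancel_right_pos del: power_add)
  qed
  then show ?thesis using C0 C1 by (intro exI[of _ N] exI[of _ "2 ^ N * (2 ^ N * (C1 * C0))"]) auto
qed

lemma rapid_coef: 
  assumes "torus_smooth \<phi>" shows "rapid (coef \<phi>)"
  unfolding rapid_def
proof
  fix q
  obtain N C where C: "\<And>\<phi> B k. torus_smooth \<phi> \<Longrightarrow> (\<And>\<alpha> x. length \<alpha> \<le> N \<Longrightarrow> norm (pderivs \<alpha> \<phi> x) \<le> B) \<Longrightarrow>
      norm (coef \<phi> k) * jap k ^ q \<le> C * B" using coef_decay[of q] by metis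
  obtain A where A: "\<And>\<alpha> x. length \<alpha> \<le> N \<Longrightarrow> norm (pderivs \<alpha> \<phi> x) \<le> A"
    using torus_smooth_pderivs_bounded[OF assms] by blast
  show "\<exists>D. \<forall>k. norm (coef \<phi> k) * jap k ^ q \<le> D" using C[OF assms A] by blast
qed

lemma coef_eq: "coef \<phi> k = integral\<^sup>L torus_measure (\<lambda>x. sym k x * \<phi> x * cnj (fourier_mode k x))"
  by (simp add: coef_def fourier_coeff_eq)

lemma coef_linear:
  assumes "torus_smooth \<phi>" "torus_smooth \<psi>"
  shows "coef (\<lambda>x. a * \<phi> x + b * \<psi> x) k = a * coef \<phi> k + b * coef \<psi> k"
proof -
  have i: "integrable torus_measure (\<lambda>x. a * (sym k x * \<phi> x * cnj (fourier_mode k x)))"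
    "integrable torus_measure (\<lambda>x. b * (sym k x * \<psi> x * cnj (fourier_mode k x)))"
    by (intro torus_smooth_integrable torus_smooth_cmult torus_smooth_mult torus_smooth_cnj torus_smooth_sym torus_smooth_fourier_mode assms)+
  have "(\<lambda>x. sym k x * (a * \<phi> x + b * \<psi> x) * cnj (fourier_mode k x)) =
      (\<lambda>x. a * (sym k x * \<phi> x * cnj (fourier_mode k x)) + b * (sym k x * \<psi> x * cnj (fourier_mode k x)))"
    by (auto simp: algebra_simps)
  then show ?thesis using Bochner_Integration.integral_add[OF i] by (simp add: coef_eq)
qed

text \<open>The polynomially growing symbol is dominated by the rapid decay of the coefficients of
  \<open>f\<close>, so the series may be integrated termwise. The real symbol then moves to the side
  of \<phi>, and Parseval identifies the result.\<close>

lemma torus_inner_Op: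
  assumes f: "torus_smooth f" and \<phi>: "torus_smooth \<phi>"
  shows "torus_inner (torus_Op (matern_symbol \<kappa> m) f) \<phi> = torus_inner f (fseries (coef \<phi>))"
proof -
  let ?a = "\<lambda>k x. sym k x * fourier_coeff f k * fourier_mode k x"
  obtain C0 M where C0: "C0 > 0" "\<And>k x. norm (sym k x) \<le> C0 * jap k ^ M" using sym_poly_bound by blast
  obtain C1 where C1: "\<And>k. norm (fourier_coeff f k) * jap k ^ (M + (CARD('d) + 1)) \<le> C1"
    using rapid_fourier_coeff[OF f, unfolded rapid_def, rule_format, of "M + (CARD('d) + 1)"] by blast
  have "0 \<le> norm (fourier_coeff f 0) * jap 0 ^ (M + (CARD('d) + 1))" by (intro mult_nonneg_nonneg zero_le_power) auto
  then have C10: "C1 \<ge> 0" using C1 by (rule order.trans)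
  have a: "norm (?a k x) * jap k ^ (CARD('d) + 1) \<le> C0 * C1" for k x
  proof -
    have "norm (?a k x) * jap k ^ (CARD('d) + 1) \<le> (C0 * jap k ^ M) * norm (fourier_coeff f k) * jap k ^ (CARD('d) + 1)"
      unfolding norm_mult norm_fourier_mode mult_1_right using C0 by (intro mult_right_mono) auto
    also have "\<dots> = C0 * (norm (fourier_coeff f k) * jap k ^ (M + (CARD('d) + 1)))" by (simp add: power_add mult_ac)
    also have "\<dots> \<le> C0 * C1" using C0 C1 by (intro mult_left_mono) auto
    finally show ?thesis .
  qed
  let ?D = "4 ^ CARD('d) * (C0 * C1)"
  have bl: "norm (\<Sum>k\<in>shell j. ?a k x) \<le> ?D * (1 / 2) ^ j" for j x
    using norm_sum[of "\<lambda>k. ?a k x" "shell j"] shell_sum_bound[of j "\<lambda>k. ?a k x" "C0 * C1"] a C0 C10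
    by (meson mult_nonneg_nonneg order.trans less_imp_le)
  have Op: "(\<lambda>j. \<Sum>k\<in>shell j. ?a k x) sums torus_Op (matern_symbol \<kappa> m) f x" for x
    unfolding torus_Op_def by (rule shells_sums_infsum) (rule a)
  obtain B where B: "B > 0" "\<And>x. norm (\<phi> x) \<le> B" using torus_smooth_bounded[OF \<phi>] by blast
  let ?q = "\<lambda>j x. (\<Sum>k\<in>shell j. ?a k x) * cnj (\<phi> x)"
  have sm: "torus_smooth (?a k)" for k
    by (intro torus_smooth_mult torus_smooth_const torus_smooth_sym torus_smooth_fourier_mode)
  have "(\<lambda>j. integral\<^sup>L torus_measure (?q j)) sums integral\<^sup>L torus_measure (\<lambda>x. \<Sum>j. ?q j x)"
  proof (rule torus_integral_suminf[where b = "\<lambda>j. (?D * (1 / 2) ^ j) * B"])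
    show "integrable torus_measure (?q j)" for j
      by (intro torus_smooth_integrable torus_smooth_mult[OF torus_smooth_sum torus_smooth_cnj] sm \<phi>)
    show "norm (?q j x) \<le> (?D * (1 / 2) ^ j) * B" for j x
      unfolding norm_mult complex_mod_cnj using B bl C0 C10 by (intro mult_mono) auto
    show "summable (\<lambda>j. (?D * (1 / 2) ^ j) * B)" by (intro summable_mult2 summable_mult summable_geometric) simp
  qed
  moreover have "(\<Sum>j. ?q j x) = torus_Op (matern_symbol \<kappa> m) f x * cnj (\<phi> x)" for x
    using sums_unique[OF sums_mult2[OF Op]] by simp
  moreover have "integral\<^sup>L torus_measure (?q j) = (\<Sum>k\<in>shell j. fourier_coeff f k * cnj (coef \<phi> k))" for j
  proof -
    let ?b = "\<lambda>k x. fourier_coeff f k * cnj (sym k x * \<phi> x * cnj (fourier_mode k x))"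
    have int: "integrable torus_measure (?b k)" for k
      by (intro torus_smooth_integrable torus_smooth_cmult torus_smooth_mult torus_smooth_cnj torus_smooth_sym torus_smooth_fourier_mode \<phi>)
    have "cnj (sym k x) = sym k x" for k x by (simp add: matern_symbol_def)
    then have "?q j = (\<lambda>x. \<Sum>k\<in>shell j. ?b k x)" by (auto simp: sum_distrib_left sum_distrib_right mult_ac)
    then have "integral\<^sup>L torus_measure (?q j) = (\<Sum>k\<in>shell j. integral\<^sup>L torus_measure (?b k))"
      using int by (simp only: Bochner_Integration.integral_sum)
    then show ?thesis
      by (simp only: integral_mult_right_zero Bochner_Integration.integral_cnj coef_eq[symmetric])
  qed
  ultimately have "(\<lambda>j. \<Sum>k\<in>shell j. fourier_coeff f k * cnj (coef \<phi> k)) sums torus_inner (torus_Op (matern_symbol \<kappa> m) f) \<phi>"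
    by (simp add: torus_inner_def torus_integral_eq)
  then show ?thesis using torus_inner_fseries[OF rapid_coef[OF \<phi>] f] sums_unique2 by blast
qed

text \<open>For uniqueness, the difference of two candidates is itself a test function; testing
  against it shows that its norm is zero.\<close>

lemma L2_adjoint_Op:
  assumes "\<phi> \<in> test_functions"
  shows "L2_adjoint (torus_Op (matern_symbol \<kappa> m)) \<phi> = fseries (coef \<phi>)"
  unfolding L2_adjoint_def
proof (rule the_equality)
  have \<phi>: "torus_smooth \<phi>" using assms by (simp add: test_functions_def)
  note s = torus_smooth_fseries[OF rapid_coef[OF \<phi>]]
  show "fseries (coef \<phi>) \<in> test_functions \<and> (\<forall>f\<in>test_functions.
      torus_inner (torus_Op (matern_symbol \<kappa> m) f) \<phi> = torus_inner f (fseries (coef \<phi>)))"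
    using s torus_inner_Op[OF _ \<phi>] by (simp add: test_functions_def)
  fix \<psi> assume \<psi>: "\<psi> \<in> test_functions \<and> (\<forall>f\<in>test_functions. torus_inner (torus_Op (matern_symbol \<kappa> m) f) \<phi> = torus_inner f \<psi>)"
  then have sp: "torus_smooth \<psi>" by (simp add: test_functions_def)
  let ?g = "\<lambda>x. \<psi> x + (- 1) * fseries (coef \<phi>) x"
  have sg: "torus_smooth ?g" by (intro torus_smooth_add torus_smooth_cmult s sp)
  have "torus_inner ?g \<psi> = torus_inner ?g (fseries (coef \<phi>))"
    using \<psi> sg torus_inner_Op[OF sg \<phi>] by (simp add: test_functions_def)
  moreover have "integrable torus_measure (\<lambda>x. ?g x * cnj (\<psi> x))" "integrable torus_measure (\<lambda>x. ?g x * cnj (fseries (coef \<phi>) x))"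
    by (intro torus_smooth_integrable torus_smooth_mult[OF sg] torus_smooth_cnj s sp)+
  ultimately have "torus_inner ?g ?g = 0"
    by (simp add: torus_inner_def torus_integral_eq right_diff_distrib)
  from torus_inner_self_eq_0[OF sg this] show "\<psi> = fseries (coef \<phi>)" by auto
qed

end


section \<open>Gaussian variables\<close>

text \<open>Linear combinations of noise values equal a noise value only almost surely, so
  Gaussianity has to be carried across such equalities.\<close>

lemma gaussian_rv_cong_AE:
  assumes "gaussian_rv M X" "Y \<in> borel_measurable M" "AE \<omega> in M. Y \<omega> = X \<omega>"
  shows "gaussian_rv M Y"
proof -
  have X: "X \<in> borel_measurable M" using assms(1) by (simp add: gaussian_rv_def)
  have "distr M lborel Y = distr M lborel X"
    by (rule distr_cong_AE) (use assms X in auto)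
  then have "distributed M lborel Y f" if "distributed M lborel X f" for f
    using that assms(2) unfolding distributed_def by simp
  moreover have "AE \<omega> in M. Y \<omega> = \<mu>" if "AE \<omega> in M. X \<omega> = \<mu>" for \<mu>
    using that assms(3) by eventually_elim simp
  ultimately show ?thesis
    using assms(1,2) unfolding gaussian_rv_def by blast
qed

context prob_space
begin

lemma gaussian_rv_char:
  assumes X: "gaussian_rv M X" and 0: "expectation X = 0"
  shows "(CLINT \<omega>|M. iexp (X \<omega>)) = complex_of_real (exp (- (expectation (\<lambda>\<omega>. (X \<omega>)\<^sup>2)) / 2))"
proof -
  have Xm [measurable]: "X \<in> borel_measurable M" using X by (simp add: gaussian_rv_def)
  from X consider \<mu> where "AE \<omega> in M. X \<omega> = \<mu>" | \<mu> \<sigma> where "\<sigma> > 0" "distributed M lborel X (normal_density \<mu> \<sigma>)"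
    unfolding gaussian_rv_def by blast
  then show ?thesis
  proof cases
    case 1
    have "expectation X = expectation (\<lambda>_. \<mu>)" by (rule integral_cong_AE) (use 1 in auto)
    then have ae: "AE \<omega> in M. X \<omega> = 0" using 1 0 by (simp add: prob_space)
    have "(CLINT \<omega>|M. iexp (X \<omega>)) = (CLINT \<omega>|M. 1)" by (rule integral_cong_AE) (use ae in auto)
    moreover have "expectation (\<lambda>\<omega>. (X \<omega>)\<^sup>2) = expectation (\<lambda>_. 0)" by (rule integral_cong_AE) (use ae in auto)
    ultimately show ?thesis by (simp add: prob_space)
  next
    case 2
    have \<mu>: "\<mu> = 0" using normal_distributed_expectation[OF 2] 0 by simp
    have var: "expectation (\<lambda>\<omega>. (X \<omega>)\<^sup>2) = \<sigma>\<^sup>2" using normal_distributed_variance[OF 2] 0 by simp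
    have "distributed M lborel (\<lambda>\<omega>. X \<omega> / \<sigma>) std_normal_density"
      using normal_standard_normal_convert[OF 2(1), of X \<mu>] 2(2) \<mu> by simp
    then have "distr M lborel (\<lambda>\<omega>. X \<omega> / \<sigma>) = std_normal_distribution" by (simp add: distributed_def)
    then have "char std_normal_distribution \<sigma> = char (distr M lborel (\<lambda>\<omega>. X \<omega> / \<sigma>)) \<sigma>" by simp
    also have "\<dots> = (CLINT \<omega>|M. iexp (\<sigma> * (X \<omega> / \<sigma>)))"
      unfolding char_def by (rule integral_distr) (simp_all, measurable)
    also have "\<dots> = (CLINT \<omega>|M. iexp (X \<omega>))" using 2(1) by simp
    finally show ?thesis by (simp add: char_std_normal_distribution var)
  qed
qed

text \<open>The factor is the double factorial (2 p - 1)!!. In the degenerate case the variable is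
  almost surely 0 because its mean is 0, and the identity holds with 0 ^ 0 = 1.\<close>

lemma gaussian_rv_moment:
  assumes X: "gaussian_rv M X" and 0: "expectation X = 0"
  shows "integrable M (\<lambda>\<omega>. X \<omega> ^ (2 * p)) \<and>
    expectation (\<lambda>\<omega>. X \<omega> ^ (2 * p)) = fact (2 * p) / (2 ^ p * fact p) * expectation (\<lambda>\<omega>. (X \<omega>)\<^sup>2) ^ p"
proof -
  have Xm [measurable]: "X \<in> borel_measurable M" using X by (simp add: gaussian_rv_def)
  from X consider \<mu> where "AE \<omega> in M. X \<omega> = \<mu>" | \<mu> \<sigma> where "\<sigma> > 0" "distributed M lborel X (normal_density \<mu> \<sigma>)"
    unfolding gaussian_rv_def by blast
  then show ?thesis
  proof cases
    case 1
    have "expectation X = expectation (\<lambda>_. \<mu>)" by (rule integral_cong_AE) (use 1 in auto)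
    then have ae: "AE \<omega> in M. X \<omega> = 0" using 1 0 by (simp add: prob_space)
    have "expectation (\<lambda>\<omega>. (X \<omega>)\<^sup>2) = expectation (\<lambda>_. 0)" by (rule integral_cong_AE) (use ae in auto)
    moreover have "expectation (\<lambda>\<omega>. X \<omega> ^ (2 * p)) = expectation (\<lambda>_. 0 ^ (2 * p))" by (rule integral_cong_AE) (use ae in auto)
    moreover have "integrable M (\<lambda>\<omega>. X \<omega> ^ (2 * p)) \<longleftrightarrow> integrable M (\<lambda>\<omega>. 0 ^ (2 * p) :: real)" by (rule integrable_cong_AE) (use ae in auto)
    ultimately show ?thesis by (cases p) (auto simp: prob_space)
  next
    case 2
    have \<mu>: "\<mu> = 0" using normal_distributed_expectation[OF 2] 0 by simp
    have var: "expectation (\<lambda>\<omega>. (X \<omega>)\<^sup>2) = \<sigma>\<^sup>2" using normal_distributed_variance[OF 2] 0 by simp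
    have b: "has_bochner_integral lborel (\<lambda>x. normal_density 0 \<sigma> x * x ^ (2 * p)) (fact (2 * p) / ((2 / \<sigma>\<^sup>2)^p * fact p))"
      using normal_moment_even[OF 2(1), of 0 p] by simp
    have "integrable M (\<lambda>\<omega>. X \<omega> ^ (2 * p))"
      using distributed_integrable[OF 2(2), of "\<lambda>x. x ^ (2 * p)"] b \<mu> by (simp add: has_bochner_integral_iff)
    moreover have "expectation (\<lambda>\<omega>. X \<omega> ^ (2 * p)) = fact (2 * p) / ((2 / \<sigma>\<^sup>2)^p * fact p)"
      using distributed_integral[OF 2(2), of "\<lambda>x. x ^ (2 * p)"] b \<mu> by (simp add: has_bochner_integral_iff)
    ultimately show ?thesis using 2(1) by (simp add: var power_divide)
  qed
qed

text \<open>The expectations are summable, so the sum of the whole sequence is almost surely finite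
  and bounds every term. This replaces the first Borel-Cantelli lemma throughout: a weight that
  decays geometrically is built into \<open>Y\<close>.\<close>

lemma AE_bounded_sequence:
  fixes Y :: "nat \<Rightarrow> 'a \<Rightarrow> real"
  assumes Y: "\<And>j. integrable M (Y j)" "\<And>j \<omega>. Y j \<omega> \<ge> 0" and b: "\<And>j. expectation (Y j) \<le> A * (1 / 2) ^ j"
  shows "AE \<omega> in M. \<exists>C>0. \<forall>j. Y j \<omega> \<le> C"
proof -
  have A: "A \<ge> 0" using order.trans[OF _ b[of 0]] Y(2) by simp
  have [measurable]: "Y j \<in> borel_measurable M" for j using Y(1) by auto
  have "(\<integral>\<^sup>+\<omega>. (\<Sum>j. ennreal (Y j \<omega>)) \<partial>M) = (\<Sum>j. \<integral>\<^sup>+\<omega>. ennreal (Y j \<omega>) \<partial>M)"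
    by (rule nn_integral_suminf) measurable
  also have "\<dots> = (\<Sum>j. ennreal (expectation (Y j)))"
    using Y by (simp add: nn_integral_eq_integral)
  also have "\<dots> \<le> (\<Sum>j. ennreal (A * (1 / 2) ^ j))"
    by (intro suminf_le ennreal_leI b) auto
  also have "\<dots> < \<top>"
    using A by (subst suminf_ennreal2) (auto intro!: summable_mult summable_geometric)
  finally have "(\<integral>\<^sup>+\<omega>. (\<Sum>j. ennreal (Y j \<omega>)) \<partial>M) \<noteq> \<infinity>" by simp
  then have "AE \<omega> in M. (\<Sum>j. ennreal (Y j \<omega>)) \<noteq> \<infinity>" by (intro nn_integral_PInf_AE) auto
  then show ?thesis
  proof eventually_elim
    fix \<omega> assume fin: "(\<Sum>j. ennreal (Y j \<omega>)) \<noteq> \<infinity>"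
    have "Y j \<omega> \<le> enn2real (\<Sum>j. ennreal (Y j \<omega>)) + 1" for j
    proof -
      have "ennreal (Y j \<omega>) \<le> (\<Sum>j. ennreal (Y j \<omega>))"
        using sum_le_suminf[of "\<lambda>j. ennreal (Y j \<omega>)" "{j}"] by simp
      then have "enn2real (ennreal (Y j \<omega>)) \<le> enn2real (\<Sum>j. ennreal (Y j \<omega>))"
        using fin by (intro enn2real_mono) (auto simp: less_top)
      then show ?thesis using Y(2)[of j \<omega>] by simp
    qed
    moreover have "enn2real (\<Sum>j. ennreal (Y j \<omega>)) + 1 > 0" by (simp add: add_nonneg_pos)
    ultimately show "\<exists>C>0. \<forall>j. Y j \<omega> \<le> C" by blast
  qed
qed

end

section \<open>Laplace transform of a sum of squares of jointly Gaussian variables\<close>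

definition psd_form :: "((nat \<Rightarrow> real) \<Rightarrow> (nat \<Rightarrow> real) \<Rightarrow> real) \<Rightarrow> bool" where
  "psd_form Q \<longleftrightarrow> (\<forall>c d. Q c d = Q d c) \<and> (\<forall>a c d e. Q (\<lambda>i. c i + a * d i) e = Q c e + a * Q d e) \<and> (\<forall>c. 0 \<le> Q c c)"

lemma psd_formD:
  assumes "psd_form Q"
  shows "Q c d = Q d c" "Q (\<lambda>i. c i + a * d i) e = Q c e + a * Q d e" "Q e (\<lambda>i. c i + a * d i) = Q e c + a * Q e d" "0 \<le> Q c c"
  using assms unfolding psd_form_def by metis+

text \<open>The forms are covariances of linear combinations and may be degenerate. If Q d d = 0,
  the nonnegative quadratic in \<open>a\<close> is affine, which forces its slope to vanish;
  otherwise it is evaluated at its minimum.\<close>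

lemma psd_form_cauchy_schwarz:
  assumes Q: "psd_form Q"
  shows "(Q c d)\<^sup>2 \<le> Q c c * Q d d"
proof -
  have q: "0 \<le> Q c c + 2 * a * Q c d + a\<^sup>2 * Q d d" for a
  proof -
    have "0 \<le> Q (\<lambda>i. c i + a * d i) (\<lambda>i. c i + a * d i)" by (rule psd_formD(4)[OF Q])
    also have "\<dots> = Q c c + 2 * a * Q c d + a\<^sup>2 * Q d d"
      unfolding psd_formD(2)[OF Q] psd_formD(3)[OF Q] psd_formD(1)[OF Q, of d c] by (simp add: algebra_simps power2_eq_square)
    finally show ?thesis .
  qed
  show ?thesis
  proof (cases "Q d d = 0")
    case True
    have "Q c d = 0"
    proof (rule ccontr)
      assume n: "Q c d \<noteq> 0"
      have "2 * (- (Q c c + 1) / (2 * Q c d)) * Q c d = - (Q c c + 1)" using n by (simp add: field_simps)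
      then show False using q[of "- (Q c c + 1) / (2 * Q c d)"] True by simp
    qed
    then show ?thesis using True by simp
  next
    case False
    then have d: "Q d d > 0" using psd_formD(4)[OF Q, of d] by simp
    have "0 \<le> (Q c c + 2 * (- Q c d / Q d d) * Q c d + (- Q c d / Q d d)\<^sup>2 * Q d d) * Q d d"
      using d by (intro mult_nonneg_nonneg[OF q]) simp
    also have "\<dots> = Q c c * Q d d - (Q c d)\<^sup>2" using d by (simp add: field_simps power2_eq_square)
    finally show ?thesis by simp
  qed
qed

text \<open>Completing the square turns the integrand times the standard density into a multiple of
  the normal density with mean - b / (1 + q) and variance 1 / (1 + q).\<close>

lemma gaussian_integral_quadratic:
  assumes q: "q \<ge> 0"
  shows "(\<integral>x. exp (- (a + 2 * x * b + x\<^sup>2 * q) / 2) \<partial>std_normal_distribution) =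
    exp (- (a - b\<^sup>2 / (1 + q)) / 2) / sqrt (1 + q)"
proof -
  define s where "s = 1 / sqrt (1 + q)"
  have s: "s > 0" "s\<^sup>2 = 1 / (1 + q)" using q by (auto simp: s_def power_divide)
  let ?C = "exp (- (a - b\<^sup>2 / (1 + q)) / 2) / sqrt (1 + q)"
  have eq: "std_normal_density x * exp (- (a + 2 * x * b + x\<^sup>2 * q) / 2) = ?C * normal_density (- b / (1 + q)) s x" for x
  proof -
    have h: "(x - - b / (1 + q))\<^sup>2 * (1 + q) = x\<^sup>2 * (1 + q) + 2 * x * b + b\<^sup>2 / (1 + q)"
    proof -
      define r where "r = b / (1 + q)"
      have b: "b = r * (1 + q)" using q by (simp add: r_def)
      have "b\<^sup>2 / (1 + q) = r\<^sup>2 * (1 + q)" using q by (simp add: b power2_eq_square)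
      moreover have "x - - b / (1 + q) = x + r" by (simp add: r_def)
      moreover have "(x + r)\<^sup>2 * (1 + q) = x\<^sup>2 * (1 + q) + 2 * x * (r * (1 + q)) + r\<^sup>2 * (1 + q)"
        by (simp add: power2_eq_square algebra_simps)
      ultimately show ?thesis by (simp only: b[symmetric])
    qed
    have "- (x - - b / (1 + q))\<^sup>2 / (2 * s\<^sup>2) = - ((x - - b / (1 + q))\<^sup>2 * (1 + q)) / 2"
      by (simp add: s(2))
    also have "\<dots> = - (x\<^sup>2 * (1 + q) + 2 * x * b + b\<^sup>2 / (1 + q)) / 2" by (simp only: h)
    finally have E2: "- (x - - b / (1 + q))\<^sup>2 / (2 * s\<^sup>2) = - (x\<^sup>2 * (1 + q) + 2 * x * b + b\<^sup>2 / (1 + q)) / 2" .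
    have "- (x\<^sup>2) / 2 + - (a + 2 * x * b + x\<^sup>2 * q) / 2 = - (a - z) / 2 + - (x\<^sup>2 * (1 + q) + 2 * x * b + z) / 2" for z
      by (simp add: field_simps)
    then have e: "- (x\<^sup>2) / 2 + - (a + 2 * x * b + x\<^sup>2 * q) / 2 =
        - (a - b\<^sup>2 / (1 + q)) / 2 + - (x - - b / (1 + q))\<^sup>2 / (2 * s\<^sup>2)"
      by (simp only: E2)
    have "std_normal_density x * exp (- (a + 2 * x * b + x\<^sup>2 * q) / 2) = 1 / sqrt (2 * pi) * exp (- (x\<^sup>2) / 2 + - (a + 2 * x * b + x\<^sup>2 * q) / 2)"
      by (simp only: std_normal_density_def exp_add mult.assoc)
    also have "\<dots> = 1 / sqrt (2 * pi) * (exp (- (a - b\<^sup>2 / (1 + q)) / 2) * exp (- (x - - b / (1 + q))\<^sup>2 / (2 * s\<^sup>2)))"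
      by (simp only: e exp_add)
    also have "1 / sqrt (2 * pi) = 1 / sqrt (1 + q) * (1 / sqrt (2 * pi * s\<^sup>2))"
      using q by (simp add: s(2) real_sqrt_divide real_sqrt_mult)
    finally show ?thesis by (simp add: normal_density_def mult_ac)
  qed
  have "(\<integral>x. exp (- (a + 2 * x * b + x\<^sup>2 * q) / 2) \<partial>std_normal_distribution) =
      (\<integral>x. std_normal_density x * exp (- (a + 2 * x * b + x\<^sup>2 * q) / 2) \<partial>lborel)"
    by (subst integral_density) auto
  also have "\<dots> = ?C" unfolding eq using s(1) by simp
  finally show ?thesis .
qed

text \<open>The Laplace transform of \<open>\<Sum>k<K. X\<^sub>k\<^sup>2\<close> is computed by adding one square at a time, writing
  \<open>exp (- X\<^sub>N\<^sup>2 / 2)\<close> as the mean of \<open>exp (i \<eta> X\<^sub>N)\<close> over an independent standard normal \<open>\<eta>\<close>. Only the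
  characteristic functions of the linear combinations of the \<open>X\<^sub>k\<close> enter.\<close>

lemma (in prob_space) gaussian_laplace_step:
  fixes X :: "nat \<Rightarrow> 'a \<Rightarrow> real"
  assumes X [measurable]: "\<And>k. k < K \<Longrightarrow> X k \<in> borel_measurable M"
    and char: "\<And>c. (CLINT \<omega>|M. iexp (\<Sum>k<K. c k * X k \<omega>)) = complex_of_real (exp (- G c c / 2))"
    and G: "psd_form G" and N: "N \<le> K"
  shows "\<exists>(D::real) Q. D > 0 \<and> psd_form Q \<and>
    (\<forall>c. (CLINT \<omega>|M. iexp (\<Sum>k<K. c k * X k \<omega>) * exp (- (\<Sum>k<N. (X k \<omega>)\<^sup>2) / 2)) = complex_of_real (D * exp (- Q c c / 2))) \<and>
    D\<^sup>2 * (1 + (\<Sum>k<K. G (\<lambda>i. of_bool (i = k)) (\<lambda>i. of_bool (i = k)))) \<le>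
      1 + (\<Sum>k\<in>{N..<K}. Q (\<lambda>i. of_bool (i = k)) (\<lambda>i. of_bool (i = k)))"
  using N
proof (induction N)
  case 0
  show ?case
    by (rule exI[of _ 1], rule exI[of _ G]) (use G char in \<open>auto simp: lessThan_atLeast0\<close>)
next
  case (Suc N)
  let ?\<delta> = "\<lambda>k i. of_bool (i = k) :: real"
  let ?Y = "\<lambda>c \<omega>. \<Sum>k<K. c k * X k \<omega>" and ?S = "\<lambda>N \<omega>. \<Sum>k<N. (X k \<omega>)\<^sup>2"
  let ?T = "1 + (\<Sum>k<K. G (?\<delta> k) (?\<delta> k))"
  obtain D :: real and Q where D: "D > 0" and Q: "psd_form Q"
    and E: "\<And>c. (CLINT \<omega>|M. iexp (?Y c \<omega>) * exp (- ?S N \<omega> / 2)) = complex_of_real (D * exp (- Q c c / 2))"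
    and tr: "D\<^sup>2 * ?T \<le> 1 + (\<Sum>k\<in>{N..<K}. Q (?\<delta> k) (?\<delta> k))"
    using Suc.IH[OF Suc_leD[OF Suc.prems]] by (elim exE conjE) blast
  note Qd = psd_formD[OF Q]
  define q where "q = Q (?\<delta> N) (?\<delta> N)"
  have q: "q \<ge> 0" unfolding q_def by (rule Qd)
  \<comment> \<open>Weighting by exp (- X_N ^ 2 / 2) changes the covariance by this rank-one Schur
    complement and the mass by 1 / sqrt (1 + q). After all K steps, \<open>D\<close> is the inverse
    square root of det (1 + G).\<close>
  define Q' where "Q' = (\<lambda>c d. Q c d - Q c (?\<delta> N) * Q d (?\<delta> N) / (1 + q))"
  define D' where "D' = D / sqrt (1 + q)"
  have NK: "N < K" using Suc.prems by simp
  have [measurable]: "?Y c \<in> borel_measurable M" for c by (intro borel_measurable_sum borel_measurable_times) auto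
  have [measurable]: "?S N \<in> borel_measurable M" using NK by (intro borel_measurable_sum borel_measurable_power X) auto
  have [measurable]: "X N \<in> borel_measurable M" using NK by simp
  have CS: "(Q c (?\<delta> N))\<^sup>2 / (1 + q) \<le> Q c c * (q / (1 + q))" for c
    using psd_form_cauchy_schwarz[OF Q, of c "?\<delta> N"] q by (simp add: q_def[symmetric] divide_right_mono)
  \<comment> \<open>By Cauchy-Schwarz the rank-one correction takes away at most the fraction q / (1
    + q) of the form. This gives positivity of \<open>Q'\<close> and also the lower bound on the
    remaining trace.\<close>
  have low: "Q c c / (1 + q) \<le> Q' c c" for c
  proof -
    have "Q c c / (1 + q) = Q c c - Q c c * (q / (1 + q))" using q by (simp add: field_simps)
    then show ?thesis using CS[of c] by (simp add: Q'_def power2_eq_square)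
  qed
  have psd: "psd_form Q'"
    unfolding psd_form_def
  proof (intro conjI allI)
    show "Q' c d = Q' d c" for c d unfolding Q'_def using Qd(1)[of c d] by simp
    show "Q' (\<lambda>i. c i + a * d i) e = Q' c e + a * Q' d e" for a c d e
      unfolding Q'_def Qd(2) by (simp add: algebra_simps add_divide_distrib)
    show "0 \<le> Q' c c" for c
    proof -
      have "0 \<le> Q c c / (1 + q)" using Qd(4)[of c] q by simp
      also have "\<dots> \<le> Q' c c" by (rule low)
      finally show ?thesis .
    qed
  qed
  have "prob_space std_normal_distribution" by (rule prob_space_normal_density) simp
  then interpret \<gamma>: prob_space std_normal_distribution .
  interpret P: pair_prob_space M std_normal_distribution ..
  have E': "(CLINT \<omega>|M. iexp (?Y c \<omega>) * exp (- ?S (Suc N) \<omega> / 2)) = complex_of_real (D' * exp (- Q' c c / 2))" for c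
  proof -
    let ?f = "\<lambda>\<omega> \<eta>. iexp (?Y c \<omega>) * exp (- ?S N \<omega> / 2) * iexp (X N \<omega> * \<eta>)"
    have S0: "?S N \<omega> \<ge> 0" for \<omega> by (intro sum_nonneg) auto
    have int: "integrable (M \<Otimes>\<^sub>M std_normal_distribution) (\<lambda>(\<omega>, \<eta>). ?f \<omega> \<eta>)"
    proof (rule P.integrable_const_bound[of _ 1])
      show "AE z in M \<Otimes>\<^sub>M std_normal_distribution. norm (case z of (\<omega>, \<eta>) \<Rightarrow> ?f \<omega> \<eta>) \<le> 1"
        using S0 by (auto simp: norm_mult)
      have [measurable]: "(\<lambda>z. snd z) \<in> borel_measurable (M \<Otimes>\<^sub>M std_normal_distribution)"
        using measurable_snd[of M std_normal_distribution] by simp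
      show "(\<lambda>(\<omega>, \<eta>). ?f \<omega> \<eta>) \<in> borel_measurable (M \<Otimes>\<^sub>M std_normal_distribution)"
        unfolding case_prod_beta by measurable
    qed
    have "(CLINT \<omega>|M. iexp (?Y c \<omega>) * exp (- ?S (Suc N) \<omega> / 2)) = (CLINT \<omega>|M. CLINT \<eta>|std_normal_distribution. ?f \<omega> \<eta>)"
    proof (rule Bochner_Integration.integral_cong[OF refl])
      fix \<omega>
      have "(CLINT \<eta>|std_normal_distribution. iexp (X N \<omega> * \<eta>)) = complex_of_real (exp (- (X N \<omega>)\<^sup>2 / 2))"
        using char_std_normal_distribution by (metis char_def)
      then have "(CLINT \<eta>|std_normal_distribution. ?f \<omega> \<eta>) = iexp (?Y c \<omega>) * exp (- ?S N \<omega> / 2) * exp (- (X N \<omega>)\<^sup>2 / 2)"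
        by simp
      also have "\<dots> = iexp (?Y c \<omega>) * exp (- ?S (Suc N) \<omega> / 2)"
        by (simp add: exp_add[symmetric] of_real_mult[symmetric] field_simps del: of_real_mult)
      finally show "iexp (?Y c \<omega>) * exp (- ?S (Suc N) \<omega> / 2) = (CLINT \<eta>|std_normal_distribution. ?f \<omega> \<eta>)" ..
    qed
    also have "\<dots> = (CLINT \<eta>|std_normal_distribution. CLINT \<omega>|M. ?f \<omega> \<eta>)"
      by (rule P.Fubini_integral[OF int, symmetric])
    also have "\<dots> = (CLINT \<eta>|std_normal_distribution. complex_of_real (D * exp (- (Q c c + 2 * \<eta> * Q c (?\<delta> N) + \<eta>\<^sup>2 * q) / 2)))"
    proof (rule Bochner_Integration.integral_cong[OF refl])
      fix \<eta> :: real
      have Y: "?Y (\<lambda>i. c i + \<eta> * ?\<delta> N i) \<omega> = ?Y c \<omega> + X N \<omega> * \<eta>" for \<omega>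
      proof -
        have "?Y (\<lambda>i. c i + \<eta> * ?\<delta> N i) \<omega> = ?Y c \<omega> + (\<Sum>k<K. if k = N then \<eta> * X N \<omega> else 0)"
          unfolding sum.distrib[symmetric] by (intro sum.cong refl) (auto simp: algebra_simps)
        then show ?thesis using NK by (simp add: mult.commute)
      qed
      have "(CLINT \<omega>|M. ?f \<omega> \<eta>) = (CLINT \<omega>|M. iexp (?Y (\<lambda>i. c i + \<eta> * ?\<delta> N i) \<omega>) * exp (- ?S N \<omega> / 2))"
        unfolding Y by (simp add: exp_add distrib_left mult_ac)
      also have "\<dots> = complex_of_real (D * exp (- Q (\<lambda>i. c i + \<eta> * ?\<delta> N i) (\<lambda>i. c i + \<eta> * ?\<delta> N i) / 2))" by (rule E)
      also have "Q (\<lambda>i. c i + \<eta> * ?\<delta> N i) (\<lambda>i. c i + \<eta> * ?\<delta> N i) = Q c c + 2 * \<eta> * Q c (?\<delta> N) + \<eta>\<^sup>2 * q"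
        unfolding Qd(2) Qd(3) q_def Qd(1)[of "?\<delta> N" c] by (simp add: algebra_simps power2_eq_square)
      finally show "(CLINT \<omega>|M. ?f \<omega> \<eta>) = complex_of_real (D * exp (- (Q c c + 2 * \<eta> * Q c (?\<delta> N) + \<eta>\<^sup>2 * q) / 2))" .
    qed
    also have "\<dots> = complex_of_real (D * (\<integral>\<eta>. exp (- (Q c c + 2 * \<eta> * Q c (?\<delta> N) + \<eta>\<^sup>2 * q) / 2) \<partial>std_normal_distribution))"
      by (simp only: Bochner_Integration.integral_complex_of_real integral_mult_right_zero)
    also have "\<dots> = complex_of_real (D' * exp (- Q' c c / 2))"
      unfolding gaussian_integral_quadratic[OF q] by (simp add: D'_def Q'_def power2_eq_square)
    finally show ?thesis .
  qed
  \<comment> \<open>The invariant is a stepwise form of det (1 + G) >= 1 + tr G: index N leaves the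
    remaining trace with its variance q, and dividing by 1 + q turns 1 + q + rest into 1 + rest / (1
    + q).\<close>
  have "D'\<^sup>2 * ?T = D\<^sup>2 * ?T / (1 + q)" using q by (simp add: D'_def power_divide)
  also have "\<dots> \<le> (1 + (\<Sum>k\<in>{N..<K}. Q (?\<delta> k) (?\<delta> k))) / (1 + q)" using tr q by (intro divide_right_mono) auto
  also have "(\<Sum>k\<in>{N..<K}. Q (?\<delta> k) (?\<delta> k)) = q + (\<Sum>k\<in>{Suc N..<K}. Q (?\<delta> k) (?\<delta> k))"
    using NK by (simp add: sum.atLeast_Suc_lessThan q_def)
  also have "(1 + (q + (\<Sum>k\<in>{Suc N..<K}. Q (?\<delta> k) (?\<delta> k)))) / (1 + q) = 1 + (\<Sum>k\<in>{Suc N..<K}. Q (?\<delta> k) (?\<delta> k) / (1 + q))"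
    using q by (simp add: sum_divide_distrib[symmetric] field_simps)
  also have "\<dots> \<le> 1 + (\<Sum>k\<in>{Suc N..<K}. Q' (?\<delta> k) (?\<delta> k))"
    by (intro add_left_mono sum_mono low)
  finally have "D'\<^sup>2 * ?T \<le> 1 + (\<Sum>k\<in>{Suc N..<K}. Q' (?\<delta> k) (?\<delta> k))" .
  moreover have "D' > 0" using D q by (simp add: D'_def)
  ultimately show ?case using psd E' by blast
qed

text \<open>The expectation is the constant \<open>D\<close> of the last step, read off at the zero
  combination. With no indices left the invariant says that D squared times 1 plus the total
  variance is at most 1.\<close>

lemma (in prob_space) gaussian_laplace_bound:
  fixes X :: "nat \<Rightarrow> 'a \<Rightarrow> real"
  assumes gauss: "\<And>c. gaussian_rv M (\<lambda>\<omega>. \<Sum>k<K. c k * X k \<omega>)"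
    and X: "\<And>k. k < K \<Longrightarrow> X k \<in> borel_measurable M" "\<And>k. k < K \<Longrightarrow> integrable M (\<lambda>\<omega>. (X k \<omega>)\<^sup>2)"
    and mean: "\<And>k. k < K \<Longrightarrow> expectation (X k) = 0"
  shows "expectation (\<lambda>\<omega>. exp (- (\<Sum>k<K. (X k \<omega>)\<^sup>2) / 2)) \<le> 1 / sqrt (1 + (\<Sum>k<K. expectation (\<lambda>\<omega>. (X k \<omega>)\<^sup>2)))"
proof -
  let ?\<delta> = "\<lambda>k i. of_bool (i = k) :: real"
  let ?Y = "\<lambda>c \<omega>. \<Sum>k<K. c k * X k \<omega>"
  have i1: "integrable M (X k)" if "k < K" for k
  proof -
    have le: "y \<le> 1 + y\<^sup>2" "- y \<le> 1 + y\<^sup>2" for y :: real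
      using zero_le_power2[of "y - 1 / 2"] zero_le_power2[of "y + 1 / 2"] by (auto simp: power2_eq_square algebra_simps)
    show ?thesis
      by (rule Bochner_Integration.integrable_bound[of _ "\<lambda>\<omega>. 1 + (X k \<omega>)\<^sup>2"]) (use X[OF that] le in \<open>auto intro!: AE_I2 simp: abs_le_iff\<close>)
  qed
  have i2: "integrable M (\<lambda>\<omega>. X k \<omega> * X l \<omega>)" if "k < K" "l < K" for k l
  proof (rule Bochner_Integration.integrable_bound[of _ "\<lambda>\<omega>. (X k \<omega>)\<^sup>2 + (X l \<omega>)\<^sup>2"])
    have le: "\<bar>y * z\<bar> \<le> y\<^sup>2 + z\<^sup>2" for y z :: real
      using zero_le_power2[of "y - z"] zero_le_power2[of "y + z"] zero_le_power2[of y] zero_le_power2[of z]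
      unfolding power2_diff power2_sum abs_le_iff by simp
    show "AE \<omega> in M. norm (X k \<omega> * X l \<omega>) \<le> norm ((X k \<omega>)\<^sup>2 + (X l \<omega>)\<^sup>2)" using le by (intro AE_I2) simp
  qed (use X that in \<open>auto intro!: borel_measurable_times\<close>)
  define G where "G = (\<lambda>c d. expectation (\<lambda>\<omega>. ?Y c \<omega> * ?Y d \<omega>))"
  have iY: "integrable M (\<lambda>\<omega>. ?Y c \<omega> * ?Y d \<omega>)" for c d
  proof -
    have "(\<lambda>\<omega>. ?Y c \<omega> * ?Y d \<omega>) = (\<lambda>\<omega>. \<Sum>k<K. \<Sum>l<K. (c k * d l) * (X k \<omega> * X l \<omega>))"
      by (simp add: sum_product mult_ac)
    then show ?thesis by (auto intro!: Bochner_Integration.integrable_sum integrable_mult_right i2)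
  qed
  have G: "psd_form G"
    unfolding psd_form_def
  proof (intro conjI allI)
    show "G c d = G d c" for c d by (simp add: G_def mult.commute)
    show "0 \<le> G c c" for c by (simp add: G_def)
    fix a c d e
    have "(\<lambda>\<omega>. ?Y (\<lambda>i. c i + a * d i) \<omega> * ?Y e \<omega>) = (\<lambda>\<omega>. ?Y c \<omega> * ?Y e \<omega> + a * (?Y d \<omega> * ?Y e \<omega>))"
    proof -
      have "?Y (\<lambda>i. c i + a * d i) \<omega> = ?Y c \<omega> + a * ?Y d \<omega>" for \<omega>
        by (simp add: distrib_right sum.distrib sum_distrib_left mult.assoc)
      then show ?thesis by (simp only: distrib_right mult.assoc)
    qed
    then show "G (\<lambda>i. c i + a * d i) e = G c e + a * G d e" using iY by (simp add: G_def)
  qed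
  have char: "(CLINT \<omega>|M. iexp (?Y c \<omega>)) = complex_of_real (exp (- G c c / 2))" for c
    using gaussian_rv_char[OF gauss[of c]] i1 mean by (simp add: G_def power2_eq_square)
  have \<delta>: "?Y (?\<delta> k) = X k" if "k < K" for k
  proof
    fix \<omega>
    have "?Y (?\<delta> k) \<omega> = (\<Sum>l<K. if l = k then X k \<omega> else 0)" by (intro sum.cong) auto
    then show "?Y (?\<delta> k) \<omega> = X k \<omega>" using that by simp
  qed
  obtain D :: real and Q where D: "D > 0" and Q: "psd_form Q"
    and E: "\<And>c. (CLINT \<omega>|M. iexp (?Y c \<omega>) * exp (- (\<Sum>k<K. (X k \<omega>)\<^sup>2) / 2)) = complex_of_real (D * exp (- Q c c / 2))"
    and tr: "D\<^sup>2 * (1 + (\<Sum>k<K. G (?\<delta> k) (?\<delta> k))) \<le> 1 + (\<Sum>k\<in>{K..<K}. Q (?\<delta> k) (?\<delta> k))"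
    using gaussian_laplace_step[OF X(1) char G order_refl] by blast
  have "Q (\<lambda>_. 0) (\<lambda>_. 0) = 0" using psd_formD(2)[OF Q, of "\<lambda>_. 0" 1 "\<lambda>_. 0" "\<lambda>_. 0"] by simp
  with E[of "\<lambda>_. 0"] have "complex_of_real (expectation (\<lambda>\<omega>. exp (- (\<Sum>k<K. (X k \<omega>)\<^sup>2) / 2))) = D"
    by (simp only: mult_zero_left sum.neutral_const mult_zero_right of_real_0 exp_zero mult_1_left
        Bochner_Integration.integral_complex_of_real div_0 minus_zero of_real_1 mult_1_right)
  then have ED: "expectation (\<lambda>\<omega>. exp (- (\<Sum>k<K. (X k \<omega>)\<^sup>2) / 2)) = D" by simp
  let ?T = "1 + (\<Sum>k<K. expectation (\<lambda>\<omega>. (X k \<omega>)\<^sup>2))"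
  have "(\<Sum>k<K. G (?\<delta> k) (?\<delta> k)) = (\<Sum>k<K. expectation (\<lambda>\<omega>. (X k \<omega>)\<^sup>2))"
    by (intro sum.cong refl) (simp add: G_def \<delta> power2_eq_square)
  then have "D\<^sup>2 * ?T \<le> 1" using tr by simp
  moreover have T: "?T > 0" by (intro add_pos_nonneg sum_nonneg) auto
  ultimately have "D\<^sup>2 \<le> 1 / ?T" by (simp add: pos_le_divide_eq)
  then have "D \<le> sqrt (1 / ?T)" by (rule real_le_rsqrt)
  then show ?thesis by (simp only: ED real_sqrt_divide real_sqrt_one)
qed

text \<open>If all the sums S_n stay below C, then exp (- S_n / 2) is at least exp (- C / 2), so
  this event has probability at most exp (C / 2) / sqrt (1 + E S_n) for every n. No relation between
  different n is used; choosing n with large E S_n makes the probability zero, and countably many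
  integers C cover all bounds.\<close>

lemma (in prob_space) gaussian_squares_unbounded:
  fixes X :: "nat \<Rightarrow> nat \<Rightarrow> 'a \<Rightarrow> real" and K :: "nat \<Rightarrow> nat"
  assumes gauss: "\<And>n c. gaussian_rv M (\<lambda>\<omega>. \<Sum>k<K n. c k * X n k \<omega>)"
    and X: "\<And>n k. k < K n \<Longrightarrow> X n k \<in> borel_measurable M" "\<And>n k. k < K n \<Longrightarrow> integrable M (\<lambda>\<omega>. (X n k \<omega>)\<^sup>2)"
    and mean: "\<And>n k. k < K n \<Longrightarrow> expectation (X n k) = 0"
    and unb: "\<And>B. \<exists>n. (\<Sum>k<K n. expectation (\<lambda>\<omega>. (X n k \<omega>)\<^sup>2)) \<ge> B"
  shows "AE \<omega> in M. \<not> (\<exists>C. \<forall>n. (\<Sum>k<K n. (X n k \<omega>)\<^sup>2) \<le> C)"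
proof -
  let ?S = "\<lambda>n \<omega>. \<Sum>k<K n. (X n k \<omega>)\<^sup>2"
  have Sm [measurable]: "?S n \<in> borel_measurable M" for n by (intro borel_measurable_sum borel_measurable_power X) auto
  have "AE \<omega> in M. \<not> (\<forall>n. ?S n \<omega> \<le> real C)" for C :: nat
  proof -
    let ?A = "{\<omega>\<in>space M. \<forall>n. ?S n \<omega> \<le> real C}"
    have A [measurable]: "?A \<in> sets M" by measurable
    have "prob ?A \<le> e" if e: "e > 0" for e
    proof -
      \<comment> \<open>Chosen such that exp (C / 2) / sqrt B = e.\<close>
      define B where "B = (exp (real C / 2) / e)\<^sup>2"
      obtain n where n: "(\<Sum>k<K n. expectation (\<lambda>\<omega>. (X n k \<omega>)\<^sup>2)) \<ge> B" using unb by blast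
      have "exp (- real C / 2) * prob ?A = expectation (\<lambda>\<omega>. exp (- real C / 2) * indicator ?A \<omega>)" by simp
      also have "\<dots> \<le> expectation (\<lambda>\<omega>. exp (- ?S n \<omega> / 2))"
      proof (rule integral_mono)
        show "integrable M (\<lambda>\<omega>. exp (- ?S n \<omega> / 2))"
          by (rule integrable_const_bound[of _ 1]) (auto intro!: AE_I2 sum_nonneg)
        show "integrable M (\<lambda>\<omega>. exp (- real C / 2) * indicator ?A \<omega>)"
          by (intro integrable_mult_right integrable_real_indicator A) (simp add: emeasure_eq_measure)
        show "exp (- real C / 2) * indicator ?A \<omega> \<le> exp (- ?S n \<omega> / 2)" for \<omega>
          by (auto simp: indicator_def)
      qed
      also have "\<dots> \<le> 1 / sqrt (1 + (\<Sum>k<K n. expectation (\<lambda>\<omega>. (X n k \<omega>)\<^sup>2)))"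
        by (rule gaussian_laplace_bound[OF gauss X mean])
      also have "\<dots> \<le> 1 / sqrt B"
      proof -
        have "B > 0" using e by (simp add: B_def)
        then show ?thesis using n by (intro divide_left_mono real_sqrt_le_mono mult_pos_pos) auto
      qed
      also have "sqrt B = exp (real C / 2) / e" using e by (simp add: B_def)
      also have "1 / (exp (real C / 2) / e) = e * inverse (exp (real C / 2))" by (simp only: divide_inverse inverse_mult_distrib inverse_inverse_eq mult_1_left mult.commute)
      also have "inverse (exp (real C / 2)) = exp (- real C / 2)" using exp_minus[of "real C / 2"] by simp
      finally show ?thesis by (simp add: mult.commute)
    qed
    then have "prob ?A = 0" using field_le_epsilon[of "prob ?A" 0] measure_nonneg[of M ?A] by force
    then have "AE \<omega> in M. \<omega> \<notin> ?A" by (subst (asm) prob_eq_0) auto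
    then show ?thesis by (rule AE_mp) (auto intro!: AE_I2)
  qed
  then have "AE \<omega> in M. \<forall>C::nat. \<not> (\<forall>n. ?S n \<omega> \<le> real C)" by (subst AE_all_countable) blast
  then show ?thesis
  proof eventually_elim
    fix \<omega> assume h: "\<forall>C::nat. \<not> (\<forall>n. ?S n \<omega> \<le> real C)"
    show "\<not> (\<exists>C. \<forall>n. ?S n \<omega> \<le> C)"
    proof
      assume "\<exists>C. \<forall>n. ?S n \<omega> \<le> C"
      then obtain C where C: "\<And>n. ?S n \<omega> \<le> C" by blast
      obtain c :: nat where "C \<le> real c" using real_arch_simple by blast
      then show False using h C order.trans by blast
    qed
  qed
qed


section \<open>White noise and the dyadic blocks of the field\<close>

locale matern_noise = matern \<kappa> m + prob_space M
  for \<kappa> :: real and m :: "real^'d \<Rightarrow> real" and M :: "'w measure" +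
  fixes W :: "(real^'d \<Rightarrow> complex) \<Rightarrow> 'w \<Rightarrow> complex"
  assumes white: "gaussian_white_noise M W"
begin

lemma W_measurable: "torus_smooth \<phi> \<Longrightarrow> W \<phi> \<in> borel_measurable M"
  and W_square_integrable: "torus_smooth \<phi> \<Longrightarrow> integrable M (\<lambda>\<omega>. (norm (W \<phi> \<omega>))\<^sup>2)"
  using white unfolding gaussian_white_noise_def real_GeRF_def test_functions_def by blast+

lemma W_linear: "torus_smooth \<phi> \<Longrightarrow> torus_smooth \<psi> \<Longrightarrow> AE \<omega> in M. W (\<lambda>x. a * \<phi> x + b * \<psi> x) \<omega> = a * W \<phi> \<omega> + b * W \<psi> \<omega>"
  using white unfolding gaussian_white_noise_def real_GeRF_def test_functions_def by blast

lemma W_integrable: 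
  assumes "torus_smooth \<phi>" shows "integrable M (W \<phi>)"
proof -
  have le: "y \<le> 1 + y\<^sup>2" for y :: real
    using zero_le_power2[of "y - 1 / 2"] by (simp add: power2_eq_square algebra_simps)
  show ?thesis
    by (rule Bochner_Integration.integrable_bound[of _ "\<lambda>\<omega>. 1 + (norm (W \<phi> \<omega>))\<^sup>2"])
      (use W_measurable[OF assms] W_square_integrable[OF assms] le in \<open>auto intro!: AE_I2\<close>)
qed

lemma W_isometry:
  assumes "torus_smooth \<phi>"
  shows "expectation (\<lambda>\<omega>. (norm (W \<phi> \<omega>))\<^sup>2) = (\<integral>x. (norm (\<phi> x))\<^sup>2 \<partial>torus_measure)"
proof -
  have "(LINT \<omega>|M. W \<phi> \<omega> * cnj (W \<phi> \<omega>)) = torus_inner \<phi> \<phi>"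
    using white assms unfolding gaussian_white_noise_def test_functions_def by blast
  then have "complex_of_real (expectation (\<lambda>\<omega>. (norm (W \<phi> \<omega>))\<^sup>2)) = complex_of_real (\<integral>x. (norm (\<phi> x))\<^sup>2 \<partial>torus_measure)"
    by (simp only: torus_inner_def torus_integral_eq complex_norm_square[symmetric] Bochner_Integration.integral_complex_of_real)
  then show ?thesis by (simp only: of_real_eq_iff)
qed

lemma W_gaussian:
  assumes "torus_smooth \<phi>"
  shows "gaussian_rv M (\<lambda>\<omega>. Re (W \<phi> \<omega>))" "gaussian_rv M (\<lambda>\<omega>. Im (W \<phi> \<omega>))"
    "expectation (\<lambda>\<omega>. Re (W \<phi> \<omega>)) = 0" "expectation (\<lambda>\<omega>. Im (W \<phi> \<omega>)) = 0"
proof -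
  have g: "gaussian_rv M (\<lambda>\<omega>. a * Re (W \<phi> \<omega>) + b * Im (W \<phi> \<omega>))" for a b
    using white assms unfolding gaussian_white_noise_def gaussian_GeRF_def test_functions_def by blast
  show "gaussian_rv M (\<lambda>\<omega>. Re (W \<phi> \<omega>))" "gaussian_rv M (\<lambda>\<omega>. Im (W \<phi> \<omega>))"
    using g[of 1 0] g[of 0 1] by simp_all
  have "expectation (W \<phi>) = 0"
    using white assms unfolding gaussian_white_noise_def centered_GeRF_def test_functions_def by blast
  then show "expectation (\<lambda>\<omega>. Re (W \<phi> \<omega>)) = 0" "expectation (\<lambda>\<omega>. Im (W \<phi> \<omega>)) = 0"
    using W_integrable[OF assms] by simp_all
qed

lemma W_zero: "AE \<omega> in M. W (\<lambda>_. 0) \<omega> = 0"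
  using W_linear[of "\<lambda>_. 0" "\<lambda>_. 0" 0 0] by simp

text \<open>The exceptional null set depends on the functions and the coefficients, so this is only
  ever applied to countably many combinations at a time.\<close>

lemma W_sum:
  assumes "finite F" "\<And>k. k \<in> F \<Longrightarrow> torus_smooth (\<phi> k)"
  shows "AE \<omega> in M. W (\<lambda>x. \<Sum>k\<in>F. c k * \<phi> k x) \<omega> = (\<Sum>k\<in>F. c k * W (\<phi> k) \<omega>)"
  using assms
proof (induction F rule: finite_induct)
  case empty
  then show ?case using W_zero by simp
next
  case (insert k F)
  have s: "torus_smooth (\<phi> k)" "torus_smooth (\<lambda>x. \<Sum>k\<in>F. c k * \<phi> k x)"
    using insert.prems by (auto intro!: torus_smooth_sum torus_smooth_cmult)
  have "AE \<omega> in M. W (\<lambda>x. \<Sum>k\<in>F. c k * \<phi> k x) \<omega> = (\<Sum>k\<in>F. c k * W (\<phi> k) \<omega>)"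
    using insert by auto
  with W_linear[OF s, of "c k" 1] show ?case
    by eventually_elim (simp add: insert.hyps)
qed

text \<open>Moments of a centered Gaussian variable are controlled by its variance with a constant
  that depends on \<open>p\<close> alone. Independence of \<psi> is essential, since the bound is
  used at all grid points and in all blocks.\<close>

lemma W_moment:
  "\<exists>C\<ge>0. \<forall>\<psi>. torus_smooth \<psi> \<longrightarrow> integrable M (\<lambda>\<omega>. norm (W \<psi> \<omega>) ^ (2 * p)) \<and>
     expectation (\<lambda>\<omega>. norm (W \<psi> \<omega>) ^ (2 * p)) \<le> C * (\<integral>x. (norm (\<psi> x))\<^sup>2 \<partial>torus_measure) ^ p"
proof (intro exI conjI allI impI)
  let ?K = "fact (2 * p) / (2 ^ p * fact p) :: real"
  show "0 \<le> 2 ^ p * (?K + ?K)" by simp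
  fix \<psi> :: "real^'d \<Rightarrow> complex" assume \<psi>: "torus_smooth \<psi>"
  let ?X = "\<lambda>\<omega>. Re (W \<psi> \<omega>)" and ?Y = "\<lambda>\<omega>. Im (W \<psi> \<omega>)"
  let ?V = "\<integral>x. (norm (\<psi> x))\<^sup>2 \<partial>torus_measure"
  note g = W_gaussian[OF \<psi>] and [measurable] = W_measurable[OF \<psi>]
  note X = gaussian_rv_moment[OF g(1,3), of p] and Y = gaussian_rv_moment[OF g(2,4), of p]
  have le: "norm z ^ (2 * p) \<le> 2 ^ p * (Re z ^ (2 * p) + Im z ^ (2 * p))" for z
  proof -
    have "norm z ^ (2 * p) = ((Re z)\<^sup>2 + (Im z)\<^sup>2) ^ p" by (simp add: power_mult cmod_power2)
    also have "\<dots> \<le> (2 * max ((Re z)\<^sup>2) ((Im z)\<^sup>2)) ^ p" by (intro power_mono) auto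
    also have "\<dots> = 2 ^ p * max ((Re z)\<^sup>2) ((Im z)\<^sup>2) ^ p" by (simp add: power_mult_distrib)
    also have "\<dots> \<le> 2 ^ p * (Re z ^ (2 * p) + Im z ^ (2 * p))"
      by (intro mult_left_mono) (auto simp: max_def power_mult)
    finally show ?thesis .
  qed
  have iZ: "integrable M (\<lambda>\<omega>. 2 ^ p * (?X \<omega> ^ (2 * p) + ?Y \<omega> ^ (2 * p)))" using X Y by auto
  show int: "integrable M (\<lambda>\<omega>. norm (W \<psi> \<omega>) ^ (2 * p))"
    by (rule Bochner_Integration.integrable_bound[OF iZ]) (use le in \<open>auto intro!: AE_I2 order.trans[OF le abs_ge_self]\<close>)
  have "expectation (\<lambda>\<omega>. (?X \<omega>)\<^sup>2) \<le> ?V" "expectation (\<lambda>\<omega>. (?Y \<omega>)\<^sup>2) \<le> ?V"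
    unfolding W_isometry[OF \<psi>, symmetric]
    using gaussian_rv_moment[OF g(1,3), of 1] gaussian_rv_moment[OF g(2,4), of 1]
    by (intro integral_mono W_square_integrable[OF \<psi>]; simp add: cmod_power2)+
  then have V: "expectation (\<lambda>\<omega>. (?X \<omega>)\<^sup>2) ^ p \<le> ?V ^ p" "expectation (\<lambda>\<omega>. (?Y \<omega>)\<^sup>2) ^ p \<le> ?V ^ p"
    by (intro power_mono; simp)+
  have "expectation (\<lambda>\<omega>. norm (W \<psi> \<omega>) ^ (2 * p)) \<le> expectation (\<lambda>\<omega>. 2 ^ p * (?X \<omega> ^ (2 * p) + ?Y \<omega> ^ (2 * p)))"
    by (rule integral_mono[OF int iZ le])
  also have "\<dots> = 2 ^ p * (?K * expectation (\<lambda>\<omega>. (?X \<omega>)\<^sup>2) ^ p + ?K * expectation (\<lambda>\<omega>. (?Y \<omega>)\<^sup>2) ^ p)"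
    using X Y by simp
  also have "\<dots> \<le> 2 ^ p * (?K * ?V ^ p + ?K * ?V ^ p)"
    by (intro mult_left_mono add_mono V) auto
  also have "\<dots> = 2 ^ p * (?K + ?K) * ?V ^ p" by (simp only: distrib_right mult.assoc)
  finally show "expectation (\<lambda>\<omega>. norm (W \<psi> \<omega>) ^ (2 * p)) \<le> 2 ^ p * (?K + ?K) * ?V ^ p" .
qed

lemma norm_square_integral_fourier_sum:
  assumes "finite F"
  shows "(\<integral>x. (norm (\<Sum>k\<in>F. a k * fourier_mode k x))\<^sup>2 \<partial>torus_measure) = (\<Sum>k\<in>F. (norm (a k))\<^sup>2)"
proof -
  have "complex_of_real (\<integral>x. (norm (\<Sum>k\<in>F. a k * fourier_mode k x))\<^sup>2 \<partial>torus_measure) = complex_of_real (\<Sum>k\<in>F. (norm (a k))\<^sup>2)"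
    using torus_inner_fourier_sums[OF assms, of a a] unfolding torus_inner_def torus_integral_eq
    by (simp only: complex_norm_square[symmetric] Bochner_Integration.integral_complex_of_real of_real_sum)
  then show ?thesis by (simp only: of_real_eq_iff)
qed

abbreviation xi :: "int^'d \<Rightarrow> 'w \<Rightarrow> complex" where
  "xi k \<equiv> W (fourier_mode k)"

text \<open>A pathwise condition on the noise coefficients. On such \<omega> convergence of the
  series against test functions and all crude bounds are deterministic.\<close>

definition xi_growth :: "'w \<Rightarrow> bool" where
  "xi_growth \<omega> \<longleftrightarrow> (\<exists>C>0. \<forall>k. norm (xi k \<omega>) \<le> C * jap k ^ (CARD('d) + 1))"

text \<open>The coefficients have unit variance, so the weighted sum over shell j has mean of order
  \<open>2 ^ (j * d)\<close> times \<open>2 ^ (- j * (d + 1))\<close>, which is summable. From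
  squares to norms one passes by y <= 1 + y ^ 2.\<close>

lemma xi_growth: "AE \<omega> in M. xi_growth \<omega>"
proof -
  let ?d = "CARD('d)"
  define Y where "Y = (\<lambda>j \<omega>. (\<Sum>k\<in>shell j. (norm (xi k \<omega>))\<^sup>2) * (1 / 2) ^ (j * (?d + 1)))"
  have one: "expectation (\<lambda>\<omega>. (norm (xi k \<omega>))\<^sup>2) = 1" for k
    unfolding W_isometry[OF torus_smooth_fourier_mode] by (simp add: torus.prob_space[simplified])
  have sq: "integrable M (\<lambda>\<omega>. (norm (xi k \<omega>))\<^sup>2)" for k by (rule W_square_integrable[OF torus_smooth_fourier_mode])
  have "AE \<omega> in M. \<exists>C>0. \<forall>j. Y j \<omega> \<le> C"
  proof (rule AE_bounded_sequence[where A = "4 ^ ?d"])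
    show "integrable M (Y j)" for j unfolding Y_def using sq by auto
    show "Y j \<omega> \<ge> 0" for j \<omega> unfolding Y_def by (intro mult_nonneg_nonneg sum_nonneg) auto
    show "expectation (Y j) \<le> 4 ^ ?d * (1 / 2) ^ j" for j
    proof -
      have "expectation (Y j) = real (card (shell j :: (int^'d) set)) * (1 / 2) ^ (j * (?d + 1))"
        unfolding Y_def using sq by (simp add: one)
      also have "\<dots> \<le> (4 ^ ?d * (2 ^ j) ^ ?d) * (1 / 2) ^ (j * (?d + 1))"
        using shell_finite_card by (intro mult_right_mono) auto
      also have "\<dots> = 4 ^ ?d * (1 / 2) ^ j" by (simp add: power_mult power_add power_one_over field_simps)
      finally show ?thesis .
    qed
  qed
  then show ?thesis
  proof eventually_elim
    fix \<omega> assume "\<exists>C>0. \<forall>j. Y j \<omega> \<le> C"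
    then obtain C where C: "C > 0" "\<And>j. Y j \<omega> \<le> C" by blast
    have "norm (xi k \<omega>) \<le> (1 + C) * jap k ^ (?d + 1)" for k
    proof -
      obtain j where j: "k \<in> shell j" using ex_shell by blast
      have le: "y \<le> 1 + y\<^sup>2" for y :: real
        using zero_le_power2[of "y - 1 / 2"] by (simp add: power2_eq_square algebra_simps)
      have "(norm (xi k \<omega>))\<^sup>2 \<le> (\<Sum>k\<in>shell j. (norm (xi k \<omega>))\<^sup>2)"
        using j by (intro member_le_sum) auto
      also have "\<dots> = Y j \<omega> * 2 ^ (j * (?d + 1))" by (simp add: Y_def power_one_over)
      also have "\<dots> \<le> C * 2 ^ (j * (?d + 1))" using C by (intro mult_right_mono) auto
      also have "\<dots> = C * (2 ^ j) ^ (?d + 1)" by (simp only: power_mult)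
      also have "\<dots> \<le> C * jap k ^ (?d + 1)" using shell_jap[OF j] C by (intro mult_left_mono power_mono) auto
      finally have "norm (xi k \<omega>) \<le> 1 + C * jap k ^ (?d + 1)" using le[of "norm (xi k \<omega>)"] by linarith
      also have "\<dots> \<le> (1 + C) * jap k ^ (?d + 1)"
        using one_le_power[OF jap_ge_1[of k], of "?d + 1"] by (simp only: distrib_right mult_1_left add_right_mono)
      finally show ?thesis .
    qed
    then show "xi_growth \<omega>" unfolding xi_growth_def using C by (intro exI[of _ "1 + C"]) auto
  qed
qed

text \<open>The pairing of the noise with test functions is bilinear, so its formal expansion is the
  sum of W(e_k) times the conjugate of e_k. This is why the conjugate mode accompanies
  \<open>xi k\<close>.\<close>

definition bas :: "int^'d \<Rightarrow> real^'d \<Rightarrow> complex" where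
  "bas k x = sym k x * cnj (fourier_mode k x)"

lemma torus_smooth_bas: "torus_smooth (bas k)"
  unfolding bas_def by (intro torus_smooth_mult torus_smooth_sym torus_smooth_cnj torus_smooth_fourier_mode)

lemma norm_bas: "norm (bas k x) = norm (sym k x)"
  by (simp add: bas_def norm_mult)

text \<open>Symbol and mode are joined into one exponential. Differentiating its phase costs a full
  factor \<open>jap k\<close>, which dominates the logarithm produced by the variable order; so
  \<alpha> costs exactly \<open>length \<alpha>\<close> powers and the size of the symbol at x
  remains.\<close>

lemma pderivs_bas_bound:
  "\<exists>C>0. \<forall>k x. norm (pderivs \<alpha> (bas k) x) \<le> C * jap k ^ length \<alpha> * norm (sym k x)"
proof -
  let ?n = "length \<alpha>"
  obtain L where L: "L \<ge> 1" "\<And>k::int^'d. 1 + \<bar>ln (matern_lambda \<kappa> k)\<bar> \<le> L * sqrt (jap k)" using ln_lambda_bound by blast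
  have tm: "torus_smooth (\<lambda>x. complex_of_real (m x))" by (rule torus_smooth_of_real[OF m_smooth])
  then have s: "smooth (\<lambda>x. complex_of_real (m x))" by (simp add: torus_smooth_iff)
  obtain A where A: "A \<ge> 0" "\<And>\<alpha> x. length \<alpha> \<le> ?n + 1 \<Longrightarrow> norm (pderivs \<alpha> (\<lambda>x. complex_of_real (m x)) x) \<le> A"
    using torus_smooth_pderivs_bounded[OF tm] by blast
  define D where "D = (1 + A) * L + 2 * pi"
  have D: "D \<ge> 1" 
  proof -
    have "(1 + A) * L \<ge> 1 * 1" using A L by (intro mult_mono) auto
    then show ?thesis unfolding D_def using pi_gt3 by linarith
  qed
  have "norm (pderivs \<alpha> (bas k) x) \<le> (2 ^ (?n\<^sup>2) * D ^ ?n) * jap k ^ ?n * norm (sym k x)" for k x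
  proof -
    let ?l = "complex_of_real (- ln (matern_lambda \<kappa> k))"
    let ?\<theta> = "\<lambda>x. ?l * complex_of_real (m x) + (lattice_vec (- k) \<bullet> x) *\<^sub>R (2 * pi * \<i>)"
    have sq: "sqrt (jap k) \<le> jap k" using jap_ge_1[of k] by (intro real_le_lsqrt) (auto simp: power2_eq_square)
    have s1: "smooth (\<lambda>x. ?l * complex_of_real (m x))" by (intro smooth_cmult s)
    have s2: "smooth (\<lambda>x. (lattice_vec (- k) \<bullet> x) *\<^sub>R (2 * pi * \<i>))"
      by (intro smooth_linear[OF bounded_linear_scaleR_left] smooth_inner)
    have bas: "bas k = (\<lambda>x. exp (?\<theta> x))"
    proof
      fix x
      have "fourier_mode (- k) x = exp ((lattice_vec (- k) \<bullet> x) *\<^sub>R (2 * pi * \<i>))"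
        by (simp add: fourier_mode_def cis_conv_exp scaleR_conv_of_real mult_ac)
      then show "bas k x = exp (?\<theta> x)" unfolding bas_def sym_exp cnj_fourier_mode exp_add by simp
    qed
    have ki: "\<bar>real_of_int (k $ i)\<bar> \<le> jap k" for i
    proof -
      have "real_of_int \<bar>k $ i\<bar> \<le> real_of_int (int (inorm k))" by (intro of_int_le_iff[THEN iffD2] inorm_ge)
      then show ?thesis by (simp add: jap_def)
    qed
    have lnb: "\<bar>ln (matern_lambda \<kappa> k)\<bar> * A \<le> (1 + A) * L * jap k"
    proof -
      have "\<bar>ln (matern_lambda \<kappa> k)\<bar> \<le> L * jap k"
        using L(2)[of k] mult_left_mono[OF sq, of L] L(1) by linarith
      then have "\<bar>ln (matern_lambda \<kappa> k)\<bar> * A \<le> (L * jap k) * (1 + A)" using A L by (intro mult_mono) auto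
      then show ?thesis by (simp add: mult_ac)
    qed
    \<comment> \<open>The mode contributes a constant to the first derivative of the exponent, so
      only the empty list gives a nonzero term.\<close>
    have p2: "norm (pderivs \<beta> (\<lambda>x. - real_of_int (k $ i) *\<^sub>R (2 * pi * \<i>)) x) \<le> 2 * pi * jap k" for \<beta> i
    proof (cases \<beta> rule: rev_cases)
      case Nil
      then show ?thesis using ki[of i] by (simp add: norm_mult)
    next
      case (snoc \<gamma> j)
      then show ?thesis by (simp add: pderivs_snoc)
    qed
    have "norm (pderivs \<alpha> (\<lambda>x. exp (?\<theta> x)) x) \<le> 2 ^ (?n\<^sup>2) * (D * jap k) ^ ?n * norm (exp (?\<theta> x))"
    proof (rule pderivs_exp_bound)
      show "smooth ?\<theta>" by (intro smooth_add s1 s2)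
      show "1 \<le> D * jap k" using D jap_ge_1[of k] mult_mono[of 1 D 1 "jap k"] by simp
      fix i :: 'd and \<beta> :: "'d list" assume l: "length \<beta> < ?n"
      have "pderiv_at i (\<lambda>x. (lattice_vec (- k) \<bullet> x) *\<^sub>R (2 * pi * \<i>)) = (\<lambda>x. (lattice_vec (- k) $ i) *\<^sub>R (2 * pi * \<i>))"
        by (rule ext, rule has_pderiv_pderiv_at) (intro has_pderiv_linear[OF bounded_linear_scaleR_left] has_pderiv_inner)
      then have "pderiv_at i ?\<theta> = (\<lambda>x. pderiv_at i (\<lambda>x. ?l * complex_of_real (m x)) x + (- real_of_int (k $ i)) *\<^sub>R (2 * pi * \<i>))"
        unfolding pderiv_at_add[OF s1 s2] by simp
      then have "pderivs \<beta> (pderiv_at i ?\<theta>) x = pderivs (\<beta> @ [i]) (\<lambda>x. ?l * complex_of_real (m x)) x +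
          pderivs \<beta> (\<lambda>x. (- real_of_int (k $ i)) *\<^sub>R (2 * pi * \<i>)) x"
        using pderivs_add[OF smooth_pderiv_at[OF s1, of i] smooth_const[of "(- real_of_int (k $ i)) *\<^sub>R (2 * pi * \<i>)"], of \<beta>]
        by (simp only: pderivs_snoc)
      also have "norm \<dots> \<le> \<bar>ln (matern_lambda \<kappa> k)\<bar> * A + 2 * pi * jap k"
      proof (intro norm_triangle_le add_mono p2)
        show "norm (pderivs (\<beta> @ [i]) (\<lambda>x. ?l * complex_of_real (m x)) x) \<le> \<bar>ln (matern_lambda \<kappa> k)\<bar> * A"
          unfolding pderivs_cmult[OF s] using A(2)[of "\<beta> @ [i]" x] l by (simp add: norm_mult mult_left_mono)
      qed
      also have "\<dots> \<le> D * jap k" using lnb by (simp add: D_def distrib_right)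
      finally show "norm (pderivs \<beta> (pderiv_at i ?\<theta>) x) \<le> D * jap k" .
    qed simp
    moreover have "norm (exp (?\<theta> x)) = norm (sym k x)" by (simp only: norm_bas[symmetric] fun_cong[OF bas, of x])
    ultimately have "norm (pderivs \<alpha> (bas k) x) \<le> 2 ^ (?n\<^sup>2) * (D * jap k) ^ ?n * norm (sym k x)"
      by (simp only: bas[symmetric])
    then show ?thesis by (simp only: power_mult_distrib mult_ac)
  qed
  moreover have "2 ^ (?n\<^sup>2) * D ^ ?n > 0" using D by simp
  ultimately show ?thesis by blast
qed

abbreviation H :: "real^'d \<Rightarrow> real" where
  "H x \<equiv> m x - real CARD('d) / 2"

definition blk :: "nat \<Rightarrow> 'w \<Rightarrow> real^'d \<Rightarrow> complex" where
  "blk j \<omega> x = (\<Sum>k\<in>shell j. xi k \<omega> * bas k x)"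

lemma torus_smooth_blk: "torus_smooth (blk j \<omega>)"
  unfolding blk_def[abs_def] by (intro torus_smooth_sum torus_smooth_cmult torus_smooth_bas)

lemma smooth_bas: "smooth (bas k)" and smooth_blk: "smooth (blk j \<omega>)"
  using torus_smooth_bas torus_smooth_blk by (auto simp: torus_smooth_iff)

lemma pderivs_blk: "pderivs \<alpha> (blk j \<omega>) x = (\<Sum>k\<in>shell j. xi k \<omega> * pderivs \<alpha> (bas k) x)"
  unfolding blk_def[abs_def] using pderivs_sum[of "shell j" "\<lambda>k x. xi k \<omega> * bas k x" \<alpha>] smooth_bas
  by (simp add: smooth_cmult pderivs_cmult)

lemma shell_powr_bound:
  "\<exists>C>0. \<forall>j k x. k \<in> shell j \<longrightarrow> norm (sym k x) \<le> C * 2 powr (- real j * m x)"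
proof -
  obtain C where C: "C > 0" "\<And>k x. norm (sym k x) \<le> C * jap k powr (- m x)" using norm_sym_bounds by blast
  obtain N :: nat where N: "\<And>x. \<bar>m x\<bar> \<le> real N" using m_bounded by blast
  have "norm (sym k x) \<le> (C * 2 powr N) * 2 powr (- real j * m x)" if k: "k \<in> shell j" for j k x
  proof -
    define r where "r = jap k / 2 ^ j"
    have r: "1 \<le> r" "r \<le> 2" "jap k = r * 2 ^ j" using shell_jap[OF k] by (auto simp: r_def field_simps)
    have "r powr (- m x) \<le> r powr N" using N[of x] r by (intro powr_mono) auto
    also have "\<dots> \<le> 2 powr N" using r by (intro powr_mono2) auto
    finally have rp: "r powr (- m x) \<le> 2 powr N" .
    have "jap k powr (- m x) = r powr (- m x) * 2 powr (- real j * m x)"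
      using r by (simp add: powr_mult powr_realpow[symmetric] powr_powr)
    also have "\<dots> \<le> 2 powr N * 2 powr (- real j * m x)" using rp by (intro mult_right_mono) auto
    finally have "C * jap k powr (- m x) \<le> C * (2 powr N * 2 powr (- real j * m x))" using C(1) by simp
    then show ?thesis by (intro order.trans[OF C(2)]) (simp add: mult.assoc)
  qed
  moreover have "C * 2 powr N > 0" using C by simp
  ultimately show ?thesis by blast
qed

text \<open>About \<open>2 ^ (j * d)\<close> frequencies contribute, each with square of order
  \<open>2 powr (2 * j * (length \<alpha> - m x))\<close>. The number of frequencies shifts m(x) to
  H(x).\<close>

lemma blk_variance:
  "\<exists>C>0. \<forall>j x. (\<Sum>k\<in>shell j. (norm (pderivs \<alpha> (bas k) x))\<^sup>2) \<le> C * 2 powr (2 * real j * (length \<alpha> - H x))"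
proof -
  let ?n = "length \<alpha>" and ?d = "CARD('d)"
  obtain C1 where C1: "C1 > 0" "\<And>k x. norm (pderivs \<alpha> (bas k) x) \<le> C1 * jap k ^ ?n * norm (sym k x)"
    using pderivs_bas_bound by blast
  obtain C2 where C2: "C2 > 0" "\<And>j k x. k \<in> shell j \<Longrightarrow> norm (sym k x) \<le> C2 * 2 powr (- real j * m x)"
    using shell_powr_bound by blast
  have "(\<Sum>k\<in>shell j. (norm (pderivs \<alpha> (bas k) x))\<^sup>2) \<le> (4 ^ ?d * (C1 * 2 ^ ?n * C2)\<^sup>2) * 2 powr (2 * real j * (?n - H x))" for j x
  proof -
    let ?B = "(C1 * 2 ^ ?n * C2) * (2 powr (real j * ?n) * 2 powr (- real j * m x))"
    have "norm (pderivs \<alpha> (bas k) x) \<le> ?B" if k: "k \<in> shell j" for k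
    proof -
      have "norm (pderivs \<alpha> (bas k) x) \<le> C1 * jap k ^ ?n * norm (sym k x)" by (rule C1)
      also have "\<dots> \<le> C1 * (2 ^ (j + 1)) ^ ?n * (C2 * 2 powr (- real j * m x))"
        using shell_jap[OF k] C1(1) C2(2)[OF k] by (intro mult_mono mult_left_mono power_mono) auto
      also have "(2 ^ (j + 1)) ^ ?n = 2 ^ ?n * 2 powr (real j * ?n)"
        by (simp add: power_mult_distrib powr_realpow[symmetric] powr_powr)
      finally show ?thesis by (simp add: mult_ac)
    qed
    then have "(\<Sum>k\<in>shell j. (norm (pderivs \<alpha> (bas k) x))\<^sup>2) \<le> real (card (shell j :: (int^'d) set)) * ?B\<^sup>2"
      by (intro sum_bounded_above power_mono) auto
    also have "\<dots> \<le> (4 ^ ?d * (2 ^ j) ^ ?d) * ?B\<^sup>2" using shell_finite_card by (intro mult_right_mono) auto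
    also have "(2 ^ j) ^ ?d = 2 powr (real j * ?d)" by (simp add: powr_realpow[symmetric] powr_powr)
    also have "?B\<^sup>2 = (C1 * 2 ^ ?n * C2)\<^sup>2 * 2 powr (2 * (real j * ?n + - real j * m x))"
      by (simp only: power_mult_distrib powr_add[symmetric]) (simp add: powr_power mult.commute)
    also have "4 ^ ?d * 2 powr (real j * ?d) * ((C1 * 2 ^ ?n * C2)\<^sup>2 * 2 powr (2 * (real j * ?n + - real j * m x))) =
       (4 ^ ?d * (C1 * 2 ^ ?n * C2)\<^sup>2) * 2 powr (real j * ?d + 2 * (real j * ?n + - real j * m x))"
      by (simp only: powr_add mult_ac)
    also have "real j * ?d + 2 * (real j * ?n + - real j * m x) = 2 * real j * (?n - H x)"
      by (simp add: algebra_simps)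
    finally show ?thesis .
  qed
  moreover have "4 ^ ?d * (C1 * 2 ^ ?n * C2)\<^sup>2 > 0" using C1 C2 by simp
  ultimately show ?thesis by blast
qed

text \<open>The exponent \<open>E\<close> collects the number of frequencies, the growth of the
  noise, the derivatives and the symbol. It does not depend on \<omega>, which allows the mesh of
  the grid to be fixed before the random constant is known.\<close>

lemma blk_crude_bound:
  "\<exists>E::nat. \<forall>\<omega>. xi_growth \<omega> \<longrightarrow> (\<exists>C>0. \<forall>j x. norm (pderivs \<alpha> (blk j \<omega>) x) \<le> C * 2 ^ (j * E))"
proof -
  let ?n = "length \<alpha>" and ?d = "CARD('d)"
  obtain C1 where C1: "C1 > 0" "\<And>k x. norm (pderivs \<alpha> (bas k) x) \<le> C1 * jap k ^ ?n * norm (sym k x)"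
    using pderivs_bas_bound by blast
  obtain C2 N where C2: "C2 > 0" "\<And>k x. norm (sym k x) \<le> C2 * jap k ^ N" using sym_poly_bound by blast
  let ?E = "?d + 1 + ?n + N"
  show ?thesis
  proof (intro exI[of _ "?d + ?E"] allI impI)
    fix \<omega> assume "xi_growth \<omega>"
    then obtain C where C: "C > 0" "\<And>k. norm (xi k \<omega>) \<le> C * jap k ^ (?d + 1)" by (auto simp: xi_growth_def)
    let ?K = "C * C1 * C2"
    have "norm (pderivs \<alpha> (blk j \<omega>) x) \<le> (4 ^ ?d * (?K * 2 ^ ?E)) * 2 ^ (j * (?d + ?E))" for j x
    proof -
      have "norm (xi k \<omega> * pderivs \<alpha> (bas k) x) \<le> ?K * (2 ^ (j + 1)) ^ ?E" if k: "k \<in> shell j" for k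
      proof -
        have "norm (xi k \<omega> * pderivs \<alpha> (bas k) x) \<le> (C * jap k ^ (?d + 1)) * (C1 * jap k ^ ?n * (C2 * jap k ^ N))"
          unfolding norm_mult using C C1 C2
          by (intro mult_mono order.trans[OF C1(2)] mult_left_mono) auto
        also have "\<dots> = ?K * jap k ^ ?E" by (simp add: power_add mult_ac)
        also have "\<dots> \<le> ?K * (2 ^ (j + 1)) ^ ?E"
          using shell_jap[OF k] C C1 C2 by (intro mult_left_mono power_mono) auto
        finally show ?thesis .
      qed
      then have "norm (pderivs \<alpha> (blk j \<omega>) x) \<le> real (card (shell j :: (int^'d) set)) * (?K * (2 ^ (j + 1)) ^ ?E)"
        unfolding pderivs_blk by (intro order.trans[OF norm_sum] sum_bounded_above)
      also have "\<dots> \<le> (4 ^ ?d * (2 ^ j) ^ ?d) * (?K * (2 ^ (j + 1)) ^ ?E)"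
        using shell_finite_card C C1 C2 by (intro mult_right_mono) auto
      also have "\<dots> = (4 ^ ?d * (?K * 2 ^ ?E)) * ((2 ^ j) ^ ?d * (2 ^ j) ^ ?E)"
        by (simp only: power_mult_distrib power_add[of 2 j 1] power_one_right mult_ac)
      also have "(2 ^ j) ^ ?d * (2 ^ j) ^ ?E = (2::real) ^ (j * (?d + ?E))" by (simp only: power_add[symmetric] power_mult)
      finally show ?thesis .
    qed
    moreover have "4 ^ ?d * (?K * 2 ^ ?E) > 0" using C C1 C2 by simp
    ultimately show "\<exists>C>0. \<forall>j x. norm (pderivs \<alpha> (blk j \<omega>) x) \<le> C * 2 ^ (j * (?d + ?E))" by blast
  qed
qed

end


section \<open>Uniform bounds for the dyadic blocks\<close>

context matern_noise
begin

definition blk_ok :: "'d list \<Rightarrow> real \<Rightarrow> 'w \<Rightarrow> bool" where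
  "blk_ok \<alpha> \<epsilon> \<omega> \<longleftrightarrow> (\<exists>C>0. \<forall>j x. norm (pderivs \<alpha> (blk j \<omega>) x) \<le> C * 2 powr (real j * (length \<alpha> - H x + \<epsilon>)))"

text \<open>For fixed \<open>x\<close> the derivative of the block is almost surely a single value
  of the noise, at the test function with Fourier coefficients
  \<open>pderivs \<alpha> (bas k) x\<close>. Its variance is the sum of their squares, by
  Parseval.\<close>

lemma blk_moment:
  "\<exists>C\<ge>0. \<forall>j x. integrable M (\<lambda>\<omega>. norm (pderivs \<alpha> (blk j \<omega>) x) ^ (2 * p)) \<and>
     expectation (\<lambda>\<omega>. norm (pderivs \<alpha> (blk j \<omega>) x) ^ (2 * p)) \<le> C * 2 powr (2 * real p * (real j * (length \<alpha> - H x)))"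
proof -
  obtain Cv where Cv: "Cv > 0" "\<And>j x. (\<Sum>k\<in>shell j. (norm (pderivs \<alpha> (bas k) x))\<^sup>2) \<le> Cv * 2 powr (2 * real j * (length \<alpha> - H x))"
    using blk_variance by blast
  obtain C where C: "C \<ge> 0" "\<And>\<psi>. torus_smooth \<psi> \<Longrightarrow> integrable M (\<lambda>\<omega>. norm (W \<psi> \<omega>) ^ (2 * p))"
    "\<And>\<psi>. torus_smooth \<psi> \<Longrightarrow> expectation (\<lambda>\<omega>. norm (W \<psi> \<omega>) ^ (2 * p)) \<le> C * (\<integral>x. (norm (\<psi> x))\<^sup>2 \<partial>torus_measure) ^ p"
    using W_moment[of p] by blast
  have "integrable M (\<lambda>\<omega>. norm (pderivs \<alpha> (blk j \<omega>) x) ^ (2 * p)) \<and>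
     expectation (\<lambda>\<omega>. norm (pderivs \<alpha> (blk j \<omega>) x) ^ (2 * p)) \<le> (C * Cv ^ p) * 2 powr (2 * real p * (real j * (length \<alpha> - H x)))" for j x
  proof -
    let ?\<psi> = "\<lambda>y. \<Sum>k\<in>shell j. pderivs \<alpha> (bas k) x * fourier_mode k y"
    have s: "torus_smooth ?\<psi>" by (rule torus_smooth_block)
    note [measurable] = W_measurable[OF s] W_measurable[OF torus_smooth_fourier_mode]
    have [measurable]: "(\<lambda>\<omega>. pderivs \<alpha> (blk j \<omega>) x) \<in> borel_measurable M" unfolding pderivs_blk by measurable
    have ae: "AE \<omega> in M. norm (W ?\<psi> \<omega>) ^ (2 * p) = norm (pderivs \<alpha> (blk j \<omega>) x) ^ (2 * p)"
      using W_sum[where F = "shell j" and \<phi> = fourier_mode and c = "\<lambda>k. pderivs \<alpha> (bas k) x", OF finite_shell torus_smooth_fourier_mode]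
      by eventually_elim (simp add: pderivs_blk mult.commute)
    have "integrable M (\<lambda>\<omega>. norm (pderivs \<alpha> (blk j \<omega>) x) ^ (2 * p)) \<longleftrightarrow> integrable M (\<lambda>\<omega>. norm (W ?\<psi> \<omega>) ^ (2 * p))"
      by (rule integrable_cong_AE) (use ae in auto)
    moreover have "expectation (\<lambda>\<omega>. norm (pderivs \<alpha> (blk j \<omega>) x) ^ (2 * p)) = expectation (\<lambda>\<omega>. norm (W ?\<psi> \<omega>) ^ (2 * p))"
      by (rule integral_cong_AE) (use ae in auto)
    moreover have "expectation (\<lambda>\<omega>. norm (W ?\<psi> \<omega>) ^ (2 * p)) \<le> (C * Cv ^ p) * 2 powr (2 * real p * (real j * (length \<alpha> - H x)))"
    proof -
      have "expectation (\<lambda>\<omega>. norm (W ?\<psi> \<omega>) ^ (2 * p)) \<le> C * (\<Sum>k\<in>shell j. (norm (pderivs \<alpha> (bas k) x))\<^sup>2) ^ p"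
        using C(3)[OF s] unfolding norm_square_integral_fourier_sum[OF finite_shell] .
      also have "\<dots> \<le> C * (Cv * 2 powr (2 * real j * (length \<alpha> - H x))) ^ p"
        by (intro mult_left_mono power_mono Cv C sum_nonneg) auto
      also have "\<dots> = (C * Cv ^ p) * 2 powr (2 * real p * (real j * (length \<alpha> - H x)))"
        by (simp add: power_mult_distrib powr_power mult_ac)
      finally show ?thesis .
    qed
    ultimately show ?thesis using C(2)[OF s] by simp
  qed
  moreover have "C * Cv ^ p \<ge> 0" using C Cv by simp
  ultimately show ?thesis by blast
qed

text \<open>The supremum of a block is controlled by a union bound over the grid of mesh \<open>2 ^ (- q j)\<close>, for which
  Gaussian moments of a high order \<open>2 p\<close> are affordable; between the grid points the crude bound
  \<open>blk_crude_bound\<close> on the next derivatives suffices.\<close>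

lemma AE_blk_ok:
  assumes \<epsilon>: "\<epsilon> > 0"
  shows "AE \<omega> in M. blk_ok \<alpha> \<epsilon> \<omega>"
proof -
  let ?n = "length \<alpha>" and ?d = "CARD('d)"
  have "\<forall>i. \<exists>E::nat. \<forall>\<omega>. xi_growth \<omega> \<longrightarrow> (\<exists>C>0. \<forall>j x. norm (pderivs (i # \<alpha>) (blk j \<omega>) x) \<le> C * 2 ^ (j * E))"
    using blk_crude_bound by blast
  then obtain Ef :: "'d \<Rightarrow> nat" where Ef: "\<And>i \<omega>. xi_growth \<omega> \<Longrightarrow> \<exists>C>0. \<forall>j x. norm (pderivs (i # \<alpha>) (blk j \<omega>) x) \<le> C * 2 ^ (j * Ef i)"
    by metis
  define E where "E = (\<Sum>i\<in>UNIV. Ef i)"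
  obtain N :: nat where N: "\<And>x. \<bar>m x\<bar> \<le> real N" using m_bounded by blast
  have sm: "smooth m" "periodic_on UNIV m" using m_smooth by (auto simp: torus_smooth_iff)
  obtain L where L: "L \<ge> 0" "\<And>\<beta> x. length \<beta> \<le> 1 \<Longrightarrow> norm (pderivs \<beta> m x) \<le> L"
    using torus_smooth_pderivs_bounded[OF m_smooth] by blast
  have lip: "\<bar>m y - m x\<bar> \<le> L * (\<Sum>i\<in>UNIV. \<bar>y $ i - x $ i\<bar>)" for x y
    using smooth_lipschitz[OF sm(1), of L y x] L(2)[of "[_]"] by simp
  \<comment> \<open>Within a mesh cell the gradient bound contributes
    \<open>2 ^ (j * E) / 2 ^ (q * j)\<close>, that is 2 to the power - j (N + 1). This is below the
    target bound because the target exponent \<open>s\<close> is at least - N.\<close>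
  define q where "q = E + N + 1"
  \<comment> \<open>The grid has 2 to the power q d j points and a moment of order 2 p gains 2 to
    the power - 2 p \<epsilon> j at each of them, so 2 p \<epsilon> >= q d + 1 leaves a summable
    factor 2 to the power - j.\<close>
  obtain p' :: nat where p': "(real (q * ?d) + 1) / (2 * \<epsilon>) \<le> real p'" using real_arch_simple by blast
  define p where "p = Suc p'"
  have p: "real (q * ?d) + 1 \<le> 2 * real p * \<epsilon>"
  proof -
    have "real (q * ?d) + 1 \<le> real p' * (2 * \<epsilon>)" using p' \<epsilon> by (simp add: pos_divide_le_eq)
    also have "\<dots> \<le> 2 * real p * \<epsilon>" using \<epsilon> by (simp add: p_def algebra_simps)
    finally show ?thesis .
  qed
  obtain Cm where Cm: "Cm \<ge> 0" "\<And>j x. integrable M (\<lambda>\<omega>. norm (pderivs \<alpha> (blk j \<omega>) x) ^ (2 * p))"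
    "\<And>j x. expectation (\<lambda>\<omega>. norm (pderivs \<alpha> (blk j \<omega>) x) ^ (2 * p)) \<le> Cm * 2 powr (2 * real p * (real j * (?n - H x)))"
    using blk_moment[of \<alpha> p] by blast
  define pt where "pt = (\<lambda>j (r::int^'d). (\<chi> i. real_of_int (r $ i) / 2 ^ (q * j)) :: real^'d)"
  define R where "R = (\<lambda>j. {r::int^'d. \<forall>i. r $ i \<in> {0..<2 ^ (q * j)}})"
  have finR: "finite (R j)" and cardR: "card (R j) = (2 ^ (q * j)) ^ ?d" for j
    unfolding R_def using card_vec_box[of "\<lambda>_::'d. {0..<2 ^ (q * j) :: int}"] by (auto simp: nat_power_eq)
  define s where "s = (\<lambda>x. real ?n - H x + \<epsilon>)"
  define Y where "Y = (\<lambda>j \<omega>. \<Sum>r\<in>R j. norm (pderivs \<alpha> (blk j \<omega>) (pt j r)) ^ (2 * p) * 2 powr (- (2 * real p * (real j * s (pt j r)))))"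
  have "AE \<omega> in M. \<exists>C>0. \<forall>j. Y j \<omega> \<le> C"
  proof (rule AE_bounded_sequence[where A = Cm])
    show "integrable M (Y j)" for j unfolding Y_def using Cm(2) by auto
    show "Y j \<omega> \<ge> 0" for j \<omega> unfolding Y_def by (intro sum_nonneg mult_nonneg_nonneg) auto
    show "expectation (Y j) \<le> Cm * (1 / 2) ^ j" for j
    proof -
      have t: "expectation (\<lambda>\<omega>. norm (pderivs \<alpha> (blk j \<omega>) x) ^ (2 * p)) * 2 powr (- (2 * real p * (real j * s x))) \<le>
          Cm * 2 powr (- (2 * real p * \<epsilon> * real j))" for x
      proof -
        have "expectation (\<lambda>\<omega>. norm (pderivs \<alpha> (blk j \<omega>) x) ^ (2 * p)) * 2 powr (- (2 * real p * (real j * s x))) \<le>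
            Cm * 2 powr (2 * real p * (real j * (?n - H x))) * 2 powr (- (2 * real p * (real j * s x)))"
          by (intro mult_right_mono Cm) auto
        also have "\<dots> = Cm * 2 powr (- (2 * real p * \<epsilon> * real j))"
          unfolding mult.assoc[of Cm] powr_add[symmetric] by (simp add: s_def algebra_simps)
        finally show ?thesis .
      qed
      have "expectation (Y j) = (\<Sum>r\<in>R j. expectation (\<lambda>\<omega>. norm (pderivs \<alpha> (blk j \<omega>) (pt j r)) ^ (2 * p)) *
          2 powr (- (2 * real p * (real j * s (pt j r)))))"
        unfolding Y_def using Cm(2) by simp
      also have "\<dots> \<le> real (card (R j)) * (Cm * 2 powr (- (2 * real p * \<epsilon> * real j)))"
        by (intro sum_bounded_above t)
      also have "real (card (R j)) = 2 powr (real (q * ?d) * real j)"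
        by (simp add: cardR powr_realpow[symmetric] powr_powr mult_ac)
      also have "2 powr (real (q * ?d) * real j) * (Cm * 2 powr (- (2 * real p * \<epsilon> * real j))) =
          Cm * 2 powr ((real (q * ?d) - 2 * real p * \<epsilon>) * real j)"
      proof -
        have "2 powr u * (Cm * 2 powr (- v)) = Cm * 2 powr (u + - v)" for u v :: real by (simp only: powr_add mult_ac)
        then show ?thesis by (simp add: left_diff_distrib)
      qed
      also have "\<dots> \<le> Cm * 2 powr (- real j)"
      proof -
        have "(real (q * ?d) - 2 * real p * \<epsilon>) * real j \<le> (- 1) * real j" using p by (intro mult_right_mono) auto
        then show ?thesis using Cm(1) by (intro mult_left_mono powr_mono) auto
      qed
      also have "2 powr (- real j) = (1 / 2) ^ j" by (simp add: powr_minus_divide powr_realpow power_one_over)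
      finally show ?thesis .
    qed
  qed
  then show ?thesis using xi_growth
  proof eventually_elim
    fix \<omega> assume "\<exists>C>0. \<forall>j. Y j \<omega> \<le> C" and gr: "xi_growth \<omega>"
    then obtain C where C: "C > 0" "\<And>j. Y j \<omega> \<le> C" by blast
    have "\<forall>i. \<exists>C>0. \<forall>j x. norm (pderivs (i # \<alpha>) (blk j \<omega>) x) \<le> C * 2 ^ (j * Ef i)" using Ef[OF gr] by blast
    then obtain Cf where Cf: "\<And>i. Cf i > 0" "\<And>i j x. norm (pderivs (i # \<alpha>) (blk j \<omega>) x) \<le> Cf i * 2 ^ (j * Ef i)" by metis
    define C' where "C' = (\<Sum>i\<in>UNIV. Cf i)"
    have C': "C' \<ge> 0" unfolding C'_def using Cf by (intro sum_nonneg) (auto intro: less_imp_le)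
    have grad: "norm (pderiv_at i (pderivs \<alpha> (blk j \<omega>)) x) \<le> C' * 2 ^ (j * E)" for i j x
    proof -
      have "Cf i \<le> C'" unfolding C'_def by (rule member_le_sum) (use Cf in \<open>auto intro: less_imp_le\<close>)
      moreover have "Ef i \<le> E" unfolding E_def by (rule member_le_sum) auto
      ultimately have "Cf i * 2 ^ (j * Ef i) \<le> C' * 2 ^ (j * E)" using C'
        by (intro mult_mono power_increasing mult_left_mono) auto
      then show ?thesis using Cf(2)[of i j x] by simp
    qed
    have sm_blk: "smooth (pderivs \<alpha> (blk j \<omega>))" "periodic_on UNIV (pderivs \<alpha> (blk j \<omega>))" for j
      using torus_smooth_pderivs[OF torus_smooth_blk] by (auto simp: torus_smooth_iff)
    let ?C = "(1 + C) * 2 powr (L * ?d) + C' * ?d"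
    have main: "norm (pderivs \<alpha> (blk j \<omega>) y) \<le> ?C * 2 powr (real j * s y)" if y: "y \<in> half_cell" for j y
    proof -
      define r :: "int^'d" where "r = (\<chi> i. \<lfloor>2 ^ (q * j) * y $ i\<rfloor>)"
      have r: "r \<in> R j"
      proof -
        have "0 \<le> r $ i \<and> r $ i < 2 ^ (q * j)" for i
        proof -
          have "0 \<le> y $ i" "y $ i < 1" using y by (auto simp: half_cell_def)
          then have "0 \<le> 2 ^ (q * j) * y $ i" "2 ^ (q * j) * y $ i < of_int (2 ^ (q * j))" by (auto simp: mult_less_cancel_left1)
          then show ?thesis unfolding r_def by (simp add: floor_less_iff)
        qed
        then show ?thesis by (simp add: R_def)
      qed
      let ?x = "pt j r"
      have close: "(\<Sum>i\<in>UNIV. \<bar>y $ i - ?x $ i\<bar>) \<le> ?d / 2 ^ (q * j)"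
      proof -
        have "\<bar>y $ i - ?x $ i\<bar> \<le> 1 / 2 ^ (q * j)" for i
        proof -
          let ?z = "2 ^ (q * j) * y $ i"
          have "y $ i - ?x $ i = (?z - of_int \<lfloor>?z\<rfloor>) / 2 ^ (q * j)" by (simp add: pt_def r_def diff_divide_distrib)
          moreover have "0 \<le> ?z - of_int \<lfloor>?z\<rfloor>" "?z - of_int \<lfloor>?z\<rfloor> \<le> 1" by linarith+
          ultimately show ?thesis by (simp add: divide_right_mono)
        qed
        then have "(\<Sum>i\<in>UNIV. \<bar>y $ i - ?x $ i\<bar>) \<le> of_nat (card (UNIV :: 'd set)) * (1 / 2 ^ (q * j))" by (intro sum_bounded_above) auto
        then show ?thesis by simp
      qed
      define a where "a = norm (pderivs \<alpha> (blk j \<omega>) ?x)"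
      have A1: "a \<le> (1 + C) * 2 powr (real j * s ?x)"
      proof -
        let ?w = "2 powr (- (real j * s ?x))"
        have "(a * ?w) ^ (2 * p) = a ^ (2 * p) * 2 powr (- (2 * real p * (real j * s ?x)))"
          by (simp add: power_mult_distrib powr_power mult_ac)
        also have "\<dots> \<le> Y j \<omega>"
          unfolding Y_def a_def
          by (rule member_le_sum[where i = r and f = "\<lambda>r. norm (pderivs \<alpha> (blk j \<omega>) (pt j r)) ^ (2 * p) * 2 powr (- (2 * real p * (real j * s (pt j r))))"])
            (use r finR in auto)
        also have "\<dots> \<le> (1 + C) ^ 1" using C(2)[of j] by simp
        also have "\<dots> \<le> (1 + C) ^ (2 * p)" using C(1) by (intro power_increasing) (auto simp: p_def)
        finally have "(a * ?w) ^ Suc (2 * p - 1) \<le> (1 + C) ^ Suc (2 * p - 1)" by (simp add: p_def)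
        then have "a * ?w \<le> 1 + C" by (rule power_le_imp_le_base) (use C in auto)
        then have "a * ?w * 2 powr (real j * s ?x) \<le> (1 + C) * 2 powr (real j * s ?x)" by (intro mult_right_mono) auto
        then show ?thesis by (simp add: mult.assoc powr_add[symmetric])
      qed
      \<comment> \<open>The exponent may be read at the grid point instead of at \<open>y\<close>: m
        is Lipschitz, the points differ by at most \<open>2 ^ (- q * j)\<close> per coordinate, and
        j times this stays bounded.\<close>
      have A2: "real j * s ?x \<le> L * ?d + real j * s y"
      proof -
        have "real j \<le> 2 ^ (q * j)"
        proof -
          have "real j \<le> 2 ^ j" using of_nat_less_two_power[of j, where 'a = real] by (rule less_imp_le)
          also have "\<dots> \<le> 2 ^ (q * j)" by (intro power_increasing) (auto simp: q_def)
          finally show ?thesis .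
        qed
        then have jq: "real j / 2 ^ (q * j) \<le> 1" by (simp add: pos_divide_le_eq)
        have "s ?x - s y \<le> L * (?d / 2 ^ (q * j))"
        proof -
          have "s ?x - s y = m y - m ?x" by (simp add: s_def)
          also have "\<dots> \<le> L * (\<Sum>i\<in>UNIV. \<bar>y $ i - ?x $ i\<bar>)" using lip[of y ?x] by linarith
          also have "\<dots> \<le> L * (?d / 2 ^ (q * j))" using close L(1) by (intro mult_left_mono)
          finally show ?thesis .
        qed
        then have "real j * (s ?x - s y) \<le> real j * (L * (?d / 2 ^ (q * j)))" by (intro mult_left_mono) auto
        also have "\<dots> = L * ?d * (real j / 2 ^ (q * j))" by simp
        also have "\<dots> \<le> L * ?d * 1" using jq L(1) by (intro mult_left_mono) auto
        finally show ?thesis by (simp add: right_diff_distrib)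
      qed
      have A3: "norm (pderivs \<alpha> (blk j \<omega>) y - pderivs \<alpha> (blk j \<omega>) ?x) \<le> C' * ?d * 2 powr (real j * s y)"
      proof -
        have "norm (pderivs \<alpha> (blk j \<omega>) y - pderivs \<alpha> (blk j \<omega>) ?x) \<le> C' * 2 ^ (j * E) * (\<Sum>i\<in>UNIV. \<bar>y $ i - ?x $ i\<bar>)"
          by (rule smooth_lipschitz[OF sm_blk(1) grad])
        also have "\<dots> \<le> C' * 2 ^ (j * E) * (?d / 2 ^ (q * j))" using close C' by (intro mult_left_mono) auto
        also have "\<dots> = C' * ?d * (2 ^ (j * E) / 2 ^ (q * j))" by simp
        also have "2 ^ (j * E) / 2 ^ (q * j) = (2::real) powr (real j * (real E - real q))"
          by (simp add: right_diff_distrib powr_diff powr_realpow[symmetric] mult_ac)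
        also have "C' * ?d * \<dots> \<le> C' * ?d * 2 powr (real j * s y)"
        proof -
          have "real E - real q \<le> s y" using N[of y] \<epsilon> by (simp add: q_def s_def)
          then have "real j * (real E - real q) \<le> real j * s y" by (intro mult_left_mono) auto
          from mult_left_mono[OF powr_mono[OF this, of 2], of "C' * ?d"] show ?thesis using C' by simp
        qed
        finally show ?thesis .
      qed
      have "norm (pderivs \<alpha> (blk j \<omega>) y) \<le> a + norm (pderivs \<alpha> (blk j \<omega>) y - pderivs \<alpha> (blk j \<omega>) ?x)"
        unfolding a_def using norm_triangle_sub[of "pderivs \<alpha> (blk j \<omega>) y"] by (simp add: add.commute)
      also have "\<dots> \<le> (1 + C) * 2 powr (L * ?d + real j * s y) + C' * ?d * 2 powr (real j * s y)"
        using A1 A2 A3 C(1) by (intro add_mono order.trans[OF A1] mult_left_mono powr_mono) auto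
      also have "\<dots> = ?C * 2 powr (real j * s y)" by (simp add: powr_add distrib_right)
      finally show ?thesis .
    qed
    have "norm (pderivs \<alpha> (blk j \<omega>) x) \<le> ?C * 2 powr (real j * s x)" for j x
    proof -
      let ?y = "x - lattice_vec (floor_vec x)"
      have "s ?y = s x" using periodic_frac[OF sm(2), of x] by (simp add: s_def)
      then show ?thesis using main[OF half_cell_frac[of x], of j] periodic_frac[OF sm_blk(2)[of j], of x] by simp
    qed
    moreover have "?C > 0" using C C' by (intro add_pos_nonneg mult_pos_pos) auto
    ultimately show "blk_ok \<alpha> \<epsilon> \<omega>" unfolding blk_ok_def s_def by blast
  qed
qed

text \<open>Only \<epsilon> = 1 / (e + 1) is used, so that a single null set serves all derivatives
  and all positive \<epsilon>.\<close>

definition good :: "'w \<Rightarrow> bool" where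
  "good \<omega> \<longleftrightarrow> xi_growth \<omega> \<and> (\<forall>\<alpha>. \<forall>e::nat. blk_ok \<alpha> (1 / real (Suc e)) \<omega>)"

lemma AE_good: "AE \<omega> in M. good \<omega>"
proof -
  have "AE \<omega> in M. \<forall>\<alpha>. \<forall>e::nat. blk_ok \<alpha> (1 / real (Suc e)) \<omega>"
    unfolding AE_all_countable by (auto intro: AE_blk_ok)
  with xi_growth show ?thesis by eventually_elim (simp add: good_def)
qed

section \<open>The continuous modification\<close>

text \<open>Built from the countably many coefficients \<open>xi k\<close>, this is linear and
  continuous for every \<omega> with \<open>xi_growth\<close>, whereas the noise is linear only
  almost surely for each pair of test functions.\<close>

definition T0 :: "'w \<Rightarrow> (real^'d \<Rightarrow> complex) \<Rightarrow> complex" where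
  "T0 \<omega> \<phi> = (\<Sum>j. \<Sum>k\<in>shell j. xi k \<omega> * coef \<phi> k)"

definition g0 :: "'w \<Rightarrow> real^'d \<Rightarrow> complex" where
  "g0 \<omega> x = (\<Sum>j. blk j \<omega> x)"

text \<open>Twice the order d + 1 is demanded of the coefficients: one half absorbs the growth of
  the noise, the other half pays for the summation. The bound is linear in \<open>B\<close>, which
  is what continuity in the topology of test functions needs.\<close>

lemma T0_block_bound:
  assumes "xi_growth \<omega>"
  shows "\<exists>N K. K \<ge> 0 \<and> (\<forall>\<phi> B j. torus_smooth \<phi> \<longrightarrow> (\<forall>\<alpha> x. length \<alpha> \<le> N \<longrightarrow> norm (pderivs \<alpha> \<phi> x) \<le> B) \<longrightarrow>
    norm (\<Sum>k\<in>shell j. xi k \<omega> * coef \<phi> k) \<le> K * B * (1 / 2) ^ j)"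
proof -
  let ?d = "CARD('d)"
  obtain C where C: "C > 0" "\<And>k. norm (xi k \<omega>) \<le> C * jap k ^ (?d + 1)" using assms by (auto simp: xi_growth_def)
  obtain N C1 where C1: "C1 \<ge> 0" "\<And>\<phi> B k. torus_smooth \<phi> \<Longrightarrow> (\<forall>\<alpha> x. length \<alpha> \<le> N \<longrightarrow> norm (pderivs \<alpha> \<phi> x) \<le> B) \<Longrightarrow>
      norm (coef \<phi> k) * jap k ^ ((?d + 1) + (?d + 1)) \<le> C1 * B"
    using coef_decay[of "(?d + 1) + (?d + 1)"] by blast
  have "norm (\<Sum>k\<in>shell j. xi k \<omega> * coef \<phi> k) \<le> (4 ^ ?d * (C * C1)) * B * (1 / 2) ^ j"
    if \<phi>: "torus_smooth \<phi>" and B: "\<forall>\<alpha> x. length \<alpha> \<le> N \<longrightarrow> norm (pderivs \<alpha> \<phi> x) \<le> B" for \<phi> B j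
  proof -
    have B0: "B \<ge> 0" using order.trans[OF norm_ge_zero B[rule_format, of "[]"]] by simp
    have "norm (xi k \<omega> * coef \<phi> k) * jap k ^ (?d + 1) \<le> C * (C1 * B)" for k
    proof -
      have "norm (xi k \<omega> * coef \<phi> k) * jap k ^ (?d + 1) \<le> (C * jap k ^ (?d + 1)) * norm (coef \<phi> k) * jap k ^ (?d + 1)"
        unfolding norm_mult by (intro mult_right_mono C) auto
      also have "\<dots> = C * (norm (coef \<phi> k) * jap k ^ ((?d + 1) + (?d + 1)))" by (simp only: power_add mult_ac)
      also have "\<dots> \<le> C * (C1 * B)" using C(1) C1(2)[OF \<phi> B] by (intro mult_left_mono) auto
      finally show ?thesis .
    qed
    then have "(\<Sum>k\<in>shell j. norm (xi k \<omega> * coef \<phi> k)) \<le> 4 ^ ?d * (C * (C1 * B)) * (1 / 2) ^ j"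
      using C C1(1) B0 by (intro shell_sum_bound) auto
    then show ?thesis using norm_sum[of "\<lambda>k. xi k \<omega> * coef \<phi> k" "shell j"] by (simp only: mult_ac)
  qed
  then show ?thesis using C C1 by (intro exI[of _ N] exI[of _ "4 ^ ?d * (C * C1)"]) auto
qed

lemma T0_bound:
  assumes "xi_growth \<omega>"
  shows "\<exists>N K. K \<ge> 0 \<and> (\<forall>\<phi> B. torus_smooth \<phi> \<longrightarrow> (\<forall>\<alpha> x. length \<alpha> \<le> N \<longrightarrow> norm (pderivs \<alpha> \<phi> x) \<le> B) \<longrightarrow>
    summable (\<lambda>j. \<Sum>k\<in>shell j. xi k \<omega> * coef \<phi> k) \<and> norm (T0 \<omega> \<phi>) \<le> K * B)"
proof -
  obtain N K where K: "K \<ge> 0" "\<And>\<phi> B j. torus_smooth \<phi> \<Longrightarrow> (\<forall>\<alpha> x. length \<alpha> \<le> N \<longrightarrow> norm (pderivs \<alpha> \<phi> x) \<le> B) \<Longrightarrow>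
    norm (\<Sum>k\<in>shell j. xi k \<omega> * coef \<phi> k) \<le> K * B * (1 / 2) ^ j" using T0_block_bound[OF assms] by blast
  have "summable (\<lambda>j. \<Sum>k\<in>shell j. xi k \<omega> * coef \<phi> k) \<and> norm (T0 \<omega> \<phi>) \<le> (2 * K) * B"
    if \<phi>: "torus_smooth \<phi>" and B: "\<forall>\<alpha> x. length \<alpha> \<le> N \<longrightarrow> norm (pderivs \<alpha> \<phi> x) \<le> B" for \<phi> B
  proof -
    have g: "summable (\<lambda>j. K * B * (1 / 2) ^ j)" by (intro summable_mult summable_geometric) simp
    have "summable (\<lambda>j. \<Sum>k\<in>shell j. xi k \<omega> * coef \<phi> k)"
      by (rule summable_comparison_test'[OF g, of 0]) (rule K(2)[OF \<phi> B])
    moreover have "norm (T0 \<omega> \<phi>) \<le> (\<Sum>j. K * B * (1 / 2) ^ j)"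
      unfolding T0_def by (rule norm_suminf_le[OF K(2)[OF \<phi> B] g])
    moreover have "(\<Sum>j. K * B * (1 / 2) ^ j) = (2 * K) * B"
      by (subst suminf_mult) (auto simp: suminf_geometric summable_geometric)
    ultimately show ?thesis by simp
  qed
  then show ?thesis using K by (intro exI[of _ N] exI[of _ "2 * K"]) auto
qed

lemma T0_summable:
  assumes "xi_growth \<omega>" "torus_smooth \<phi>"
  shows "summable (\<lambda>j. \<Sum>k\<in>shell j. xi k \<omega> * coef \<phi> k)"
proof -
  from T0_bound[OF assms(1)] obtain N K where K: "K \<ge> 0 \<and> (\<forall>\<phi> B. torus_smooth \<phi> \<longrightarrow> (\<forall>\<alpha> x. length \<alpha> \<le> N \<longrightarrow> norm (pderivs \<alpha> \<phi> x) \<le> B) \<longrightarrow>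
    summable (\<lambda>j. \<Sum>k\<in>shell j. xi k \<omega> * coef \<phi> k) \<and> norm (T0 \<omega> \<phi>) \<le> K * B)" by (elim exE)
  obtain B where "\<And>\<alpha> x. length \<alpha> \<le> N \<Longrightarrow> norm (pderivs \<alpha> \<phi> x) \<le> B"
    using torus_smooth_pderivs_bounded[OF assms(2)] by blast
  then show ?thesis by (intro K[THEN conjunct2, rule_format, THEN conjunct1, OF assms(2)]) auto
qed

lemma T0_linear:
  assumes "xi_growth \<omega>" "torus_smooth \<phi>" "torus_smooth \<psi>"
  shows "T0 \<omega> (\<lambda>x. a * \<phi> x + b * \<psi> x) = a * T0 \<omega> \<phi> + b * T0 \<omega> \<psi>"
proof -
  note s = T0_summable[OF assms(1,2)] T0_summable[OF assms(1,3)]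
  have "(\<Sum>k\<in>shell j. xi k \<omega> * coef (\<lambda>x. a * \<phi> x + b * \<psi> x) k) =
      a * (\<Sum>k\<in>shell j. xi k \<omega> * coef \<phi> k) + b * (\<Sum>k\<in>shell j. xi k \<omega> * coef \<psi> k)" for j
    by (simp add: coef_linear[OF assms(2,3)] sum_distrib_left sum.distrib algebra_simps)
  then show ?thesis
    unfolding T0_def using s by (simp add: suminf_add[symmetric] suminf_mult[symmetric] summable_mult)
qed

lemma T0_distribution:
  assumes "xi_growth \<omega>"
  shows "T0 \<omega> \<in> torus_distributions"
  unfolding torus_distributions_def
proof (intro CollectI conjI ballI allI impI)
  fix \<phi> \<psi> :: "real^'d \<Rightarrow> complex" and a b assume "\<phi> \<in> test_functions" "\<psi> \<in> test_functions"
  then show "T0 \<omega> (\<lambda>x. a * \<phi> x + b * \<psi> x) = a * T0 \<omega> \<phi> + b * T0 \<omega> \<psi>"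
    using T0_linear[OF assms] by (simp add: test_functions_def)
next
  fix \<phi> :: "real^'d \<Rightarrow> complex" and \<epsilon> :: real assume \<phi>: "\<phi> \<in> test_functions" and \<epsilon>: "\<epsilon> > 0"
  from T0_bound[OF assms] obtain N K where NK: "K \<ge> 0 \<and> (\<forall>\<phi> B. torus_smooth \<phi> \<longrightarrow> (\<forall>\<alpha> x. length \<alpha> \<le> N \<longrightarrow> norm (pderivs \<alpha> \<phi> x) \<le> B) \<longrightarrow>
    summable (\<lambda>j. \<Sum>k\<in>shell j. xi k \<omega> * coef \<phi> k) \<and> norm (T0 \<omega> \<phi>) \<le> K * B)" by (elim exE)
  then have K: "K \<ge> 0" by simp
  have T0_le: "norm (T0 \<omega> \<phi>) \<le> K * B" if "torus_smooth \<phi>" "\<And>\<alpha> x. length \<alpha> \<le> N \<Longrightarrow> norm (pderivs \<alpha> \<phi> x) \<le> B" for \<phi> B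
    using that by (intro NK[THEN conjunct2, rule_format, THEN conjunct2]) auto
  have \<phi>': "torus_smooth \<phi>" using \<phi> by (simp add: test_functions_def)
  let ?\<delta> = "\<epsilon> / (2 * (K + 1))"
  show "\<exists>N. \<exists>\<delta>>0. \<forall>\<psi>\<in>test_nbhd \<phi> N \<delta>. norm (T0 \<omega> \<psi> - T0 \<omega> \<phi>) < \<epsilon>"
  proof (rule exI[of _ N], rule exI[of _ ?\<delta>], intro conjI ballI)
    show "?\<delta> > 0" using \<epsilon> K by simp
    fix \<psi> assume "\<psi> \<in> test_nbhd \<phi> N ?\<delta>"
    then have \<psi>: "torus_smooth \<psi>" and d: "\<And>\<alpha> x. length \<alpha> \<le> N \<Longrightarrow> norm (pderivs \<alpha> (\<lambda>y. \<psi> y - \<phi> y) x) < ?\<delta>"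
      by (auto simp: test_nbhd_def test_functions_def)
    have eq: "(\<lambda>y. \<psi> y - \<phi> y) = (\<lambda>y. 1 * \<psi> y + (- 1) * \<phi> y)" by auto
    have s: "torus_smooth (\<lambda>y. \<psi> y - \<phi> y)" unfolding eq by (intro torus_smooth_add torus_smooth_cmult \<phi>' \<psi>)
    have "norm (T0 \<omega> (\<lambda>y. \<psi> y - \<phi> y)) \<le> K * ?\<delta>"
      by (rule T0_le[OF s]) (rule less_imp_le[OF d])
    also have "\<dots> \<le> (K + 1) * ?\<delta>" using K \<epsilon> by (intro mult_right_mono) auto
    also have "\<dots> = \<epsilon> / 2" using K by (simp add: field_simps)
    also have "\<dots> < \<epsilon>" using \<epsilon> by simp
    finally show "norm (T0 \<omega> \<psi> - T0 \<omega> \<phi>) < \<epsilon>"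
      unfolding eq using T0_linear[OF assms \<psi> \<phi>', of 1 "- 1"] by simp
  qed
qed

lemma matern_field_eq: "\<phi> \<in> test_functions \<Longrightarrow> matern_field \<kappa> m W \<phi> = W (fseries (coef \<phi>))"
  by (simp add: matern_field_def L2_adjoint_Op)

text \<open>The error of the J-th partial sum is the noise evaluated at a Fourier tail, so by the
  isometry its second moment is of order 4 ^ (- J). Even after multiplication by 2 ^ J the second
  moments are summable, and the error tends to zero almost surely.\<close>

lemma AE_T0_eq:
  assumes \<phi>: "torus_smooth \<phi>"
  shows "AE \<omega> in M. T0 \<omega> \<phi> = W (fseries (coef \<phi>)) \<omega>"
proof -
  note r = rapid_coef[OF \<phi>]
  let ?\<psi> = "fseries (coef \<phi>)" and ?F = "\<lambda>J. \<Union>j\<in>{..<J}. shell j :: (int^'d) set"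
  let ?S = "\<lambda>J x. \<Sum>k\<in>?F J. coef \<phi> k * fourier_mode k x"
  let ?R = "\<lambda>J x. ?S J x + (- 1) * ?\<psi> x"
  have part: "(\<Sum>k\<in>?F J. f k) = (\<Sum>j<J. \<Sum>k\<in>shell j. f k)" for J and f :: "int^'d \<Rightarrow> complex"
    using shell_disjoint by (intro sum.UNION_disjoint) auto
  note s\<psi> = torus_smooth_fseries[OF r]
  have sS: "torus_smooth (?S J)" for J by (rule torus_smooth_block)
  have sR: "torus_smooth (?R J)" for J by (intro torus_smooth_add torus_smooth_cmult sS s\<psi>)
  obtain C where C: "C \<ge> 0" "\<And>J x. norm (?R J x) \<le> C * (1 / 2) ^ J"
    using fseries_tail_bound[OF r, of "[]"] unfolding part[symmetric] by auto
  define Y where "Y = (\<lambda>J \<omega>. (norm (W (?R J) \<omega>))\<^sup>2 * 2 ^ J)"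
  have "AE \<omega> in M. \<exists>C>0. \<forall>J. Y J \<omega> \<le> C"
  proof (rule AE_bounded_sequence[where A = "C\<^sup>2"])
    show "integrable M (Y J)" for J unfolding Y_def using W_square_integrable[OF sR] by simp
    show "Y J \<omega> \<ge> 0" for J \<omega> by (simp add: Y_def)
    show "expectation (Y J) \<le> C\<^sup>2 * (1 / 2) ^ J" for J
    proof -
      have "norm (\<integral>x. (norm (?R J x))\<^sup>2 \<partial>torus_measure) \<le> (C * (1 / 2) ^ J)\<^sup>2"
      proof (rule torus_integral_bound)
        show "(\<lambda>x. (norm (?R J x))\<^sup>2) \<in> borel_measurable torus_measure"
          by (intro continuous_torus_measurable continuous_intros torus_smooth_continuous sS s\<psi>)
        show "norm ((norm (?R J x))\<^sup>2) \<le> (C * (1 / 2) ^ J)\<^sup>2" for x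
        proof -
          have "norm (?R J x) \<le> C * (1 / 2) ^ J" by (rule C(2))
          from power_mono[OF this norm_ge_zero, of 2] show ?thesis by simp
        qed
      qed
      then have "expectation (\<lambda>\<omega>. (norm (W (?R J) \<omega>))\<^sup>2) \<le> (C * (1 / 2) ^ J)\<^sup>2" unfolding W_isometry[OF sR] by simp
      then have "expectation (Y J) \<le> (C * (1 / 2) ^ J)\<^sup>2 * 2 ^ J" unfolding Y_def by simp
      also have "\<dots> = C\<^sup>2 * (1 / 2) ^ J" by (simp add: power_mult_distrib power_one_over power2_eq_square field_simps)
      finally show ?thesis .
    qed
  qed
  moreover have "AE \<omega> in M. \<forall>J. W (?R J) \<omega> = (\<Sum>j<J. \<Sum>k\<in>shell j. xi k \<omega> * coef \<phi> k) - W ?\<psi> \<omega>"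
    unfolding AE_all_countable
  proof
    fix J
    have "AE \<omega> in M. W (?S J) \<omega> = (\<Sum>k\<in>?F J. coef \<phi> k * xi k \<omega>)"
      by (rule W_sum) (auto intro: torus_smooth_fourier_mode)
    with W_linear[OF sS[of J] s\<psi>, of 1 "- 1"]
    show "AE \<omega> in M. W (?R J) \<omega> = (\<Sum>j<J. \<Sum>k\<in>shell j. xi k \<omega> * coef \<phi> k) - W ?\<psi> \<omega>"
      by eventually_elim (simp add: part mult.commute)
  qed
  ultimately show ?thesis using xi_growth
  proof eventually_elim
    fix \<omega> assume "\<exists>C>0. \<forall>J. Y J \<omega> \<le> C" and eq: "\<forall>J. W (?R J) \<omega> = (\<Sum>j<J. \<Sum>k\<in>shell j. xi k \<omega> * coef \<phi> k) - W ?\<psi> \<omega>"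
      and gr: "xi_growth \<omega>"
    then obtain D where D: "D > 0" "\<And>J. Y J \<omega> \<le> D" by blast
    have "(\<lambda>J. (norm (W (?R J) \<omega>))\<^sup>2) \<longlonglongrightarrow> 0"
    proof (rule Lim_null_comparison)
      show "(\<lambda>J. D * (1 / 2) ^ J) \<longlonglongrightarrow> 0" by (intro tendsto_mult_right_zero LIMSEQ_power_zero) simp
      show "\<forall>\<^sub>F J in sequentially. norm ((norm (W (?R J) \<omega>))\<^sup>2) \<le> D * (1 / 2) ^ J"
        using D(2) by (intro always_eventually allI) (simp add: Y_def power_one_over field_simps)
    qed
    then have "(\<lambda>J. sqrt ((norm (W (?R J) \<omega>))\<^sup>2)) \<longlonglongrightarrow> sqrt 0" by (rule tendsto_real_sqrt)
    then have "(\<lambda>J. W (?R J) \<omega>) \<longlonglongrightarrow> 0" by (simp add: tendsto_norm_zero_iff)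
    then have "(\<lambda>J. (\<Sum>j<J. \<Sum>k\<in>shell j. xi k \<omega> * coef \<phi> k) - W ?\<psi> \<omega>) \<longlonglongrightarrow> 0" using eq by simp
    then have "(\<lambda>J. \<Sum>j<J. \<Sum>k\<in>shell j. xi k \<omega> * coef \<phi> k) \<longlonglongrightarrow> W ?\<psi> \<omega>" by (rule Lim_null[THEN iffD2])
    moreover have "(\<lambda>J. \<Sum>j<J. \<Sum>k\<in>shell j. xi k \<omega> * coef \<phi> k) \<longlonglongrightarrow> T0 \<omega> \<phi>"
      unfolding T0_def using summable_LIMSEQ[OF T0_summable[OF gr \<phi>]] .
    ultimately show "T0 \<omega> \<phi> = W ?\<psi> \<omega>" using LIMSEQ_unique by blast
  qed
qed

end


section \<open>Regularity of the block series above the threshold\<close>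

context matern_noise
begin

abbreviation U :: "(real^'d) set" where
  "U \<equiv> {x. m x > real CARD('d) / 2}"

lemma summable_2_powr: "s < 0 \<Longrightarrow> summable (\<lambda>j. C * 2 powr (real j * s))"
proof -
  assume s: "s < 0"
  have "(2::real) powr s < 2 powr 0" using s by (intro powr_less_mono) auto
  then have "norm ((2::real) powr s) < 1" by simp
  then have "summable (\<lambda>j. C * (2 powr s) ^ j)" by (intro summable_mult summable_geometric)
  moreover have "(2 powr s) ^ j = 2 powr (real j * s)" for j :: nat by (simp add: powr_power)
  ultimately show ?thesis by simp
qed

text \<open>Replaces the pointwise exponent by a lower bound \<gamma> of H on \<open>V\<close> and
  joins the constants of the finitely many derivatives of order at most \<open>n\<close>.\<close>

lemma good_bound:
  fixes \<gamma> \<epsilon> :: real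
  assumes g: "good \<omega>" and V: "\<And>x. x \<in> V \<Longrightarrow> \<gamma> \<le> H x" and \<epsilon>: "\<epsilon> > 0"
  shows "\<exists>C>0. \<forall>\<alpha> j x. length \<alpha> \<le> n \<longrightarrow> x \<in> V \<longrightarrow> norm (pderivs \<alpha> (blk j \<omega>) x) \<le> C * 2 powr (real j * (length \<alpha> - \<gamma> + \<epsilon>))"
proof -
  obtain e :: nat where e: "1 / real (Suc e) < \<epsilon>" using nat_approx_posE[OF \<epsilon>] .
  have "\<forall>\<alpha>. \<exists>C>0. \<forall>j x. norm (pderivs \<alpha> (blk j \<omega>) x) \<le> C * 2 powr (real j * (length \<alpha> - H x + 1 / real (Suc e)))"
    using g by (simp add: good_def blk_ok_def)
  then obtain Cf where Cf: "\<And>\<alpha>. Cf \<alpha> > 0"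
    "\<And>\<alpha> j x. norm (pderivs \<alpha> (blk j \<omega>) x) \<le> Cf \<alpha> * 2 powr (real j * (length \<alpha> - H x + 1 / real (Suc e)))" by metis
  define C where "C = 1 + (\<Sum>\<alpha>\<in>{\<alpha>. set \<alpha> \<subseteq> UNIV \<and> length \<alpha> \<le> n}. Cf \<alpha>)"
  have fin: "finite {\<alpha>::'d list. set \<alpha> \<subseteq> UNIV \<and> length \<alpha> \<le> n}" by (rule finite_lists_length_le) simp
  have "C > 0" unfolding C_def using Cf(1) by (intro add_pos_nonneg sum_nonneg) (auto intro: less_imp_le)
  moreover have "norm (pderivs \<alpha> (blk j \<omega>) x) \<le> C * 2 powr (real j * (length \<alpha> - \<gamma> + \<epsilon>))"
    if l: "length \<alpha> \<le> n" and x: "x \<in> V" for \<alpha> j x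
  proof -
    have "Cf \<alpha> \<le> (\<Sum>\<alpha>\<in>{\<alpha>. set \<alpha> \<subseteq> UNIV \<and> length \<alpha> \<le> n}. Cf \<alpha>)"
      by (rule member_le_sum[where i = \<alpha> and f = Cf]) (use l fin Cf(1) in \<open>auto intro: less_imp_le\<close>)
    then have 1: "Cf \<alpha> \<le> C" by (simp add: C_def)
    have "length \<alpha> - H x + 1 / real (Suc e) \<le> length \<alpha> - \<gamma> + \<epsilon>" using V[OF x] e by linarith
    then have 2: "real j * (length \<alpha> - H x + 1 / real (Suc e)) \<le> real j * (length \<alpha> - \<gamma> + \<epsilon>)" by (rule mult_left_mono) simp
    have "norm (pderivs \<alpha> (blk j \<omega>) x) \<le> Cf \<alpha> * 2 powr (real j * (length \<alpha> - H x + 1 / real (Suc e)))" by (rule Cf(2))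
    also have "\<dots> \<le> C * 2 powr (real j * (length \<alpha> - \<gamma> + \<epsilon>))"
      by (rule mult_mono[OF 1 powr_mono[OF 2]]) (use \<open>C > 0\<close> in auto)
    finally show ?thesis .
  qed
  ultimately show ?thesis by blast
qed

lemma good_summable_bound:
  assumes g: "good \<omega>" and V: "\<And>x. x \<in> V \<Longrightarrow> \<gamma> \<le> H x" and \<gamma>: "\<gamma> > 0"
  shows "\<exists>b. summable b \<and> (\<forall>j. 0 \<le> b j) \<and> (\<forall>j. \<forall>x\<in>V. norm (blk j \<omega> x) \<le> b j)"
proof -
  have "\<gamma> / 2 > 0" using \<gamma> by simp
  from good_bound[OF g V this, of _ 0]
  obtain C where C0: "C > 0" and C: "\<And>\<alpha> j x. length \<alpha> \<le> 0 \<Longrightarrow> x \<in> V \<Longrightarrow> norm (pderivs \<alpha> (blk j \<omega>) x) \<le> C * 2 powr (real j * (length \<alpha> - \<gamma> + \<gamma> / 2))"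
    by blast
  have "norm (blk j \<omega> x) \<le> C * 2 powr (real j * (- \<gamma> / 2))" if "x \<in> V" for j x
    using C[of "[]", OF _ that] by (simp add: field_simps)
  moreover have "summable (\<lambda>j. C * 2 powr (real j * (- \<gamma> / 2)))" using \<gamma> by (intro summable_2_powr) simp
  moreover have "0 \<le> C * 2 powr (real j * (- \<gamma> / 2))" for j using C0 by simp
  ultimately show ?thesis by blast
qed

lemma continuous_m: "continuous_on S m"
  by (rule torus_smooth_continuous[OF m_smooth])

lemma m_periodic: "m (x + lattice_vec k) = m x"
  using m_smooth by (simp add: torus_smooth_iff periodic_on_def)

lemma g0_periodic: "g0 \<omega> (x + lattice_vec k) = g0 \<omega> x"
  unfolding g0_def using torus_smooth_blk[of _ \<omega>] by (simp add: torus_smooth_iff periodic_on_def)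

text \<open>Convergence need not be uniform on \<open>U\<close>, where H may approach 0. It is
  uniform on each of the open sets H > 1 / (n + 1), and these exhaust \<open>U\<close>.\<close>

lemma g0_continuous:
  assumes g: "good \<omega>"
  shows "continuous_on U (g0 \<omega>)"
proof -
  have op: "open {x. \<gamma> < H x}" for \<gamma>
    by (intro open_Collect_less continuous_intros continuous_m)
  have "U = (\<Union>n::nat. {x. 1 / real (Suc n) < H x})"
  proof (intro equalityI subsetI)
    fix x assume "x \<in> U"
    then have "H x > 0" by simp
    then obtain n :: nat where "1 / real (Suc n) < H x" using nat_approx_posE by blast
    then show "x \<in> (\<Union>n::nat. {x. 1 / real (Suc n) < H x})" by blast
  next
    fix x assume "x \<in> (\<Union>n::nat. {x. 1 / real (Suc n) < H x})"
    then obtain n :: nat where "1 / real (Suc n) < H x" by blast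
    moreover have "0 < 1 / real (Suc n)" by simp
    ultimately have "0 < H x" by linarith
    then show "x \<in> U" by simp
  qed
  moreover have "continuous_on (\<Union>n::nat. {x. 1 / real (Suc n) < H x}) (g0 \<omega>)"
  proof (rule continuous_on_open_UN)
    fix n :: nat
    show "open {x. 1 / real (Suc n) < H x}" by (rule op)
    obtain b where "summable b" "\<And>j x. x \<in> {x. 1 / real (Suc n) < H x} \<Longrightarrow> norm (blk j \<omega> x) \<le> b j"
      using good_summable_bound[OF g, of "{x. 1 / real (Suc n) < H x}" "1 / real (Suc n)"] by auto
    then show "continuous_on {x. 1 / real (Suc n) < H x} (g0 \<omega>)"
      unfolding g0_def[abs_def] by (intro continuous_on_suminf_bounded smooth_continuous smooth_blk)
  qed
  ultimately show ?thesis by simp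
qed

lemma compact_subset_U:
  assumes "compact K" "K \<subseteq> U"
  obtains \<gamma> where "\<gamma> > 0" "\<And>x. x \<in> K \<Longrightarrow> \<gamma> \<le> H x"
proof (cases "K = {}")
  case True then show ?thesis using that[of 1] by simp
next
  case False
  have "continuous_on K H" by (intro continuous_intros continuous_m)
  then obtain x where x: "x \<in> K" "\<And>y. y \<in> K \<Longrightarrow> H x \<le> H y"
    using continuous_attains_inf[OF assms(1) False] by blast
  have "0 < H x" using x(1) assms(2) by auto
  then show ?thesis using that x(2) by blast
qed

text \<open>The support of \<phi> inside the cell is compact, so H has a positive minimum there and
  the blocks are summable uniformly. Off the support \<phi> is zero, and it does not matter whether
  the block series converges.\<close>

lemma g0_represents:
  assumes g: "good \<omega>"
  shows "represents_on U (g0 \<omega>) (T0 \<omega>)"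
  unfolding represents_on_def
proof (intro conjI allI ballI impI)
  show "periodic_on U (g0 \<omega>)" by (simp add: periodic_on_def g0_periodic)
  fix K :: "(real^'d) set" assume "compact K \<and> K \<subseteq> U"
  then show "set_integrable lborel K (g0 \<omega>)"
    unfolding set_integrable_def
    by (intro borel_integrable_compact continuous_on_subset[OF g0_continuous[OF g]]) auto
next
  fix \<phi> :: "real^'d \<Rightarrow> complex" assume "\<phi> \<in> test_functions" and supp: "closure {x. \<phi> x \<noteq> 0} \<subseteq> U"
  then have \<phi>: "torus_smooth \<phi>" by (simp add: test_functions_def)
  let ?K = "closure {x. \<phi> x \<noteq> 0} \<inter> torus_cell"
  have K: "compact ?K" "?K \<subseteq> U" using supp by (auto intro!: closed_Int_compact simp: torus_cell_def)
  from compact_subset_U[OF K] obtain \<gamma> where \<gamma>: "\<gamma> > 0" "\<And>x. x \<in> ?K \<Longrightarrow> \<gamma> \<le> H x" by blast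
  have "\<exists>b. summable b \<and> (\<forall>j. 0 \<le> b j) \<and> (\<forall>j. \<forall>x\<in>?K. norm (blk j \<omega> x) \<le> b j)"
    by (rule good_summable_bound[OF g _ \<gamma>(1)]) (rule \<gamma>(2))
  then obtain b where "summable b \<and> (\<forall>j. 0 \<le> b j) \<and> (\<forall>j. \<forall>x\<in>?K. norm (blk j \<omega> x) \<le> b j)" by (elim exE)
  then have b: "summable b" "\<And>j x. x \<in> ?K \<Longrightarrow> norm (blk j \<omega> x) \<le> b j" and b0: "\<And>j. 0 \<le> b j" by simp_all
  obtain B where B: "B > 0" "\<And>x. norm (\<phi> x) \<le> B" using torus_smooth_bounded[OF \<phi>] by blast
  have in_K: "x \<in> ?K" if "x \<in> torus_cell" "\<phi> x \<noteq> 0" for x using that closure_subset by fastforce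
  have "(\<lambda>j. integral\<^sup>L torus_measure (\<lambda>x. blk j \<omega> x * \<phi> x)) sums integral\<^sup>L torus_measure (\<lambda>x. \<Sum>j. blk j \<omega> x * \<phi> x)"
  proof (rule torus_integral_suminf[where b = "\<lambda>j. \<bar>b j\<bar> * B"])
    show "integrable torus_measure (\<lambda>x. blk j \<omega> x * \<phi> x)" for j
      by (intro torus_smooth_integrable torus_smooth_mult torus_smooth_blk \<phi>)
    show "norm (blk j \<omega> x * \<phi> x) \<le> \<bar>b j\<bar> * B" if "x \<in> torus_cell" for j x
    proof (cases "\<phi> x = 0")
      case False
      have "norm (blk j \<omega> x) \<le> \<bar>b j\<bar>" using b(2)[OF in_K[OF that False], of j] by linarith
      then show ?thesis unfolding norm_mult using B by (intro mult_mono) auto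
    qed (use B in auto)
    show "summable (\<lambda>j. \<bar>b j\<bar> * B)" using b0 b(1) by (simp add: summable_mult2)
  qed
  moreover have "integral\<^sup>L torus_measure (\<lambda>x. blk j \<omega> x * \<phi> x) = (\<Sum>k\<in>shell j. xi k \<omega> * coef \<phi> k)" for j
  proof -
    have int: "integrable torus_measure (\<lambda>x. xi k \<omega> * (sym k x * \<phi> x * cnj (fourier_mode k x)))" for k
      by (intro torus_smooth_integrable torus_smooth_cmult torus_smooth_mult torus_smooth_cnj torus_smooth_sym torus_smooth_fourier_mode \<phi>)
    have "(\<lambda>x. blk j \<omega> x * \<phi> x) = (\<lambda>x. \<Sum>k\<in>shell j. xi k \<omega> * (sym k x * \<phi> x * cnj (fourier_mode k x)))"
      by (auto simp: blk_def bas_def sum_distrib_left sum_distrib_right mult_ac)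
    then have "integral\<^sup>L torus_measure (\<lambda>x. blk j \<omega> x * \<phi> x) =
        (\<Sum>k\<in>shell j. integral\<^sup>L torus_measure (\<lambda>x. xi k \<omega> * (sym k x * \<phi> x * cnj (fourier_mode k x))))"
      using int by (simp only: Bochner_Integration.integral_sum)
    then show ?thesis by (simp only: integral_mult_right_zero coef_eq[symmetric])
  qed
  moreover have "integral\<^sup>L torus_measure (\<lambda>x. \<Sum>j. blk j \<omega> x * \<phi> x) = integral\<^sup>L torus_measure (\<lambda>x. g0 \<omega> x * \<phi> x)"
  proof (rule Bochner_Integration.integral_cong[OF refl])
    fix x :: "real^'d" assume x: "x \<in> space torus_measure"
    show "(\<Sum>j. blk j \<omega> x * \<phi> x) = g0 \<omega> x * \<phi> x"
    proof (cases "\<phi> x = 0")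
      case False
      have xK: "x \<in> ?K" using in_K False x by simp
      have "summable (\<lambda>j. blk j \<omega> x)" by (rule summable_comparison_test'[OF b(1), of 0]) (rule b(2)[OF xK])
      then show ?thesis unfolding g0_def by (rule suminf_mult2[symmetric])
    qed simp
  qed
  ultimately show "T0 \<omega> \<phi> = torus_integral (\<lambda>x. g0 \<omega> x * \<phi> x)"
    unfolding T0_def torus_integral_eq by (simp add: sums_iff)
qed

text \<open>For s >= 1 the right side is already at least 2; for s < 1 lowering the exponent from 1
  to \<open>g\<close> increases the power.\<close>

lemma min_le_powr:
  fixes s g D :: real
  assumes "0 \<le> g" "g \<le> 1" "s > 0" "D \<ge> 1"
  shows "min 2 (D * s) \<le> 2 * D * s powr g"
proof (cases "s \<ge> 1")
  case True
  then have "1 \<le> s powr g" using assms by (simp add: ge_one_powr_ge_zero)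
  then have "2 * 1 * 1 \<le> 2 * D * s powr g" using assms by (intro mult_mono) auto
  then show ?thesis by linarith
next
  case False
  then have "s powr 1 \<le> s powr g" using assms by (intro powr_mono') auto
  then have "D * s \<le> D * s powr g" using assms by (intro mult_left_mono) auto
  also have "\<dots> \<le> 2 * D * s powr g" using assms by simp
  finally show ?thesis by linarith
qed

text \<open>Interpolating between the size of a block and the size of its gradient, \<open>min 2 (D s) \<le> 2 D s ^ \<gamma>'\<close> with
  \<open>s = 2 ^ j \<parallel>x - y\<parallel>\<close>, gives the Hoelder bound block by block, uniformly in \<open>\<gamma>' \<in> [0, 1]\<close>.\<close>

lemma g0_holder:
  fixes \<gamma> \<gamma>' :: real
  assumes g: "good \<omega>" and V: "torus_open V" "\<And>x. x \<in> V \<Longrightarrow> \<gamma> \<le> H x" and n: "0 \<le> \<gamma>'" "\<gamma>' \<le> 1" "real n + \<gamma>' < \<gamma>"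
  shows "g0 \<omega> \<in> holder_loc n \<gamma>' V"
proof -
  let ?d = "real CARD('d)"
  have opV: "open V" using V by (simp add: torus_open_def)
  \<comment> \<open>Half of the gap between n + \<gamma>' and \<gamma>: the exponents of the blocks
    stay negative after this loss, both for the sup bound and for the Hoelder bound.\<close>
  define \<epsilon> where "\<epsilon> = (\<gamma> - n - \<gamma>') / 2"
  have \<epsilon>: "\<epsilon> > 0" "real n + \<gamma>' - \<gamma> + \<epsilon> < 0" "real n - \<gamma> + \<epsilon> < 0" using n by (auto simp: \<epsilon>_def field_simps)
  obtain C where C: "C > 0" "\<And>\<alpha> j x. length \<alpha> \<le> n + 1 \<Longrightarrow> x \<in> V \<Longrightarrow>
      norm (pderivs \<alpha> (blk j \<omega>) x) \<le> C * 2 powr (real j * (length \<alpha> - \<gamma> + \<epsilon>))"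
    using good_bound[OF g V(2) \<epsilon>(1), of _ "n + 1"] by blast
  define b where "b = (\<lambda>j. C * 2 powr (real j * (real n - \<gamma> + \<epsilon>)))"
  have sb: "summable b" unfolding b_def by (rule summable_2_powr[OF \<epsilon>(3)])
  have bb: "norm (pderivs \<alpha> (blk j \<omega>) x) \<le> b j" if "length \<alpha> \<le> n" "x \<in> V" for \<alpha> j x
  proof -
    have "real j * (length \<alpha> - \<gamma> + \<epsilon>) \<le> real j * (real n - \<gamma> + \<epsilon>)" using that by (intro mult_left_mono) auto
    then have "C * 2 powr (real j * (length \<alpha> - \<gamma> + \<epsilon>)) \<le> b j"
      unfolding b_def by (rule mult_left_mono[OF powr_mono]) (use C(1) in auto)
    with C(2)[of \<alpha> x j] that show ?thesis by simp
  qed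
  have eq: "pderivs \<alpha> (g0 \<omega>) x = (\<Sum>j. pderivs \<alpha> (blk j \<omega>) x)" if "length \<alpha> \<le> n" "x \<in> V" for \<alpha> x
    unfolding g0_def[abs_def]
    by (rule pderivs_suminf(1)[where n = n and b = b and V = V, OF smooth_blk opV _ sb that]) (rule bb)
  have "has_pderivs_on n V (g0 \<omega>)"
    unfolding has_pderivs_on_def g0_def[abs_def]
  proof (intro allI impI ballI)
    fix \<alpha> :: "'d list" and i :: 'd and x assume "length \<alpha> < n" "x \<in> V"
    then have "has_pderiv i (pderivs \<alpha> (\<lambda>x. \<Sum>j. blk j \<omega> x)) (\<Sum>j. pderivs (i # \<alpha>) (blk j \<omega>) x) x"
      by (intro pderivs_suminf(2)[where n = n and b = b and V = V, OF smooth_blk opV _ sb]) (rule bb)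
    then show "(\<lambda>t. pderivs \<alpha> (\<lambda>x. \<Sum>j. blk j \<omega> x) (x + t *\<^sub>R axis i 1)) differentiable at 0"
      by (rule has_pderiv_imp_differentiable)
  qed
  moreover have "\<exists>C>0. \<forall>\<alpha> x y. length \<alpha> = n \<and> x \<in> K \<and> y \<in> K \<longrightarrow>
      norm (pderivs \<alpha> (g0 \<omega>) x - pderivs \<alpha> (g0 \<omega>) y) \<le> C * norm (x - y) powr \<gamma>'" if K: "compact K" "K \<subseteq> V" for K
  proof -
    \<comment> \<open>\<open>K\<close> need not be convex. For points closer than \<open>e\<close>
      the box spanned by them lies in \<open>V\<close> and the gradient bound is available on it;
      for the remaining pairs the sup bound suffices, at the cost of a factor
      \<open>e powr (- \<gamma>')\<close>.\<close>
    obtain e where e: "e > 0" "(\<Union>x\<in>K. ball x e) \<subseteq> V"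
      using compact_subset_open_imp_ball_epsilon_subset[OF K(1) opV K(2)] by blast
    define h where "h = (\<lambda>j. 2 * ?d * C * 2 powr (real j * (real n + \<gamma>' - \<gamma> + \<epsilon>)))"
    have sh: "summable h" unfolding h_def by (rule summable_2_powr[OF \<epsilon>(2)])
    have h0: "h j \<ge> 0" for j using C by (simp add: h_def)
    have b0: "b j \<ge> 0" for j using C by (simp add: b_def)
    define C1 where "C1 = (\<Sum>j. h j) + (\<Sum>j. 2 * b j) * e powr (- \<gamma>') + 1"
    have s0: "(\<Sum>j. h j) \<ge> 0" "(\<Sum>j. 2 * b j) * e powr (- \<gamma>') \<ge> 0"
      using suminf_nonneg[OF sh h0] suminf_nonneg[OF summable_mult[OF sb, of 2]] b0 by auto
    have "norm (pderivs \<alpha> (g0 \<omega>) x - pderivs \<alpha> (g0 \<omega>) y) \<le> C1 * norm (x - y) powr \<gamma>'"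
      if a: "length \<alpha> = n" "x \<in> K" "y \<in> K" for \<alpha> x y
    proof (cases "x = y")
      case True
      then show ?thesis by simp
    next
      case False
      let ?D = "\<lambda>j. pderivs \<alpha> (blk j \<omega>) x - pderivs \<alpha> (blk j \<omega>) y"
      have xy: "x \<in> V" "y \<in> V" using a K by auto
      define t where "t = norm (x - y)"
      have t: "t > 0" using False by (simp add: t_def)
      have sx: "summable (\<lambda>j. pderivs \<alpha> (blk j \<omega>) x)" "summable (\<lambda>j. pderivs \<alpha> (blk j \<omega>) y)"
        using xy a by (auto intro!: summable_comparison_test'[OF sb, of 0] bb)
      have D: "pderivs \<alpha> (g0 \<omega>) x - pderivs \<alpha> (g0 \<omega>) y = (\<Sum>j. ?D j)"
        using eq[of \<alpha>] a xy by (simp add: suminf_diff[OF sx])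
      have D2: "norm (?D j) \<le> 2 * b j" for j
        using norm_triangle_ineq4[of "pderivs \<alpha> (blk j \<omega>) x" "pderivs \<alpha> (blk j \<omega>) y"] bb[of \<alpha> x j] bb[of \<alpha> y j] a xy by simp
      show ?thesis
      proof (cases "t < e")
        case True
        have Dj: "norm (?D j) \<le> h j * t powr \<gamma>'" for j
        proof -
          let ?G = "C * 2 powr (real j * (real (n + 1) - \<gamma> + \<epsilon>))"
          have box: "cbox (\<chi> i. min (x $ i) (y $ i)) (\<chi> i. max (x $ i) (y $ i)) \<subseteq> V"
          proof
            fix z assume z: "z \<in> cbox (\<chi> i. min (x $ i) (y $ i)) (\<chi> i. max (x $ i) (y $ i))"
            have "norm (x - z) \<le> norm (x - y)"
            proof (rule norm_le_componentwise_cart)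
              fix i
              have "min (x $ i) (y $ i) \<le> z $ i \<and> z $ i \<le> max (x $ i) (y $ i)" using z by (simp add: mem_box_cart)
              then show "norm ((x - z) $ i) \<le> norm ((x - y) $ i)" by (auto simp: min_def max_def abs_real_def split: if_splits)
            qed
            then have "z \<in> ball x e" using True by (simp add: t_def dist_norm)
            then show "z \<in> V" using e(2) a by blast
          qed
          have "norm (?D j) \<le> ?G * (\<Sum>i\<in>UNIV. \<bar>x $ i - y $ i\<bar>)"
          proof (rule box_lipschitz[where D = "\<lambda>i. pderivs (i # \<alpha>) (blk j \<omega>)"])
            show "has_pderiv i (pderivs \<alpha> (blk j \<omega>)) (pderivs (i # \<alpha>) (blk j \<omega>) z) z" for i z
              by (simp, intro smooth_has_pderiv smooth_pderivs smooth_blk)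
            show "norm (pderivs (i # \<alpha>) (blk j \<omega>) z) \<le> ?G" if "z \<in> cbox (\<chi> i. min (x $ i) (y $ i)) (\<chi> i. max (x $ i) (y $ i))" for i z
              using C(2)[of "i # \<alpha>" z j] box that a(1) by (auto simp: add.commute)
          qed (auto simp: mem_box_cart)
          also have "\<dots> \<le> ?G * (?d * t)"
          proof (intro mult_left_mono)
            have "(\<Sum>i\<in>UNIV. \<bar>x $ i - y $ i\<bar>) \<le> of_nat (card (UNIV :: 'd set)) * t"
              using component_le_norm_cart[of "x - y"] by (intro sum_bounded_above) (auto simp: t_def)
            then show "(\<Sum>i\<in>UNIV. \<bar>x $ i - y $ i\<bar>) \<le> ?d * t" by simp
          qed (use C in auto)
          also have "?G = b j * 2 powr (real j)" unfolding b_def mult.assoc powr_add[symmetric] by (simp add: algebra_simps)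
          finally have D1: "norm (?D j) \<le> b j * (?d * (2 powr real j * t))" by (simp add: mult_ac)
          have "norm (?D j) \<le> b j * min 2 (?d * (2 powr real j * t))"
            using D1 D2[of j] b0[of j] by (auto simp: min_def mult.commute)
          also have "\<dots> \<le> b j * (2 * ?d * (2 powr real j * t) powr \<gamma>')"
            using b0[of j] t n by (intro mult_left_mono min_le_powr) (auto simp: Suc_leI)
          also have "(2 powr real j * t) powr \<gamma>' = 2 powr (real j * \<gamma>') * t powr \<gamma>'"
            using t by (simp add: powr_mult powr_powr)
          also have "b j * (2 * ?d * (2 powr (real j * \<gamma>') * t powr \<gamma>')) = 2 * ?d * C * (2 powr (real j * (real n - \<gamma> + \<epsilon>)) * 2 powr (real j * \<gamma>')) * t powr \<gamma>'"
            by (simp add: b_def mult_ac)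
          also have "2 powr (real j * (real n - \<gamma> + \<epsilon>)) * 2 powr (real j * \<gamma>') = 2 powr (real j * (real n + \<gamma>' - \<gamma> + \<epsilon>))"
            unfolding powr_add[symmetric] by (simp add: algebra_simps)
          finally show ?thesis by (simp add: h_def)
        qed
        have "norm (\<Sum>j. ?D j) \<le> (\<Sum>j. h j * t powr \<gamma>')"
          by (rule norm_suminf_le[OF Dj summable_mult2[OF sh]])
        also have "\<dots> = (\<Sum>j. h j) * t powr \<gamma>'" by (rule suminf_mult2[OF sh, symmetric])
        also have "\<dots> \<le> C1 * t powr \<gamma>'" using s0 by (intro mult_right_mono) (auto simp: C1_def)
        finally show ?thesis by (simp add: D t_def)
      next
        case False
        have "norm (\<Sum>j. ?D j) \<le> (\<Sum>j. 2 * b j)" by (rule norm_suminf_le[OF D2 summable_mult[OF sb]])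
        also have "\<dots> \<le> (\<Sum>j. 2 * b j) * (e powr (- \<gamma>') * t powr \<gamma>')"
        proof -
          have "1 = e powr (- \<gamma>') * e powr \<gamma>'" using e by (simp add: powr_add[symmetric])
          also have "\<dots> \<le> e powr (- \<gamma>') * t powr \<gamma>'" using e False n by (intro mult_left_mono powr_mono2) auto
          finally have "(\<Sum>j. 2 * b j) * 1 \<le> (\<Sum>j. 2 * b j) * (e powr (- \<gamma>') * t powr \<gamma>')"
            using suminf_nonneg[OF summable_mult[OF sb, of 2]] b0 by (intro mult_left_mono) auto
          then show ?thesis by simp
        qed
        also have "\<dots> \<le> C1 * t powr \<gamma>'"
          unfolding mult.assoc[symmetric] using s0 by (intro mult_right_mono) (auto simp: C1_def)
        finally show ?thesis by (simp add: D t_def)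
      qed
    qed
    moreover have "C1 > 0" using s0 by (simp add: C1_def)
    ultimately show ?thesis by blast
  qed
  moreover have "periodic_on V (g0 \<omega>)" by (simp add: periodic_on_def g0_periodic)
  ultimately show ?thesis unfolding holder_loc_def by blast
qed

lemma g0_holder_minus:
  assumes "good \<omega>" "torus_open V" "\<And>x. x \<in> V \<Longrightarrow> \<gamma> \<le> H x"
  shows "g0 \<omega> \<in> holder_loc_minus \<gamma> V"
  unfolding holder_loc_minus_def using g0_holder[OF assms] by (auto simp: periodic_on_def g0_periodic)

text \<open>\<open>good\<close> quantifies over all points x, so its failure is enclosed in a
  measurable null set \<open>N\<close>. On \<open>N\<close> field and function are set to zero: this
  keeps measurability and makes continuity and representation hold for every \<omega>.\<close>

lemma continuous_modification:
  obtains T g where "distributional_modification M (matern_field \<kappa> m W) T"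
    "\<And>\<omega>. \<omega> \<in> space M \<Longrightarrow> continuous_on U (g \<omega>) \<and> represents_on U (g \<omega>) (T \<omega>)"
    "\<And>V \<gamma>. torus_open V \<Longrightarrow> (\<And>x. x \<in> V \<Longrightarrow> \<gamma> \<le> H x) \<Longrightarrow> AE \<omega> in M. g \<omega> \<in> holder_loc_minus \<gamma> V"
proof -
  from AE_good obtain N where N: "{\<omega>\<in>space M. \<not> good \<omega>} \<subseteq> N" "emeasure M N = 0" "N \<in> sets M"
    by (rule AE_E)
  define T where "T = (\<lambda>\<omega> \<phi>. if \<omega> \<in> N then 0 else T0 \<omega> \<phi>)"
  define g where "g = (\<lambda>\<omega> x. if \<omega> \<in> N then 0 else g0 \<omega> x)"
  have ok: "good \<omega>" if "\<omega> \<in> space M" "\<omega> \<notin> N" for \<omega> using N that by blast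
  have gr: "xi_growth \<omega>" if "\<omega> \<in> space M" "\<omega> \<notin> N" for \<omega> using ok[OF that] by (simp add: good_def)
  have aeN: "AE \<omega> in M. \<omega> \<notin> N" using N by (intro AE_not_in null_setsI)
  show ?thesis
  proof
    show "distributional_modification M (matern_field \<kappa> m W) T"
      unfolding distributional_modification_def
    proof (intro conjI ballI)
      fix \<omega> assume \<omega>: "\<omega> \<in> space M"
      show "T \<omega> \<in> torus_distributions"
      proof (cases "\<omega> \<in> N")
        case True
        then have "T \<omega> = (\<lambda>_. 0)" by (simp add: T_def fun_eq_iff)
        then show ?thesis by (auto simp: torus_distributions_def intro: exI[of _ 1])
      next
        case False
        then have "T \<omega> = T0 \<omega>" by (simp add: T_def fun_eq_iff)
        then show ?thesis using T0_distribution[OF gr[OF \<omega> False]] by simp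
      qed
    next
      fix \<phi> :: "real^'d \<Rightarrow> complex" assume \<phi>: "\<phi> \<in> test_functions"
      then have \<phi>': "torus_smooth \<phi>" by (simp add: test_functions_def)
      have [measurable]: "xi k \<in> borel_measurable M" for k by (rule W_measurable[OF torus_smooth_fourier_mode])
      have [measurable]: "N \<in> sets M" by (rule N)
      have [measurable]: "(\<lambda>\<omega>. T0 \<omega> \<phi>) \<in> borel_measurable M" unfolding T0_def by measurable
      show "(\<lambda>\<omega>. T \<omega> \<phi>) \<in> borel_measurable M" unfolding T_def by measurable
      show "AE \<omega> in M. T \<omega> \<phi> = matern_field \<kappa> m W \<phi> \<omega>"
        using AE_T0_eq[OF \<phi>'] aeN by eventually_elim (simp add: T_def matern_field_eq[OF \<phi>])
    qed
    show "continuous_on U (g \<omega>) \<and> represents_on U (g \<omega>) (T \<omega>)" if \<omega>: "\<omega> \<in> space M" for \<omega>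
    proof (cases "\<omega> \<in> N")
      case True
      then have "g \<omega> = (\<lambda>_. 0)" "T \<omega> = (\<lambda>_. 0)" by (simp_all add: g_def T_def fun_eq_iff)
      then show ?thesis by (simp add: represents_on_def periodic_on_def torus_integral_eq set_integrable_def)
    next
      case False
      then have "g \<omega> = g0 \<omega>" "T \<omega> = T0 \<omega>" by (simp_all add: g_def T_def fun_eq_iff)
      then show ?thesis using g0_continuous[OF ok[OF \<omega> False]] g0_represents[OF ok[OF \<omega> False]] by simp
    qed
    show "AE \<omega> in M. g \<omega> \<in> holder_loc_minus \<gamma> V" if V: "torus_open V" "\<And>x. x \<in> V \<Longrightarrow> \<gamma> \<le> H x" for V \<gamma>
      using aeN AE_good
    proof eventually_elim
      fix \<omega> assume "\<omega> \<notin> N" "good \<omega>"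
      then have "g \<omega> = g0 \<omega>" by (simp add: g_def fun_eq_iff)
      then show "g \<omega> \<in> holder_loc_minus \<gamma> V" using g0_holder_minus[OF \<open>good \<omega>\<close> V] by simp
    qed
  qed
qed

end


section \<open>Decay of Fourier coefficients of directionally Hoelder functions\<close>

text \<open>Global Hoelder regularity of order n + s along one coordinate axis. One axis is enough
  because the frequencies used for the lower bound are large in one fixed coordinate.\<close>

primrec dirh :: "nat \<Rightarrow> 'd \<Rightarrow> real \<Rightarrow> (real^'d \<Rightarrow> complex) \<Rightarrow> bool" where
  "dirh 0 i s h \<longleftrightarrow> (\<exists>C. \<forall>x t. norm (h (x + t *\<^sub>R axis i 1) - h x) \<le> C * \<bar>t\<bar> powr s)"
| "dirh (Suc n) i s h \<longleftrightarrow> (\<exists>h'. (\<forall>x. has_pderiv i h (h' x) x) \<and> dirh n i s h')"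

lemma dirh_add: "dirh n i s g \<Longrightarrow> dirh n i s h \<Longrightarrow> dirh n i s (\<lambda>x. g x + h x)"
proof (induction n arbitrary: g h)
  case 0
  then obtain C D where C: "\<And>x t. norm (g (x + t *\<^sub>R axis i 1) - g x) \<le> C * \<bar>t\<bar> powr s"
    "\<And>x t. norm (h (x + t *\<^sub>R axis i 1) - h x) \<le> D * \<bar>t\<bar> powr s" by auto
  have "norm (g (x + t *\<^sub>R axis i 1) + h (x + t *\<^sub>R axis i 1) - (g x + h x)) \<le> (C + D) * \<bar>t\<bar> powr s" for x t
    using norm_triangle_le[OF add_mono[OF C(1)[of x t] C(2)[of x t]]] by (simp add: distrib_right add_diff_add)
  then show ?case by auto
next
  case (Suc n)
  then obtain g' h' where "\<forall>x. has_pderiv i g (g' x) x" "dirh n i s g'" "\<forall>x. has_pderiv i h (h' x) x" "dirh n i s h'"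
    by auto
  then show ?case using Suc.IH by (auto intro!: exI[of _ "\<lambda>x. g' x + h' x"] has_pderiv_add)
qed

definition fdiff :: "'d \<Rightarrow> real \<Rightarrow> (real^'d \<Rightarrow> complex) \<Rightarrow> real^'d \<Rightarrow> complex" where
  "fdiff i t h x = h (x + t *\<^sub>R axis i 1) - h x"

lemma has_pderiv_shift: "has_pderiv i h D (x + c) \<Longrightarrow> has_pderiv i (\<lambda>x. h (x + c)) D x"
  by (simp add: has_pderiv_def add_ac)

lemma has_pderiv_fdiff:
  assumes "\<And>x. has_pderiv i h (h' x) x"
  shows "has_pderiv i ((fdiff i t ^^ n) h) ((fdiff i t ^^ n) h' x) x"
proof (induction n arbitrary: x)
  case 0
  then show ?case using assms by simp
next
  case (Suc n)
  have "has_pderiv i (\<lambda>x. (fdiff i t ^^ n) h (x + t *\<^sub>R axis i 1) + (- 1) * (fdiff i t ^^ n) h x)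
    ((fdiff i t ^^ n) h' (x + t *\<^sub>R axis i 1) + (- 1) * (fdiff i t ^^ n) h' x) x"
    by (intro has_pderiv_add has_pderiv_shift Suc has_pderiv_linear[OF bounded_linear_mult_right])
  then show ?case by (simp add: fdiff_def[abs_def])
qed

text \<open>Of the n + 1 differences, one uses the Hoelder bound of the n-th derivative; each of the
  others is exchanged for a derivative by the mean value estimate and contributes a factor
  |t|.\<close>

lemma dirh_fdiff_bound:
  "dirh n i s h \<Longrightarrow> \<exists>C. \<forall>t x. norm ((fdiff i t ^^ (n + 1)) h x) \<le> C * \<bar>t\<bar> powr (s + n)"
proof (induction n arbitrary: h)
  case 0
  then show ?case by (auto simp: fdiff_def)
next
  case (Suc n)
  then obtain h' where h': "\<And>x. has_pderiv i h (h' x) x" "dirh n i s h'" by auto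
  from Suc.IH[OF h'(2)] obtain C where C: "\<And>t x. norm ((fdiff i t ^^ (n + 1)) h' x) \<le> C * \<bar>t\<bar> powr (s + n)" by blast
  have "norm ((fdiff i t ^^ (Suc n + 1)) h x) \<le> C * \<bar>t\<bar> powr (s + Suc n)" for t x
  proof -
    let ?g = "(fdiff i t ^^ (n + 1)) h"
    have "norm (?g (x + t *\<^sub>R axis i 1) - ?g x) \<le> (C * \<bar>t\<bar> powr (s + n)) * \<bar>t\<bar>"
      by (rule pderiv_mvt[OF has_pderiv_fdiff[OF h'(1)] C])
    also have "\<dots> = C * \<bar>t\<bar> powr (s + Suc n)"
      by (cases "t = 0") (auto simp: powr_add mult_ac)
    finally show ?thesis by (simp add: fdiff_def)
  qed
  then show ?case by blast
qed

lemma fdiff_fourier: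
  fixes h :: "real^'d \<Rightarrow> complex" and t :: real
  assumes h: "periodic_on UNIV h" "integrable torus_measure h" and t: "0 \<le> t" "t \<le> 1"
  shows "periodic_on UNIV (fdiff i t h) \<and> integrable torus_measure (fdiff i t h) \<and>
    fourier_coeff (fdiff i t h) k = (cis (2 * pi * (k $ i * t)) - 1) * fourier_coeff h k"
proof (intro conjI)
  show "periodic_on UNIV (fdiff i t h)"
    unfolding periodic_on_def
  proof (intro ballI allI)
    fix x k
    have "h (x + t *\<^sub>R axis i 1 + lattice_vec k) = h (x + t *\<^sub>R axis i 1)" "h (x + lattice_vec k) = h x"
      using h(1) unfolding periodic_on_def by blast+
    then show "fdiff i t h (x + lattice_vec k) = fdiff i t h x" by (simp add: fdiff_def add_ac)
  qed
  have sh: "integrable torus_measure (\<lambda>x. h (x + t *\<^sub>R axis i 1))"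
    using torus_shift[OF h t, of i] by blast
  then show "integrable torus_measure (fdiff i t h)" unfolding fdiff_def[abs_def] using h(2) by (rule Bochner_Integration.integrable_diff)
  let ?e = "\<lambda>x. cnj (fourier_mode k x)"
  have me: "?e \<in> borel_measurable torus_measure" 
    unfolding cnj_fourier_mode by (intro continuous_torus_measurable torus_smooth_continuous torus_smooth_fourier_mode)
  have mult: "integrable torus_measure (\<lambda>x. g x * ?e x)" if "integrable torus_measure g" for g :: "real^'d \<Rightarrow> complex"
    by (rule Bochner_Integration.integrable_bound[OF that]) (use that me in \<open>auto simp: norm_mult intro!: borel_measurable_times\<close>)
  let ?G = "\<lambda>x. h x * ?e x"
  have perG: "periodic_on UNIV ?G"
    using h(1) torus_smooth_fourier_mode[of k] by (simp add: periodic_on_def torus_smooth_iff)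
  have shift_e: "fourier_mode k (x + t *\<^sub>R axis i 1) = cis (2 * pi * (k $ i * t)) * fourier_mode k x" for x
    by (simp add: fourier_mode_def inner_add_right inner_axis cis_mult algebra_simps)
  have "integral\<^sup>L torus_measure (\<lambda>x. ?G (x + t *\<^sub>R axis i 1)) = fourier_coeff h k"
    using torus_shift[OF perG mult[OF h(2)] t, of i] by (simp add: fourier_coeff_eq)
  moreover have "?G (x + t *\<^sub>R axis i 1) = cnj (cis (2 * pi * (k $ i * t))) * (h (x + t *\<^sub>R axis i 1) * ?e x)" for x
    by (simp add: shift_e mult_ac)
  ultimately have "cnj (cis (2 * pi * (k $ i * t))) * integral\<^sup>L torus_measure (\<lambda>x. h (x + t *\<^sub>R axis i 1) * ?e x) = fourier_coeff h k"
    by (simp only: integral_mult_right_zero)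
  then have "cis (2 * pi * (k $ i * t)) * (cnj (cis (2 * pi * (k $ i * t))) * integral\<^sup>L torus_measure (\<lambda>x. h (x + t *\<^sub>R axis i 1) * ?e x)) =
      cis (2 * pi * (k $ i * t)) * fourier_coeff h k" by simp
  then have "integral\<^sup>L torus_measure (\<lambda>x. h (x + t *\<^sub>R axis i 1) * ?e x) = cis (2 * pi * (k $ i * t)) * fourier_coeff h k"
    by (simp add: mult.assoc[symmetric] cis_cnj cis_mult)
  moreover have "fourier_coeff (fdiff i t h) k = integral\<^sup>L torus_measure (\<lambda>x. h (x + t *\<^sub>R axis i 1) * ?e x) - fourier_coeff h k"
    unfolding fourier_coeff_eq fdiff_def left_diff_distrib
    by (rule Bochner_Integration.integral_diff[OF mult[OF sh] mult[OF h(2)]])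
  ultimately show "fourier_coeff (fdiff i t h) k = (cis (2 * pi * (k $ i * t)) - 1) * fourier_coeff h k"
    by (simp add: left_diff_distrib)
qed

lemma fdiff_funpow_fourier:
  fixes h :: "real^'d \<Rightarrow> complex" and t :: real
  assumes h: "periodic_on UNIV h" "integrable torus_measure h" and t: "0 \<le> t" "t \<le> 1"
  shows "periodic_on UNIV ((fdiff i t ^^ n) h) \<and> integrable torus_measure ((fdiff i t ^^ n) h) \<and>
    (\<forall>k. fourier_coeff ((fdiff i t ^^ n) h) k = (cis (2 * pi * (k $ i * t)) - 1) ^ n * fourier_coeff h k)"
proof (induction n)
  case (Suc n)
  then show ?case using fdiff_fourier[OF _ _ t, of "(fdiff i t ^^ n) h" i] by simp
qed (use h in simp)

lemma norm_cis_minus_one_sq: "(norm (cis \<theta> - 1))\<^sup>2 = 2 - 2 * cos \<theta>"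
proof -
  have "(norm (cis \<theta> - 1))\<^sup>2 = (cos \<theta>)\<^sup>2 + (sin \<theta>)\<^sup>2 + 1 - 2 * cos \<theta>"
    by (simp add: cmod_power2 power2_diff)
  then show ?thesis by simp
qed

text \<open>A finite difference with step \<open>1 / (4 N)\<close> multiplies the Fourier coefficients with
  \<open>N \<le> \<bar>k\<^sub>i\<bar> < 2 N\<close> by a factor bounded below.\<close>

lemma dirh_fourier_decay:
  fixes h :: "real^'d \<Rightarrow> complex"
  assumes h: "periodic_on UNIV h" "integrable torus_measure h" and d: "dirh n i s h"
  shows "\<exists>C. \<forall>N::nat. \<forall>F. N \<ge> 1 \<longrightarrow> finite F \<longrightarrow> (\<forall>k\<in>F. int N \<le> \<bar>k $ i\<bar> \<and> \<bar>k $ i\<bar> < 2 * int N) \<longrightarrow>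
    (\<Sum>k\<in>F. (norm (fourier_coeff h k))\<^sup>2) \<le> C * real N powr (- 2 * (s + n))"
proof -
  obtain C where C: "\<And>t x. norm ((fdiff i t ^^ (n + 1)) h x) \<le> C * \<bar>t\<bar> powr (s + n)" using dirh_fdiff_bound[OF d] by blast
  have "(\<Sum>k\<in>F. (norm (fourier_coeff h k))\<^sup>2) \<le> (C\<^sup>2 * 4 powr (- 2 * (s + n))) * real N powr (- 2 * (s + n))"
    if N: "N \<ge> 1" and F: "finite F" and k: "\<And>k. k \<in> F \<Longrightarrow> int N \<le> \<bar>k $ i\<bar> \<and> \<bar>k $ i\<bar> < 2 * int N" for N :: nat and F
  proof -
    define t where "t = 1 / (4 * real N)"
    have t: "0 < t" "t \<le> 1" using N by (auto simp: t_def)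
    let ?g = "(fdiff i t ^^ (n + 1)) h"
    have g: "periodic_on UNIV ?g" "integrable torus_measure ?g"
      "\<And>k. fourier_coeff ?g k = (cis (2 * pi * (k $ i * t)) - 1) ^ (n + 1) * fourier_coeff h k"
      using fdiff_funpow_fourier[where i = i and n = "n + 1", OF h less_imp_le[OF t(1)] t(2)] by blast+
    have gm: "?g \<in> borel_measurable torus_measure" using g(2) by auto
    let ?B = "(C * \<bar>t\<bar> powr (s + n))\<^sup>2"
    have gb: "norm ((norm (?g x))\<^sup>2) \<le> ?B" for x using power_mono[OF C[of t x] norm_ge_zero, of 2] by simp
    have "norm (fourier_coeff h k) \<le> norm (fourier_coeff ?g k)" if "k \<in> F" for k
    proof -
      let ?\<theta> = "2 * pi * (k $ i * t)"
      have "real_of_int (int N) \<le> real_of_int \<bar>k $ i\<bar>" "real_of_int \<bar>k $ i\<bar> < real_of_int (2 * int N)"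
        using k[OF that] by (simp_all only: of_int_le_iff of_int_less_iff)
      \<comment> \<open>With this step size the angle 2 pi k_i t lies, up to sign, between pi / 2
        and pi. There the cosine is not positive, so the squared multiplier 2 - 2 cos is at least
        2.\<close>
      then have "1 / 4 \<le> \<bar>real_of_int (k $ i)\<bar> * t" "\<bar>real_of_int (k $ i)\<bar> * t \<le> 1 / 2" using N by (simp_all add: t_def field_simps)
      then have "pi / 2 \<le> \<bar>?\<theta>\<bar>" "\<bar>?\<theta>\<bar> \<le> pi" using t(1) by (simp_all add: abs_mult)
      then have "cos \<bar>?\<theta>\<bar> \<le> cos (pi / 2)" by (intro cos_monotone_0_pi_le) auto
      then have "cos ?\<theta> \<le> 0" by (simp only: cos_abs_real cos_pi_half)
      then have "1 \<le> (norm (cis ?\<theta> - 1))\<^sup>2"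
        unfolding norm_cis_minus_one_sq by linarith
      then have "1 \<le> norm (cis ?\<theta> - 1)" using power2_le_imp_le[of 1 "norm (cis ?\<theta> - 1)"] by simp
      then have "1 \<le> norm (cis ?\<theta> - 1) ^ (n + 1)" by (rule one_le_power)
      then have "1 * norm (fourier_coeff h k) \<le> norm (cis ?\<theta> - 1) ^ (n + 1) * norm (fourier_coeff h k)" by (intro mult_right_mono) auto
      then show ?thesis unfolding g(3) norm_mult norm_power by simp
    qed
    then have "(\<Sum>k\<in>F. (norm (fourier_coeff h k))\<^sup>2) \<le> (\<Sum>k\<in>F. (norm (fourier_coeff ?g k))\<^sup>2)"
      by (intro sum_mono power_mono) auto
    also have "\<dots> \<le> (\<integral>x. (norm (?g x))\<^sup>2 \<partial>torus_measure)"
    proof (rule bessel[OF gm _ F])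
      show "integrable torus_measure (\<lambda>x. (norm (?g x))\<^sup>2)"
        by (rule torus_integrable_bounded[where B = ?B]) (use gm gb in auto)
    qed
    also have "\<dots> \<le> ?B" using torus_integral_bound[of "\<lambda>x. (norm (?g x))\<^sup>2" ?B] gm gb by simp
    also have "\<bar>t\<bar> = (4 * real N) powr (- 1)" using t(1) N by (simp add: t_def powr_minus_divide)
    also have "(C * ((4 * real N) powr (- 1)) powr (s + n))\<^sup>2 = (C\<^sup>2 * 4 powr (- 2 * (s + n))) * real N powr (- 2 * (s + n))"
    proof -
      have sq: "(y powr z)\<^sup>2 = y powr (2 * z)" for y z :: real by (simp add: power2_eq_square powr_add[symmetric])
      have "- 1 * (s + n) * 2 = - 2 * (s + n)" by simp
      then show ?thesis unfolding powr_powr power_mult_distrib sq by (simp add: powr_mult)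
    qed
    finally show ?thesis .
  qed
  then show ?thesis by blast
qed

section \<open>Localization of Hoelder functions by a cutoff in a box\<close>

lemma abs_le_powr: "\<bar>t\<bar> \<le> 1 \<Longrightarrow> s \<le> 1 \<Longrightarrow> \<bar>t::real\<bar> \<le> \<bar>t\<bar> powr s"
  using powr_mono'[of s 1 "\<bar>t\<bar>"] by (cases "t = 0") auto

text \<open>The side length of the box is below 1, so increments inside it satisfy |t| <= |t| ^ s
  and a Lipschitz bound implies the Hoelder bound.\<close>

locale loc_box =
  fixes V :: "(real^'d) set" and a :: "real^'d" and \<rho> :: real and i :: 'd and s :: real
  assumes V: "torus_open V" and Q: "cbox (a - (\<chi> i. \<rho>)) (a + (\<chi> i. \<rho>)) \<subseteq> V"
    and \<rho>: "0 < \<rho>" "\<rho> < 1 / 2" and s: "0 \<le> s" "s \<le> 1"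
begin

abbreviation box_of :: "real \<Rightarrow> (real^'d) set" where
  "box_of r \<equiv> cbox (a - (\<chi> i. r)) (a + (\<chi> i. r))"

text \<open>The local counterpart of \<open>dirh\<close>, with bounds on the box only. The
  derivatives are demanded on all of \<open>V\<close>, so that the product with a cutoff supported
  in \<open>V\<close> can be differentiated at every point.\<close>

primrec loch :: "nat \<Rightarrow> (real^'d \<Rightarrow> complex) \<Rightarrow> bool" where
  "loch 0 f \<longleftrightarrow> (\<exists>B. \<forall>x\<in>box_of \<rho>. norm (f x) \<le> B) \<and>
     (\<exists>C. \<forall>x t. x \<in> box_of \<rho> \<longrightarrow> x + t *\<^sub>R axis i 1 \<in> box_of \<rho> \<longrightarrow> norm (f (x + t *\<^sub>R axis i 1) - f x) \<le> C * \<bar>t\<bar> powr s)"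
| "loch (Suc n) f \<longleftrightarrow> (\<exists>B. \<forall>x\<in>box_of \<rho>. norm (f x) \<le> B) \<and>
     (\<exists>f'. (\<forall>x\<in>V. has_pderiv i f (f' x) x) \<and> periodic_on V f' \<and> loch n f')"

lemma mem_box_of: "x \<in> box_of r \<longleftrightarrow> (\<forall>j. \<bar>x $ j - a $ j\<bar> \<le> r)"
  by (simp add: mem_box_cart abs_le_iff) (metis add.commute diff_le_eq minus_diff_eq le_diff_eq)

lemma in_V: "x + lattice_vec k \<in> box_of \<rho> \<Longrightarrow> x \<in> V"
proof -
  assume "x + lattice_vec k \<in> box_of \<rho>"
  then have "x + lattice_vec k + lattice_vec (- k) \<in> V" using V Q unfolding torus_open_def by blast
  then show "x \<in> V" by simp
qed

lemma loch_bounded: "loch n f \<Longrightarrow> \<exists>B. \<forall>x\<in>box_of \<rho>. norm (f x) \<le> B"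
  by (cases n) auto

lemma box_step:
  assumes "x \<in> box_of \<rho>" "x + t *\<^sub>R axis i 1 \<in> box_of \<rho>" "u \<in> closed_segment 0 t"
  shows "x + u *\<^sub>R axis i 1 \<in> box_of \<rho>"
proof -
  obtain v where v: "0 \<le> v" "v \<le> 1" "u = v * t" using assms(3) by (auto simp: closed_segment_def)
  have "x + u *\<^sub>R axis i 1 = (1 - v) *\<^sub>R x + v *\<^sub>R (x + t *\<^sub>R axis i 1)"
    by (simp add: v(3) scaleR_left_diff_distrib scaleR_right_distrib)
  then show ?thesis using convexD_alt[OF convex_box(1) assms(1,2) v(1,2)] by simp
qed

lemma box_of_mono: "r \<le> r' \<Longrightarrow> x \<in> box_of r \<Longrightarrow> x \<in> box_of r'"
  unfolding mem_box_of by (meson order.trans)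

lemma box_step_le: "x \<in> box_of \<rho> \<Longrightarrow> x + t *\<^sub>R axis i 1 \<in> box_of \<rho> \<Longrightarrow> \<bar>t\<bar> \<le> 1"
proof -
  assume "x \<in> box_of \<rho>" "x + t *\<^sub>R axis i 1 \<in> box_of \<rho>"
  then have "\<bar>x $ i - a $ i\<bar> \<le> \<rho>" "\<bar>x $ i + t - a $ i\<bar> \<le> \<rho>" unfolding mem_box_of by (auto simp: axis_def dest: spec[of _ i])
  then show ?thesis using \<rho> by linarith
qed

lemma box_shift: "x \<in> box_of r \<Longrightarrow> \<bar>t\<bar> \<le> r' - r \<Longrightarrow> x + t *\<^sub>R axis i 1 \<in> box_of r'"
  unfolding mem_box_of
proof
  fix j assume x: "\<forall>j. \<bar>x $ j - a $ j\<bar> \<le> r" and t: "\<bar>t\<bar> \<le> r' - r"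
  have "\<bar>(t *\<^sub>R axis i (1::real)) $ j\<bar> \<le> \<bar>t\<bar>" by (simp add: axis_def)
  then show "\<bar>(x + t *\<^sub>R axis i 1) $ j - a $ j\<bar> \<le> r'"
    unfolding vector_add_component using spec[OF x, of j] t by arith
qed

text \<open>Needed for the second term of the product rule, in which \<open>f\<close> itself appears
  undifferentiated at the lower level. A bounded derivative gives a Lipschitz bound in direction
  \<open>i\<close>, and increments in the box are at most 1.\<close>

lemma loch_Suc_imp: "loch (Suc n) f \<Longrightarrow> loch n f"
proof (induction n arbitrary: f)
  case 0
  then obtain f' where f': "\<And>x. x \<in> V \<Longrightarrow> has_pderiv i f (f' x) x" "loch 0 f'" by auto
  obtain B where B: "\<And>x. x \<in> box_of \<rho> \<Longrightarrow> norm (f' x) \<le> B" using f'(2) by auto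
  have "norm (f (x + t *\<^sub>R axis i 1) - f x) \<le> \<bar>B\<bar> * \<bar>t\<bar> powr s"
    if x: "x \<in> box_of \<rho>" "x + t *\<^sub>R axis i 1 \<in> box_of \<rho>" for x t
  proof -
    have "norm (f (x + t *\<^sub>R axis i 1) - f x) \<le> B * \<bar>t\<bar>"
    proof (rule pderiv_mvt[where D = "\<lambda>u. f' (x + u *\<^sub>R axis i 1)"])
      fix u assume "u \<in> closed_segment 0 t"
      then have "x + u *\<^sub>R axis i 1 \<in> box_of \<rho>" by (rule box_step[OF x])
      then show "has_pderiv i f (f' (x + u *\<^sub>R axis i 1)) (x + u *\<^sub>R axis i 1)" "norm (f' (x + u *\<^sub>R axis i 1)) \<le> B"
        using f'(1) B Q by auto
    qed
    also have "\<dots> \<le> \<bar>B\<bar> * \<bar>t\<bar> powr s"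
      using abs_le_powr[OF box_step_le[OF x] s(2)] by (intro mult_mono) auto
    finally show ?thesis .
  qed
  then show ?case using loch_bounded[OF 0] by auto
next
  case (Suc n)
  from Suc.prems obtain f' where f': "\<forall>x\<in>V. has_pderiv i f (f' x) x" "periodic_on V f'" "loch (Suc n) f'" 
    unfolding loch.simps(2)[of "Suc n"] by blast
  then show ?case using Suc.IH[OF f'(3)] loch_bounded[OF Suc.prems] unfolding loch.simps(2)[of n] by blast
qed

text \<open>By the product rule the derivative is f' \<eta> + f \<eta>', and both terms are covered
  by the induction hypothesis, since the cutoff is generalized and differentiation does not enlarge
  its support. Outside \<open>V\<close> the product vanishes on an open set.\<close>

lemma dirh_mult_cutoff:
  assumes r: "0 < r" "r < \<rho>"
  shows "loch n f \<Longrightarrow> periodic_on V f \<Longrightarrow> torus_smooth \<eta> \<Longrightarrow>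
    (\<And>x. x \<in> closure {x. \<eta> x \<noteq> 0} \<Longrightarrow> \<exists>k. x + lattice_vec k \<in> box_of r) \<Longrightarrow> dirh n i s (\<lambda>x. f x * \<eta> x)"
proof (induction n arbitrary: f \<eta>)
  case 0
  obtain B where "\<And>x. x \<in> box_of \<rho> \<Longrightarrow> norm (f x) \<le> B" using 0(1) by auto
  then have B: "\<And>x. x \<in> box_of \<rho> \<Longrightarrow> norm (f x) \<le> \<bar>B\<bar>" by (meson abs_ge_self order.trans)
  obtain C where "\<And>x t. x \<in> box_of \<rho> \<Longrightarrow> x + t *\<^sub>R axis i 1 \<in> box_of \<rho> \<Longrightarrow> norm (f (x + t *\<^sub>R axis i 1) - f x) \<le> C * \<bar>t\<bar> powr s"
    using 0(1) by auto
  then have C: "\<And>x t. x \<in> box_of \<rho> \<Longrightarrow> x + t *\<^sub>R axis i 1 \<in> box_of \<rho> \<Longrightarrow> norm (f (x + t *\<^sub>R axis i 1) - f x) \<le> \<bar>C\<bar> * \<bar>t\<bar> powr s"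
    by (meson abs_ge_self mult_right_mono order.trans powr_ge_zero)
  obtain E where E: "E \<ge> 0" "\<And>\<alpha> x. length \<alpha> \<le> 1 \<Longrightarrow> norm (pderivs \<alpha> \<eta> x) \<le> E"
    using torus_smooth_pderivs_bounded[OF 0(3)] by blast
  have E0: "norm (\<eta> x) \<le> E" for x using E(2)[of "[]" x] by simp
  have E1: "norm (pderiv_at i \<eta> x) \<le> E" for x using E(2)[of "[i]" x] by simp
  have sm: "smooth \<eta>" and pe: "\<And>x k. \<eta> (x + lattice_vec k) = \<eta> x" using 0(3) by (auto simp: torus_smooth_iff periodic_on_def)
  have pf: "f (x + lattice_vec k) = f x" if "x + lattice_vec k \<in> box_of \<rho>" for x k
    using 0(2) in_V[OF that] by (simp add: periodic_on_def)
  have supp: "\<exists>k. x + lattice_vec k \<in> box_of r" if "\<eta> x \<noteq> 0" for x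
    by (rule 0(4)) (use that closure_subset[of "{x. \<eta> x \<noteq> 0}"] in auto)
  have fB: "norm (f x * \<eta> x) \<le> \<bar>B\<bar> * E" for x
  proof (cases "\<eta> x = 0")
    case False
    then obtain k where "x + lattice_vec k \<in> box_of r" using supp by blast
    then have k: "x + lattice_vec k \<in> box_of \<rho>" using box_of_mono[OF less_imp_le[OF r(2)]] by blast
    show ?thesis unfolding norm_mult using B[OF k] pf[OF k] E0 by (intro mult_mono) auto
  qed (use E in simp)
  \<comment> \<open>The margin between the box that contains the support of \<eta> and the box on
    which \<open>f\<close> is controlled. If |t| is smaller and one end of the increment meets the
    support, a common lattice translate puts both ends into the larger box; for larger |t|
    boundedness suffices.\<close>
  define \<delta> where "\<delta> = \<rho> - r"
  have \<delta>: "0 < \<delta>" "\<delta> < 1" using r \<rho> by (auto simp: \<delta>_def)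
  let ?C = "2 * (\<bar>B\<bar> * E) * \<delta> powr (- s) + (\<bar>C\<bar> * E + \<bar>B\<bar> * E)"
  have "norm (f (x + t *\<^sub>R axis i 1) * \<eta> (x + t *\<^sub>R axis i 1) - f x * \<eta> x) \<le> ?C * \<bar>t\<bar> powr s" for x t
  proof (cases "\<bar>t\<bar> < \<delta>")
    case False
    have "1 = \<delta> powr (- s) * \<delta> powr s" using \<delta> by (simp add: powr_add[symmetric])
    also have "\<dots> \<le> \<delta> powr (- s) * \<bar>t\<bar> powr s" using False \<delta> s by (intro mult_left_mono powr_mono2) auto
    finally have 1: "1 \<le> \<delta> powr (- s) * \<bar>t\<bar> powr s" .
    have "norm (f (x + t *\<^sub>R axis i 1) * \<eta> (x + t *\<^sub>R axis i 1) - f x * \<eta> x) \<le> 2 * (\<bar>B\<bar> * E) * 1"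
      using norm_triangle_ineq4[of "f (x + t *\<^sub>R axis i 1) * \<eta> (x + t *\<^sub>R axis i 1)" "f x * \<eta> x"] fB[of x] fB[of "x + t *\<^sub>R axis i 1"] by linarith
    also have "\<dots> \<le> 2 * (\<bar>B\<bar> * E) * (\<delta> powr (- s) * \<bar>t\<bar> powr s)" using 1 E by (intro mult_left_mono) auto
    also have "\<dots> \<le> ?C * \<bar>t\<bar> powr s" using E unfolding distrib_right mult.assoc[symmetric] by simp
    finally show ?thesis .
  next
    case True
    let ?y = "x + t *\<^sub>R axis i 1"
    show ?thesis
    proof (cases "\<eta> x = 0 \<and> \<eta> ?y = 0")
      case True
      then show ?thesis using E by simp
    next
      case False
      then obtain k where k': "x + lattice_vec k \<in> box_of r \<or> ?y + lattice_vec k \<in> box_of r" using supp by blast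
      have eq: "x + lattice_vec k + t *\<^sub>R axis i 1 = ?y + lattice_vec k" by (simp add: add_ac)
      have k: "x + lattice_vec k \<in> box_of \<rho> \<and> ?y + lattice_vec k \<in> box_of \<rho>"
        using k'
      proof
        assume *: "x + lattice_vec k \<in> box_of r"
        show ?thesis
          using box_of_mono[OF less_imp_le[OF r(2)] *] box_shift[OF *, of t \<rho>] True unfolding \<delta>_def eq by simp
      next
        assume *: "?y + lattice_vec k \<in> box_of r"
        have "?y + lattice_vec k + (- t) *\<^sub>R axis i 1 = x + lattice_vec k" by simp
        then show ?thesis
          using box_of_mono[OF less_imp_le[OF r(2)] *] box_shift[OF *, of "- t" \<rho>] True unfolding \<delta>_def by simp
      qed
      note k = conjunct1[OF k] conjunct2[OF k]
      have df: "norm (f ?y - f x) \<le> \<bar>C\<bar> * \<bar>t\<bar> powr s"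
        using C[OF k(1), of t] k pf[OF k(1)] pf[OF k(2)] unfolding eq by simp
      have de: "norm (\<eta> ?y - \<eta> x) \<le> E * \<bar>t\<bar>"
        by (rule pderiv_mvt[where D = "\<lambda>u. pderiv_at i \<eta> (x + u *\<^sub>R axis i 1)"]) (auto intro: smooth_has_pderiv sm E1)
      have ts: "\<bar>t\<bar> \<le> \<bar>t\<bar> powr s" using True \<delta> s by (intro abs_le_powr) auto
      have fx: "norm (f x) \<le> \<bar>B\<bar>" using B[OF k(1)] pf[OF k(1)] by simp
      have "f ?y * \<eta> ?y - f x * \<eta> x = (f ?y - f x) * \<eta> ?y + f x * (\<eta> ?y - \<eta> x)" by (simp add: algebra_simps)
      also have "norm \<dots> \<le> (\<bar>C\<bar> * \<bar>t\<bar> powr s) * E + \<bar>B\<bar> * (E * \<bar>t\<bar> powr s)"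
      proof (intro norm_triangle_le add_mono)
        show "norm ((f ?y - f x) * \<eta> ?y) \<le> (\<bar>C\<bar> * \<bar>t\<bar> powr s) * E"
          unfolding norm_mult using df E0 by (intro mult_mono) auto
        have "norm (\<eta> ?y - \<eta> x) \<le> E * \<bar>t\<bar> powr s" using de mult_left_mono[OF ts E(1)] by linarith
        then show "norm (f x * (\<eta> ?y - \<eta> x)) \<le> \<bar>B\<bar> * (E * \<bar>t\<bar> powr s)"
          unfolding norm_mult using fx by (intro mult_mono) auto
      qed
      also have "\<dots> = (\<bar>C\<bar> * E + \<bar>B\<bar> * E) * \<bar>t\<bar> powr s" by (simp add: algebra_simps)
      also have "\<dots> \<le> ?C * \<bar>t\<bar> powr s" using E by (intro mult_right_mono) auto
      finally show ?thesis .
    qed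
  qed
  then show ?case unfolding dirh.simps by blast
next
  case (Suc n)
  from Suc.prems(1) obtain f' where f': "\<And>x. x \<in> V \<Longrightarrow> has_pderiv i f (f' x) x" "periodic_on V f'" "loch n f'" by auto
  have sm: "smooth \<eta>" using Suc.prems(3) by (simp add: torus_smooth_iff)
  let ?S = "closure {x. \<eta> x \<noteq> 0}"
  have out0: "\<eta> x = 0" if "x \<notin> ?S" for x using that closure_subset[of "{x. \<eta> x \<noteq> 0}"] by auto
  have op: "open (- ?S)" by (rule open_Compl[OF closed_closure])
  have out: "\<eta> x = 0" "pderiv_at i \<eta> x = 0" if "x \<notin> ?S" for x
  proof -
    show "\<eta> x = 0" using that by (rule out0)
    have "pderiv_at i \<eta> x = pderiv_at i (\<lambda>_. 0) x"
      by (rule pderiv_at_cong_open[OF op iffD2[OF Compl_iff that]]) (rule out0, erule ComplD)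
    then show "pderiv_at i \<eta> x = 0" by simp
  qed
  have SV: "?S \<subseteq> V"
  proof
    fix x assume "x \<in> ?S"
    then obtain k where k: "x + lattice_vec k \<in> box_of r" using Suc.prems(4) by blast
    have "x + lattice_vec k \<in> box_of \<rho>" by (rule box_of_mono[OF less_imp_le[OF r(2)] k])
    then show "x \<in> V" by (rule in_V)
  qed
  have der: "has_pderiv i (\<lambda>x. f x * \<eta> x) (f' x * \<eta> x + f x * pderiv_at i \<eta> x) x" for x
  proof (cases "x \<in> V")
    case True
    then show ?thesis using f'(1) sm by (intro has_pderiv_mult smooth_has_pderiv)
  next
    case False
    then have x: "x \<in> - ?S" using SV by blast
    have z: "f y * \<eta> y = 0" if "y \<in> - ?S" for y unfolding out(1)[OF ComplD[OF that]] by simp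
    have "has_pderiv i (\<lambda>x. f x * \<eta> x) 0 x"
      by (rule has_pderiv_cong_open[OF has_pderiv_const[where c = 0] op x z])
    then show ?thesis unfolding out(1)[OF ComplD[OF x]] out(2)[OF ComplD[OF x]] by simp
  qed
  have "dirh n i s (\<lambda>x. f' x * \<eta> x)" by (rule Suc.IH[OF f'(3,2) Suc.prems(3,4)])
  moreover have "dirh n i s (\<lambda>x. f x * pderiv_at i \<eta> x)"
  proof (rule Suc.IH[OF loch_Suc_imp[OF Suc.prems(1)] Suc.prems(2)])
    show "torus_smooth (pderiv_at i \<eta>)" using torus_smooth_pderivs[OF Suc.prems(3), of "[i]"] by simp
    have "{x. pderiv_at i \<eta> x \<noteq> 0} \<subseteq> ?S" using out(2) by blast
    then have "closure {x. pderiv_at i \<eta> x \<noteq> 0} \<subseteq> ?S" by (rule closure_minimal) simp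
    then show "\<exists>k. x + lattice_vec k \<in> box_of r" if "x \<in> closure {x. pderiv_at i \<eta> x \<noteq> 0}" for x
      using Suc.prems(4) that by blast
  qed
  ultimately have "dirh n i s (\<lambda>x. f' x * \<eta> x + f x * pderiv_at i \<eta> x)" by (rule dirh_add)
  with der show ?case unfolding dirh.simps by (intro exI[of _ "\<lambda>x. f' x * \<eta> x + f x * pderiv_at i \<eta> x"] conjI allI)
qed

lemma holder_locD:
  assumes f: "f \<in> holder_loc n s V"
  shows "periodic_on V f"
    and "length \<alpha> < n \<Longrightarrow> x \<in> V \<Longrightarrow> has_pderiv j (pderivs \<alpha> f) (pderivs (j # \<alpha>) f x) x"
    and "\<exists>C>0. \<forall>\<alpha> x y. length \<alpha> = n \<and> x \<in> box_of \<rho> \<and> y \<in> box_of \<rho> \<longrightarrow>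
           norm (pderivs \<alpha> f x - pderivs \<alpha> f y) \<le> C * norm (x - y) powr s"
proof -
  have h: "periodic_on V f \<and> has_pderivs_on n V f \<and> (\<forall>K. compact K \<and> K \<subseteq> V \<longrightarrow>
        (\<exists>C>0. \<forall>\<alpha> x y. length \<alpha> = n \<and> x \<in> K \<and> y \<in> K \<longrightarrow>
           norm (pderivs \<alpha> f x - pderivs \<alpha> f y) \<le> C * norm (x - y) powr s))"
    using f unfolding holder_loc_def mem_Collect_eq .
  show "periodic_on V f" by (rule conjunct1[OF h])
  show "\<exists>C>0. \<forall>\<alpha> x y. length \<alpha> = n \<and> x \<in> box_of \<rho> \<and> y \<in> box_of \<rho> \<longrightarrow>
           norm (pderivs \<alpha> f x - pderivs \<alpha> f y) \<le> C * norm (x - y) powr s"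
    by (rule mp[OF spec[OF conjunct2[OF conjunct2[OF h]], of "box_of \<rho>"] conjI[OF compact_cbox Q]])
  assume l: "length \<alpha> < n" and x: "x \<in> V"
  have "has_pderivs_on n V f" by (rule conjunct1[OF conjunct2[OF h]])
  then have "\<forall>x\<in>V. (\<lambda>t. pderivs \<alpha> f (x + t *\<^sub>R axis j 1)) differentiable (at 0)"
    using l unfolding has_pderivs_on_def by (elim allE[of _ \<alpha>] allE[of _ j] impE)
  then have "(\<lambda>t. pderivs \<alpha> f (x + t *\<^sub>R axis j 1)) differentiable (at 0)" by (rule bspec[OF _ x])
  then show "has_pderiv j (pderivs \<alpha> f) (pderivs (j # \<alpha>) f x) x" by (simp add: differentiable_imp_has_pderiv)
qed

lemma holder_loc_lipschitz:
  assumes f: "f \<in> holder_loc n s V"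
  obtains C where "C > 0" "\<And>\<alpha> x y. length \<alpha> = n \<Longrightarrow> x \<in> box_of \<rho> \<Longrightarrow> y \<in> box_of \<rho> \<Longrightarrow>
      norm (pderivs \<alpha> f x - pderivs \<alpha> f y) \<le> C * norm (x - y) powr s"
proof -
  from holder_locD(3)[OF f] obtain C where C: "C > 0 \<and> (\<forall>\<alpha> x y. length \<alpha> = n \<and> x \<in> box_of \<rho> \<and> y \<in> box_of \<rho> \<longrightarrow>
           norm (pderivs \<alpha> f x - pderivs \<alpha> f y) \<le> C * norm (x - y) powr s)" by (elim exE)
  show ?thesis
  proof (rule that[of C])
    show "C > 0" by (rule conjunct1[OF C])
    fix \<alpha> :: "'d list" and x y :: "real^'d" assume "length \<alpha> = n" "x \<in> box_of \<rho>" "y \<in> box_of \<rho>"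
    then show "norm (pderivs \<alpha> f x - pderivs \<alpha> f y) \<le> C * norm (x - y) powr s"
      by (intro mp[OF spec[OF spec[OF spec[OF conjunct2[OF C]]]]] conjI)
  qed
qed

text \<open>Induction downwards from the top order. There the Hoelder bound compares every value
  with the one at the centre \<open>a\<close>; below, the derivatives of the next order are bounded,
  and the Lipschitz estimate on the box gives the bound.\<close>

lemma holder_loc_bounded:
  assumes f: "f \<in> holder_loc n s V"
  shows "length \<alpha> \<le> n \<Longrightarrow> \<exists>B. \<forall>x\<in>box_of \<rho>. norm (pderivs \<alpha> f x) \<le> B"
proof (induction "n - length \<alpha>" arbitrary: \<alpha>)
  case 0
  then have l: "length \<alpha> = n" by simp
  obtain C where C: "C > 0" "\<And>\<alpha> x y. length \<alpha> = n \<Longrightarrow> x \<in> box_of \<rho> \<Longrightarrow> y \<in> box_of \<rho> \<Longrightarrow>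
      norm (pderivs \<alpha> f x - pderivs \<alpha> f y) \<le> C * norm (x - y) powr s"
    using holder_loc_lipschitz[OF f] by blast
  have a: "a \<in> box_of \<rho>" unfolding mem_box_of using \<rho> by simp
  obtain D where D: "\<And>x. x \<in> box_of \<rho> \<Longrightarrow> norm (x - a) \<le> D"
  proof -
    have "bounded ((\<lambda>x. x - a) ` box_of \<rho>)"
      by (intro compact_imp_bounded compact_continuous_image continuous_intros compact_cbox)
    then show ?thesis using that unfolding bounded_iff by blast
  qed
  have "norm (pderivs \<alpha> f x) \<le> norm (pderivs \<alpha> f a) + C * D powr s" if "x \<in> box_of \<rho>" for x
  proof -
    have "norm (pderivs \<alpha> f x - pderivs \<alpha> f a) \<le> C * norm (x - a) powr s" by (rule C(2)[OF l that a])
    also have "\<dots> \<le> C * D powr s" using D[OF that] s C by (intro mult_left_mono powr_mono2) auto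
    finally show ?thesis using norm_triangle_sub[of "pderivs \<alpha> f x" "pderivs \<alpha> f a"] by linarith
  qed
  then show ?case by blast
next
  case (Suc k)
  have "\<exists>B. \<forall>x\<in>box_of \<rho>. norm (pderivs (j # \<alpha>) f x) \<le> B" for j
    by (rule Suc.hyps(1)) (use Suc.hyps(2) in auto)
  then obtain Bf where Bf: "\<And>j x. x \<in> box_of \<rho> \<Longrightarrow> norm (pderivs (j # \<alpha>) f x) \<le> Bf j" by metis
  have a: "a \<in> box_of \<rho>" unfolding mem_box_of using \<rho> by simp
  define B where "B = (\<Sum>j\<in>UNIV. \<bar>Bf j\<bar>)"
  have B: "norm (pderivs (j # \<alpha>) f x) \<le> B" if "x \<in> box_of \<rho>" for j x
  proof -
    have "\<bar>Bf j\<bar> \<le> B" unfolding B_def by (rule member_le_sum) auto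
    then show ?thesis using Bf[OF that, of j] by linarith
  qed
  have hp: "has_pderiv j (pderivs \<alpha> f) (pderivs (j # \<alpha>) f x) x" if "x \<in> box_of \<rho>" for j x
  proof -
    have "length \<alpha> < n" using Suc.hyps(2) by simp
    moreover have "x \<in> V" using that Q by (rule set_rev_mp)
    ultimately show ?thesis by (rule holder_locD(2)[OF f])
  qed
  have "norm (pderivs \<alpha> f x) \<le> norm (pderivs \<alpha> f a) + B * (\<Sum>j\<in>(UNIV :: 'd set). \<rho>)" if x: "x \<in> box_of \<rho>" for x
  proof -
    have "norm (pderivs \<alpha> f x - pderivs \<alpha> f a) \<le> B * (\<Sum>j\<in>UNIV. \<bar>x $ j - a $ j\<bar>)"
      by (rule box_lipschitz[OF hp B a x])
    also have "\<dots> \<le> B * (\<Sum>j\<in>(UNIV :: 'd set). \<rho>)"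
      using x unfolding mem_box_of by (intro mult_left_mono sum_mono) (auto simp: B_def sum_nonneg)
    finally show ?thesis using norm_triangle_sub[of "pderivs \<alpha> f x" "pderivs \<alpha> f a"] by linarith
  qed
  then show ?case by blast
qed

text \<open>The induction climbs from the n-th derivative in direction \<open>i\<close>, which
  carries the Hoelder bound, back to \<open>f\<close>.\<close>

lemma holder_loc_imp_loch:
  assumes f: "f \<in> holder_loc n s V"
  shows "loch n f"
proof -
  have "loch k (pderivs (replicate (n - k) i) f)" if "k \<le> n" for k
    using that
  proof (induction k)
    case 0
    obtain C where C: "C > 0" "\<And>\<alpha> x y. length \<alpha> = n \<Longrightarrow> x \<in> box_of \<rho> \<Longrightarrow> y \<in> box_of \<rho> \<Longrightarrow>
        norm (pderivs \<alpha> f x - pderivs \<alpha> f y) \<le> C * norm (x - y) powr s"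
      using holder_loc_lipschitz[OF f] by blast
    have "norm (pderivs (replicate n i) f (x + t *\<^sub>R axis i 1) - pderivs (replicate n i) f x) \<le> C * \<bar>t\<bar> powr s"
      if "x \<in> box_of \<rho>" "x + t *\<^sub>R axis i 1 \<in> box_of \<rho>" for x t
      using C(2)[of "replicate n i", OF _ that(2,1)] by simp
    then show ?case using holder_loc_bounded[OF f, of "replicate n i"] by auto
  next
    case (Suc k)
    let ?\<alpha> = "replicate (n - Suc k) i"
    have eq: "replicate (n - k) i = i # ?\<alpha>" using Suc.prems by (metis Suc_diff_le diff_Suc_Suc replicate_Suc)
    have "has_pderiv i (pderivs ?\<alpha> f) (pderivs (i # ?\<alpha>) f x) x" if "x \<in> V" for x
      by (rule holder_locD(2)[OF f _ that]) (use Suc.prems in simp)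
    moreover have "periodic_on V (pderivs (i # ?\<alpha>) f)" by (intro pderivs_periodic V holder_locD(1)[OF f])
    moreover have "loch k (pderivs (i # ?\<alpha>) f)" using Suc by (simp add: eq[symmetric] del: pderivs.simps)
    moreover have "\<exists>B. \<forall>x\<in>box_of \<rho>. norm (pderivs ?\<alpha> f x) \<le> B" by (rule holder_loc_bounded[OF f]) simp
    ultimately show ?case unfolding loch.simps(2) by blast
  qed
  from this[of n] show ?thesis by simp
qed

end


section \<open>Localized coefficients of the field\<close>

text \<open>The integral of the nonnegative function dominates all its Fourier coefficients. Were it
  zero, all coefficients would vanish, and so would the function by Fourier inversion.\<close>

lemma torus_integral_pos:
  fixes \<eta> :: "real^'d \<Rightarrow> real"
  assumes \<eta>: "torus_smooth \<eta>" "\<And>x. \<eta> x \<ge> 0" "\<eta> a > 0"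
  shows "0 < integral\<^sup>L torus_measure \<eta>"
proof (rule ccontr)
  assume "\<not> 0 < integral\<^sup>L torus_measure \<eta>"
  then have I: "integral\<^sup>L torus_measure \<eta> \<le> 0" by simp
  have s: "torus_smooth (\<lambda>x. complex_of_real (\<eta> x))" by (rule torus_smooth_of_real[OF \<eta>(1)])
  have "norm (fourier_coeff (\<lambda>x. complex_of_real (\<eta> x)) k) \<le> 0" for k
  proof -
    have "norm (fourier_coeff (\<lambda>x. complex_of_real (\<eta> x)) k) \<le> (\<integral>x. norm (complex_of_real (\<eta> x) * cnj (fourier_mode k x)) \<partial>torus_measure)"
      unfolding fourier_coeff_eq by (rule integral_norm_bound)
    also have "\<dots> = integral\<^sup>L torus_measure \<eta>" using \<eta>(2) by (simp add: norm_mult)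
    finally show ?thesis using I by linarith
  qed
  then have "fourier_coeff (\<lambda>x. complex_of_real (\<eta> x)) = (\<lambda>_. 0)" by auto
  then have "(\<lambda>x. complex_of_real (\<eta> x)) = fseries (\<lambda>_. 0)" using fourier_inversion[OF s] by simp
  then have "complex_of_real (\<eta> a) = 0" by (simp add: fun_eq_iff fseries_def)
  then show False using \<eta>(3) by simp
qed

text \<open>A cube of N ^ d frequencies of size comparable to N, placed away from the hyperplane k_i
  = 0 so that differences in direction \<open>i\<close> see all of them.\<close>

definition corner_block :: "'d \<Rightarrow> nat \<Rightarrow> (int^'d) set" where
  "corner_block i N = {k. \<forall>j. k $ j \<in> (if j = i then {int N..<2 * int N} else {0..<int N})}"

lemma finite_corner_block: "finite (corner_block i N)"
  and card_corner_block: "card (corner_block (i::'d::finite) N) = N ^ CARD('d)"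
proof -
  have *: "finite (corner_block i N) \<and> card (corner_block i N) = (\<Prod>j\<in>UNIV. card (if j = i then {int N..<2 * int N} else {0..<int N}))"
    unfolding corner_block_def by (rule card_vec_box) simp
  have "card (if j = i then {int N..<2 * int N} else {0..<int N}) = N" for j by simp
  then show "finite (corner_block i N)" "card (corner_block i N) = N ^ CARD('d)" using * by simp_all
qed

lemma corner_block_bounds:
  assumes "k \<in> corner_block i N"
  shows "int N \<le> \<bar>k $ i\<bar> \<and> \<bar>k $ i\<bar> < 2 * int N" "real N \<le> jap k" "jap k \<le> 2 * real N"
proof -
  have k: "k $ j \<in> (if j = i then {int N..<2 * int N} else {0..<int N})" for j using assms by (simp add: corner_block_def)
  show i: "int N \<le> \<bar>k $ i\<bar> \<and> \<bar>k $ i\<bar> < 2 * int N" using k[of i] by auto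
  have "int N \<le> int (inorm k)" using i inorm_ge[of k i] by linarith
  then show "real N \<le> jap k" by (simp add: jap_def)
  obtain j where j: "\<bar>k $ j\<bar> = int (inorm k)" by (rule inorm_attained)
  have "int (inorm k) < 2 * int N" unfolding j[symmetric] using k[of j] by (auto split: if_splits)
  then show "jap k \<le> 2 * real N" by (simp add: jap_def)
qed

context matern_noise
begin

text \<open>Pairing a distribution with this test function yields the Fourier coefficient at
  \<open>k\<close> of its product with \<eta>.\<close>

definition cutoff_mode :: "(real^'d \<Rightarrow> real) \<Rightarrow> int^'d \<Rightarrow> real^'d \<Rightarrow> complex" where
  "cutoff_mode \<eta> k = (\<lambda>x. complex_of_real (\<eta> x) * cnj (fourier_mode k x))"

text \<open>The adjoint operator applied to the cutoff mode; the noise at this function is the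
  localized Fourier coefficient of the field.\<close>

abbreviation adj_mode :: "(real^'d \<Rightarrow> real) \<Rightarrow> int^'d \<Rightarrow> real^'d \<Rightarrow> complex" where
  "adj_mode \<eta> k \<equiv> fseries (coef (cutoff_mode \<eta> k))"

lemma torus_smooth_cutoff_mode: "torus_smooth \<eta> \<Longrightarrow> torus_smooth (cutoff_mode \<eta> k)"
  unfolding cutoff_mode_def by (intro torus_smooth_mult torus_smooth_of_real torus_smooth_cnj torus_smooth_fourier_mode)

lemma torus_smooth_adj_mode: "torus_smooth \<eta> \<Longrightarrow> torus_smooth (adj_mode \<eta> k)"
  by (intro torus_smooth_fseries rapid_coef torus_smooth_cutoff_mode)

text \<open>The coefficient of the adjoint at the frequency \<open>- k\<close> is \<open>\<integral> q\<^sub>m(x, k) \<eta>(x) dx\<close>; by Bessel's inequality it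
  bounds the variance of the localized coefficient from below.\<close>

lemma adj_mode_variance:
  assumes \<eta>: "torus_smooth \<eta>" "\<And>x. \<eta> x \<ge> 0" "\<eta> a > 0" and m1: "\<And>x. \<eta> x \<noteq> 0 \<Longrightarrow> m x \<le> m1"
  shows "\<exists>c>0. \<forall>N k. N \<ge> 1 \<longrightarrow> k \<in> corner_block i N \<longrightarrow>
    c * real N powr (- 2 * m1) \<le> expectation (\<lambda>\<omega>. (norm (W (adj_mode \<eta> k) \<omega>))\<^sup>2)"
proof -
  obtain C where C: "C > 0" "\<And>k x. jap k powr (- m x) \<le> C * norm (sym k x)" using norm_sym_bounds by blast
  let ?I = "integral\<^sup>L torus_measure \<eta>"
  have I: "0 < ?I" by (rule torus_integral_pos[OF \<eta>])
  \<comment> \<open>\<open>jap k\<close> and N differ by a factor between 1 and 2, and m1 may have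
    either sign; hence the absolute value. \<open>C\<close> compares the symbol with the power of
    \<open>jap k\<close>.\<close>
  define c where "c = 2 powr (- \<bar>m1\<bar>) / C"
  have c: "0 < c" using C(1) by (simp add: c_def)
  have "(c * ?I)\<^sup>2 * real N powr (- 2 * m1) \<le> expectation (\<lambda>\<omega>. (norm (W (adj_mode \<eta> k) \<omega>))\<^sup>2)"
    if N: "N \<ge> 1" and k: "k \<in> corner_block i N" for N k
  proof -
    have jb: "real N \<le> jap k" "jap k \<le> 2 * real N" using corner_block_bounds[OF k] by auto
    have j1: "2 powr (- \<bar>m1\<bar>) * real N powr (- m1) \<le> jap k powr (- m1)"
    proof -
      have N0: "0 < real N" using N by simp
      define v where "v = jap k / real N"
      have v: "1 \<le> v" "v \<le> 2" "jap k = v * real N" using jb N0 by (simp_all add: v_def field_simps)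
      have "2 powr (- \<bar>m1\<bar>) \<le> v powr (- \<bar>m1\<bar>)" using v by (intro powr_mono2') auto
      also have "\<dots> \<le> v powr (- m1)" using v by (intro powr_mono) auto
      finally show ?thesis unfolding v(3) using v(1) by (simp add: powr_mult mult_right_mono)
    qed
    have lower: "c * real N powr (- m1) * \<eta> x \<le> norm (sym k x) * \<eta> x" for x
    proof (cases "\<eta> x = 0")
      case False
      have "jap k powr (- m1) \<le> jap k powr (- m x)" using m1[OF False] jap_ge_1[of k] by (intro powr_mono) auto
      then have "2 powr (- \<bar>m1\<bar>) * real N powr (- m1) \<le> C * norm (sym k x)" using j1 C(2)[of k x] by linarith
      then have "c * real N powr (- m1) \<le> norm (sym k x)" using C(1) by (simp add: c_def field_simps)
      then show ?thesis using \<eta>(2) by (intro mult_right_mono)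
    qed simp
    have ieta: "integrable torus_measure \<eta>" by (rule torus_smooth_integrable[OF \<eta>(1)])
    have isym: "integrable torus_measure (\<lambda>x. norm (sym k x) * \<eta> x)"
      by (intro continuous_torus_integrable continuous_on_mult continuous_on_norm torus_smooth_continuous torus_smooth_sym \<eta>(1))
    have "c * real N powr (- m1) * ?I = (\<integral>x. c * real N powr (- m1) * \<eta> x \<partial>torus_measure)" by simp
    also have "\<dots> \<le> (\<integral>x. norm (sym k x) * \<eta> x \<partial>torus_measure)"
      by (rule integral_mono[OF _ isym lower]) (use ieta in simp)
    finally have low: "c * real N powr (- m1) * ?I \<le> (\<integral>x. norm (sym k x) * \<eta> x \<partial>torus_measure)" .
    \<comment> \<open>\<lambda> is even in the frequency, so the symbol at - k is the positive
      number at k; the two modes then cancel and the coefficient is the integral of a nonnegative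
      function.\<close>
    have sym_eq: "sym (- k) x = complex_of_real (norm (sym k x))" for x
      by (simp add: matern_symbol_def matern_lambda_def)
    have one: "cnj (fourier_mode k x) * cnj (fourier_mode (- k) x) = 1" for x
      unfolding cnj_fourier_mode[of "- k"] minus_minus using complex_norm_square[of "fourier_mode k x"] by (simp add: mult.commute)
    have "sym (- k) x * cutoff_mode \<eta> k x * cnj (fourier_mode (- k) x) = complex_of_real (norm (sym k x) * \<eta> x)" for x
    proof -
      have "sym (- k) x * cutoff_mode \<eta> k x * cnj (fourier_mode (- k) x) = sym (- k) x * complex_of_real (\<eta> x) * (cnj (fourier_mode k x) * cnj (fourier_mode (- k) x))"
        unfolding cutoff_mode_def by (simp only: mult.assoc)
      then show ?thesis unfolding one sym_eq by simp
    qed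
    then have cf: "coef (cutoff_mode \<eta> k) (- k) = complex_of_real (\<integral>x. norm (sym k x) * \<eta> x \<partial>torus_measure)"
      unfolding coef_eq by (simp only: Bochner_Integration.integral_complex_of_real)
    note sm = torus_smooth_adj_mode[OF \<eta>(1), of k]
    have "(c * ?I)\<^sup>2 * real N powr (- 2 * m1) = (c * real N powr (- m1) * ?I)\<^sup>2"
      by (simp add: power_mult_distrib power2_eq_square powr_add[symmetric])
    also have "\<dots> \<le> (\<integral>x. norm (sym k x) * \<eta> x \<partial>torus_measure)\<^sup>2"
      using low c I by (intro power_mono) auto
    also have "\<dots> = (norm (fourier_coeff (adj_mode \<eta> k) (- k)))\<^sup>2"
      unfolding fourier_coeff_fseries[OF rapid_coef[OF torus_smooth_cutoff_mode[OF \<eta>(1)]]] cf by simp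
    also have "\<dots> \<le> (\<integral>x. (norm (adj_mode \<eta> k x))\<^sup>2 \<partial>torus_measure)"
      using bessel[of "adj_mode \<eta> k" "{- k}"] continuous_torus_measurable[OF torus_smooth_continuous[OF sm]]
        continuous_torus_integrable[OF continuous_on_power[OF continuous_on_norm[OF torus_smooth_continuous[OF sm]]]]
      by simp
    also have "\<dots> = expectation (\<lambda>\<omega>. (norm (W (adj_mode \<eta> k) \<omega>))\<^sup>2)" by (rule W_isometry[OF sm, symmetric])
    finally show ?thesis .
  qed
  moreover have "0 < (c * ?I)\<^sup>2" using c I by simp
  ultimately show ?thesis by blast
qed

text \<open>The complex coefficients are replaced by real ones of at least half the variance and
  multiplied by N ^ \<sigma>. Real combinations of these are real parts of a single noise value,
  hence Gaussian, and the means of the sums of squares grow at least like N to the power 2 \<sigma>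
  - 2 m1 + d, which is positive.\<close>

lemma noise_blocks_unbounded:
  assumes \<eta>: "torus_smooth \<eta>" "\<And>x. \<eta> x \<ge> 0" "\<eta> a > 0" and m1: "\<And>x. \<eta> x \<noteq> 0 \<Longrightarrow> m x \<le> m1"
    and \<sigma>: "m1 - real CARD('d) / 2 < \<sigma>"
  shows "AE \<omega> in M. \<not> (\<exists>C. \<forall>N::nat. N \<ge> 1 \<longrightarrow>
    (\<Sum>k\<in>corner_block i N. (norm (W (adj_mode \<eta> k) \<omega>))\<^sup>2) \<le> C * real N powr (- 2 * \<sigma>))"
proof -
  obtain c where c: "c > 0" "\<And>N k. N \<ge> 1 \<Longrightarrow> k \<in> corner_block i N \<Longrightarrow>
    c * real N powr (- 2 * m1) \<le> expectation (\<lambda>\<omega>. (norm (W (adj_mode \<eta> k) \<omega>))\<^sup>2)"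
    using adj_mode_variance[OF \<eta> m1] by blast
  let ?A = "\<lambda>n. corner_block i (Suc n)"
  define K where "K n = card (?A n)" for n
  have "\<exists>h. bij_betw h {..<K n} (?A n)" for n
    using ex_bij_betw_nat_finite[OF finite_corner_block[of i "Suc n"]] unfolding K_def atLeast0LessThan .
  then obtain en where en: "\<And>n. bij_betw (en n) {..<K n} (?A n)" by metis
  let ?Z = "\<lambda>k. W (adj_mode \<eta> k)"
  \<comment> \<open>Selects the real or the imaginary part, whichever has the larger second moment:
    Re (- i z) = Im z.\<close>
  define \<theta> where "\<theta> k = (if expectation (\<lambda>\<omega>. (Im (?Z k \<omega>))\<^sup>2) \<le> expectation (\<lambda>\<omega>. (Re (?Z k \<omega>))\<^sup>2) then 1 else - \<i>)" for k
  define Y where "Y k \<omega> = Re (\<theta> k * ?Z k \<omega>)" for k \<omega>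
  note sm = torus_smooth_adj_mode[OF \<eta>(1)]
  note [measurable] = W_measurable[OF sm]
  have Ym [measurable]: "Y k \<in> borel_measurable M" for k unfolding Y_def by measurable
  have Yle: "(Y k \<omega>)\<^sup>2 \<le> (norm (?Z k \<omega>))\<^sup>2" for k \<omega>
  proof -
    have "\<bar>Y k \<omega>\<bar> \<le> norm (\<theta> k * ?Z k \<omega>)" unfolding Y_def by (rule abs_Re_le_cmod)
    also have "\<dots> = norm (?Z k \<omega>)" by (simp add: \<theta>_def norm_mult)
    finally show ?thesis using abs_le_square_iff[of "Y k \<omega>" "norm (?Z k \<omega>)"] by simp
  qed
  have Yi: "integrable M (\<lambda>\<omega>. (Y k \<omega>)\<^sup>2)" for k
    by (rule Bochner_Integration.integrable_bound[OF W_square_integrable[OF sm[of k]]]) (use Yle in auto)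
  have Y0: "expectation (Y k) = 0" for k
    unfolding Y_def \<theta>_def using W_gaussian(3,4)[OF sm[of k]] by simp
  have Yv: "expectation (\<lambda>\<omega>. (norm (?Z k \<omega>))\<^sup>2) \<le> 2 * expectation (\<lambda>\<omega>. (Y k \<omega>)\<^sup>2)" for k
  proof -
    have i: "integrable M (\<lambda>\<omega>. (Re (?Z k \<omega>))\<^sup>2)" "integrable M (\<lambda>\<omega>. (Im (?Z k \<omega>))\<^sup>2)"
      by (rule Bochner_Integration.integrable_bound[OF W_square_integrable[OF sm[of k]]]; simp add: cmod_power2)+
    have "expectation (\<lambda>\<omega>. (norm (?Z k \<omega>))\<^sup>2) = expectation (\<lambda>\<omega>. (Re (?Z k \<omega>))\<^sup>2) + expectation (\<lambda>\<omega>. (Im (?Z k \<omega>))\<^sup>2)"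
      unfolding cmod_power2 by (rule Bochner_Integration.integral_add[OF i])
    then show ?thesis by (simp add: Y_def \<theta>_def)
  qed
  define X where "X n k \<omega> = real (Suc n) powr \<sigma> * Y (en n k) \<omega>" for n k \<omega>
  have "AE \<omega> in M. \<not> (\<exists>C. \<forall>n. (\<Sum>k<K n. (X n k \<omega>)\<^sup>2) \<le> C)"
  proof (rule gaussian_squares_unbounded)
    fix n :: nat and b :: "nat \<Rightarrow> real"
    let ?b = "\<lambda>k. complex_of_real (b k * real (Suc n) powr \<sigma>) * \<theta> (en n k)"
    let ?f = "\<lambda>x. \<Sum>k<K n. ?b k * adj_mode \<eta> (en n k) x"
    have f: "torus_smooth ?f" by (intro torus_smooth_sum torus_smooth_cmult sm)
    have "AE \<omega> in M. W ?f \<omega> = (\<Sum>k<K n. ?b k * ?Z (en n k) \<omega>)"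
      by (rule W_sum) (use sm in auto)
    then have ae: "AE \<omega> in M. (\<Sum>k<K n. b k * X n k \<omega>) = Re (W ?f \<omega>)"
    proof eventually_elim
      case (elim \<omega>)
      have "b k * X n k \<omega> = Re (?b k * ?Z (en n k) \<omega>)" for k
        unfolding X_def Y_def mult.assoc[of "complex_of_real _"] by simp
      then show ?case unfolding elim Re_sum by simp
    qed
    show "gaussian_rv M (\<lambda>\<omega>. \<Sum>k<K n. b k * X n k \<omega>)"
      by (rule gaussian_rv_cong_AE[OF W_gaussian(1)[OF f] _ ae]) (simp add: X_def)
  next
    fix n k :: nat
    show "X n k \<in> borel_measurable M" unfolding X_def by measurable
    show "integrable M (\<lambda>\<omega>. (X n k \<omega>)\<^sup>2)" unfolding X_def power_mult_distrib using Yi by simp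
    show "expectation (X n k) = 0" unfolding X_def using Y0 by simp
  next
    fix B :: real
    \<comment> \<open>The block has N ^ d members with scaled variances of order N to the power 2
      \<sigma> - 2 m1. The assumption on \<sigma> makes the total exponent positive.\<close>
    define p where "p = 2 * \<sigma> - 2 * m1 + real CARD('d)"
    have p: "p > 0" using \<sigma> by (simp add: p_def field_simps)
    obtain n :: nat where n: "(2 * \<bar>B\<bar> / c) powr (1 / p) \<le> real n" using real_arch_simple by blast
    have "2 * \<bar>B\<bar> / c = ((2 * \<bar>B\<bar> / c) powr (1 / p)) powr p" using p c(1) by (simp add: powr_powr)
    also have "\<dots> \<le> real (Suc n) powr p" using n p by (intro powr_mono2) auto
    finally have 1: "\<bar>B\<bar> \<le> c / 2 * real (Suc n) powr p" using c(1) by (simp add: field_simps)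
    have "real (Suc n) powr (2 * \<sigma>) * (c * real (Suc n) powr (- 2 * m1) / 2) \<le> expectation (\<lambda>\<omega>. (X n k \<omega>)\<^sup>2)" if "k < K n" for k
    proof -
      have "en n k \<in> ?A n" using en[of n] that unfolding bij_betw_def by blast
      then have "c * real (Suc n) powr (- 2 * m1) \<le> expectation (\<lambda>\<omega>. (norm (?Z (en n k) \<omega>))\<^sup>2)" by (intro c(2)) auto
      then have "c * real (Suc n) powr (- 2 * m1) / 2 \<le> expectation (\<lambda>\<omega>. (Y (en n k) \<omega>)\<^sup>2)" using Yv[of "en n k"] by linarith
      then have "real (Suc n) powr (2 * \<sigma>) * (c * real (Suc n) powr (- 2 * m1) / 2) \<le> real (Suc n) powr (2 * \<sigma>) * expectation (\<lambda>\<omega>. (Y (en n k) \<omega>)\<^sup>2)"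
        by (intro mult_left_mono) auto
      also have "real (Suc n) powr (2 * \<sigma>) * expectation (\<lambda>\<omega>. (Y (en n k) \<omega>)\<^sup>2) = expectation (\<lambda>\<omega>. (X n k \<omega>)\<^sup>2)"
      proof -
        have "real (Suc n) powr (2 * \<sigma>) = (real (Suc n) powr \<sigma>)\<^sup>2" by (simp add: power2_eq_square powr_add[symmetric])
        then show ?thesis unfolding X_def power_mult_distrib by simp
      qed
      finally show ?thesis .
    qed
    then have "(\<Sum>k<K n. real (Suc n) powr (2 * \<sigma>) * (c * real (Suc n) powr (- 2 * m1) / 2)) \<le> (\<Sum>k<K n. expectation (\<lambda>\<omega>. (X n k \<omega>)\<^sup>2))"
      by (intro sum_mono) auto
    moreover have "(\<Sum>k<K n. real (Suc n) powr (2 * \<sigma>) * (c * real (Suc n) powr (- 2 * m1) / 2)) = c / 2 * real (Suc n) powr p"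
    proof -
      have "real (K n) = real (Suc n) powr real CARD('d)" unfolding K_def card_corner_block by (simp only: of_nat_power powr_realpow of_nat_0_less_iff zero_less_Suc)
      moreover have "real (Suc n) powr p = real (Suc n) powr (2 * \<sigma>) * real (Suc n) powr (- 2 * m1) * real (Suc n) powr real CARD('d)"
        unfolding powr_add[symmetric] p_def by (rule arg_cong[where f = "\<lambda>x. real (Suc n) powr x"]) simp
      ultimately show ?thesis by simp
    qed
    ultimately have "B \<le> (\<Sum>k<K n. expectation (\<lambda>\<omega>. (X n k \<omega>)\<^sup>2))" using 1 by linarith
    then show "\<exists>n. B \<le> (\<Sum>k<K n. expectation (\<lambda>\<omega>. (X n k \<omega>)\<^sup>2))" by blast
  qed
  then show ?thesis
  proof (eventually_elim, intro notI, elim exE)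
    fix \<omega> C
    assume nb: "\<not> (\<exists>C. \<forall>n. (\<Sum>k<K n. (X n k \<omega>)\<^sup>2) \<le> C)"
      and b: "\<forall>N\<ge>1. (\<Sum>k\<in>corner_block i N. (norm (?Z k \<omega>))\<^sup>2) \<le> C * real N powr (- 2 * \<sigma>)"
    have "(\<Sum>k<K n. (X n k \<omega>)\<^sup>2) \<le> C" for n
    proof -
      let ?q = "real (Suc n) powr (2 * \<sigma>)"
      have "(\<Sum>k<K n. (X n k \<omega>)\<^sup>2) \<le> (\<Sum>k<K n. ?q * (norm (?Z (en n k) \<omega>))\<^sup>2)"
      proof (rule sum_mono)
        fix k
        have "(X n k \<omega>)\<^sup>2 = ?q * (Y (en n k) \<omega>)\<^sup>2" by (simp add: X_def power2_eq_square powr_add[symmetric])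
        then show "(X n k \<omega>)\<^sup>2 \<le> ?q * (norm (?Z (en n k) \<omega>))\<^sup>2" using Yle by (simp add: mult_left_mono)
      qed
      also have "\<dots> = ?q * (\<Sum>k\<in>?A n. (norm (?Z k \<omega>))\<^sup>2)"
        unfolding sum_distrib_left by (rule sum.reindex_bij_betw[OF en])
      also have "\<dots> \<le> ?q * (C * real (Suc n) powr (- 2 * \<sigma>))"
        using b by (intro mult_left_mono) auto
      also have "\<dots> = C * (?q * real (Suc n) powr (- 2 * \<sigma>))" by (simp only: mult_ac)
      also have "?q * real (Suc n) powr (- 2 * \<sigma>) = 1" unfolding powr_add[symmetric] by simp
      finally show ?thesis by simp
    qed
    with nb show False by blast
  qed
qed

end


section \<open>Sharpness and the sample-path exponent\<close>

text \<open>A representing function is integrable on compact subsets of \<open>V\<close> only; the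
  part of the support of \<eta> in the cell is such a set, and \<eta> is bounded.\<close>

lemma cutoff_integrable:
  fixes f :: "real^'d \<Rightarrow> complex" and \<eta> :: "real^'d \<Rightarrow> real"
  assumes f: "represents_on V f T" and \<eta>: "torus_smooth \<eta>" "closure {x. \<eta> x \<noteq> 0} \<subseteq> V"
  shows "integrable torus_measure (\<lambda>x. f x * complex_of_real (\<eta> x))"
proof -
  let ?K = "closure {x. \<eta> x \<noteq> 0} \<inter> torus_cell"
  have "compact ?K" unfolding torus_cell_def by (intro closed_Int_compact closed_closure compact_cbox)
  moreover have "?K \<subseteq> V" using \<eta>(2) by (rule subset_trans[OF Int_lower1])
  ultimately have K: "integrable lborel (\<lambda>x. indicator ?K x *\<^sub>R f x)"
    using f unfolding represents_on_def set_integrable_def by (elim conjE allE[of _ ?K] impE) auto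
  obtain B where B: "B > 0" "\<And>x. norm (\<eta> x) \<le> B" using torus_smooth_bounded[OF \<eta>(1)] by blast
  have [measurable]: "\<eta> \<in> borel_measurable borel"
    using torus_smooth_continuous[OF \<eta>(1)] by (rule borel_measurable_continuous_onI)
  have [measurable]: "(\<lambda>x. indicator ?K x *\<^sub>R f x) \<in> borel_measurable borel"
    using borel_measurable_integrable[OF K] by simp
  have eq: "indicator torus_cell x *\<^sub>R (f x * complex_of_real (\<eta> x)) = (indicator ?K x *\<^sub>R f x) * complex_of_real (\<eta> x)" for x
  proof (cases "\<eta> x = 0")
    case False
    then have "x \<in> closure {x. \<eta> x \<noteq> 0}" by (intro subsetD[OF closure_subset]) simp
    then show ?thesis by (simp add: indicator_def)
  qed simp
  have "integrable lborel (\<lambda>x. (indicator ?K x *\<^sub>R f x) * complex_of_real (\<eta> x))"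
  proof (rule Bochner_Integration.integrable_bound)
    show "integrable lborel (\<lambda>x. B * norm (indicator ?K x *\<^sub>R f x))" using K by (intro integrable_mult_right integrable_norm)
    show "(\<lambda>x. (indicator ?K x *\<^sub>R f x) * complex_of_real (\<eta> x)) \<in> borel_measurable lborel" by measurable
    have "norm ((indicator ?K x *\<^sub>R f x) * complex_of_real (\<eta> x)) \<le> norm (indicator ?K x *\<^sub>R f x) * B" for x
      unfolding norm_mult norm_of_real by (intro mult_left_mono norm_ge_zero) (use B(2)[of x] in simp)
    then show "AE x in lborel. norm ((indicator ?K x *\<^sub>R f x) * complex_of_real (\<eta> x)) \<le> norm (B * norm (indicator ?K x *\<^sub>R f x))"
      using B(1) by (simp add: abs_mult mult.commute)
  qed
  then show ?thesis unfolding set_integrable_torus_cell_iff[symmetric] set_integrable_def eq .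
qed

lemma cutoff_square_integrable:
  fixes f :: "real^'d \<Rightarrow> complex" and \<eta> :: "real^'d \<Rightarrow> real"
  assumes f: "represents_on V f T" "f \<in> torus_L2 V" and V: "torus_open V"
    and \<eta>: "torus_smooth \<eta>" "closure {x. \<eta> x \<noteq> 0} \<subseteq> V"
  shows "integrable torus_measure (\<lambda>x. (norm (f x * complex_of_real (\<eta> x)))\<^sup>2)"
proof -
  have i: "integrable torus_measure (\<lambda>x. f x * complex_of_real (\<eta> x))" by (rule cutoff_integrable[OF f(1) \<eta>])
  then have m: "(\<lambda>x. f x * complex_of_real (\<eta> x)) \<in> borel_measurable torus_measure" by (rule borel_measurable_integrable)
  obtain B where B: "B > 0" "\<And>x. norm (\<eta> x) \<le> B" using torus_smooth_bounded[OF \<eta>(1)] by blast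
  have "integrable lborel (\<lambda>x. indicator (V \<inter> torus_cell) x *\<^sub>R (norm (f x))\<^sup>2)"
    using f(2) unfolding torus_L2_def set_integrable_def by simp
  also have "(\<lambda>x. indicator (V \<inter> torus_cell) x *\<^sub>R (norm (f x))\<^sup>2) = (\<lambda>x. indicator torus_cell x *\<^sub>R (indicator V x * (norm (f x))\<^sup>2))"
    by (auto simp: indicator_def)
  finally have L2: "integrable torus_measure (\<lambda>x. indicator V x * (norm (f x))\<^sup>2)"
    unfolding set_integrable_torus_cell_iff[symmetric] set_integrable_def .
  show ?thesis
  proof (rule Bochner_Integration.integrable_bound)
    show "integrable torus_measure (\<lambda>x. B\<^sup>2 * (indicator V x * (norm (f x))\<^sup>2))" using L2 by (rule integrable_mult_right)
    show "(\<lambda>x. (norm (f x * complex_of_real (\<eta> x)))\<^sup>2) \<in> borel_measurable torus_measure" using m by measurable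
    have "(norm (f x * complex_of_real (\<eta> x)))\<^sup>2 \<le> B\<^sup>2 * (indicator V x * (norm (f x))\<^sup>2)" for x
    proof (cases "\<eta> x = 0")
      case False
      then have "x \<in> closure {x. \<eta> x \<noteq> 0}" by (intro subsetD[OF closure_subset]) simp
      then have "x \<in> V" using \<eta>(2) by (rule set_rev_mp)
      moreover have "\<bar>\<eta> x\<bar>\<^sup>2 \<le> B\<^sup>2" using B(2)[of x] by (intro power_mono) auto
      ultimately show ?thesis unfolding norm_mult power_mult_distrib norm_of_real
        by (simp add: mult.commute[of "(norm (f x))\<^sup>2"] mult_right_mono)
    qed simp
    then show "AE x in torus_measure. norm ((norm (f x * complex_of_real (\<eta> x)))\<^sup>2) \<le> norm (B\<^sup>2 * (indicator V x * (norm (f x))\<^sup>2))"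
      by (intro AE_I2) (simp add: abs_of_nonneg)
  qed
qed

lemma represents_on_subset:
  assumes "represents_on V f T" "V' \<subseteq> V"
  shows "represents_on V' f T"
  using assms unfolding represents_on_def periodic_on_def by (meson subset_iff subset_trans)

text \<open>The partial Fourier sums of a test function converge to it in every derivative, so
  continuity reduces a distribution to its values on the countably many modes. This turns almost
  sure equality for each test function into equality for all of them at once.\<close>

lemma distributions_eqI:
  fixes T T' :: "(real^'d \<Rightarrow> complex) \<Rightarrow> complex"
  assumes T: "T \<in> torus_distributions" "T' \<in> torus_distributions"
    and eq: "\<And>k. T (fourier_mode k) = T' (fourier_mode k)" and \<phi>: "\<phi> \<in> test_functions"
  shows "T \<phi> = T' \<phi>"
proof -
  have sm: "torus_smooth \<phi>" using \<phi> by (simp add: test_functions_def)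
  have lin: "T (\<lambda>x. a * f x + b * g x) = a * T f + b * T g"
    if "T \<in> torus_distributions" "f \<in> test_functions" "g \<in> test_functions" for T f g a b
    using that unfolding torus_distributions_def by simp
  let ?c = "fourier_coeff \<phi>"
  have r: "rapid ?c" by (rule rapid_fourier_coeff[OF sm])
  let ?s = "\<lambda>F x. \<Sum>k\<in>F. ?c k * fourier_mode k x"
  have sF: "T (?s F) = (\<Sum>k\<in>F. ?c k * T (fourier_mode k))" if "finite F" "T \<in> torus_distributions" for F T
    using that(1)
  proof (induction F rule: finite_induct)
    case empty
    have "T (\<lambda>x. 0 * \<phi> x + 0 * \<phi> x) = 0 * T \<phi> + 0 * T \<phi>" by (rule lin[OF that(2) \<phi> \<phi>])
    then show ?case by simp
  next
    case (insert k F)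
    have m: "fourier_mode k \<in> test_functions" "?s F \<in> test_functions"
      unfolding test_functions_def by (simp_all add: torus_smooth_fourier_mode torus_smooth_block)
    have "T (\<lambda>x. ?c k * fourier_mode k x + 1 * ?s F x) = ?c k * T (fourier_mode k) + 1 * T (?s F)"
      by (rule lin[OF that(2) m])
    then show ?case using insert by simp
  qed
  let ?S = "\<lambda>J x. \<Sum>j<J. \<Sum>k\<in>shell j. ?c k * fourier_mode k x"
  have S_eq: "?S J = ?s (\<Union>j<J. shell j)" for J
    by (rule ext, rule sum.UNION_disjoint[symmetric]) (auto simp: finite_shell shell_disjoint)
  have fin: "finite (\<Union>j<J. shell j :: (int^'d) set)" for J by (intro finite_UN_I finite_lessThan finite_shell)
  have lim: "(\<lambda>J. T (?S J)) \<longlonglongrightarrow> T \<phi>" if "T \<in> torus_distributions" for T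
  proof (rule LIMSEQ_I)
    fix e :: real assume "0 < e"
    have "\<forall>\<phi>\<in>test_functions. \<forall>\<epsilon>>0. \<exists>N. \<exists>\<delta>>0. \<forall>\<psi>\<in>test_nbhd \<phi> N \<delta>. norm (T \<psi> - T \<phi>) < \<epsilon>"
      using that unfolding torus_distributions_def by simp
    from mp[OF spec[OF bspec[OF this \<phi>]] \<open>0 < e\<close>]
    obtain N \<delta> where "0 < \<delta> \<and> (\<forall>\<psi>\<in>test_nbhd \<phi> N \<delta>. norm (T \<psi> - T \<phi>) < e)" by (elim exE)
    note N = conjunct1[OF this] bspec[OF conjunct2[OF this]]
    have "\<forall>\<alpha>. \<exists>C\<ge>0. \<forall>J x. norm (pderivs \<alpha> (\<lambda>x. ?S J x - \<phi> x) x) \<le> C * (1 / 2) ^ J"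
      using fseries_tail_bound[OF r] unfolding fourier_inversion[OF sm] by (intro allI)
    from choice[OF this] obtain C where
      C': "\<forall>\<alpha>. 0 \<le> C \<alpha> \<and> (\<forall>J x. norm (pderivs \<alpha> (\<lambda>x. ?S J x - \<phi> x) x) \<le> C \<alpha> * (1 / 2) ^ J)" by (elim exE)
    have C: "0 \<le> C \<alpha>" "norm (pderivs \<alpha> (\<lambda>x. ?S J x - \<phi> x) x) \<le> C \<alpha> * (1 / 2) ^ J" for \<alpha> J x
      by (rule conjunct1[OF spec[OF C']]) (rule spec[OF spec[OF conjunct2[OF spec[OF C']]]])
    \<comment> \<open>A basic neighbourhood constrains the derivatives up to order N together, so
      the constants of these finitely many derivatives are added up.\<close>
    define D where "D = (\<Sum>\<alpha>\<in>{\<alpha>::'d list. length \<alpha> \<le> N}. C \<alpha>)"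
    have fl: "finite {\<alpha>::'d list. length \<alpha> \<le> N}" using finite_lists_length_le[of "UNIV :: 'd set" N] by simp
    have D: "C \<alpha> \<le> D" if "length \<alpha> \<le> N" for \<alpha>
      unfolding D_def by (rule member_le_sum) (use that C(1) fl in auto)
    have "(\<lambda>J. D * (1 / 2) ^ J) \<longlonglongrightarrow> D * 0" by (intro tendsto_intros LIMSEQ_power_zero) simp
    then have "eventually (\<lambda>J. D * (1 / 2) ^ J < \<delta>) sequentially" using N(1) by (intro order_tendstoD) auto
    then obtain J0 where J0: "\<And>J. J \<ge> J0 \<Longrightarrow> D * (1 / 2) ^ J < \<delta>" unfolding eventually_sequentially by blast
    have "norm (T (?S J) - T \<phi>) < e" if "J \<ge> J0" for J
    proof (rule N(2))
      have "?S J \<in> test_functions" unfolding S_eq test_functions_def by (simp add: torus_smooth_block)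
      moreover have "norm (pderivs \<alpha> (\<lambda>x. ?S J x - \<phi> x) x) < \<delta>" if "length \<alpha> \<le> N" for \<alpha> x
      proof -
        have "C \<alpha> * (1 / 2) ^ J \<le> D * (1 / 2) ^ J" by (intro mult_right_mono D that) simp
        then show ?thesis by (rule le_less_trans[OF order.trans[OF C(2)] J0[OF \<open>J \<ge> J0\<close>]])
      qed
      ultimately show "?S J \<in> test_nbhd \<phi> N \<delta>" unfolding test_nbhd_def by (intro CollectI conjI allI impI)
    qed
    then show "\<exists>J0. \<forall>J\<ge>J0. norm (T (?S J) - T \<phi>) < e" by blast
  qed
  have "T (?S J) = T' (?S J)" for J unfolding S_eq sF[OF fin T(1)] sF[OF fin T(2)] eq ..
  then show ?thesis using LIMSEQ_unique[OF lim[OF T(1)]] lim[OF T(2)] by simp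
qed

lemma box_inside:
  fixes a :: "real^'d"
  assumes S: "open S" "a \<in> S"
  obtains \<rho> where "0 < \<rho>" "\<rho> < 1 / 2" "cbox (a - (\<chi> i. \<rho>)) (a + (\<chi> i. \<rho>)) \<subseteq> S"
proof -
  obtain e where e: "e > 0" "cball a e \<subseteq> S" using S open_contains_cball by blast
  \<comment> \<open>The Euclidean norm is at most the sum of the d coordinate distances, each at
    most \<rho>; the value 1 / 4 keeps \<rho> below 1 / 2.\<close>
  define \<rho> where "\<rho> = min (1 / 4) (e / real CARD('d))"
  have \<rho>: "0 < \<rho>" "\<rho> < 1 / 2" "real CARD('d) * \<rho> \<le> e" using e(1) by (auto simp: \<rho>_def min_def field_simps)
  have "x \<in> S" if "x \<in> cbox (a - (\<chi> i. \<rho>)) (a + (\<chi> i. \<rho>))" for x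
  proof -
    have c: "\<bar>(x - a) $ j\<bar> \<le> \<rho>" for j using that by (auto simp: mem_box_cart abs_le_iff dest!: spec[of _ j])
    have "norm (x - a) \<le> (\<Sum>j\<in>UNIV. \<bar>(x - a) $ j\<bar>)" by (rule norm_le_l1_cart)
    also have "\<dots> \<le> (\<Sum>j\<in>(UNIV :: 'd set). \<rho>)" by (intro sum_mono c)
    also have "\<dots> \<le> e" using \<rho>(3) by simp
    finally have "x \<in> cball a e" by (simp add: dist_norm norm_minus_commute)
    then show ?thesis using e(2) by blast
  qed
  then show ?thesis using that[OF \<rho>(1,2)] by blast
qed


context matern_noise
begin

lemma cutoff_mode_coeff:
  assumes f: "represents_on V f T" and \<eta>: "torus_smooth \<eta>" "closure {x. \<eta> x \<noteq> 0} \<subseteq> V"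
  shows "T (cutoff_mode \<eta> k) = fourier_coeff (\<lambda>x. f x * complex_of_real (\<eta> x)) k"
proof -
  have "fourier_mode k x \<noteq> 0" for x by (metis norm_fourier_mode norm_zero zero_neq_one)
  then have "{x. cutoff_mode \<eta> k x \<noteq> 0} = {x. \<eta> x \<noteq> 0}" by (simp add: cutoff_mode_def)
  then have "closure {x. cutoff_mode \<eta> k x \<noteq> 0} \<subseteq> V" using \<eta>(2) by simp
  moreover have "cutoff_mode \<eta> k \<in> test_functions" using torus_smooth_cutoff_mode[OF \<eta>(1)] by (simp add: test_functions_def)
  moreover have "\<forall>\<phi>\<in>test_functions. closure {x. \<phi> x \<noteq> 0} \<subseteq> V \<longrightarrow> T \<phi> = torus_integral (\<lambda>x. f x * \<phi> x)"
    using f unfolding represents_on_def by (elim conjE)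
  ultimately have "T (cutoff_mode \<eta> k) = torus_integral (\<lambda>x. f x * cutoff_mode \<eta> k x)" by simp
  then show ?thesis by (simp only: torus_integral_eq fourier_coeff_eq cutoff_mode_def mult.assoc)
qed

text \<open>Continuity of m gives a box around \<open>a\<close> on which m < m1. The cutoff lives on
  the box of half the size, which leaves a margin for increments, and periodicity of m carries the
  bound to the lattice translates.\<close>

lemma bump_near:
  assumes V: "torus_open V" "a \<in> V" and m1: "m a < m1"
  obtains \<rho> and \<eta> :: "real^'d \<Rightarrow> real" where "0 < \<rho>" "\<rho> < 1 / 2" "cbox (a - (\<chi> i. \<rho>)) (a + (\<chi> i. \<rho>)) \<subseteq> V"
    "torus_smooth \<eta>" "\<And>x. \<eta> x \<ge> 0" "\<eta> a > 0"
    "\<And>x. x \<in> closure {x. \<eta> x \<noteq> 0} \<Longrightarrow> \<exists>k. x + lattice_vec k \<in> cbox (a - (\<chi> i. \<rho> / 2)) (a + (\<chi> i. \<rho> / 2))"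
    "closure {x. \<eta> x \<noteq> 0} \<subseteq> V" "\<And>x. \<eta> x \<noteq> 0 \<Longrightarrow> m x \<le> m1"
proof -
  have o: "open (V \<inter> {x. m x < m1})"
    using V(1) unfolding torus_open_def by (intro open_Int open_Collect_less continuous_m continuous_on_const) auto
  obtain \<rho> where \<rho>: "0 < \<rho>" "\<rho> < 1 / 2" "cbox (a - (\<chi> i. \<rho>)) (a + (\<chi> i. \<rho>)) \<subseteq> V \<inter> {x. m x < m1}"
    using box_inside[OF o, of a] V(2) m1 by blast
  have r: "0 < \<rho> / 2" "\<rho> / 2 < 1 / 2" using \<rho> by auto
  obtain \<eta> :: "real^'d \<Rightarrow> real" where \<eta>: "torus_smooth \<eta>" "\<And>x. \<eta> x \<ge> 0" "\<eta> a > 0"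
    "\<And>x. x \<in> closure {x. \<eta> x \<noteq> 0} \<Longrightarrow> \<exists>k. x + lattice_vec k \<in> cbox (a - (\<chi> i. \<rho> / 2)) (a + (\<chi> i. \<rho> / 2))"
    using torus_bump[OF r] by blast
  have sub: "cbox (a - (\<chi> i. \<rho> / 2)) (a + (\<chi> i. \<rho> / 2)) \<subseteq> cbox (a - (\<chi> i. \<rho>)) (a + (\<chi> i. \<rho>))"
  proof
    fix x assume x: "x \<in> cbox (a - (\<chi> i. \<rho> / 2)) (a + (\<chi> i. \<rho> / 2))"
    show "x \<in> cbox (a - (\<chi> i. \<rho>)) (a + (\<chi> i. \<rho>))"
      unfolding mem_box_cart
    proof
      fix j
      show "(a - (\<chi> i. \<rho>)) $ j \<le> x $ j \<and> x $ j \<le> (a + (\<chi> i. \<rho>)) $ j"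
        using spec[OF x[unfolded mem_box_cart], of j] \<rho>(1)
        unfolding vector_minus_component vector_add_component vec_lambda_beta by linarith
    qed
  qed
  have S: "x \<in> V \<and> m x < m1" if x: "x \<in> closure {x. \<eta> x \<noteq> 0}" for x
  proof -
    from \<eta>(4)[OF x] obtain k where k: "x + lattice_vec k \<in> cbox (a - (\<chi> i. \<rho> / 2)) (a + (\<chi> i. \<rho> / 2))" by (elim exE)
    have "x + lattice_vec k \<in> V \<inter> {x. m x < m1}" by (rule subsetD[OF \<rho>(3) subsetD[OF sub k]])
    then have y: "x + lattice_vec k \<in> V" "m (x + lattice_vec k) < m1" by auto
    from V(1) y(1) have "x + lattice_vec k + lattice_vec (- k) \<in> V" unfolding torus_open_def by blast
    then show ?thesis using y(2) by (simp add: m_periodic)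
  qed
  show ?thesis
  proof (rule that[OF \<rho>(1,2) _ \<eta>])
    show "cbox (a - (\<chi> i. \<rho>)) (a + (\<chi> i. \<rho>)) \<subseteq> V" using \<rho>(3) by (rule subset_trans[OF _ Int_lower1])
    show "closure {x. \<eta> x \<noteq> 0} \<subseteq> V" by (rule subsetI, drule S, erule conjunct1)
    show "m x \<le> m1" if "\<eta> x \<noteq> 0" for x
    proof -
      have "x \<in> closure {x. \<eta> x \<noteq> 0}" by (rule subsetD[OF closure_subset]) (simp add: that)
      then show ?thesis using S[of x] by simp
    qed
  qed
qed

text \<open>The quantifier over \<open>f\<close> stands inside the almost sure event: whatever
  represents the distribution on \<open>V\<close>, its localized Fourier coefficients are the values
  at the cutoff modes, and these are countably many noise values.\<close>

lemma rough_blocks: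
  assumes dm: "distributional_modification M (matern_field \<kappa> m W) T"
    and \<eta>: "torus_smooth \<eta>" "\<And>x. \<eta> x \<ge> 0" "\<eta> a > 0" and m1: "\<And>x. \<eta> x \<noteq> 0 \<Longrightarrow> m x \<le> m1"
    and \<sigma>: "m1 - real CARD('d) / 2 < \<sigma>" and S: "closure {x. \<eta> x \<noteq> 0} \<subseteq> V"
  shows "AE \<omega> in M. \<forall>f. represents_on V f (T \<omega>) \<longrightarrow> \<not> (\<exists>C. \<forall>N::nat. N \<ge> 1 \<longrightarrow>
    (\<Sum>k\<in>corner_block i N. (norm (fourier_coeff (\<lambda>x. f x * complex_of_real (\<eta> x)) k))\<^sup>2) \<le> C * real N powr (- 2 * \<sigma>))"
proof -
  have "AE \<omega> in M. T \<omega> (cutoff_mode \<eta> k) = W (adj_mode \<eta> k) \<omega>" for k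
  proof -
    have t: "cutoff_mode \<eta> k \<in> test_functions" using torus_smooth_cutoff_mode[OF \<eta>(1)] by (simp add: test_functions_def)
    then have "AE \<omega> in M. T \<omega> (cutoff_mode \<eta> k) = matern_field \<kappa> m W (cutoff_mode \<eta> k) \<omega>"
      using dm unfolding distributional_modification_def by blast
    then show ?thesis unfolding matern_field_eq[OF t] .
  qed
  then have "AE \<omega> in M. \<forall>k. T \<omega> (cutoff_mode \<eta> k) = W (adj_mode \<eta> k) \<omega>"
    unfolding AE_all_countable by blast
  moreover have "AE \<omega> in M. \<not> (\<exists>C. \<forall>N::nat. N \<ge> 1 \<longrightarrow>
      (\<Sum>k\<in>corner_block i N. (norm (W (adj_mode \<eta> k) \<omega>))\<^sup>2) \<le> C * real N powr (- 2 * \<sigma>))"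
    by (rule noise_blocks_unbounded[OF \<eta> _ \<sigma>]) (rule m1)
  ultimately show ?thesis
  proof eventually_elim
    case (elim \<omega>)
    show ?case
    proof (intro allI impI)
      fix f assume f: "represents_on V f (T \<omega>)"
      have "fourier_coeff (\<lambda>x. f x * complex_of_real (\<eta> x)) k = W (adj_mode \<eta> k) \<omega>" for k
        using cutoff_mode_coeff[OF f \<eta>(1) S, of k] elim(1) by simp
      then show "\<not> (\<exists>C. \<forall>N::nat. N \<ge> 1 \<longrightarrow>
        (\<Sum>k\<in>corner_block i N. (norm (fourier_coeff (\<lambda>x. f x * complex_of_real (\<eta> x)) k))\<^sup>2) \<le> C * real N powr (- 2 * \<sigma>))"
        using elim(2) by simp
    qed
  qed
qed

text \<open>The decay of the localized coefficients forced by order \<sigma> contradicts their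
  almost sure size. It suffices that the order is too small at one point \<open>a\<close> of
  \<open>V\<close>.\<close>

lemma not_holder:
  assumes dm: "distributional_modification M (matern_field \<kappa> m W) T"
    and V: "torus_open V" "a \<in> V" and H: "0 < H a" "H a < \<gamma>"
  shows "AE \<omega> in M. \<not> restriction_in (T \<omega>) V (holder_loc_minus \<gamma> V)"
proof -
  \<comment> \<open>Every coordinate direction serves equally well.\<close>
  let ?i = "undefined :: 'd"
  define \<sigma> where "\<sigma> = (H a + \<gamma>) / 2"
  define n where "n = nat \<lfloor>\<sigma>\<rfloor>"
  define s where "s = frac \<sigma>"
  define m1 where "m1 = m a + (\<sigma> - H a) / 2"
  have \<sigma>: "H a < \<sigma>" "\<sigma> < \<gamma>" "0 < \<sigma>" using H by (auto simp: \<sigma>_def)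
  have s: "0 \<le> s" "s \<le> 1" unfolding s_def using frac_lt_1[of \<sigma>] by (simp_all add: less_imp_le)
  have ns: "s + real n = \<sigma>" unfolding s_def n_def frac_def using \<sigma>(3) by simp
  have m1: "m a < m1" "m1 - real CARD('d) / 2 < \<sigma>" using \<sigma>(1) by (auto simp: m1_def field_simps)
  obtain \<rho> and \<eta> :: "real^'d \<Rightarrow> real" where \<rho>: "0 < \<rho>" "\<rho> < 1 / 2" and Q: "cbox (a - (\<chi> i. \<rho>)) (a + (\<chi> i. \<rho>)) \<subseteq> V"
    and \<eta>: "torus_smooth \<eta>" "\<And>x. \<eta> x \<ge> 0" "\<eta> a > 0"
    and supp: "\<And>x. x \<in> closure {x. \<eta> x \<noteq> 0} \<Longrightarrow> \<exists>k. x + lattice_vec k \<in> cbox (a - (\<chi> i. \<rho> / 2)) (a + (\<chi> i. \<rho> / 2))"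
    and S: "closure {x. \<eta> x \<noteq> 0} \<subseteq> V" and le: "\<And>x. \<eta> x \<noteq> 0 \<Longrightarrow> m x \<le> m1"
    by (rule bump_near[OF V m1(1)]) (rule that)
  interpret loc_box V a \<rho> ?i s by (rule loc_box.intro[OF V(1) Q \<rho> s])
  have "AE \<omega> in M. \<forall>f. represents_on V f (T \<omega>) \<longrightarrow> \<not> (\<exists>C. \<forall>N::nat. N \<ge> 1 \<longrightarrow>
      (\<Sum>k\<in>corner_block ?i N. (norm (fourier_coeff (\<lambda>x. f x * complex_of_real (\<eta> x)) k))\<^sup>2) \<le> C * real N powr (- 2 * \<sigma>))"
    by (rule rough_blocks[OF dm \<eta> _ m1(2) S]) (rule le)
  then show ?thesis
  proof (eventually_elim, intro notI)
    fix \<omega>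
    assume rb: "\<forall>f. represents_on V f (T \<omega>) \<longrightarrow> \<not> (\<exists>C. \<forall>N::nat. N \<ge> 1 \<longrightarrow>
      (\<Sum>k\<in>corner_block ?i N. (norm (fourier_coeff (\<lambda>x. f x * complex_of_real (\<eta> x)) k))\<^sup>2) \<le> C * real N powr (- 2 * \<sigma>))"
      and "restriction_in (T \<omega>) V (holder_loc_minus \<gamma> V)"
    then obtain f where f: "f \<in> holder_loc_minus \<gamma> V" "represents_on V f (T \<omega>)" unfolding restriction_in_def by (elim bexE)
    have "f \<in> holder_loc n s V"
      using f(1) s \<sigma>(2) ns unfolding holder_loc_minus_def by simp
    then have "loch n f" by (rule holder_loc_imp_loch)
    have pf: "periodic_on V f" using f(2) unfolding represents_on_def by (elim conjE)
    let ?h = "\<lambda>x. f x * complex_of_real (\<eta> x)"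
    have d: "dirh n ?i s ?h"
    proof (rule dirh_mult_cutoff[of "\<rho> / 2", OF _ _ \<open>loch n f\<close> pf torus_smooth_of_real[OF \<eta>(1)]])
      show "0 < \<rho> / 2" "\<rho> / 2 < \<rho>" using \<rho>(1) by simp_all
      fix x assume "x \<in> closure {x. complex_of_real (\<eta> x) \<noteq> 0}"
      then show "\<exists>k. x + lattice_vec k \<in> box_of (\<rho> / 2)" unfolding of_real_eq_0_iff by (rule supp)
    qed
    have ph: "periodic_on UNIV ?h"
      unfolding periodic_on_def
    proof (intro ballI allI)
      fix x :: "real^'d" and k :: "int^'d"
      have e: "\<eta> (x + lattice_vec k) = \<eta> x" using \<eta>(1) unfolding torus_smooth_def periodic_on_def by blast
      show "f (x + lattice_vec k) * complex_of_real (\<eta> (x + lattice_vec k)) = f x * complex_of_real (\<eta> x)"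
      proof (cases "\<eta> x = 0")
        case False
        then have "x \<in> closure {x. \<eta> x \<noteq> 0}" by (intro subsetD[OF closure_subset]) simp
        then have "x \<in> V" by (rule subsetD[OF S])
        then have "f (x + lattice_vec k) = f x" using pf unfolding periodic_on_def by blast
        then show ?thesis using e by simp
      qed (simp add: e)
    qed
    obtain C where C: "\<forall>N::nat. \<forall>F. N \<ge> 1 \<longrightarrow> finite F \<longrightarrow> (\<forall>k\<in>F. int N \<le> \<bar>k $ ?i\<bar> \<and> \<bar>k $ ?i\<bar> < 2 * int N) \<longrightarrow>
      (\<Sum>k\<in>F. (norm (fourier_coeff ?h k))\<^sup>2) \<le> C * real N powr (- 2 * (s + n))"
      using dirh_fourier_decay[OF ph cutoff_integrable[OF f(2) \<eta>(1) S] d] by (elim exE)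
    have "(\<Sum>k\<in>corner_block ?i N. (norm (fourier_coeff ?h k))\<^sup>2) \<le> C * real N powr (- 2 * \<sigma>)" if "N \<ge> 1" for N
      unfolding ns[symmetric]
    proof (rule mp[OF mp[OF mp[OF spec[OF spec[OF C]] that] finite_corner_block]], rule ballI)
      show "int N \<le> \<bar>k $ ?i\<bar> \<and> \<bar>k $ ?i\<bar> < 2 * int N" if "k \<in> corner_block ?i N" for k
        using that by (rule corner_block_bounds(1))
    qed
    then have "\<exists>C. \<forall>N::nat. N \<ge> 1 \<longrightarrow>
      (\<Sum>k\<in>corner_block ?i N. (norm (fourier_coeff ?h k))\<^sup>2) \<le> C * real N powr (- 2 * \<sigma>)" by (intro exI allI impI)
    then show False by (rule notE[OF mp[OF spec[OF rb] f(2)]])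
  qed
qed

text \<open>The case \<sigma> = 0, in which Bessel's inequality alone bounds the blocks and no
  differences are needed.\<close>

lemma not_L2:
  assumes dm: "distributional_modification M (matern_field \<kappa> m W) T"
    and V: "torus_open V" "a \<in> V" and H: "m a < real CARD('d) / 2"
  shows "AE \<omega> in M. \<not> restriction_in (T \<omega>) V (torus_L2 V)"
proof -
  let ?i = "undefined :: 'd"
  define m1 where "m1 = (m a + real CARD('d) / 2) / 2"
  have m1: "m a < m1" "m1 - real CARD('d) / 2 < 0" using H by (auto simp: m1_def field_simps)
  obtain \<rho> and \<eta> :: "real^'d \<Rightarrow> real" where \<eta>: "torus_smooth \<eta>" "\<And>x. \<eta> x \<ge> 0" "\<eta> a > 0"
    and S: "closure {x. \<eta> x \<noteq> 0} \<subseteq> V" and le: "\<And>x. \<eta> x \<noteq> 0 \<Longrightarrow> m x \<le> m1"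
    by (rule bump_near[OF V m1(1)]) (rule that)
  have "AE \<omega> in M. \<forall>f. represents_on V f (T \<omega>) \<longrightarrow> \<not> (\<exists>C. \<forall>N::nat. N \<ge> 1 \<longrightarrow>
      (\<Sum>k\<in>corner_block ?i N. (norm (fourier_coeff (\<lambda>x. f x * complex_of_real (\<eta> x)) k))\<^sup>2) \<le> C * real N powr (- 2 * 0))"
    by (rule rough_blocks[OF dm \<eta> _ m1(2) S]) (rule le)
  then show ?thesis
  proof (eventually_elim, intro notI)
    fix \<omega>
    assume rb: "\<forall>f. represents_on V f (T \<omega>) \<longrightarrow> \<not> (\<exists>C. \<forall>N::nat. N \<ge> 1 \<longrightarrow>
      (\<Sum>k\<in>corner_block ?i N. (norm (fourier_coeff (\<lambda>x. f x * complex_of_real (\<eta> x)) k))\<^sup>2) \<le> C * real N powr (- 2 * 0))"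
      and "restriction_in (T \<omega>) V (torus_L2 V)"
    then obtain f where f: "f \<in> torus_L2 V" "represents_on V f (T \<omega>)" unfolding restriction_in_def by (elim bexE)
    let ?h = "\<lambda>x. f x * complex_of_real (\<eta> x)"
    have "(\<Sum>k\<in>corner_block ?i N. (norm (fourier_coeff ?h k))\<^sup>2) \<le> (\<integral>x. (norm (?h x))\<^sup>2 \<partial>torus_measure)" for N
      by (rule bessel[OF borel_measurable_integrable[OF cutoff_integrable[OF f(2) \<eta>(1) S]]
            cutoff_square_integrable[OF f(2,1) V(1) \<eta>(1) S] finite_corner_block])
    then have "(\<Sum>k\<in>corner_block ?i N. (norm (fourier_coeff ?h k))\<^sup>2) \<le>
        (\<integral>x. (norm (?h x))\<^sup>2 \<partial>torus_measure) * real N powr (- 2 * 0)" if "N \<ge> 1" for N using that by simp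
    then have "\<exists>C. \<forall>N::nat. N \<ge> 1 \<longrightarrow>
      (\<Sum>k\<in>corner_block ?i N. (norm (fourier_coeff ?h k))\<^sup>2) \<le> C * real N powr (- 2 * 0)" by (intro exI allI impI)
    then show False by (rule notE[OF mp[OF spec[OF rb] f(2)]])
  qed
qed

text \<open>Two modifications agree almost surely on the countable family of modes, and
  distributions that agree there are equal. Regularity of the constructed modification thus passes
  to every other one.\<close>

lemma modifications_agree:
  assumes dm: "distributional_modification M (matern_field \<kappa> m W) T" "distributional_modification M (matern_field \<kappa> m W) T'"
  shows "AE \<omega> in M. \<forall>\<phi>\<in>test_functions. T \<omega> \<phi> = T' \<omega> \<phi>"
proof -
  have "AE \<omega> in M. T \<omega> (fourier_mode k) = T' \<omega> (fourier_mode k)" for k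
  proof -
    have t: "fourier_mode k \<in> test_functions" by (simp add: test_functions_def torus_smooth_fourier_mode)
    have "AE \<omega> in M. T \<omega> (fourier_mode k) = matern_field \<kappa> m W (fourier_mode k) \<omega>" "AE \<omega> in M. T' \<omega> (fourier_mode k) = matern_field \<kappa> m W (fourier_mode k) \<omega>"
      using dm t unfolding distributional_modification_def by blast+
    then show ?thesis by eventually_elim simp
  qed
  then have "AE \<omega> in M. \<forall>k. T \<omega> (fourier_mode k) = T' \<omega> (fourier_mode k)" unfolding AE_all_countable by blast
  with AE_space show ?thesis
  proof eventually_elim
    case (elim \<omega>)
    then have "T \<omega> \<in> torus_distributions" "T' \<omega> \<in> torus_distributions"
      using dm unfolding distributional_modification_def by blast+
    then show ?case using distributions_eqI elim(2) by blast
  qed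
qed

lemma ex_continuous_modification:
  "\<exists>T g. distributional_modification M (matern_field \<kappa> m W) T \<and>
    (\<forall>\<omega>\<in>space M. continuous_on U (g \<omega>) \<and> represents_on U (g \<omega>) (T \<omega>)) \<and>
    (\<forall>V \<gamma>. torus_open V \<longrightarrow> (\<forall>x\<in>V. \<gamma> \<le> H x) \<longrightarrow> (AE \<omega> in M. g \<omega> \<in> holder_loc_minus \<gamma> V))"
proof (rule continuous_modification)
  fix T :: "'w \<Rightarrow> (real^'d \<Rightarrow> complex) \<Rightarrow> complex" and g :: "'w \<Rightarrow> real^'d \<Rightarrow> complex"
  assume 1: "distributional_modification M (matern_field \<kappa> m W) T"
    and 2: "\<And>\<omega>. \<omega> \<in> space M \<Longrightarrow> continuous_on U (g \<omega>) \<and> represents_on U (g \<omega>) (T \<omega>)"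
    and 3: "\<And>V \<gamma>. torus_open V \<Longrightarrow> (\<And>x. x \<in> V \<Longrightarrow> \<gamma> \<le> H x) \<Longrightarrow> AE \<omega> in M. g \<omega> \<in> holder_loc_minus \<gamma> V"
  show ?thesis
    by (intro exI conjI ballI allI impI, rule 1, rule conjunct1[OF 2], assumption, rule conjunct2[OF 2], assumption, rule 3)
      (assumption, erule bspec)
qed

lemma torus_open_superlevel: "torus_open {x. c < m x}"
  unfolding torus_open_def by (auto simp: m_periodic intro: open_Collect_less continuous_m)

text \<open>From above, an order larger than H at the point would make an event and its negation
  both almost sure. From below, every \<gamma> between 0 and the value of H is attained on a
  superlevel set of H.\<close>

lemma sample_path_exponent:
  assumes dm: "distributional_modification M (matern_field \<kappa> m W) T" and x0: "0 < H x\<^sub>0"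
  shows "(SUP \<gamma>\<in>{\<gamma>. \<gamma> > 0 \<and> (\<exists>V. torus_open V \<and> x\<^sub>0 \<in> V \<and>
      (AE \<omega> in M. restriction_in (T \<omega>) V (holder_loc_minus \<gamma> V)))}. ereal \<gamma>) = ereal (H x\<^sub>0)"
    (is "(SUP \<gamma>\<in>?G. ereal \<gamma>) = _")
proof (rule antisym)
  show "(SUP \<gamma>\<in>?G. ereal \<gamma>) \<le> ereal (H x\<^sub>0)"
  proof (rule SUP_least)
    fix \<gamma> assume "\<gamma> \<in> ?G"
    then obtain V where V: "torus_open V" "x\<^sub>0 \<in> V" and ae: "AE \<omega> in M. restriction_in (T \<omega>) V (holder_loc_minus \<gamma> V)" by blast
    show "ereal \<gamma> \<le> ereal (H x\<^sub>0)"
    proof (rule ccontr)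
      assume "\<not> ereal \<gamma> \<le> ereal (H x\<^sub>0)"
      then have "AE \<omega> in M. \<not> restriction_in (T \<omega>) V (holder_loc_minus \<gamma> V)" by (intro not_holder[OF dm V x0]) simp
      with ae have "AE \<omega> in M. False" by eventually_elim simp
      then show False by (simp only: AE_False)
    qed
  qed
  show "ereal (H x\<^sub>0) \<le> (SUP \<gamma>\<in>?G. ereal \<gamma>)"
  proof (rule dense_le)
    fix y assume "y < ereal (H x\<^sub>0)"
    then have "max y 0 < ereal (H x\<^sub>0)" using x0 by simp
    then obtain \<gamma> where \<gamma>: "max y 0 < ereal \<gamma>" "ereal \<gamma> < ereal (H x\<^sub>0)" using ereal_dense2 by blast
    then have \<gamma>': "y \<le> ereal \<gamma>" "0 < \<gamma>" "\<gamma> < H x\<^sub>0" by (auto simp: less_imp_le)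
    \<comment> \<open>The set where H exceeds \<gamma>: it contains the point, lies in
      \<open>U\<close>, and is open and lattice invariant because m is continuous and
      periodic.\<close>
    let ?V = "{x. \<gamma> + real CARD('d) / 2 < m x}"
    obtain T' g where T': "distributional_modification M (matern_field \<kappa> m W) T'"
      and g: "\<forall>\<omega>\<in>space M. continuous_on U (g \<omega>) \<and> represents_on U (g \<omega>) (T' \<omega>)"
      and h: "\<forall>V \<gamma>. torus_open V \<longrightarrow> (\<forall>x\<in>V. \<gamma> \<le> H x) \<longrightarrow> (AE \<omega> in M. g \<omega> \<in> holder_loc_minus \<gamma> V)"
      using ex_continuous_modification by (elim exE conjE)
    have VU: "?V \<subseteq> U" using \<gamma>'(2) by auto
    have "AE \<omega> in M. g \<omega> \<in> holder_loc_minus \<gamma> ?V" by (rule h[rule_format, OF torus_open_superlevel]) simp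
    with modifications_agree[OF dm T'] AE_space have "AE \<omega> in M. restriction_in (T \<omega>) ?V (holder_loc_minus \<gamma> ?V)"
    proof eventually_elim
      case (elim \<omega>)
      have "represents_on ?V (g \<omega>) (T' \<omega>)" by (rule represents_on_subset[OF conjunct2[OF bspec[OF g elim(2)]] VU])
      then have "represents_on ?V (g \<omega>) (T \<omega>)" using elim(1) unfolding represents_on_def by simp
      then show ?case unfolding restriction_in_def using elim(3) by blast
    qed
    moreover have "\<gamma> + real CARD('d) / 2 < m x\<^sub>0" using \<gamma>'(3) by simp
    ultimately have "\<gamma> \<in> ?G"
      by (intro CollectI conjI exI[of _ ?V] \<gamma>'(2) torus_open_superlevel)
    then show "y \<le> (SUP \<gamma>\<in>?G. ereal \<gamma>)" by (rule order.trans[of y "ereal \<gamma>", OF \<gamma>'(1) SUP_upper[of \<gamma> ?G ereal]])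
  qed
qed

text \<open>Gives the real-valued infimum of H and supremum of m over a nonempty set their usual
  meaning.\<close>

lemma bdd_below_H: "bdd_below (H ` V)" and bdd_above_m: "bdd_above (m ` V)"
proof -
  obtain N :: nat where N: "\<And>x. \<bar>m x\<bar> \<le> real N" using m_bounded by blast
  have "- real N - real CARD('d) / 2 \<le> H x" "m x \<le> real N" for x using N[of x] by linarith+
  then show "bdd_below (H ` V)" "bdd_above (m ` V)" unfolding bdd_below_def bdd_above_def by blast+
qed

end

theorem theorem4p5:
  fixes M :: "'w measure"
    and W :: "(real^'d \<Rightarrow> complex) \<Rightarrow> 'w \<Rightarrow> complex"
    and m :: "real^'d \<Rightarrow> real"
    and \<kappa> :: real
  defines "u \<equiv> matern_field \<kappa> m W"
    and "U \<equiv> {x. m x > real CARD('d) / 2}"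
    and "H \<equiv> (\<lambda>x. m x - real CARD('d) / 2)"
  assumes "prob_space M"
    and "gaussian_white_noise M W"
    and "torus_smooth m"
    and "\<kappa> > 0"
  shows
    "(\<exists>T g. distributional_modification M u T \<and>
        (\<forall>\<omega>\<in>space M. continuous_on U (g \<omega>) \<and> represents_on U (g \<omega>) (T \<omega>)) \<and>
        (\<forall>V. torus_open V \<and> V \<noteq> {} \<and> closure V \<subseteq> U \<longrightarrow>
           (AE \<omega> in M. g \<omega> \<in> holder_loc_minus (INF x\<in>V. H x) V)))
     \<and> (\<forall>T. distributional_modification M u T \<longrightarrow>
          (\<forall>V \<gamma>. torus_open V \<and> V \<noteq> {} \<and> V \<subseteq> U \<and> \<gamma> > (INF x\<in>V. H x) \<longrightarrow>
             (AE \<omega> in M. \<not> restriction_in (T \<omega>) V (holder_loc_minus \<gamma> V)))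
        \<and> (\<forall>V. torus_open V \<and> V \<noteq> {} \<and> (SUP x\<in>V. m x) < real CARD('d) / 2 \<longrightarrow>
             (AE \<omega> in M. \<not> restriction_in (T \<omega>) V (torus_L2 V)))
        \<and> (\<forall>x\<^sub>0\<in>U.
             (SUP \<gamma>\<in>{\<gamma>. \<gamma> > 0 \<and> (\<exists>V. torus_open V \<and> x\<^sub>0 \<in> V \<and>
                          (AE \<omega> in M. restriction_in (T \<omega>) V (holder_loc_minus \<gamma> V)))}.
                ereal \<gamma>) = ereal (H x\<^sub>0)))"
proof -
  interpret matern_noise \<kappa> m M W
    using assms by (intro matern_noise.intro matern.intro matern_noise_axioms.intro)
  obtain T g where T: "distributional_modification M (matern_field \<kappa> m W) T"
    and g: "\<forall>\<omega>\<in>space M. continuous_on {x. real CARD('d) / 2 < m x} (g \<omega>) \<and> represents_on {x. real CARD('d) / 2 < m x} (g \<omega>) (T \<omega>)"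
    and h: "\<forall>V \<gamma>. torus_open V \<longrightarrow> (\<forall>x\<in>V. \<gamma> \<le> m x - real CARD('d) / 2) \<longrightarrow> (AE \<omega> in M. g \<omega> \<in> holder_loc_minus \<gamma> V)"
    using ex_continuous_modification by (elim exE conjE)
  have upper: "AE \<omega> in M. g \<omega> \<in> holder_loc_minus (INF x\<in>V. H x) V" if "torus_open V" for V
    by (rule h[rule_format, OF that]) (unfold H_def, rule cINF_lower[OF bdd_below_H])
  have sharp: "AE \<omega> in M. \<not> restriction_in (T \<omega>) V (holder_loc_minus \<gamma> V)"
    if T: "distributional_modification M u T" and V: "torus_open V" "V \<noteq> {}" "V \<subseteq> U" and \<gamma>: "(INF x\<in>V. H x) < \<gamma>" for T V \<gamma>
  proof -
    \<comment> \<open>The infimum need not be attained, but \<gamma> exceeds it, so some point of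
      \<open>V\<close> already has H below \<gamma>.\<close>
    obtain a where a: "a \<in> V" "m a - real CARD('d) / 2 < \<gamma>"
      using \<gamma> unfolding H_def cINF_less_iff[OF V(2) bdd_below_H] by (elim bexE)
    have "a \<in> U" using V(3) a(1) by (rule subsetD)
    then have "0 < m a - real CARD('d) / 2" by (simp add: U_def)
    then show ?thesis by (rule not_holder[OF T[unfolded u_def] V(1) a(1) _ a(2)])
  qed
  have below: "AE \<omega> in M. \<not> restriction_in (T \<omega>) V (torus_L2 V)"
    if T: "distributional_modification M u T" and V: "torus_open V" "V \<noteq> {}" and S: "(SUP x\<in>V. m x) < real CARD('d) / 2" for T V
  proof -
    obtain a where a: "a \<in> V" using V(2) by blast
    have "m a < real CARD('d) / 2" by (rule le_less_trans[OF cSUP_upper[OF a bdd_above_m] S])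
    then show ?thesis by (rule not_L2[OF T[unfolded u_def] V(1) a])
  qed
  have exponent: "(SUP \<gamma>\<in>{\<gamma>. \<gamma> > 0 \<and> (\<exists>V. torus_open V \<and> x\<^sub>0 \<in> V \<and>
      (AE \<omega> in M. restriction_in (T \<omega>) V (holder_loc_minus \<gamma> V)))}. ereal \<gamma>) = ereal (H x\<^sub>0)"
    if "distributional_modification M u T" "x\<^sub>0 \<in> U" for T x\<^sub>0
    unfolding H_def by (rule sample_path_exponent[OF that(1)[unfolded u_def]]) (use that(2) in \<open>simp add: U_def\<close>)
  have "distributional_modification M u T \<and> (\<forall>\<omega>\<in>space M. continuous_on U (g \<omega>) \<and> represents_on U (g \<omega>) (T \<omega>)) \<and>
      (\<forall>V. torus_open V \<and> V \<noteq> {} \<and> closure V \<subseteq> U \<longrightarrow> (AE \<omega> in M. g \<omega> \<in> holder_loc_minus (INF x\<in>V. H x) V))"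
    unfolding u_def U_def using T g by (intro conjI allI impI) (assumption, assumption, elim conjE, rule upper)
  then show ?thesis
    by (intro conjI, intro exI, assumption, intro allI impI conjI ballI)
      ((elim conjE, rule sharp, assumption+)[1], (elim conjE, rule below, assumption+)[1], rule exponent)
qed

end
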